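(* There exist constants $C_7>0$ and $c>0$ such that for every locally integrable $V\ge 0$ on $\mathbb{R}^2$, $$N_-(\mathcal{E}_V) \le 1 + 4\sum_{\{n\in\mathbb{Z}:\ A_n>1/4\}}\sqrt{A_n} + C_7\sum_{\{n\in\mathbb{Z}:\ \mathcal{B}_n>c\}}\mathcal{B}_n .$$
   Context: For a Hermitian form $\mathbf{q}$ with domain $\mathrm{Dom}(\mathbf{q})$ in a Hilbert space, $N_-(\mathbf{q}) := \sup\{\dim\mathcal{L} : \mathcal{L}\subseteq \mathrm{Dom}(\mathbf{q}) \text{ a linear subspace},\ \mathbf{q}[u]<0\ \forall u\in\mathcal{L}\setminus\{0\}\}\in\{0,1,2,\dots\}\cup\{\infty\}$. For locally integrable $V\ge 0$ on $\mathbb{R}^2$, $\mathcal{E}_V[w] := \int_{\mathbb{R}^2}|\nabla w(x)|^2dx - \int_{\mathbb{R}^2}V(x)|w(x)|^2dx$ with $\mathrm{Dom}(\mathcal{E}_V) := W^1_2(\mathbb{R}^2)\cap L_2(\mathbb{R}^2,V(x)dx)$, where $W^1_2$ is the Sobolev space of $L_2$ functions with $L_2$ first-order weak derivatives. Annuli: $U_n := \{x\in\mathbb{R}^2 : e^{2^{n-1}}<|x|<e^{2^n}\}$ for $n>0$; $U_0 := \{e^{-1}<|x|<e\}$; $U_n := \{e^{-2^{|n|}}<|x|<e^{-2^{|n|-1}}\}$ for $n<0$. Set $A_0 := \int_{U_0}V(x)\,dx$ and $A_n := \int_{U_n}V(x)|\ln|x||\,dx$ for $n\ne 0$. $\Omega_n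 := \{x\in\mathbb{R}^2 : e^n<|x|<e^{n+1}\}$, $n\in\mathbb{Z}$. $\mathcal{A}(s)=e^{|s|}-1-|s|$ and $\mathcal{B}(s)=(1+|s|)\ln(1+|s|)-|s|$ are mutually complementary $N$-functions. For a set $\Omega$ of finite Lebesgue measure $|\Omega|$, $\|f\|^{\rm (av)}_{\mathcal{B},\Omega} := \sup\{|\int_\Omega fg\,dx| : g \text{ measurable},\ \int_\Omega\mathcal{A}(g)\,dx\le|\Omega|\}$ ($+\infty$ if $f\notin L_{\mathcal{B}}(\Omega)$, the Orlicz space). Set $\mathcal{B}_n := \|V\|^{\rm (av)}_{\mathcal{B},\Omega_n}$, $n\in\mathbb{Z}$. *)

theory Defs
  imports "HOL-Analysis.Analysis" "HOL-Library.Function_Algebras"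
begin

section \<open>The negative index of a Hermitian form\<close>

text \<open>The library function \<open>dim\<close> takes values in \<^typ>\<open>nat\<close> and carries no
  information about infinite-dimensional sets, hence the variant below. The first argument
  is the scalar multiplication, as in the locale \<^locale>\<open>vector_space\<close>.\<close>

definition edim :: "('k::field \<Rightarrow> 'b::ab_group_add \<Rightarrow> 'b) \<Rightarrow> 'b set \<Rightarrow> enat" where
  "edim scl S =
     (if \<exists>X. finite X \<and> S \<subseteq> module.span scl X then enat (vector_space.dim scl S) else \<infinity>)"

definition neg_index ::
    "('k::field \<Rightarrow> 'b::ab_group_add \<Rightarrow> 'b) \<Rightarrow> 'b set \<Rightarrow> ('b \<Rightarrow> real) \<Rightarrow> enat" where
  "neg_index scl D q =
     (SUP L \<in> {L. module.subspace scl L \<and> L \<subseteq> D \<and> (\<forall>u \<in> L - {0}. q u < 0)}. edim scl L)"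

definition scale_fun :: "complex \<Rightarrow> ('a \<Rightarrow> complex) \<Rightarrow> 'a \<Rightarrow> complex" where
  "scale_fun c f = (\<lambda>x. c * f x)"

global_interpretation cfun: vector_space scale_fun
  by unfold_locales (auto simp: scale_fun_def fun_eq_iff algebra_simps)

text \<open>Elements of \<open>L\<^sub>2\<close> are represented by genuine functions, with pointwise vector space
  operations, instead of classes modulo equality almost everywhere. This does not
  change \<open>neg_index\<close> for a form \<open>q\<close> that depends only on the class: a nonzero function that
  vanishes almost everywhere has \<open>q u = 0\<close>, so no admissible \<open>L\<close> contains one. Admissible
  \<open>L\<close> therefore embed into the quotient with the same dimension, and conversely every
  admissible subspace of the quotient lifts along a basis to such an \<open>L\<close>.\<close>

section \<open>Weak derivatives and the Sobolev space on the plane\<close>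

definition partial :: "2 \<Rightarrow> (real^2 \<Rightarrow> real) \<Rightarrow> real^2 \<Rightarrow> real" where
  "partial i \<phi> x = frechet_derivative \<phi> (at x) (axis i 1)"

fun C_k :: "nat \<Rightarrow> (real^2 \<Rightarrow> real) \<Rightarrow> bool" where
  "C_k 0 \<phi> \<longleftrightarrow> continuous_on UNIV \<phi>"
| "C_k (Suc k) \<phi> \<longleftrightarrow> \<phi> differentiable_on UNIV \<and> (\<forall>i. C_k k (partial i \<phi>))"

definition test_function :: "(real^2 \<Rightarrow> real) \<Rightarrow> bool" where
  "test_function \<phi> \<longleftrightarrow> (\<forall>k. C_k k \<phi>) \<and> compact (closure {x. \<phi> x \<noteq> 0})"

definition locally_integrable ::
    "('a::euclidean_space \<Rightarrow> 'b::{banach, second_countable_topology}) \<Rightarrow> bool" where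
  "locally_integrable f \<longleftrightarrow> (\<forall>K. compact K \<longrightarrow> integrable (lebesgue_on K) f)"

definition has_weak_partial :: "2 \<Rightarrow> (real^2 \<Rightarrow> complex) \<Rightarrow> (real^2 \<Rightarrow> complex) \<Rightarrow> bool" where
  "has_weak_partial i w g \<longleftrightarrow>
     locally_integrable w \<and> locally_integrable g \<and>
     (\<forall>\<phi>. test_function \<phi> \<longrightarrow>
       (LINT x|lebesgue. partial i \<phi> x *\<^sub>R w x) = - (LINT x|lebesgue. \<phi> x *\<^sub>R g x))"

text \<open>Weak derivatives are unique up to null sets; \<open>weak_partial\<close> picks a representative.\<close>

definition weak_partial :: "2 \<Rightarrow> (real^2 \<Rightarrow> complex) \<Rightarrow> real^2 \<Rightarrow> complex" where
  "weak_partial i w = (SOME g. has_weak_partial i w g)"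

definition L2 :: "'a measure \<Rightarrow> ('a \<Rightarrow> complex) set" where
  "L2 M = {w \<in> borel_measurable M. integrable M (\<lambda>x. (norm (w x))\<^sup>2)}"

definition W12 :: "(real^2 \<Rightarrow> complex) set" where
  "W12 = {w \<in> L2 lebesgue. \<forall>i. \<exists>g \<in> L2 lebesgue. has_weak_partial i w g}"

section \<open>The energy form\<close>

definition energy :: "(real^2 \<Rightarrow> real) \<Rightarrow> (real^2 \<Rightarrow> complex) \<Rightarrow> real" where
  "energy V w =
     (LINT x|lebesgue. (\<Sum>i\<in>UNIV. (norm (weak_partial i w x))\<^sup>2))
     - (LINT x|lebesgue. V x * (norm (w x))\<^sup>2)"

definition Dom_energy :: "(real^2 \<Rightarrow> real) \<Rightarrow> (real^2 \<Rightarrow> complex) set" where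
  "Dom_energy V = W12 \<inter> L2 (density lebesgue (\<lambda>x. ennreal (V x)))"

definition N_minus :: "(real^2 \<Rightarrow> real) \<Rightarrow> enat" where
  "N_minus V = neg_index scale_fun (Dom_energy V) (energy V)"

section \<open>Annuli and weighted averages of the potential\<close>

definition U :: "int \<Rightarrow> (real^2) set" where
  "U n =
     (if n > 0 then {x. exp (2 ^ nat (n - 1)) < norm x \<and> norm x < exp (2 ^ nat n)}
      else if n = 0 then {x. exp (-1) < norm x \<and> norm x < exp 1}
      else {x. exp (- (2 ^ nat \<bar>n\<bar>)) < norm x \<and> norm x < exp (- (2 ^ nat (\<bar>n\<bar> - 1)))})"

definition A :: "(real^2 \<Rightarrow> real) \<Rightarrow> int \<Rightarrow> real" where
  "A V n =
     (if n = 0 then LINT x|lebesgue_on (U 0). V x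
      else LINT x|lebesgue_on (U n). V x * \<bar>ln (norm x)\<bar>)"

definition Omega :: "int \<Rightarrow> (real^2) set" where
  "Omega n = {x. exp (of_int n) < norm x \<and> norm x < exp (of_int n + 1)}"

definition N_fun_A :: "real \<Rightarrow> real" where
  "N_fun_A s = exp \<bar>s\<bar> - 1 - \<bar>s\<bar>"

definition N_fun_B :: "real \<Rightarrow> real" where
  "N_fun_B s = (1 + \<bar>s\<bar>) * ln (1 + \<bar>s\<bar>) - \<bar>s\<bar>"

definition Orlicz_space ::
    "(real \<Rightarrow> real) \<Rightarrow> 'a::euclidean_space set \<Rightarrow> ('a \<Rightarrow> real) set" where
  "Orlicz_space \<Psi> \<Omega> =
     {f \<in> borel_measurable (lebesgue_on \<Omega>).
        \<exists>\<kappa>>0. (\<integral>\<^sup>+x. ennreal (\<Psi> (f x / \<kappa>)) \<partial>lebesgue_on \<Omega>) < \<infinity>}"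

text \<open>On the Orlicz space of \<open>N_fun_B\<close> the products \<open>f x * g x\<close> below are integrable by Young's
  inequality; off it the Bochner integral may silently be \<open>0\<close>, hence the case distinction.\<close>

definition norm_B_av :: "'a::euclidean_space set \<Rightarrow> ('a \<Rightarrow> real) \<Rightarrow> ennreal" where
  "norm_B_av \<Omega> f =
     (if f \<in> Orlicz_space N_fun_B \<Omega> then
        (SUP g \<in> {g \<in> borel_measurable (lebesgue_on \<Omega>).
            (\<integral>\<^sup>+x. ennreal (N_fun_A (g x)) \<partial>lebesgue_on \<Omega>) \<le> emeasure lebesgue \<Omega>}.
          ennreal \<bar>LINT x|lebesgue_on \<Omega>. f x * g x\<bar>)
      else \<infinity>)"

definition B :: "(real^2 \<Rightarrow> real) \<Rightarrow> int \<Rightarrow> ennreal" where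
  "B V n = norm_B_av (Omega n) V"

end

theory Submission
  imports Defs
begin

text \<open>The plane is sampled on a fine grid in the coordinates \<open>(ln |x|, arg x)\<close>, in which the Dirichlet
  integral is conformally invariant. On the grid there are at most as many linear conditions as
  the right-hand side allows under which the energy is nonnegative: with \<open>w\<close> split into its circular means
  \<open>u\<close> and the rest, \<open>V |w|\<^sup>2 \<le> 2 V |u|\<^sup>2 + 2 V |w - u|\<^sup>2\<close>. The radial part is a one-dimensional Hardy
  problem on two half lines: \<open>u\<close> is required to vanish on the unit circle (this is the summand \<open>1\<close>) and at
  finitely many points of each dyadic block with \<open>A\<^sub>n > 1/4\<close>, chosen greedily. For \<open>w - u\<close> every annulus
  \<open>\<Omega>\<^sub>n\<close> is partitioned into \<open>O(\<B>\<^sub>n)\<close> dyadic rings that are light in the Orlicz norm; a zero mean on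
  each ring suffices, because there an \<open>L\<^sub>1\<close> Poincare inequality dominates \<open>w - u\<close> by a dyadic Riesz
  potential of the gradient, to which the Schur test applies. If the negative subspace had a larger dimension, then some
  combination of its mollified basis functions, with bounded coefficients of which one is \<open>1\<close>, would
  satisfy all conditions. As the mesh and the mollification are refined, these coefficients converge along a
  subsequence, and Fatou's lemma yields a nonzero element of the subspace with nonnegative energy.\<close>

section \<open>A Hardy inequality on the half line\<close>

text \<open>The factor 4 and the threshold 1/4 are prescribed, whereas \<open>C\<^sub>7\<close> and
  \<open>c\<close> may be chosen. So only the radial estimate has to be economical: its Hardy
  constant 7/4 is doubled to 7/2 by the splitting of |w|^2, and 7/2 is still below 2\<pi>, the
  factor between the Dirichlet integral of a radial function on the plane and that of its profile in
  ln |x|. The constant for w - u is a multiple of the Orlicz threshold, which is taken so small that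
  the total stays below 1. On the grid a circle becomes a row, an annulus
  \<open>\<Omega>\<^sub>n\<close> a square of 2^K by 2^K points, and all conditions become linear
  functionals of finitely many samples. The conditions change with mesh and mollifier, but their
  number has a bound that does not; so only coefficients on a fixed finite family have to converge.
  Rings are needed because a square can be light except for a small heavy core deep inside: cutting
  such a square into dyadic squares would cost a number of pieces that grows with the depth of the
  core, while the ring around the core is a single piece.\<close>

lemma norm_diff_squared_le_sum_increments:
  fixes u :: "nat \<Rightarrow> complex"
  assumes "s \<le> k"
  shows "(cmod (u k - u s))\<^sup>2 \<le> real (k - s) * (\<Sum>i\<in>{s..<k}. (cmod (u (Suc i) - u i))\<^sup>2)"
proof -
  have "u k - u s = (\<Sum>i\<in>{s..<k}. u (Suc i) - u i)"
    using assms by (simp add: sum_Suc_diff')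
  then have "cmod (u k - u s) \<le> (\<Sum>i\<in>{s..<k}. cmod (u (Suc i) - u i))"
    by (metis norm_sum)
  then have "(cmod (u k - u s))\<^sup>2 \<le> (\<Sum>i\<in>{s..<k}. cmod (u (Suc i) - u i))\<^sup>2"
    by (simp add: power_mono)
  also have "\<dots> \<le> (\<Sum>i\<in>{s..<k}. (cmod (u (Suc i) - u i))\<^sup>2) * real (card {s..<k})"
    by (rule sum_squared_le_sum_of_squares)
  finally show ?thesis by (simp add: mult.commute)
qed

text \<open>Cauchy-Schwarz in the plane. It makes sqrt (length * mass) superadditive over
  consecutive intervals, which is how \<open>greedy_zeros\<close> counts; in
  \<open>sum_weighted_le_Hardy\<close> it weighs the value at p against the energy beyond p.\<close>

lemma sqrt_mult_add_le:
  fixes a b c d :: real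
  assumes "a \<ge> 0" "b \<ge> 0" "c \<ge> 0" "d \<ge> 0"
  shows "sqrt (a * b) + sqrt (c * d) \<le> sqrt ((a + c) * (b + d))"
proof (rule real_le_rsqrt)
  have "2 * (sqrt (a * b) * sqrt (c * d)) \<le> a * d + c * b"
  proof -
    have "0 \<le> (sqrt (a * d) - sqrt (c * b))\<^sup>2" by simp
    also have "\<dots> = a * d + c * b - 2 * (sqrt (a * d) * sqrt (c * b))"
      using assms by (simp add: power2_diff)
    also have "sqrt (a * d) * sqrt (c * b) = sqrt (a * b) * sqrt (c * d)"
      by (simp add: real_sqrt_mult)
    finally show ?thesis by simp
  qed
  then show "(sqrt (a * b) + sqrt (c * d))\<^sup>2 \<le> (a + c) * (b + d)"
    using assms by (simp add: power2_sum algebra_simps)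
qed

text \<open>Since \<open>u s = 0\<close>, the point s contributes nothing: only the mass strictly
  inside counts, and e - 1 - s is the longest distance from s that occurs. This lets the greedy
  choice place its next zero at the very point where the product overflows.\<close>

lemma sum_weighted_le_increments:
  fixes u :: "nat \<Rightarrow> complex"
  assumes G: "\<And>k. G k \<ge> (0::real)" and "u s = 0" "s < e"
    and "real (e - 1 - s) * sum G {s<..<e} \<le> \<delta>"
  shows "(\<Sum>k\<in>{s..<e}. G k * (cmod (u k))\<^sup>2)
    \<le> \<delta> * (\<Sum>k\<in>{s..<e}. (cmod (u (Suc k) - u k))\<^sup>2)"
proof -
  define E where "E = (\<Sum>k\<in>{s..<e}. (cmod (u (Suc k) - u k))\<^sup>2)"
  have E0: "E \<ge> 0" unfolding E_def by (simp add: sum_nonneg)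
  have eq: "{s..<e} = insert s {s<..<e}" using assms by auto
  have "(\<Sum>k\<in>{s..<e}. G k * (cmod (u k))\<^sup>2) = (\<Sum>k\<in>{s<..<e}. G k * (cmod (u k))\<^sup>2)"
    unfolding eq by (subst sum.insert) (auto simp: assms)
  also have "\<dots> \<le> (\<Sum>k\<in>{s<..<e}. G k * (real (e - 1 - s) * E))"
  proof (intro sum_mono mult_left_mono G)
    fix k assume k: "k \<in> {s<..<e}"
    have "(cmod (u k))\<^sup>2 \<le> real (k - s) * (\<Sum>i\<in>{s..<k}. (cmod (u (Suc i) - u i))\<^sup>2)"
      using norm_diff_squared_le_sum_increments[of s k u] k assms by auto
    also have "\<dots> \<le> real (e - 1 - s) * E"
      unfolding E_def using k by (intro mult_mono sum_mono2) (auto simp: sum_nonneg)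
    finally show "(cmod (u k))\<^sup>2 \<le> real (e - 1 - s) * E" .
  qed
  also have "\<dots> = (real (e - 1 - s) * sum G {s<..<e}) * E"
    unfolding sum_distrib_left sum_distrib_right by (intro sum.cong) (auto simp: mult_ac)
  also have "\<dots> \<le> \<delta> * E" using assms E0 by (intro mult_right_mono) auto
  finally show ?thesis unfolding E_def .
qed

text \<open>The next zero is the first e at which length times mass on {s<..e} exceeds \<delta>. By
  minimality the piece before e is light. Every completed piece contributes more than sqrt \<delta>
  to the sum of sqrt (length * mass), which by \<open>sqrt_mult_add_le\<close> is at most the value
  for the whole interval. The mass at e is charged to the piece on its left and is harmless for the
  piece on its right, because u vanishes there.\<close>

lemma greedy_zeros:
  fixes G :: "nat \<Rightarrow> real"
  assumes G: "\<And>k. G k \<ge> 0" and "\<delta> > 0" and "s < q"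
  shows "\<exists>Z\<subseteq>{s<..<q}.
    (Z = {} \<or> real (card Z) * sqrt \<delta> < sqrt (real (q - s) * sum G {s<..<q})) \<and>
    (\<forall>u :: nat \<Rightarrow> complex. u s = 0 \<longrightarrow> (\<forall>z\<in>Z. u z = 0) \<longrightarrow>
      (\<Sum>k\<in>{s..<q}. G k * (cmod (u k))\<^sup>2) \<le> \<delta> * (\<Sum>k\<in>{s..<q}. (cmod (u (Suc k) - u k))\<^sup>2))"
  using \<open>s < q\<close>
proof (induction "q - s" arbitrary: s rule: less_induct)
  case less
  define P where "P e \<longleftrightarrow> s < e \<and> e < q \<and> \<delta> < real (e - s) * sum G {s<..e}" for e
  show ?case
  proof (cases "\<exists>e. P e")
    case False
    have "real (q - 1 - s) * sum G {s<..<q} \<le> \<delta>"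
    proof (cases "s < q - 1")
      case True
      then have "\<not> P (q - 1)" and "{s<..q - 1} = {s<..<q}" using False by auto
      then show ?thesis using True unfolding P_def by auto
    qed (use less \<open>\<delta> > 0\<close> in auto)
    then show ?thesis
      by (intro exI[of _ "{}"] conjI allI impI sum_weighted_le_increments G less.prems) simp_all
  next
    case True
    define e where "e = (LEAST e. P e)"
    have Pe: "P e" unfolding e_def using True by (metis LeastI_ex)
    have least: "\<not> P e'" if "e' < e" for e' using that unfolding e_def by (rule not_less_Least)
    have se: "s < e" "e < q" and big: "\<delta> < real (e - s) * sum G {s<..e}"
      using Pe unfolding P_def by auto
    have small: "real (e - 1 - s) * sum G {s<..<e} \<le> \<delta>"
    proof (cases "s < e - 1")
      case True
      have "\<not> P (e - 1)" and "{s<..e - 1} = {s<..<e}" using least[of "e - 1"] True by auto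
      then show ?thesis using True se unfolding P_def by auto
    qed (use \<open>\<delta> > 0\<close> in auto)
    have "q - e < q - s" using se by simp
    from less.hyps[OF this se(2)] obtain Z where Z: "Z \<subseteq> {e<..<q}"
      "Z = {} \<or> real (card Z) * sqrt \<delta> < sqrt (real (q - e) * sum G {e<..<q})"
      "\<And>u :: nat \<Rightarrow> complex. u e = 0 \<Longrightarrow> (\<forall>z\<in>Z. u z = 0) \<Longrightarrow>
        (\<Sum>k\<in>{e..<q}. G k * (cmod (u k))\<^sup>2) \<le> \<delta> * (\<Sum>k\<in>{e..<q}. (cmod (u (Suc k) - u k))\<^sup>2)"
      by blast
    have fin: "finite Z" using Z(1) finite_subset by blast
    have card: "card (insert e Z) = Suc (card Z)" using Z(1) fin by (subst card_insert_disjoint) auto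
    have le2: "real (card Z) * sqrt \<delta> \<le> sqrt (real (q - e) * sum G {e<..<q})"
      using Z(2) by (auto simp: sum_nonneg G)
    have "sqrt \<delta> < sqrt (real (e - s) * sum G {s<..e})"
      using big by (simp only: real_sqrt_less_iff)
    then have "real (card (insert e Z)) * sqrt \<delta>
        < sqrt (real (e - s) * sum G {s<..e}) + sqrt (real (q - e) * sum G {e<..<q})"
      unfolding card of_nat_Suc distrib_right mult_1 using le2 by linarith
    also have "\<dots> \<le> sqrt ((real (e - s) + real (q - e)) * (sum G {s<..e} + sum G {e<..<q}))"
      by (intro sqrt_mult_add_le) (auto simp: sum_nonneg G)
    also have "sum G {s<..e} + sum G {e<..<q} = sum G {s<..<q}"
      using se by (subst sum.union_disjoint[symmetric]) (auto intro!: sum.cong)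
    also have "real (e - s) + real (q - e) = real (q - s)" using se by auto
    finally have c: "real (card (insert e Z)) * sqrt \<delta> < sqrt (real (q - s) * sum G {s<..<q})" .
    have "(\<Sum>k\<in>{s..<q}. G k * (cmod (u k))\<^sup>2) \<le> \<delta> * (\<Sum>k\<in>{s..<q}. (cmod (u (Suc k) - u k))\<^sup>2)"
      if u: "u s = 0" "\<forall>z\<in>insert e Z. u z = 0" for u :: "nat \<Rightarrow> complex"
    proof -
      have split: "sum f {s..<q} = sum f {s..<e} + sum f {e..<q}" for f :: "nat \<Rightarrow> real"
        using se by (simp add: sum.atLeastLessThan_concat)
      show ?thesis unfolding split
        using sum_weighted_le_increments[of G u s e \<delta>, OF G u(1) se(1) small] Z(3)[of u] u
        by (simp add: algebra_simps)
    qed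
    moreover have "insert e Z \<subseteq> {s<..<q}" using Z(1) se by auto
    ultimately show ?thesis using c by blast
  qed
qed

text \<open>Cauchy-Schwarz with weights p and k - p, applied to |u p| + |u k - u p|, gives |u k|^2
  \<le> k * (|u p|^2 / p + E). The factor k is the weight |ln |x|| of \<open>A\<^sub>n\<close>, so a
  light block is controlled without any zero of its own.\<close>

lemma sum_weighted_le_Hardy:
  fixes u :: "nat \<Rightarrow> complex"
  assumes G: "\<And>k. G k \<ge> (0::real)" and p: "p > 0"
  shows "(\<Sum>k\<in>{p..<2*p}. G k * (cmod (u k))\<^sup>2)
    \<le> (\<Sum>k\<in>{p..<2*p}. G k * real k) *
      ((cmod (u p))\<^sup>2 / real p + (\<Sum>k\<in>{p..<2*p}. (cmod (u (Suc k) - u k))\<^sup>2))"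
proof -
  define E where "E = (\<Sum>k\<in>{p..<2*p}. (cmod (u (Suc k) - u k))\<^sup>2)"
  have E0: "E \<ge> 0" unfolding E_def by (simp add: sum_nonneg)
  have "(cmod (u k))\<^sup>2 \<le> real k * ((cmod (u p))\<^sup>2 / real p + E)" if k: "k \<in> {p..<2*p}" for k
  proof -
    have "(cmod (u k - u p))\<^sup>2 \<le> real (k - p) * (\<Sum>i\<in>{p..<k}. (cmod (u (Suc i) - u i))\<^sup>2)"
      using norm_diff_squared_le_sum_increments[of p k u] k by auto
    also have "\<dots> \<le> real (k - p) * E"
      unfolding E_def using k by (intro mult_mono sum_mono2) (auto simp: sum_nonneg)
    finally have "cmod (u k - u p) \<le> sqrt (real (k - p) * E)" by (simp add: real_le_rsqrt)
    moreover have "cmod (u k) \<le> cmod (u p) + cmod (u k - u p)"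
      by (metis add_diff_cancel_left' diff_add_cancel norm_triangle_ineq)
    moreover have "cmod (u p) = sqrt ((cmod (u p))\<^sup>2 / real p * real p)" using p by simp
    ultimately have "cmod (u k) \<le> sqrt ((cmod (u p))\<^sup>2 / real p * real p) + sqrt (E * real (k - p))"
      by (simp add: mult.commute)
    also have "\<dots> \<le> sqrt (((cmod (u p))\<^sup>2 / real p + E) * (real p + real (k - p)))"
      by (intro sqrt_mult_add_le) (auto simp: E0)
    also have "real p + real (k - p) = real k" using k by auto
    finally have "(cmod (u k))\<^sup>2 \<le> (sqrt (((cmod (u p))\<^sup>2 / real p + E) * real k))\<^sup>2"
      by (simp add: power_mono)
    then show ?thesis using E0 by (simp add: mult.commute)
  qed
  then have "(\<Sum>k\<in>{p..<2*p}. G k * (cmod (u k))\<^sup>2)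
    \<le> (\<Sum>k\<in>{p..<2*p}. G k * (real k * ((cmod (u p))\<^sup>2 / real p + E)))"
    by (intro sum_mono mult_left_mono G) auto
  also have "\<dots> = (\<Sum>k\<in>{p..<2*p}. G k * real k) * ((cmod (u p))\<^sup>2 / real p + E)"
    by (simp only: sum_distrib_right mult.assoc)
  finally show ?thesis unfolding E_def .
qed

text \<open>From (a + b)^2 \<le> 3/2 a^2 + 3 b^2. Division by the doubled length leaves the factor
  3/4 < 1, so the boundary terms |u p|^2 / p contract from block to block and their sum is
  controlled by the energy.\<close>

lemma Hardy_weight_step:
  fixes u :: "nat \<Rightarrow> complex"
  assumes p: "p > 0"
  shows "(cmod (u (2*p)))\<^sup>2 / real (2*p) \<le> 3/4 * ((cmod (u p))\<^sup>2 / real p)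
    + 3/2 * (\<Sum>k\<in>{p..<2*p}. (cmod (u (Suc k) - u k))\<^sup>2)"
proof -
  define E where "E = (\<Sum>k\<in>{p..<2*p}. (cmod (u (Suc k) - u k))\<^sup>2)"
  have 1: "(cmod (u (2*p) - u p))\<^sup>2 \<le> real p * E"
    using norm_diff_squared_le_sum_increments[of p "2*p" u] unfolding E_def by simp
  have "cmod (u (2*p)) \<le> cmod (u p) + cmod (u (2*p) - u p)"
    by (metis add_diff_cancel_left' diff_add_cancel norm_triangle_ineq)
  then have "(cmod (u (2*p)))\<^sup>2 \<le> (cmod (u p) + cmod (u (2*p) - u p))\<^sup>2"
    by (simp add: power_mono)
  also have "\<dots> \<le> 3/2 * (cmod (u p))\<^sup>2 + 3 * (cmod (u (2*p) - u p))\<^sup>2"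
  proof -
    have "0 \<le> (cmod (u p) - 2 * cmod (u (2*p) - u p))\<^sup>2" by simp
    then show ?thesis by (simp add: power2_eq_square algebra_simps)
  qed
  also have "\<dots> \<le> 3/2 * (cmod (u p))\<^sup>2 + 3 * (real p * E)" using 1 by simp
  finally have "(cmod (u (2*p)))\<^sup>2 / real (2*p) \<le> (3/2 * (cmod (u p))\<^sup>2 + 3 * (real p * E)) / real (2*p)"
    by (intro divide_right_mono) auto
  also have "\<dots> = 3/4 * ((cmod (u p))\<^sup>2 / real p) + 3/2 * E" using p by (simp add: field_simps)
  finally show ?thesis unfolding E_def .
qed

text \<open>The discrete \<open>A\<^sub>n\<close> of one half line: row k lies at distance k/N from
  the unit circle in the variable ln |x|, and block 0 is unweighted.\<close>

definition radial_mass :: "nat \<Rightarrow> (nat \<Rightarrow> real) \<Rightarrow> nat \<Rightarrow> real" where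
  "radial_mass N G n = (if n = 0 then sum G {0..<N}
     else (\<Sum>k\<in>{2^(n-1)*N..<2^n*N}. G k * (real k / real N)))"

text \<open>A block of mass at most 1/4 needs no zero: the Hardy bound with its boundary term
  suffices. A heavier block of index m > 0 gets the greedy zeros and one at its left end, and 2 sqrt
  a + 1 \<le> 4 sqrt a because a > 1/4. In block 0 the zero at the end is \<open>u 0 = 0\<close>, so
  2 sqrt suffices; this matters since the two half lines share \<open>A\<^sub>0\<close> and their
  counts will be added. The constant is 7/4 = (1 + 6)/4, where 6 bounds the sum of the boundary
  terms in units of energy.\<close>

lemma half_line_zeros:
  fixes G :: "nat \<Rightarrow> real"
  assumes G: "\<And>k. G k \<ge> 0" and N: "N > 0"
  obtains Z where "\<And>m. finite (Z m)" "\<And>m. radial_mass N G m \<le> 1/4 \<Longrightarrow> Z m = {}"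
    "real (card (Z 0)) \<le> 2 * sqrt (radial_mass N G 0)"
    "\<And>m. real (card (Z m)) \<le> 4 * sqrt (radial_mass N G m)"
    "\<And>m (u :: nat \<Rightarrow> complex). \<lbrakk>u 0 = 0; \<forall>i\<le>m. \<forall>z\<in>Z i. u z = 0\<rbrakk> \<Longrightarrow>
      (\<Sum>k\<in>{0..<2^m*N}. G k * (cmod (u k))\<^sup>2)
        \<le> 7/4 * real N * (\<Sum>k\<in>{0..<2^m*N}. (cmod (u (Suc k) - u k))\<^sup>2)"
proof -
  define E where "E u m = (\<Sum>k\<in>(if m = 0 then {0..<N} else {2^(m-1)*N..<2^m*N}). (cmod (u (Suc k) - u k))\<^sup>2)"
    for u :: "nat \<Rightarrow> complex" and m
  define S where "S u m = (\<Sum>k\<in>(if m = 0 then {0..<N} else {2^(m-1)*N..<2^m*N}). G k * (cmod (u k))\<^sup>2)"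
    for u :: "nat \<Rightarrow> complex" and m
  define \<beta> where "\<beta> u m = (cmod (u (2^m*N)))\<^sup>2 / real (2^m*N)" for u :: "nat \<Rightarrow> complex" and m
  have E0: "E u m \<ge> 0" for u m unfolding E_def by (simp add: sum_nonneg)
  have \<beta>0: "\<beta> u m \<ge> 0" for u m unfolding \<beta>_def by simp
  have "\<exists>Z. finite Z \<and> (radial_mass N G m \<le> 1/4 \<longrightarrow> Z = {}) \<and>
    (m = 0 \<longrightarrow> real (card Z) \<le> 2 * sqrt (radial_mass N G m)) \<and>
    real (card Z) \<le> 4 * sqrt (radial_mass N G m) \<and>
    (\<forall>u :: nat \<Rightarrow> complex. u 0 = 0 \<longrightarrow> (\<forall>z\<in>Z. u z = 0) \<longrightarrow>
       S u m \<le> real N / 4 * (E u m + (if m = 0 then 0 else \<beta> u (m-1))))" for m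
  proof (cases "m = 0")
    case True
    have N4: "real N / 4 > 0" using N by simp
    from greedy_zeros[where G = G and \<delta> = "real N / 4" and s = 0 and q = N, OF G N4 N]
    obtain Z where Z: "Z \<subseteq> {0<..<N}"
      "Z = {} \<or> real (card Z) * sqrt (real N / 4) < sqrt (real (N - 0) * sum G {0<..<N})"
      "\<And>u :: nat \<Rightarrow> complex. u 0 = 0 \<Longrightarrow> (\<forall>z\<in>Z. u z = 0) \<Longrightarrow>
        (\<Sum>k\<in>{0..<N}. G k * (cmod (u k))\<^sup>2) \<le> real N / 4 * (\<Sum>k\<in>{0..<N}. (cmod (u (Suc k) - u k))\<^sup>2)"
      by (elim exE conjE) blast
    have fin: "finite Z" using Z(1) finite_subset by blast
    have mono: "sum G {0<..<N} \<le> radial_mass N G 0"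
      unfolding radial_mass_def using G by (auto intro!: sum_mono2)
    have c: "real (card Z) < 2 * sqrt (radial_mass N G 0)" if "Z \<noteq> {}"
    proof -
      have "sqrt (real N) * (real (card Z) / 2) = real (card Z) * sqrt (real N / 4)"
        by (simp add: real_sqrt_divide)
      also have "\<dots> < sqrt (real N * sum G {0<..<N})" using Z(2) that by simp
      also have "\<dots> \<le> sqrt (real N) * sqrt (radial_mass N G 0)"
        using mono by (simp add: real_sqrt_mult mult_left_mono)
      finally show ?thesis using N by simp
    qed
    \<comment> \<open>The count is strictly below 2 * sqrt (1/4) = 1, hence zero.\<close>
    have e: "Z = {}" if "radial_mass N G 0 \<le> 1/4"
    proof (rule ccontr)
      assume ne: "Z \<noteq> {}"
      have "sqrt (radial_mass N G 0) \<le> sqrt (1/4)" using that by (simp only: real_sqrt_le_iff)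
      also have "sqrt (1/4 :: real) = 1/2" by (simp add: real_sqrt_divide)
      finally have "real (card Z) < 1" using c ne by linarith
      then show False using ne fin by (simp add: card_gt_0_iff)
    qed
    have c2: "real (card Z) \<le> 2 * sqrt (radial_mass N G 0)"
      using c by (cases "Z = {}") (auto simp: radial_mass_def G sum_nonneg)
    moreover have "0 \<le> sqrt (radial_mass N G 0)" by (simp add: radial_mass_def G sum_nonneg)
    ultimately have c4: "real (card Z) \<le> 4 * sqrt (radial_mass N G 0)" by linarith
    show ?thesis using Z(3) e c2 c4 fin True unfolding S_def E_def
      by (intro exI[of _ Z]) simp
  next
    case False
    define p where "p = 2^(m-1)*N"
    have "2^m = 2 * (2::nat)^(m-1)" using False by (cases m) simp_all
    then have p: "p > 0" "2^m*N = 2*p" "real p = 2^(m-1) * real N" using N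
      unfolding p_def by simp_all
    define a where "a = radial_mass N G m"
    have a: "a = (\<Sum>k\<in>{p..<2*p}. G k * real k) / real N"
      unfolding a_def radial_mass_def p(2)[symmetric] using False by (simp add: p_def sum_divide_distrib)
    have a0: "a \<ge> 0" unfolding a using G by (simp add: sum_nonneg)
    have S: "S u m = (\<Sum>k\<in>{p..<2*p}. G k * (cmod (u k))\<^sup>2)" for u
      unfolding S_def p(2)[symmetric] using False by (simp add: p_def)
    have E: "E u m = (\<Sum>k\<in>{p..<2*p}. (cmod (u (Suc k) - u k))\<^sup>2)" for u
      unfolding E_def p(2)[symmetric] using False by (simp add: p_def)
    have \<beta>: "\<beta> u (m-1) = (cmod (u p))\<^sup>2 / real p" for u unfolding \<beta>_def p_def by simp
    show ?thesis
    proof (cases "a \<le> 1/4")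
      case True
      have "S u m \<le> real N / 4 * (E u m + \<beta> u (m-1))" for u
      proof -
        have "S u m \<le> (a * real N) * (\<beta> u (m-1) + E u m)"
          using sum_weighted_le_Hardy[of G p u] G p N unfolding S E \<beta> a by simp
        also have "\<dots> \<le> (1/4 * real N) * (\<beta> u (m-1) + E u m)"
          using True E0 \<beta>0 by (intro mult_right_mono) auto
        finally show ?thesis by (simp add: algebra_simps)
      qed
      then show ?thesis using a0 False unfolding a_def by (intro exI[of _ "{}"]) auto
    next
      case big: False
      have N4: "real N / 4 > 0" and p2: "p < 2 * p" using N p by simp_all
      from greedy_zeros[where G = G and \<delta> = "real N / 4" and s = p and q = "2 * p", OF G N4 p2]
      obtain Z where Z: "Z \<subseteq> {p<..<2*p}"
        "Z = {} \<or> real (card Z) * sqrt (real N / 4) < sqrt (real (2 * p - p) * sum G {p<..<2*p})"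
        "\<And>u :: nat \<Rightarrow> complex. u p = 0 \<Longrightarrow> (\<forall>z\<in>Z. u z = 0) \<Longrightarrow>
          (\<Sum>k\<in>{p..<2*p}. G k * (cmod (u k))\<^sup>2) \<le> real N / 4 * (\<Sum>k\<in>{p..<2*p}. (cmod (u (Suc k) - u k))\<^sup>2)"
        by (elim exE conjE) blast
      have fin: "finite Z" using Z(1) finite_subset by blast
      have "real p * sum G {p<..<2*p} \<le> real p * sum G {p..<2*p}"
        using G by (intro mult_left_mono sum_mono2) auto
      also have "\<dots> = (\<Sum>k\<in>{p..<2*p}. G k * real p)" by (simp add: sum_distrib_left mult.commute)
      also have "\<dots> \<le> a * real N" unfolding a using N G by (auto intro!: sum_mono mult_left_mono)
      finally have m: "real p * sum G {p<..<2*p} \<le> a * real N" .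
      have c: "real (card Z) \<le> 2 * sqrt a"
      proof (cases "Z = {}")
        case False
        have "sqrt (real N) * (real (card Z) / 2) = real (card Z) * sqrt (real N / 4)"
          by (simp add: real_sqrt_divide)
        also have "\<dots> < sqrt (real p * sum G {p<..<2*p})" using Z(2) False by simp
        also have "\<dots> \<le> sqrt (a * real N)" using m by simp
        also have "\<dots> = sqrt (real N) * sqrt a" by (simp add: real_sqrt_mult)
        finally show ?thesis using N by simp
      qed (use a0 in simp)
      have "sqrt (1/4) \<le> sqrt a" using big by (simp only: real_sqrt_le_iff)
      moreover have "sqrt (1/4 :: real) = 1/2" by (simp add: real_sqrt_divide)
      moreover have "real (card (insert p Z)) \<le> real (card Z) + 1"
        by (simp add: card_insert_if fin)
      ultimately have c4: "real (card (insert p Z)) \<le> 4 * sqrt a" using c by linarith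
      have "S u m \<le> real N / 4 * (E u m + \<beta> u (m-1))" if "\<forall>z\<in>insert p Z. u z = 0" for u
        using Z(3)[of u] that unfolding S E \<beta> by simp
      then show ?thesis using big c4 fin False unfolding a_def by (intro exI[of _ "insert p Z"]) auto
    qed
  qed
  then obtain Z where Z: "\<And>m. finite (Z m)" "\<And>m. radial_mass N G m \<le> 1/4 \<Longrightarrow> Z m = {}"
    "\<And>m. m = 0 \<Longrightarrow> real (card (Z m)) \<le> 2 * sqrt (radial_mass N G m)"
    "\<And>m. real (card (Z m)) \<le> 4 * sqrt (radial_mass N G m)"
    "\<And>m u. u 0 = 0 \<Longrightarrow> (\<forall>z\<in>Z m. u z = 0) \<Longrightarrow>
       S u m \<le> real N / 4 * (E u m + (if m = 0 then 0 else \<beta> u (m-1)))"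
    by metis
  have main: "(\<Sum>k\<in>{0..<2^m*N}. G k * (cmod (u k))\<^sup>2)
        \<le> 7/4 * real N * (\<Sum>k\<in>{0..<2^m*N}. (cmod (u (Suc k) - u k))\<^sup>2)"
    if u: "u 0 = 0" "\<forall>i\<le>m. \<forall>z\<in>Z i. u z = 0" for u :: "nat \<Rightarrow> complex" and m
  proof -
    have blocks: "sum f {0..<2^m*N} = (\<Sum>i\<le>m. sum f (if i = 0 then {0..<N} else {2^(i-1)*N..<2^i*N}))"
      for f :: "nat \<Rightarrow> real" and m
    proof (induction m)
      case (Suc m)
      have "sum f {0..<2^Suc m*N} = sum f {0..<2^m*N} + sum f {2^m*N..<2^Suc m*N}"
        by (simp add: sum.atLeastLessThan_concat)
      then show ?case using Suc by simp
    qed simp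
    \<comment> \<open>The weight 4 on the last boundary term is what makes the induction close: 4 *
      3/4 + 1 = 4, and each block costs 4 * 3/2 = 6 times its energy.\<close>
    have b: "(\<Sum>i<m. \<beta> u i) + 4 * \<beta> u m \<le> 6 * (\<Sum>i\<le>m. E u i)" for m
    proof (induction m)
      case 0
      have "(cmod (u N))\<^sup>2 \<le> real N * E u 0"
        using norm_diff_squared_le_sum_increments[of 0 N u] u unfolding E_def by simp
      then have "\<beta> u 0 \<le> E u 0" unfolding \<beta>_def using N by (simp add: field_simps)
      then show ?case using E0[of u 0] by simp
    next
      case (Suc m)
      have "\<beta> u (Suc m) \<le> 3/4 * \<beta> u m + 3/2 * E u (Suc m)"
        using Hardy_weight_step[of "2^m*N" u] N unfolding \<beta>_def E_def by (simp add: mult_ac)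
      then show ?case using Suc by simp
    qed
    have b2: "(\<Sum>i\<le>m. if i = 0 then 0 else \<beta> u (i-1)) = (\<Sum>i<m. \<beta> u i)"
      by (induction m) auto
    have "(\<Sum>k\<in>{0..<2^m*N}. G k * (cmod (u k))\<^sup>2) = (\<Sum>i\<le>m. S u i)"
      unfolding blocks S_def ..
    also have "\<dots> \<le> (\<Sum>i\<le>m. real N / 4 * (E u i + (if i = 0 then 0 else \<beta> u (i-1))))"
      using Z(5) u by (intro sum_mono) auto
    also have "\<dots> = real N / 4 * ((\<Sum>i\<le>m. E u i) + (\<Sum>i<m. \<beta> u i))"
      unfolding b2[symmetric] by (simp only: sum_distrib_left sum.distrib distrib_left)
    also have "\<dots> \<le> real N / 4 * (7 * (\<Sum>i\<le>m. E u i))"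
      using b[of m] \<beta>0[of u m] by (intro mult_left_mono) auto
    also have "(\<Sum>i\<le>m. E u i) = (\<Sum>k\<in>{0..<2^m*N}. (cmod (u (Suc k) - u k))\<^sup>2)"
      unfolding blocks E_def ..
    finally show ?thesis by (simp add: mult_ac)
  qed
  show thesis by (rule that[of Z]) (fact Z(1), fact Z(2), rule Z(3)[OF refl], fact Z(4), fact main)
qed

section \<open>The function \<open>N_fun_A\<close> and dyadic squares\<close>

lemma N_fun_A_nonneg: "N_fun_A t \<ge> 0"
  unfolding N_fun_A_def using exp_ge_add_one_self[of "\<bar>t\<bar>"] by linarith

lemma N_fun_A_divide:
  assumes "r \<ge> 1"
  shows "N_fun_A (t / r) \<le> N_fun_A t / r"
proof -
  have "convex_on UNIV (exp :: real \<Rightarrow> real)" by (rule exp_convex)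
  from convex_onD[OF this, of "1 / r" 0 "\<bar>t\<bar>"]
  have "exp (\<bar>t\<bar> / r) \<le> (1 - 1 / r) + exp \<bar>t\<bar> / r" using assms by simp
  then show ?thesis unfolding N_fun_A_def using assms by (simp add: field_simps)
qed

text \<open>Dyadic intervals are fibres of the division by 2^s, so nesting and disjointness reduce
  to arithmetic of quotients.\<close>

definition ivl :: "nat \<Rightarrow> nat \<Rightarrow> nat set" where
  "ivl s i = {a. a div 2^s = i}"

definition sq :: "nat \<Rightarrow> nat \<Rightarrow> nat \<Rightarrow> (nat \<times> nat) set" where
  "sq s i j = ivl s i \<times> ivl s j"

lemma ivl_eq: "ivl s i = {i * 2^s..<i * 2^s + 2^s}"
  unfolding ivl_def by (auto simp: div_nat_eqI dividend_less_times_div mult.commute add.commute)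

lemma finite_ivl [simp]: "finite (ivl s i)" by (simp add: ivl_eq)
lemma card_ivl [simp]: "card (ivl s i) = 2^s" by (simp add: ivl_eq)
lemma finite_sq [simp]: "finite (sq s i j)" by (simp add: sq_def)
lemma card_sq: "card (sq s i j) = 4^s"
  by (simp add: sq_def card_cartesian_product flip: power_mult_distrib)

lemma sq_nonempty: "sq s i j \<noteq> {}" using card_sq[of s i j] by fastforce

lemma ivl_subset: "s' \<le> s \<Longrightarrow> ivl s' i \<subseteq> ivl s (i div 2^(s - s'))"
  unfolding ivl_def by (auto simp: div_mult2_eq[symmetric] power_add[symmetric])

lemma sq_0: "sq 0 i j = {(i, j)}" unfolding sq_def ivl_def by auto

lemma ivl_child: "p < 2 \<Longrightarrow> ivl s (2*i+p) \<subseteq> ivl (Suc s) i"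
  using ivl_subset[of s "Suc s" "2*i+p"] by (simp add: div_add1_eq)

lemma ivl_split: "ivl (Suc s) i = ivl s (2*i) \<union> ivl s (Suc (2*i))"
  unfolding ivl_eq by auto

text \<open>The dyadic square of side 2^s around x. The increasing chain of these squares plays the
  part of the balls around x in a Riesz potential.\<close>

definition dy :: "nat \<Rightarrow> nat \<times> nat \<Rightarrow> (nat \<times> nat) set" where
  "dy s x = sq s (fst x div 2^s) (snd x div 2^s)"

lemma mem_dy: "y \<in> dy s x \<longleftrightarrow> fst y div 2^s = fst x div 2^s \<and> snd y div 2^s = snd x div 2^s"
  unfolding dy_def sq_def ivl_def by (cases y) auto

lemma dy_self [simp]: "x \<in> dy s x" by (simp add: mem_dy)
lemma finite_dy [simp]: "finite (dy s x)" by (simp add: dy_def)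
lemma card_dy: "card (dy s x) = 4^s" by (simp add: dy_def card_sq)

lemma dy_mono: "s \<le> t \<Longrightarrow> dy s x \<subseteq> dy t x"
proof
  fix y assume st: "s \<le> t" and "y \<in> dy s x"
  then have *: "fst y div 2^s = fst x div 2^s" "snd y div 2^s = snd x div 2^s" by (auto simp: mem_dy)
  have d: "a div 2^t = a div 2^s div 2^(t-s)" for a :: nat
    using st by (simp add: div_mult2_eq[symmetric] power_add[symmetric])
  show "y \<in> dy t x" unfolding mem_dy d[of "fst y"] d[of "snd y"] d[of "fst x"] d[of "snd x"] * by simp
qed

lemma dy_eq_sq: "x \<in> sq s i j \<Longrightarrow> dy s x = sq s i j"
  unfolding dy_def sq_def ivl_def by auto

lemma sq_subset_if_meets:
  assumes "s' \<le> s" "x \<in> sq s' i' j'" "x \<in> sq s i j"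
  shows "sq s' i' j' \<subseteq> sq s i j"
  using dy_eq_sq[OF assms(2)] dy_eq_sq[OF assms(3)] dy_mono[OF assms(1)] by blast

section \<open>The \<open>L\<^sub>1\<close> Poincare inequality on dyadic rings\<close>

text \<open>Only edges with both end points in R count. Hence the energies of disjoint sets add up
  to at most the energy of their union, and a ring does not see the values in its hole.\<close>

definition gx :: "(nat \<times> nat) set \<Rightarrow> (nat \<times> nat \<Rightarrow> complex) \<Rightarrow> nat \<times> nat \<Rightarrow> real" where
  "gx R v x = (if x \<in> R \<and> (Suc (fst x), snd x) \<in> R then cmod (v (Suc (fst x), snd x) - v x) else 0)"

definition gy :: "(nat \<times> nat) set \<Rightarrow> (nat \<times> nat \<Rightarrow> complex) \<Rightarrow> nat \<times> nat \<Rightarrow> real" where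
  "gy R v x = (if x \<in> R \<and> (fst x, Suc (snd x)) \<in> R then cmod (v (fst x, Suc (snd x)) - v x) else 0)"

definition Dirichlet :: "(nat \<times> nat) set \<Rightarrow> (nat \<times> nat \<Rightarrow> complex) \<Rightarrow> real" where
  "Dirichlet R v = (\<Sum>x\<in>R. (gx R v x)\<^sup>2 + (gy R v x)\<^sup>2)"

lemma g_nonneg [simp]: "gx R v x \<ge> 0" "gy R v x \<ge> 0" by (auto simp: gx_def gy_def)

lemma g_outside: "x \<notin> R \<Longrightarrow> gx R v x = 0" "x \<notin> R \<Longrightarrow> gy R v x = 0"
  by (auto simp: gx_def gy_def)

lemma g_mono: "S \<subseteq> R \<Longrightarrow> gx S v x \<le> gx R v x" "S \<subseteq> R \<Longrightarrow> gy S v x \<le> gy R v x"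
  by (auto simp: gx_def gy_def)

lemma norm_diff_le_sum_increments:
  fixes u :: "nat \<Rightarrow> complex"
  assumes "a \<in> {p..<p+n}" "b \<in> {p..<p+n}" and "\<And>c. c \<in> {p..<p+n-1} \<Longrightarrow> cmod (u (Suc c) - u c) \<le> g c"
    and "\<And>c. g c \<ge> 0"
  shows "cmod (u a - u b) \<le> sum g {p..<p+n}"
proof -
  have *: "cmod (u b - u a) \<le> sum g {p..<p+n}" if "a \<le> b" "a \<in> {p..<p+n}" "b \<in> {p..<p+n}" for a b
  proof -
    have "u b - u a = (\<Sum>i\<in>{a..<b}. u (Suc i) - u i)" using that by (simp add: sum_Suc_diff')
    then have "cmod (u b - u a) \<le> (\<Sum>i\<in>{a..<b}. cmod (u (Suc i) - u i))" by (metis norm_sum)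
    also have "\<dots> \<le> (\<Sum>i\<in>{a..<b}. g i)" using that by (intro sum_mono assms) auto
    also have "\<dots> \<le> sum g {p..<p+n}" using that assms(4) by (intro sum_mono2) auto
    finally show ?thesis .
  qed
  show ?thesis using *[of a b] *[of b a] assms(1,2) by (cases "a \<le> b") (auto simp: norm_minus_commute)
qed

text \<open>Two grid paths lead from (a, b) to (c, d): row b then column c, or column a then row d.
  The choice of I0 and J0 keeps column c and row d away from the hole. A point outside I' \<times>
  J' has b outside J' or a outside I', which frees its row or its column, so one of the paths stays
  in R. It costs one full row sum and one full column sum; the rest is counting how often each of
  them occurs.\<close>

lemma ring_sum_norm_diff_le:
  fixes v :: "nat \<times> nat \<Rightarrow> complex"
  assumes "I = {p..<p+n}" "J = {q..<q+n}" and I0: "I0 \<subseteq> I" "J0 \<subseteq> J"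
    and disj: "I0 \<inter> I' = {}" "J0 \<inter> J' = {}" and card: "card I0 = m" "card J0 = m" "m \<le> n"
    and R: "R = I \<times> J - I' \<times> J'"
  shows "(\<Sum>x\<in>R. \<Sum>z\<in>I0\<times>J0. cmod (v x - v z)) \<le> 2 * real n ^ 2 * real m * (\<Sum>x\<in>R. gx R v x + gy R v x)"
proof -
  define h where "h b = (\<Sum>c\<in>I. gx R v (c, b))" for b
  define k where "k a = (\<Sum>d\<in>J. gy R v (a, d))" for a
  have fin: "finite I" "finite J" "finite I0" "finite J0"
    using assms finite_subset[OF I0(1)] finite_subset[OF I0(2)] by auto
  have h0: "h b \<ge> 0" "k b \<ge> 0" for b unfolding h_def k_def by (auto intro: sum_nonneg)
  have row: "cmod (v (a, b) - v (c, b)) \<le> h b" if "a \<in> I" "c \<in> I" "I \<times> {b} \<subseteq> R" for a b c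
    unfolding h_def assms(1)
  proof (rule norm_diff_le_sum_increments[where u = "\<lambda>a. v (a, b)"])
    fix c assume "c \<in> {p..<p+n-1}"
    then have "(c, b) \<in> R" "(Suc c, b) \<in> R" using that(3) assms(1) by auto
    then show "cmod (v (Suc c, b) - v (c, b)) \<le> gx R v (c, b)" by (simp add: gx_def)
  qed (use that assms(1) in auto)
  have column: "cmod (v (a, b) - v (a, d)) \<le> k a" if "b \<in> J" "d \<in> J" "{a} \<times> J \<subseteq> R" for a b d
    unfolding k_def assms(2)
  proof (rule norm_diff_le_sum_increments[where u = "\<lambda>b. v (a, b)"])
    fix c assume "c \<in> {q..<q+n-1}"
    then have "(a, c) \<in> R" "(a, Suc c) \<in> R" using that(3) assms(2) by auto
    then show "cmod (v (a, Suc c) - v (a, c)) \<le> gy R v (a, c)" by (simp add: gy_def)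
  qed (use that assms(2) in auto)
  have pt: "cmod (v (a, b) - v (c, d)) \<le> h b + k a + k c + h d"
    if ab: "(a, b) \<in> R" and cd: "c \<in> I0" "d \<in> J0" for a b c d
  proof (cases "b \<in> J'")
    case False
    have "I \<times> {b} \<subseteq> R" "{c} \<times> J \<subseteq> R" using False ab cd I0 disj unfolding R by auto
    then have "cmod (v (a, b) - v (c, b)) \<le> h b" "cmod (v (c, b) - v (c, d)) \<le> k c"
      using row[of a c b] column[of b d c] ab cd I0 unfolding R by auto
    moreover have "cmod (v (a, b) - v (c, d)) \<le> cmod (v (a, b) - v (c, b)) + cmod (v (c, b) - v (c, d))"
      using norm_triangle_ineq[of "v (a, b) - v (c, b)" "v (c, b) - v (c, d)"] by simp
    ultimately show ?thesis using h0[of a] h0[of d] by linarith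
  next
    case True
    then have "a \<notin> I'" using ab unfolding R by auto
    then have "{a} \<times> J \<subseteq> R" "I \<times> {d} \<subseteq> R" using ab cd I0 disj unfolding R by auto
    then have "cmod (v (a, b) - v (a, d)) \<le> k a" "cmod (v (a, d) - v (c, d)) \<le> h d"
      using row[of a c d] column[of b d a] ab cd I0 unfolding R by auto
    moreover have "cmod (v (a, b) - v (c, d)) \<le> cmod (v (a, b) - v (a, d)) + cmod (v (a, d) - v (c, d))"
      using norm_triangle_ineq[of "v (a, b) - v (a, d)" "v (a, d) - v (c, d)"] by simp
    ultimately show ?thesis using h0[of b] h0[of c] by linarith
  qed
  define X Y where "X = (\<Sum>x\<in>R. gx R v x)" and "Y = (\<Sum>x\<in>R. gy R v x)"
  have XY0: "X \<ge> 0" "Y \<ge> 0" unfolding X_def Y_def by (auto intro: sum_nonneg)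
  have RIJ: "R \<subseteq> I \<times> J" unfolding R by auto
  have hs: "(\<Sum>b\<in>J. h b) = X"
  proof -
    have "(\<Sum>b\<in>J. h b) = (\<Sum>x\<in>I\<times>J. gx R v x)"
      unfolding h_def by (subst sum.swap) (simp add: sum.cartesian_product)
    also have "\<dots> = X" unfolding X_def
      using RIJ fin by (intro sum.mono_neutral_right) (auto simp: g_outside)
    finally show ?thesis .
  qed
  have ks: "(\<Sum>a\<in>I. k a) = Y"
  proof -
    have "(\<Sum>a\<in>I. k a) = (\<Sum>x\<in>I\<times>J. gy R v x)"
      unfolding k_def by (simp add: sum.cartesian_product)
    also have "\<dots> = Y" unfolding Y_def
      using RIJ fin by (intro sum.mono_neutral_right) (auto simp: g_outside)
    finally show ?thesis .
  qed
  have hs0: "(\<Sum>b\<in>J0. h b) \<le> X" unfolding hs[symmetric] using I0 fin h0 by (intro sum_mono2) auto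
  have ks0: "(\<Sum>a\<in>I0. k a) \<le> Y" unfolding ks[symmetric] using I0 fin h0 by (intro sum_mono2) auto
  have cn: "card I = n" "card J = n" using assms by auto
  have "(\<Sum>x\<in>R. \<Sum>z\<in>I0\<times>J0. cmod (v x - v z))
      \<le> (\<Sum>x\<in>R. \<Sum>z\<in>I0\<times>J0. h (snd x) + k (fst x) + k (fst z) + h (snd z))"
    using pt by (intro sum_mono) auto
  also have "\<dots> \<le> (\<Sum>x\<in>I\<times>J. \<Sum>z\<in>I0\<times>J0. h (snd x) + k (fst x) + k (fst z) + h (snd z))"
    using RIJ fin h0 by (intro sum_mono2) (auto intro!: sum_nonneg add_nonneg_nonneg)
  also have "\<dots> = (\<Sum>a\<in>I. \<Sum>b\<in>J. \<Sum>c\<in>I0. \<Sum>d\<in>J0. h b + k a + k c + h d)"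
    by (simp add: sum.cartesian_product')
  also have "\<dots> = real n * real m ^ 2 * (\<Sum>b\<in>J. h b) + real n * real m ^ 2 * (\<Sum>a\<in>I. k a)
      + real n ^ 2 * real m * (\<Sum>c\<in>I0. k c) + real n ^ 2 * real m * (\<Sum>d\<in>J0. h d)"
    by (simp add: sum.distrib card cn power2_eq_square algebra_simps sum_distrib_left[symmetric])
  also have "\<dots> \<le> real n * real m ^ 2 * X + real n * real m ^ 2 * Y
      + real n ^ 2 * real m * Y + real n ^ 2 * real m * X"
    unfolding hs ks using hs0 ks0 by (intro add_mono mult_left_mono) auto
  also have "\<dots> = (real n * real m ^ 2 + real n ^ 2 * real m) * (X + Y)" by (simp add: algebra_simps)
  also have "\<dots> \<le> (real n ^ 2 * real m + real n ^ 2 * real m) * (X + Y)"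
  proof -
    have "real n * real m * real m \<le> real n * real m * real n" using card by (intro mult_left_mono) auto
    then show ?thesis using XY0 by (intro mult_right_mono) (auto simp: power2_eq_square algebra_simps)
  qed
  also have "X + Y = (\<Sum>x\<in>R. gx R v x + gy R v x)" unfolding X_def Y_def by (simp add: sum.distrib)
  finally show ?thesis by (simp add: algebra_simps)
qed

definition mean :: "'a set \<Rightarrow> ('a \<Rightarrow> complex) \<Rightarrow> complex" where
  "mean S v = sum v S / of_nat (card S)"

lemma norm_mean_diff_le:
  assumes "finite S" "S \<noteq> {}"
  shows "cmod (mean S v - c) \<le> (\<Sum>x\<in>S. cmod (v x - c)) / real (card S)"
proof -
  have "mean S v - c = (\<Sum>x\<in>S. v x - c) / of_nat (card S)"
    unfolding mean_def using assms by (simp add: sum_subtractf field_simps)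
  then show ?thesis
    by (simp add: norm_divide divide_right_mono norm_sum)
qed

text \<open>S and the quadrant are compared through all pairs of their points. Dividing the previous
  bound by the m^2 points of the quadrant and by the at least m^2/4 points of S, with 2^s = 2 m,
  gives 64 / 2^s. The density 1/16 is that of a quadrant of the next smaller square, so the estimate
  can be chained over the scales.\<close>

lemma ring_mean_diff_le:
  fixes v :: "nat \<times> nat \<Rightarrow> complex"
  assumes s: "s \<ge> 1" and I0: "ivl (s-1) i0 \<subseteq> ivl s i" "ivl (s-1) j0 \<subseteq> ivl s j"
    and disj: "ivl (s-1) i0 \<inter> I' = {}" "ivl (s-1) j0 \<inter> J' = {}"
    and R: "R = sq s i j - I' \<times> J'" and S: "S \<subseteq> R" "16 * card S \<ge> 4^s"
  shows "cmod (mean S v - mean (sq (s-1) i0 j0) v) \<le> 64 / 2^s * (\<Sum>x\<in>R. gx R v x + gy R v x)"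
proof -
  define m where "m = (2::nat)^(s-1)"
  have n: "2^s = 2 * m" unfolding m_def using s by (cases s) auto
  have "(2::nat)^s * 2^s = 4^s" by (simp flip: power_mult_distrib)
  then have four: "4 * (m * m) = 4^s" unfolding n by simp
  have m0: "m > 0" unfolding m_def by simp
  define F where "F = (\<Sum>x\<in>R. gx R v x + gy R v x)"
  have F0: "F \<ge> 0" unfolding F_def by (auto intro: sum_nonneg)
  have finR: "finite R" unfolding R by simp
  have finS: "finite S" using S finR finite_subset by blast
  have S0: "card S > 0" using S(2) by (cases "card S") auto
  let ?O = "sq (s-1) i0 j0"
  have cO: "card ?O = m * m" unfolding m_def by (simp add: sq_def card_cartesian_product)
  have "(\<Sum>x\<in>R. \<Sum>z\<in>?O. cmod (v x - v z)) \<le> 2 * real (2*m) ^ 2 * real m * F"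
    unfolding F_def sq_def
    by (rule ring_sum_norm_diff_le[OF ivl_eq[of s i, unfolded n] ivl_eq[of s j, unfolded n]])
      (use assms n m_def in \<open>auto simp: sq_def ivl_eq\<close>)
  then have A: "(\<Sum>x\<in>R. \<Sum>z\<in>?O. cmod (v x - v z)) \<le> 8 * real m ^ 3 * F"
    by (simp add: power2_eq_square power3_eq_cube)
  have "(\<Sum>x\<in>S. cmod (v x - mean ?O v)) \<le> (\<Sum>x\<in>R. cmod (v x - mean ?O v))"
    using S finR by (intro sum_mono2) auto
  also have "\<dots> \<le> (\<Sum>x\<in>R. (\<Sum>z\<in>?O. cmod (v x - v z)) / real (m * m))"
  proof (rule sum_mono)
    fix x
    show "cmod (v x - mean ?O v) \<le> (\<Sum>z\<in>?O. cmod (v x - v z)) / real (m * m)"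
      using norm_mean_diff_le[OF finite_sq sq_nonempty, of "s-1" i0 j0 v "v x"] unfolding cO
      by (simp only: norm_minus_commute)
  qed
  also have "\<dots> \<le> 8 * real m ^ 3 * F / real (m * m)"
    unfolding sum_divide_distrib[symmetric] using A by (intro divide_right_mono) auto
  also have "\<dots> = 8 * real m * F" using m0 by (simp add: power3_eq_cube field_simps)
  finally have B: "(\<Sum>x\<in>S. cmod (v x - mean ?O v)) \<le> 8 * real m * F" .
  have "cmod (mean S v - mean ?O v) \<le> (\<Sum>x\<in>S. cmod (v x - mean ?O v)) / real (card S)"
    using norm_mean_diff_le finS S0 by fastforce
  also have "\<dots> \<le> 8 * real m * F / real (card S)" using B by (intro divide_right_mono) auto
  also have "\<dots> \<le> 8 * real m * F / (real (m * m) / 4)"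
  proof (rule divide_left_mono)
    have "16 * card S \<ge> 4 * (m * m)"
      using S(2) four by simp
    then show "real (m * m) / 4 \<le> real (card S)" by linarith
  qed (use m0 F0 S0 in auto)
  also have "\<dots> = 64 / real (2 * m) * F" using m0 by (simp add: field_simps)
  also have "real (2 * m) = 2^s" using n by (metis of_nat_numeral of_nat_power)
  finally show ?thesis unfolding F_def .
qed

text \<open>A hole that meets the square of x but does not contain x is a dyadic square of at most
  half the side. Each of its projections lies in one half of the corresponding side, so the quadrant
  that is opposite in both coordinates avoids all its rows and all its columns.\<close>

lemma dyadic_quadrant_avoiding:
  assumes Q': "Q' = {} \<or> (\<exists>s' i' j'. Q' = sq s' i' j')" and x: "x \<notin> Q'" and s: "s \<ge> 1"
  obtains I' J' i0 j0 where "dy s x - Q' = dy s x - I' \<times> J'"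
    "ivl (s-1) i0 \<subseteq> ivl s (fst x div 2^s)" "ivl (s-1) j0 \<subseteq> ivl s (snd x div 2^s)"
    "ivl (s-1) i0 \<inter> I' = {}" "ivl (s-1) j0 \<inter> J' = {}"
proof -
  have ss: "Suc (s-1) = s" using s by simp
  let ?i = "fst x div 2^s" and ?j = "snd x div 2^s"
  show thesis
  proof (cases "dy s x \<inter> Q' = {}")
    case True
    then show thesis
      using ivl_child[of 0 "s-1" ?i] ivl_child[of 0 "s-1" ?j] ss
      by (intro that[of "{}" "{}" "2 * ?i" "2 * ?j"]) auto
  next
    case False
    then obtain y s' i' j' where y: "y \<in> dy s x" "y \<in> Q'" and Q: "Q' = sq s' i' j'" using Q' by blast
    have s': "s' \<le> s - 1"
    proof (rule ccontr)
      assume "\<not> s' \<le> s - 1"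
      then have "sq s ?i ?j \<subseteq> Q'" using y unfolding Q dy_def by (intro sq_subset_if_meets) auto
      then show False using x dy_self[of x s] unfolding dy_def by blast
    qed
    have *: "\<exists>i0. ivl (s-1) i0 \<subseteq> ivl s i \<and> ivl (s-1) i0 \<inter> ivl s' i' = {}" for i i'
    proof -
      define a where "a = i' div 2^(s-1-s')"
      have "ivl s' i' \<subseteq> ivl (s-1) a" unfolding a_def by (rule ivl_subset[OF s'])
      \<comment> \<open>Flipping the last binary digit of a gives a half of \<open>ivl s i\<close>
        that differs from the interval a, whether or not a is itself a half of it.\<close>
      moreover have "ivl (s-1) (2*i + (1 - a mod 2)) \<inter> ivl (s-1) a = {}"
      proof -
        have "2*i + (1 - a mod 2) \<noteq> a" by presburger
        then show ?thesis unfolding ivl_def by auto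
      qed
      moreover have "ivl (s-1) (2*i + (1 - a mod 2)) \<subseteq> ivl s i"
        using ivl_child[of "1 - a mod 2" "s-1" i] unfolding ss by simp
      ultimately show ?thesis by blast
    qed
    obtain i0 j0 where "ivl (s-1) i0 \<subseteq> ivl s ?i" "ivl (s-1) i0 \<inter> ivl s' i' = {}"
      "ivl (s-1) j0 \<subseteq> ivl s ?j" "ivl (s-1) j0 \<inter> ivl s' j' = {}" using *[of ?i i'] *[of ?j j'] by blast
    then show thesis by (intro that[of "ivl s' i'" "ivl s' j'" i0 j0]) (auto simp: Q sq_def)
  qed
qed

text \<open>A chain of means leads from v x through the quadrants of the growing squares around x to
  the mean over R. The step at scale s costs 64 F s / 2^s, and the final step from the top quadrant
  to R is charged to the same sum once more, whence 128. The hole takes at most a quarter of the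
  square, so R is dense enough for that final step.\<close>

lemma ring_pointwise_deviation:
  fixes v :: "nat \<times> nat \<Rightarrow> complex"
  assumes R: "R = sq S i j - Q'" and S: "S \<ge> 1"
    and Q': "Q' = {} \<or> (\<exists>s' i' j'. s' < S \<and> Q' = sq s' i' j')" and x: "x \<in> R"
  shows "cmod (v x - mean R v)
    \<le> 128 * (\<Sum>s\<in>{1..S}. (\<Sum>y\<in>dy s x. gx R v y + gy R v y) / 2^s)"
proof -
  have xQ: "x \<notin> Q'" and xs: "x \<in> sq S i j" using x R by auto
  have QQ: "Q' = {} \<or> (\<exists>s' i' j'. Q' = sq s' i' j')" using Q' by blast
  have "\<forall>s. \<exists>I' J' i0 j0. s \<ge> 1 \<longrightarrow> dy s x - Q' = dy s x - I' \<times> J' \<and>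
    ivl (s-1) i0 \<subseteq> ivl s (fst x div 2^s) \<and> ivl (s-1) j0 \<subseteq> ivl s (snd x div 2^s) \<and>
    ivl (s-1) i0 \<inter> I' = {} \<and> ivl (s-1) j0 \<inter> J' = {}"
  proof
    fix s :: nat
    show "\<exists>I' J' i0 j0. s \<ge> 1 \<longrightarrow> dy s x - Q' = dy s x - I' \<times> J' \<and>
    ivl (s-1) i0 \<subseteq> ivl s (fst x div 2^s) \<and> ivl (s-1) j0 \<subseteq> ivl s (snd x div 2^s) \<and>
    ivl (s-1) i0 \<inter> I' = {} \<and> ivl (s-1) j0 \<inter> J' = {}"
    proof (cases "s \<ge> 1")
      case True
      from dyadic_quadrant_avoiding[OF QQ xQ True] show ?thesis by metis
    qed simp
  qed
  then obtain I' J' i0 j0 where *: "\<And>s. s \<ge> 1 \<Longrightarrow> dy s x - Q' = dy s x - I' s \<times> J' s \<and>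
    ivl (s-1) (i0 s) \<subseteq> ivl s (fst x div 2^s) \<and> ivl (s-1) (j0 s) \<subseteq> ivl s (snd x div 2^s) \<and>
    ivl (s-1) (i0 s) \<inter> I' s = {} \<and> ivl (s-1) (j0 s) \<inter> J' s = {}"
    by metis
  define Os where "Os s = sq (s-1) (i0 s) (j0 s)" for s
  define F where "F s = (\<Sum>y\<in>dy s x. gx R v y + gy R v y)" for s
  have F0: "F s \<ge> 0" for s unfolding F_def by (auto intro: sum_nonneg)
  have dyS: "dy S x = sq S i j" by (rule dy_eq_sq[OF xs])
  have sub: "dy s x - Q' \<subseteq> R" if "s \<le> S" for s
    using dy_mono[OF that, of x] unfolding R dyS[symmetric] by blast
  have step: "cmod (mean T v - mean (Os s) v) \<le> 64 * (F s / 2^s)"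
    if s: "s \<in> {1..S}" and T: "T \<subseteq> dy s x - Q'" "16 * card T \<ge> 4^s" for s T
  proof -
    have s1: "s \<ge> 1" using s by simp
    have "cmod (mean T v - mean (Os s) v)
      \<le> 64 / 2^s * (\<Sum>y\<in>dy s x - Q'. gx (dy s x - Q') v y + gy (dy s x - Q') v y)"
      unfolding Os_def
      by (rule ring_mean_diff_le[OF s1, where I' = "I' s" and J' = "J' s"
            and i = "fst x div 2^s" and j = "snd x div 2^s"])
        (use *[OF s1] T in \<open>auto simp: dy_def\<close>)
    also have "\<dots> \<le> 64 / 2^s * F s"
    proof (rule mult_left_mono)
      have "(\<Sum>y\<in>dy s x - Q'. gx (dy s x - Q') v y + gy (dy s x - Q') v y)
          \<le> (\<Sum>y\<in>dy s x - Q'. gx R v y + gy R v y)"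
        using s sub by (intro sum_mono add_mono g_mono) auto
      also have "\<dots> \<le> F s" unfolding F_def by (intro sum_mono2) auto
      finally show "(\<Sum>y\<in>dy s x - Q'. gx (dy s x - Q') v y + gy (dy s x - Q') v y) \<le> F s" .
    qed simp
    finally show ?thesis by simp
  qed
  have Osub: "Os s \<subseteq> dy s x - Q'" if "s \<ge> 1" for s
  proof -
    have "Os s \<subseteq> dy s x - I' s \<times> J' s" using *[OF that] unfolding Os_def dy_def sq_def by blast
    then show ?thesis using *[OF that] by simp
  qed
  have tel: "cmod (v x - mean (Os t) v) \<le> 64 * (\<Sum>s\<in>{1..t}. F s / 2^s)" if "t \<ge> 1" "t \<le> S" for t
    using that
  proof (induction t rule: nat_induct_at_least)
    case base
    have "cmod (mean {x} v - mean (Os 1) v) \<le> 64 * (F 1 / 2^1)"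
      using base xQ by (intro step) auto
    then show ?case by (simp add: mean_def)
  next
    case (Suc t)
    have "16 * card (Os t) = 4 ^ Suc t"
      using Suc.hyps unfolding Os_def card_sq by (cases t) auto
    moreover have "Os t \<subseteq> dy (Suc t) x - Q'"
      using Osub[of t] dy_mono[of t "Suc t" x] Suc.hyps by auto
    ultimately have "cmod (mean (Os t) v - mean (Os (Suc t)) v) \<le> 64 * (F (Suc t) / 2^Suc t)"
      using Suc by (intro step) auto
    moreover have "cmod (v x - mean (Os t) v) \<le> 64 * (\<Sum>s\<in>{1..t}. F s / 2^s)" using Suc by simp
    moreover have "cmod (v x - mean (Os (Suc t)) v)
       \<le> cmod (v x - mean (Os t) v) + cmod (mean (Os t) v - mean (Os (Suc t)) v)"
      using norm_triangle_ineq[of "v x - mean (Os t) v" "mean (Os t) v - mean (Os (Suc t)) v"] by simp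
    ultimately show ?case by simp
  qed
  have cR: "16 * card R \<ge> 4^S"
  proof -
    have c: "4^S - card Q' \<le> card R" unfolding R
      using diff_card_le_card_Diff[of Q' "sq S i j"] Q' by (auto simp: card_sq)
    have "4 * card Q' \<le> 4^S"
    proof (cases "Q' = {}")
      case False
      then obtain s' i' j' where "s' < S" "Q' = sq s' i' j'" using Q' by blast
      then have "4 * card Q' = 4 ^ Suc s'" "Suc s' \<le> S" by (auto simp: card_sq)
      then show ?thesis by (metis one_le_numeral power_increasing)
    qed simp
    then show ?thesis using c by linarith
  qed
  have R': "dy S x - Q' = R" unfolding dyS R ..
  have "cmod (mean R v - mean (Os S) v) \<le> 64 * (F S / 2^S)"
    using S cR R' by (intro step) auto
  also have "F S / 2^S \<le> (\<Sum>s\<in>{1..S}. F s / 2^s)"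
    using S F0 by (intro member_le_sum) auto
  finally have "cmod (mean (Os S) v - mean R v) \<le> 64 * (\<Sum>s\<in>{1..S}. F s / 2^s)"
    by (simp add: norm_minus_commute)
  moreover have "cmod (v x - mean R v) \<le> cmod (v x - mean (Os S) v) + cmod (mean (Os S) v - mean R v)"
    using norm_triangle_ineq[of "v x - mean (Os S) v" "mean (Os S) v - mean R v"] by simp
  ultimately show ?thesis using tel[OF S order_refl] unfolding F_def by linarith
qed

section \<open>The dyadic Riesz potential\<close>

text \<open>If s0 is the first index in {1..S} with P, both sides are 2^(S - s0 + 1) - 1. This turns
  the exponential of a number of scales into a sum over scales.\<close>

lemma power_sum_of_bool_le:
  assumes "\<And>s. P s \<Longrightarrow> P (Suc s)"
  shows "2 ^ (\<Sum>s\<in>{1..S}. of_bool (P s)) - 1 \<le> (\<Sum>s\<in>{1..S}. of_bool (P s) * (2::real) ^ (S - s))"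
proof (induction S)
  case (Suc S)
  have R: "(\<Sum>s\<in>{1..Suc S}. of_bool (P s) * (2::real) ^ (Suc S - s))
      = 2 * (\<Sum>s\<in>{1..S}. of_bool (P s) * 2 ^ (S - s)) + of_bool (P (Suc S))"
  proof -
    have "(\<Sum>s\<in>{1..S}. of_bool (P s) * (2::real) ^ (Suc S - s)) = 2 * (\<Sum>s\<in>{1..S}. of_bool (P s) * 2 ^ (S - s))"
      unfolding sum_distrib_left by (intro sum.cong refl) (simp add: Suc_diff_le)
    then show ?thesis by simp
  qed
  show ?case
  proof (cases "P (Suc S)")
    case True
    then show ?thesis unfolding R using Suc by simp
  next
    case False
    have "\<not> P s" if "s \<le> Suc S" for s
      using that False by (induction rule: inc_induct) (use assms in blast)+
    then show ?thesis by simp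
  qed
qed simp

text \<open>The number n of squares common to x and y is a dyadic ln (2^S / |x - y|). The sum of 2^n
  is finite uniformly in S because only 4^s points y share the scale s with x; by convexity the 1/2
  in ln 2 / 2 lowers the bound from 2 * 4^S to 4^S. So a fixed multiple of the logarithmic kernel is
  admissible in the Orlicz norm.\<close>

lemma sum_N_fun_A_dyadic_le:
  assumes "x \<in> sq S i j"
  shows "(\<Sum>y\<in>sq S i j. N_fun_A (ln 2 / 2 * real (\<Sum>s\<in>{1..S}. of_bool (y \<in> dy s x)))) \<le> 4^S"
proof -
  have up: "y \<in> dy s x \<Longrightarrow> y \<in> dy (Suc s) x" for y s using dy_mono[of s "Suc s" x] by auto
  have sub: "dy s x \<subseteq> sq S i j" if "s \<le> S" for s
    using dy_mono[OF that, of x] dy_eq_sq[OF assms] by simp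
  have "N_fun_A (ln 2 / 2 * real n) \<le> (2^n - 1) / 2" for n
  proof -
    have "N_fun_A (ln 2 * real n / 2) \<le> N_fun_A (ln 2 * real n) / 2" by (rule N_fun_A_divide) simp
    also have "N_fun_A (ln 2 * real n) \<le> 2^n - 1"
    proof -
      have "exp (ln 2 * real n) = (2::real)^n"
        by (subst mult.commute, subst exp_of_nat_mult) simp
      then show ?thesis unfolding N_fun_A_def by simp
    qed
    finally show ?thesis by simp
  qed
  then have "(\<Sum>y\<in>sq S i j. N_fun_A (ln 2 / 2 * real (\<Sum>s\<in>{1..S}. of_bool (y \<in> dy s x))))
      \<le> (\<Sum>y\<in>sq S i j. (2^(\<Sum>s\<in>{1..S}. of_bool (y \<in> dy s x)) - 1) / 2)"
    by (intro sum_mono)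
  also have "\<dots> \<le> (\<Sum>y\<in>sq S i j. (\<Sum>s\<in>{1..S}. of_bool (y \<in> dy s x) * 2 ^ (S - s)) / 2)"
    by (intro sum_mono divide_right_mono power_sum_of_bool_le up) auto
  also have "\<dots> = (\<Sum>s\<in>{1..S}. (\<Sum>y\<in>sq S i j. of_bool (y \<in> dy s x)) * 2^(S - s)) / 2"
    unfolding sum_divide_distrib[symmetric] by (subst sum.swap) (simp add: sum_distrib_right)
  also have "\<dots> = (\<Sum>s\<in>{1..S}. 4^s * 2^(S - s)) / 2"
  proof -
    have "(\<Sum>y\<in>sq S i j. of_bool (y \<in> dy s x)) = (4^s :: real)" if "s \<in> {1..S}" for s
    proof -
      have "sq S i j \<inter> {y. y \<in> dy s x} = dy s x" using sub that by auto
      then show ?thesis by (simp add: of_bool_def sum.If_cases card_dy)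
    qed
    then show ?thesis by simp
  qed
  also have "(\<Sum>s\<in>{1..S}. 4^s * 2^(S - s)) = (\<Sum>s\<in>{1..S}. 2^S * (2::real)^s)"
  proof (intro sum.cong refl)
    fix s assume "s \<in> {1..S}"
    then have "(2::real)^S = 2^s * 2^(S-s)" by (simp flip: power_add)
    moreover have "(4::real)^s = 2^s * 2^s" by (simp flip: power_mult_distrib)
    ultimately show "4^s * 2^(S - s) = 2^S * (2::real)^s" by simp
  qed
  also have "\<dots> = 2^S * (\<Sum>s\<in>{1..S}. (2::real)^s)" by (simp add: sum_distrib_left)
  also have "(\<Sum>s\<in>{1..S}. (2::real)^s) \<le> 2 * 2^S" by (induction S) auto
  also have "2^S * (2 * 2^S) / 2 = (4::real)^S" by (simp flip: power_mult_distrib)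
  finally show ?thesis by simp
qed

text \<open>The product of the Riesz kernel with its transpose is logarithmic. For s \<le> t the
  squares \<open>dy s x\<close> and \<open>dy t x'\<close> meet only if x and x' share the scale t;
  then they have at most 4^s common points, which leaves (1/2)^(t-s). The geometric series gives a
  factor 2, and the two orders of s and t another 2.\<close>

lemma sum_dyadic_kernel_product_le:
  assumes "x \<in> sq S i j" "x' \<in> sq S i j"
  shows "(\<Sum>y\<in>sq S i j. (\<Sum>s\<in>{1..S}. of_bool (y \<in> dy s x) / 2^s) * (\<Sum>t\<in>{1..S}. of_bool (y \<in> dy t x') / 2^t))
    \<le> 4 * (\<Sum>s\<in>{1..S}. of_bool (x' \<in> dy s x) :: real)"
proof -
  define c where "c s t = (if s \<le> t then of_bool (x' \<in> dy t x) * (1/2)^(t-s) else 0 :: real)" for s t :: nat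
  have sub: "dy s x \<subseteq> sq S i j" if "s \<le> S" for s
    using dy_mono[OF that, of x] dy_eq_sq[OF assms(1)] by simp
  have sub': "dy s x' \<subseteq> sq S i j" if "s \<le> S" for s
    using dy_mono[OF that, of x'] dy_eq_sq[OF assms(2)] by simp
  have key: "(\<Sum>y\<in>sq S i j. of_bool (y \<in> dy s x) * of_bool (y \<in> dy t x')) / (2^s * 2^t) \<le> c s t + c t s"
    if st: "s \<le> S" "t \<le> S" for s t
  proof -
    have half: "(4::real)^a / (2^a * 2^b) = (1/2)^(b-a)" if "a \<le> b" for a b :: nat
    proof -
      have "(2::real)^b = 2^a * 2^(b-a)" using that by (simp flip: power_add)
      moreover have "(4::real)^a = 2^a * 2^a" by (simp flip: power_mult_distrib)
      ultimately show ?thesis by (simp add: power_one_over field_simps)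
    qed
    have eq: "(\<Sum>y\<in>sq S i j. of_bool (y \<in> dy s x) * of_bool (y \<in> dy t x')) = real (card (dy s x \<inter> dy t x'))"
    proof -
      have "(\<Sum>y\<in>sq S i j. of_bool (y \<in> dy s x) * of_bool (y \<in> dy t x'))
        = (\<Sum>y\<in>dy s x \<inter> dy t x'. 1 :: real)"
        using sub[OF st(1)] by (intro sum.mono_neutral_cong_right) auto
      then show ?thesis by simp
    qed
    show ?thesis
    proof (cases "dy s x \<inter> dy t x' = {}")
      case False
      then obtain y where y: "y \<in> dy s x" "y \<in> dy t x'" by blast
      show ?thesis
      proof (cases "s \<le> t")
        case True
        have "y \<in> dy t x" using y dy_mono[OF True] by blast
        then have "x' \<in> dy t x" using y unfolding mem_dy by simp
        then have "c s t = (1/2)^(t-s)" unfolding c_def using True by simp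
        moreover have "card (dy s x \<inter> dy t x') \<le> 4^s"
          unfolding card_dy[symmetric, of s x] by (rule card_mono) auto
        then have "real (card (dy s x \<inter> dy t x')) \<le> 4^s" by (metis of_nat_le_iff of_nat_numeral of_nat_power)
        then have "real (card (dy s x \<inter> dy t x')) / (2^s * 2^t) \<le> 4^s / (2^s * 2^t)"
          by (intro divide_right_mono) auto
        moreover have "c t s \<ge> 0" unfolding c_def by simp
        ultimately show ?thesis unfolding eq half[OF True] by linarith
      next
        case F: False
        then have ts: "t \<le> s" by simp
        have "y \<in> dy s x'" using y dy_mono[OF ts] by blast
        then have "x' \<in> dy s x" using y unfolding mem_dy by simp
        then have "c t s = (1/2)^(s-t)" unfolding c_def using ts by simp
        moreover have "card (dy s x \<inter> dy t x') \<le> 4^t"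
          unfolding card_dy[symmetric, of t x'] by (rule card_mono) auto
        then have "real (card (dy s x \<inter> dy t x')) \<le> 4^t" by (metis of_nat_le_iff of_nat_numeral of_nat_power)
        then have "real (card (dy s x \<inter> dy t x')) / (2^t * 2^s) \<le> 4^t / (2^t * 2^s)"
          by (intro divide_right_mono) auto
        moreover have "c s t \<ge> 0" unfolding c_def by simp
        ultimately show ?thesis unfolding eq half[OF ts] by (simp add: mult.commute)
      qed
    qed (simp add: eq c_def)
  qed
  have col: "(\<Sum>s\<in>{1..S}. c s t) \<le> 2 * of_bool (x' \<in> dy t x)" if "t \<in> {1..S}" for t
  proof -
    have "(\<Sum>s\<in>{1..S}. c s t) = of_bool (x' \<in> dy t x) * (\<Sum>s\<in>{1..t}. (1/2)^(t-s))"
      unfolding sum_distrib_left c_def using that by (intro sum.mono_neutral_cong_right) auto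
    also have "(\<Sum>s\<in>{1..t}. (1/2)^(t-s)) \<le> (2::real)"
    proof -
      have "(\<Sum>s\<in>{1..t}. (1/2::real)^(t-s)) = 2 - 2 * (1/2)^t"
      proof (induction t)
        case (Suc t)
        have "(\<Sum>s\<in>{1..Suc t}. (1/2::real)^(Suc t-s)) = (\<Sum>s\<in>{1..t}. (1/2::real)^(Suc t-s)) + 1" by simp
        also have "(\<Sum>s\<in>{1..t}. (1/2::real)^(Suc t-s)) = 1/2 * (\<Sum>s\<in>{1..t}. (1/2::real)^(t-s))"
          unfolding sum_distrib_left by (intro sum.cong) (auto simp: Suc_diff_le)
        finally show ?case using Suc by simp
      qed simp
      then show ?thesis by simp
    qed
    finally show ?thesis by (simp add: mult.commute mult_left_mono)
  qed
  have "(\<Sum>y\<in>sq S i j. (\<Sum>s\<in>{1..S}. of_bool (y \<in> dy s x) / 2^s) * (\<Sum>t\<in>{1..S}. of_bool (y \<in> dy t x') / 2^t))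
    = (\<Sum>s\<in>{1..S}. \<Sum>t\<in>{1..S}. (\<Sum>y\<in>sq S i j. of_bool (y \<in> dy s x) * of_bool (y \<in> dy t x')) / (2^s * 2^t) :: real)"
    unfolding sum_product sum_divide_distrib
    by (subst sum.swap, rule sum.cong[OF refl], subst sum.swap) simp
  also have "\<dots> \<le> (\<Sum>s\<in>{1..S}. \<Sum>t\<in>{1..S}. c s t + c t s)"
    by (intro sum_mono key) auto
  also have "\<dots> = 2 * (\<Sum>t\<in>{1..S}. \<Sum>s\<in>{1..S}. c s t)"
    unfolding sum.distrib by (subst sum.swap) simp
  also have "\<dots> \<le> 2 * (\<Sum>t\<in>{1..S}. 2 * of_bool (x' \<in> dy t x))"
    using col by (intro mult_left_mono sum_mono) auto
  also have "\<dots> = 4 * (\<Sum>s\<in>{1..S}. of_bool (x' \<in> dy s x))" by (simp add: sum_distrib_left)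
  finally show ?thesis .
qed

text \<open>The Schur test applied to \<open>\<mu>\<^sup>1\<^sup>/\<^sup>2 K K\<^sup>T \<mu>\<^sup>1\<^sup>/\<^sup>2\<close>.\<close>

lemma Schur_test:
  fixes K :: "'a \<Rightarrow> 'b \<Rightarrow> real"
  assumes fin: "finite X" and mu: "\<And>x. x \<in> X \<Longrightarrow> \<mu> x \<ge> 0" and M: "M \<ge> 0"
    and K: "\<And>x x'. L x x' = (\<Sum>y\<in>Y. K x y * K x' y)" and L0: "\<And>x x'. L x x' \<ge> 0"
    and Sch: "\<And>x. x \<in> X \<Longrightarrow> (\<Sum>x'\<in>X. \<mu> x' * L x x') \<le> M"
  shows "(\<Sum>x\<in>X. \<mu> x * (\<Sum>y\<in>Y. K x y * f y)\<^sup>2) \<le> M * (\<Sum>y\<in>Y. (f y)\<^sup>2)"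
proof -
  define g where "g x = (\<Sum>y\<in>Y. K x y * f y)" for x
  define Z where "Z = (\<Sum>x\<in>X. \<mu> x * (g x)\<^sup>2)"
  define N where "N = (\<Sum>y\<in>Y. (f y)\<^sup>2)"
  have Z0: "Z \<ge> 0" and N0: "N \<ge> 0" unfolding Z_def N_def by (auto intro!: sum_nonneg mu mult_nonneg_nonneg)
  define k where "k y = (\<Sum>x\<in>X. K x y * (\<mu> x * g x))" for y
  have sym: "L x x' = L x' x" for x x' unfolding K by (simp add: mult.commute)
  have "Z = (\<Sum>x\<in>X. \<Sum>y\<in>Y. (\<mu> x * g x) * (K x y * f y))"
    unfolding Z_def by (intro sum.cong refl)
      (subst power2_eq_square, subst (2) g_def, simp add: sum_distrib_left mult_ac)
  also have "\<dots> = (\<Sum>y\<in>Y. f y * k y)"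
    unfolding k_def by (subst sum.swap) (simp add: sum_distrib_left mult_ac)
  finally have ZN: "Z\<^sup>2 \<le> N * (\<Sum>y\<in>Y. (k y)\<^sup>2)"
    unfolding N_def using Cauchy_Schwarz_ineq_sum[of f k Y] by simp
  have "(\<Sum>y\<in>Y. (k y)\<^sup>2) \<le> M * Z"
  proof -
    have "(\<Sum>y\<in>Y. (k y)\<^sup>2) = (\<Sum>x\<in>X. \<Sum>x'\<in>X. (\<mu> x * g x) * (\<mu> x' * g x') * L x x')"
    proof -
      have "(\<Sum>y\<in>Y. (k y)\<^sup>2) = (\<Sum>y\<in>Y. \<Sum>x\<in>X. \<Sum>x'\<in>X. (K x y * (\<mu> x * g x)) * (K x' y * (\<mu> x' * g x')))"
        unfolding k_def power2_eq_square sum_product ..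
      also have "\<dots> = (\<Sum>x\<in>X. \<Sum>x'\<in>X. \<Sum>y\<in>Y. (K x y * (\<mu> x * g x)) * (K x' y * (\<mu> x' * g x')))"
        by (subst sum.swap, rule sum.cong[OF refl], rule sum.swap)
      finally show ?thesis unfolding K by (simp add: sum_distrib_left mult_ac)
    qed
    also have "\<dots> \<le> (\<Sum>x\<in>X. \<Sum>x'\<in>X. (\<mu> x * \<mu> x' * L x x') * (((g x)\<^sup>2 + (g x')\<^sup>2) / 2))"
    proof (intro sum_mono)
      fix x x' assume xx: "x \<in> X" "x' \<in> X"
      have "0 \<le> (g x - g x')\<^sup>2" by simp
      then have "g x * g x' \<le> ((g x)\<^sup>2 + (g x')\<^sup>2) / 2" by (simp add: power2_diff)
      then have "(\<mu> x * \<mu> x' * L x x') * (g x * g x') \<le> (\<mu> x * \<mu> x' * L x x') * (((g x)\<^sup>2 + (g x')\<^sup>2) / 2)"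
        using xx mu L0 by (intro mult_left_mono) auto
      then show "(\<mu> x * g x) * (\<mu> x' * g x') * L x x' \<le> (\<mu> x * \<mu> x' * L x x') * (((g x)\<^sup>2 + (g x')\<^sup>2) / 2)"
        by (simp add: mult_ac)
    qed
    also have "\<dots> = (\<Sum>x\<in>X. \<Sum>x'\<in>X. \<mu> x * (g x)\<^sup>2 * (\<mu> x' * L x x')) / 2
        + (\<Sum>x\<in>X. \<Sum>x'\<in>X. \<mu> x' * (g x')\<^sup>2 * (\<mu> x * L x' x)) / 2"
      unfolding sum_divide_distrib sum.distrib[symmetric]
      by (intro sum.cong refl) (simp add: sym algebra_simps add_divide_distrib)
    also have "(\<Sum>x\<in>X. \<Sum>x'\<in>X. \<mu> x' * (g x')\<^sup>2 * (\<mu> x * L x' x))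
        = (\<Sum>x\<in>X. \<Sum>x'\<in>X. \<mu> x * (g x)\<^sup>2 * (\<mu> x' * L x x'))" by (rule sum.swap)
    also have "(\<Sum>x\<in>X. \<Sum>x'\<in>X. \<mu> x * (g x)\<^sup>2 * (\<mu> x' * L x x')) / 2
        + (\<Sum>x\<in>X. \<Sum>x'\<in>X. \<mu> x * (g x)\<^sup>2 * (\<mu> x' * L x x')) / 2
        = (\<Sum>x\<in>X. \<mu> x * (g x)\<^sup>2 * (\<Sum>x'\<in>X. \<mu> x' * L x x'))"
      by (simp add: sum_distrib_left)
    also have "\<dots> \<le> (\<Sum>x\<in>X. \<mu> x * (g x)\<^sup>2 * M)"
      using mu Sch by (intro sum_mono mult_left_mono) auto
    also have "\<dots> = M * Z" unfolding Z_def by (simp add: sum_distrib_left mult_ac)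
    finally show ?thesis .
  qed
  then have "N * (\<Sum>y\<in>Y. (k y)\<^sup>2) \<le> N * (M * Z)" using N0 by (rule mult_left_mono)
  then have "Z * Z \<le> (M * N) * Z" using ZN by (simp add: power2_eq_square mult_ac)
  then have "Z \<le> M * N" using Z0 M N0 by (cases "Z = 0") auto
  then show ?thesis unfolding Z_def N_def g_def .
qed

text \<open>The Schur sums are bounded by \<open>light\<close>, applied to the admissible function h
  = (ln 2 / 2) * \<nu>. Here ln 2 / 2 \<ge> 1/3 costs a factor 3, and the kernel bound 4 * \<nu>
  makes it 12.\<close>

lemma dyadic_potential_bound:
  fixes \<mu> f :: "nat \<times> nat \<Rightarrow> real"
  assumes R: "R \<subseteq> sq S i j" and mu: "\<And>x. \<mu> x \<ge> 0" and \<delta>: "\<delta> \<ge> 0"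
    and light: "\<And>h. \<lbrakk>\<And>x. h x \<ge> 0; (\<Sum>x\<in>R. N_fun_A (h x)) \<le> 4^S\<rbrakk> \<Longrightarrow> (\<Sum>x\<in>R. \<mu> x * h x) \<le> \<delta>"
  shows "(\<Sum>x\<in>R. \<mu> x * (\<Sum>s\<in>{1..S}. (\<Sum>y\<in>dy s x. f y) / 2^s)\<^sup>2) \<le> 12 * \<delta> * (\<Sum>y\<in>sq S i j. (f y)\<^sup>2)"
proof -
  define K where "K x y = (\<Sum>s\<in>{1..S}. of_bool (y \<in> dy s x) / 2^s :: real)" for x y
  define \<nu> where "\<nu> x x' = (\<Sum>s\<in>{1..S}. of_bool (x' \<in> dy s x) :: real)" for x x'
  have fin: "finite R" by (rule finite_subset[OF R]) simp
  have conv: "(\<Sum>s\<in>{1..S}. (\<Sum>y\<in>dy s x. f y) / 2^s) = (\<Sum>y\<in>sq S i j. K x y * f y)" if "x \<in> R" for x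
  proof -
    have "(\<Sum>y\<in>sq S i j. K x y * f y) = (\<Sum>s\<in>{1..S}. \<Sum>y\<in>sq S i j. of_bool (y \<in> dy s x) / 2^s * f y)"
      unfolding K_def sum_distrib_right by (rule sum.swap)
    also have "\<dots> = (\<Sum>s\<in>{1..S}. (\<Sum>y\<in>dy s x. f y) / 2^s)"
    proof (intro sum.cong refl)
      fix s assume "s \<in> {1..S}"
      then have "dy s x \<subseteq> sq S i j" using dy_mono[of s S x] dy_eq_sq[of x S i j] that R by auto
      then show "(\<Sum>y\<in>sq S i j. of_bool (y \<in> dy s x) / 2^s * f y) = (\<Sum>y\<in>dy s x. f y) / 2^s"
        unfolding sum_divide_distrib by (intro sum.mono_neutral_cong_right) auto
    qed
    finally show ?thesis by simp
  qed
  have "(\<Sum>x\<in>R. \<mu> x * (\<Sum>y\<in>sq S i j. K x y * f y)\<^sup>2) \<le> 12 * \<delta> * (\<Sum>y\<in>sq S i j. (f y)\<^sup>2)"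
  proof (rule Schur_test[OF fin mu _ refl])
    fix x assume x: "x \<in> R"
    have "(\<Sum>x'\<in>R. N_fun_A (ln 2 / 2 * \<nu> x x')) \<le> (\<Sum>x'\<in>sq S i j. N_fun_A (ln 2 / 2 * \<nu> x x'))"
      using R by (intro sum_mono2) (auto simp: N_fun_A_nonneg)
    also have "\<dots> \<le> 4^S"
      using sum_N_fun_A_dyadic_le[of x S i j] x R unfolding \<nu>_def by auto
    finally have "(\<Sum>x'\<in>R. \<mu> x' * (ln 2 / 2 * \<nu> x x')) \<le> \<delta>"
      by (intro light) (auto simp: \<nu>_def intro!: mult_nonneg_nonneg sum_nonneg)
    then have "ln 2 / 2 * (\<Sum>x'\<in>R. \<mu> x' * \<nu> x x') \<le> \<delta>" by (simp add: sum_distrib_left mult_ac)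
    moreover have "1/3 \<le> ln (2::real) / 2" using ln2_ge_two_thirds by simp
    moreover have "(\<Sum>x'\<in>R. \<mu> x' * \<nu> x x') \<ge> 0"
      unfolding \<nu>_def using mu by (auto intro!: sum_nonneg mult_nonneg_nonneg)
    ultimately have "1/3 * (\<Sum>x'\<in>R. \<mu> x' * \<nu> x x') \<le> \<delta>"
      by (meson mult_right_mono order_trans)
    moreover have "(\<Sum>x'\<in>R. \<mu> x' * (\<Sum>y\<in>sq S i j. K x y * K x' y)) \<le> (\<Sum>x'\<in>R. \<mu> x' * (4 * \<nu> x x'))"
      unfolding K_def \<nu>_def using R x mu
      by (intro sum_mono mult_left_mono sum_dyadic_kernel_product_le) auto
    moreover have "(\<Sum>x'\<in>R. \<mu> x' * (4 * \<nu> x x')) = 4 * (\<Sum>x'\<in>R. \<mu> x' * \<nu> x x')"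
      by (simp add: sum_distrib_left mult_ac)
    ultimately show "(\<Sum>x'\<in>R. \<mu> x' * (\<Sum>y\<in>sq S i j. K x y * K x' y)) \<le> 12 * \<delta>" by linarith
  qed (use \<delta> in \<open>auto simp: K_def intro!: sum_nonneg mult_nonneg_nonneg\<close>)
  then show ?thesis using conv by simp
qed

section \<open>Partition into light rings\<close>

text \<open>The discrete form of \<open>\<parallel>\<mu>\<parallel>\<^sub>\<B> > \<delta>\<close> on a subset of a square with \<open>4^S\<close> points.\<close>

definition heavy :: "(nat \<times> nat \<Rightarrow> real) \<Rightarrow> real \<Rightarrow> (nat \<times> nat) set \<Rightarrow> nat \<Rightarrow> bool" where
  "heavy \<mu> \<delta> R S \<longleftrightarrow> (\<exists>h. (\<forall>x. h x \<ge> 0) \<and> (\<Sum>x\<in>R. N_fun_A (h x)) \<le> 4^S \<and> \<delta> < (\<Sum>x\<in>R. \<mu> x * h x))"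

text \<open>A weighted Poincare inequality with constant \<beta>. It holds trivially on the empty
  set, so the partitions below may contain empty rings.\<close>

definition good :: "(nat \<times> nat \<Rightarrow> real) \<Rightarrow> real \<Rightarrow> (nat \<times> nat) set \<Rightarrow> bool" where
  "good \<mu> \<beta> R \<longleftrightarrow> (\<forall>v :: nat \<times> nat \<Rightarrow> complex. sum v R = 0 \<longrightarrow>
     (\<Sum>x\<in>R. \<mu> x * (cmod (v x))\<^sup>2) \<le> \<beta> * Dirichlet R v)"

lemma good_singleton: "\<beta> \<ge> 0 \<Longrightarrow> good \<mu> \<beta> {x}"
  unfolding good_def Dirichlet_def by simp

text \<open>The constant is 128^2 * 12 * 2 = 393216, rounded up: the square of the pointwise
  deviation, the potential estimate, and (gx + gy)^2 \<le> 2 (gx^2 + gy^2). The edge terms vanish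
  off R, so the sum over the full square that the potential estimate produces is the energy of the
  ring.\<close>

lemma good_light_ring:
  assumes R: "R = sq S i j - Q'" and mu: "\<And>x. \<mu> x \<ge> 0" and \<delta>: "\<delta> \<ge> 0"
    and Q': "Q' = {} \<or> (\<exists>s' i' j'. s' < S \<and> Q' = sq s' i' j')"
    and light: "\<not> heavy \<mu> \<delta> R S"
  shows "good \<mu> (400000 * \<delta>) R"
proof (cases "S = 0")
  case True
  then have "R = {(i, j)}" using R Q' by (auto simp: sq_0)
  then show ?thesis using \<delta> by (simp add: good_singleton)
next
  case False
  show ?thesis unfolding good_def
  proof (intro allI impI)
    fix v :: "nat \<times> nat \<Rightarrow> complex" assume "sum v R = 0"
    then have m0: "mean R v = 0" by (simp add: mean_def)
    define f where "f y = gx R v y + gy R v y" for y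
    have RQ: "R \<subseteq> sq S i j" unfolding R by auto
    have "(\<Sum>x\<in>R. \<mu> x * (cmod (v x))\<^sup>2) \<le> (\<Sum>x\<in>R. \<mu> x * (128 * (\<Sum>s\<in>{1..S}. (\<Sum>y\<in>dy s x. f y) / 2^s))\<^sup>2)"
      using ring_pointwise_deviation[OF R _ Q', of _ v] m0 False mu
      by (intro sum_mono mult_left_mono power_mono) (auto simp: f_def)
    also have "\<dots> = 16384 * (\<Sum>x\<in>R. \<mu> x * (\<Sum>s\<in>{1..S}. (\<Sum>y\<in>dy s x. f y) / 2^s)\<^sup>2)"
      unfolding sum_distrib_left[of _ _ R] by (intro sum.cong refl) (simp only: power_mult_distrib, simp)
    also have "\<dots> \<le> 16384 * (12 * \<delta> * (\<Sum>y\<in>sq S i j. (f y)\<^sup>2))"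
      using light unfolding heavy_def
      by (intro mult_left_mono dyadic_potential_bound RQ mu \<delta>) (auto simp: not_less)
    also have "(\<Sum>y\<in>sq S i j. (f y)\<^sup>2) = (\<Sum>y\<in>R. (f y)\<^sup>2)"
      using RQ by (intro sum.mono_neutral_right) (auto simp: f_def g_outside)
    also have "\<dots> \<le> (\<Sum>y\<in>R. 2 * ((gx R v y)\<^sup>2 + (gy R v y)\<^sup>2))"
    proof (intro sum_mono)
      fix y
      have "0 \<le> (gx R v y - gy R v y)\<^sup>2" by simp
      then show "(f y)\<^sup>2 \<le> 2 * ((gx R v y)\<^sup>2 + (gy R v y)\<^sup>2)"
        unfolding f_def by (simp add: power2_sum power2_diff)
    qed
    also have "\<dots> = 2 * Dirichlet R v" unfolding Dirichlet_def by (simp add: sum_distrib_left)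
    finally have "(\<Sum>x\<in>R. \<mu> x * (cmod (v x))\<^sup>2) \<le> 16384 * (12 * \<delta> * (2 * Dirichlet R v))"
      using \<delta> by (simp add: mult_left_mono)
    also have "\<dots> \<le> 400000 * \<delta> * Dirichlet R v"
    proof -
      have "\<delta> * Dirichlet R v \<ge> 0" using \<delta> unfolding Dirichlet_def by (simp add: sum_nonneg)
      then show ?thesis by (simp add: mult.assoc)
    qed
    finally show "(\<Sum>x\<in>R. \<mu> x * (cmod (v x))\<^sup>2) \<le> 400000 * \<delta> * Dirichlet R v" .
  qed
qed

lemma N_fun_A_0 [simp]: "N_fun_A 0 = 0" by (simp add: N_fun_A_def)

text \<open>The invariant of an induction on dyadic squares: outside the core \<open>Q\<close> is still light, the core is
  partitioned already, and \<open>m\<close> counts the heavy sets found in it. The summand \<open>4\<close> is the credit that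
  pays for the new rings when several children have a nonempty core.\<close>

definition cored_square ::
    "(nat \<times> nat \<Rightarrow> real) \<Rightarrow> real \<Rightarrow> nat \<Rightarrow> (nat \<times> nat) set \<Rightarrow> (nat \<times> nat) set \<Rightarrow> (nat \<times> nat) set set
     \<Rightarrow> nat \<Rightarrow> (nat \<times> nat \<Rightarrow> real) \<Rightarrow> bool" where
  "cored_square \<mu> \<delta> s Q core P m h \<longleftrightarrow>
     (core = {} \<or> core = Q \<or> (\<exists>s'<s. \<exists>i' j'. core = sq s' i' j')) \<and> core \<subseteq> Q \<and>
     (core = Q \<or> \<not> heavy \<mu> \<delta> (Q - core) s) \<and>
     finite P \<and> disjoint P \<and> \<Union>P = core \<and> (\<forall>R\<in>P. good \<mu> (400000 * \<delta>) R) \<and>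
     card P + (if core = {} then 0 else 4) \<le> 8 * m \<and> (core = {} \<longrightarrow> P = {} \<and> m = 0) \<and>
     (\<forall>x. h x \<ge> 0) \<and> (\<Sum>x\<in>core. N_fun_A (h x)) \<le> 4/3 * real (card core) \<and>
     real m * \<delta> \<le> (\<Sum>x\<in>core. \<mu> x * h x)"

text \<open>The four children are merged according to their nonempty cores. With two or more cores,
  their credits of 4 each pay for the at most four new rings and for the credit of Q. With at most
  one core and a heavy remainder, m grows by 1, which pays the same 8. Otherwise the only core, if
  any, is passed on unchanged and its complement in Q is still light. The constant 4/3 is the fixed
  point of t = 1 + t/4: a heavy remainder adds at most the size of Q, and a single old core fills at
  most a quarter of Q.\<close>

lemma cored_square_exists:
  assumes mu: "\<And>x. \<mu> x \<ge> 0" and \<delta>: "\<delta> \<ge> 0"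
  shows "\<exists>core P m h. cored_square \<mu> \<delta> s (sq s i j) core P m h"
proof (induction s arbitrary: i j)
  case 0
  show ?case
  proof (cases "heavy \<mu> \<delta> (sq 0 i j) 0")
    case True
    then obtain h where h: "\<And>x. h x \<ge> 0" "(\<Sum>x\<in>sq 0 i j. N_fun_A (h x)) \<le> 1"
      "\<delta> < (\<Sum>x\<in>sq 0 i j. \<mu> x * h x)" unfolding heavy_def by auto
    have "cored_square \<mu> \<delta> 0 (sq 0 i j) (sq 0 i j) {sq 0 i j} 1 h"
      unfolding cored_square_def using h good_singleton[of "400000 * \<delta>" \<mu> "(i, j)"] \<delta>
      by (auto simp: sq_0)
    then show ?thesis by blast
  next
    case False
    have "cored_square \<mu> \<delta> 0 (sq 0 i j) {} {} 0 (\<lambda>_. 0)"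
      unfolding cored_square_def using False by auto
    then show ?thesis by blast
  qed
next
  case (Suc s)
  define C where "C = {..<2::nat} \<times> {..<2::nat}"
  have C: "finite C" "card C = 4" unfolding C_def by auto
  define ch where "ch c = sq s (2*i + fst c) (2*j + snd c)" for c :: "nat \<times> nat"
  define Q where "Q = sq (Suc s) i j"
  have "\<exists>core P m h. cored_square \<mu> \<delta> s (ch c) core P m h" for c unfolding ch_def by (rule Suc)
  then obtain core P m h where "\<And>c. cored_square \<mu> \<delta> s (ch c) (core c) (P c) (m c) (h c)" by metis
  note IH = this[unfolded cored_square_def]
  have core1: "core c = {} \<or> core c = ch c \<or> (\<exists>s'<s. \<exists>i' j'. core c = sq s' i' j')" for c using IH[of c] by blast
  have core2: "core c \<subseteq> ch c" for c using IH[of c] by blast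
  have core3: "core c \<noteq> ch c \<Longrightarrow> \<not> heavy \<mu> \<delta> (ch c - core c) s" for c using IH[of c] by blast
  have P1: "finite (P c)" "disjoint (P c)" "\<Union>(P c) = core c" for c using IH[of c] by blast+
  have P2: "R \<in> P c \<Longrightarrow> good \<mu> (400000 * \<delta>) R" for c R using IH[of c] by blast
  have P3: "card (P c) + (if core c = {} then 0 else 4) \<le> 8 * m c" for c using IH[of c] by blast
  have P4: "core c = {} \<Longrightarrow> P c = {} \<and> m c = 0" for c using IH[of c] by blast
  have h1: "h c x \<ge> 0" for c x using IH[of c] by blast
  have h2: "(\<Sum>x\<in>core c. N_fun_A (h c x)) \<le> 4/3 * real (card (core c))" for c using IH[of c] by blast
  have h3: "real (m c) * \<delta> \<le> (\<Sum>x\<in>core c. \<mu> x * h c x)" for c using IH[of c] by blast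
  have finch: "finite (ch c)" for c unfolding ch_def by simp
  have fincore: "finite (core c)" for c using core2 finch finite_subset by blast
  have finQ: "finite Q" unfolding Q_def by simp
  have chQ: "ch c \<subseteq> Q" if "c \<in> C" for c
    using that ivl_child[of "fst c" s i] ivl_child[of "snd c" s j] unfolding ch_def Q_def sq_def C_def by auto
  have chdisj: "ch c \<inter> ch c' = {}" if "c \<in> C" "c' \<in> C" "c \<noteq> c'" for c c'
  proof -
    have "fst c \<noteq> fst c' \<or> snd c \<noteq> snd c'" using that by (auto simp: prod_eq_iff)
    then show ?thesis unfolding ch_def sq_def ivl_def by auto
  qed
  have Qch: "Q = (\<Union>c\<in>C. ch c)"
  proof
    show "Q \<subseteq> (\<Union>c\<in>C. ch c)"
    proof
      fix x assume "x \<in> Q"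
      then have x: "fst x \<in> ivl (Suc s) i" "snd x \<in> ivl (Suc s) j" unfolding Q_def sq_def by auto
      have *: "\<exists>p<2. a \<in> ivl s (2*i+p)" if "a \<in> ivl (Suc s) i" for a i
        using that unfolding ivl_split by (metis UnE add.right_neutral add_Suc_right One_nat_def one_less_numeral_iff pos2 semiring_norm(76))
      obtain p q where "p < 2" "fst x \<in> ivl s (2*i+p)" "q < 2" "snd x \<in> ivl s (2*j+q)" using *[OF x(1)] *[OF x(2)] by blast
      then have "(p, q) \<in> C" "x \<in> ch (p, q)" unfolding C_def ch_def sq_def by (auto simp: mem_Times_iff)
      then show "x \<in> (\<Union>c\<in>C. ch c)" by blast
    qed
  qed (use chQ in blast)
  define Kc where "Kc = (\<Union>c\<in>C. core c)"
  have coredisj: "core c \<inter> core c' = {}" if "c \<in> C" "c' \<in> C" "c \<noteq> c'" for c c'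
    using chdisj[OF that] core2 by blast
  have KcQ: "Kc \<subseteq> Q" unfolding Kc_def using core2 chQ by blast
  have finK: "finite Kc" using KcQ finQ finite_subset by blast
  \<comment> \<open>The cores are disjoint, so at most one summand differs from 0 and H glues the
    four witnesses together.\<close>
  define H where "H x = (\<Sum>c\<in>C. if x \<in> core c then h c x else 0)" for x
  have H0: "H x \<ge> 0" for x unfolding H_def by (rule sum_nonneg) (simp add: h1)
  have Hc: "H x = h c x" if "c \<in> C" "x \<in> core c" for c x
  proof -
    have "H x = (\<Sum>c'\<in>C. if c' = c then h c x else 0)"
      unfolding H_def
    proof (intro sum.cong refl)
      fix c' assume "c' \<in> C"
      then have "c' \<noteq> c \<Longrightarrow> x \<notin> core c'" using coredisj[of c c'] that by blast
      then show "(if x \<in> core c' then h c' x else 0) = (if c' = c then h c x else 0)" using that by auto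
    qed
    then show ?thesis using that C by simp
  qed
  have Hout: "H x = 0" if "x \<notin> Kc" for x using that unfolding H_def Kc_def by (auto intro: sum.neutral)
  have sumK: "(\<Sum>x\<in>Kc. F x (H x)) = (\<Sum>c\<in>C. \<Sum>x\<in>core c. F x (h c x))" for F :: "_ \<Rightarrow> _ \<Rightarrow> real"
  proof -
    have "(\<Sum>x\<in>Kc. F x (H x)) = (\<Sum>c\<in>C. \<Sum>x\<in>core c. F x (H x))"
      unfolding Kc_def using C coredisj fincore by (intro sum.UNION_disjoint) auto
    then show ?thesis using Hc by simp
  qed
  have cardK: "real (card Kc) = (\<Sum>c\<in>C. real (card (core c)))"
    unfolding Kc_def using C coredisj fincore by (subst card_UN_disjoint) auto
  have HA: "(\<Sum>x\<in>Kc. N_fun_A (H x)) \<le> 4/3 * real (card Kc)"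
    unfolding sumK[of "\<lambda>_. N_fun_A"] cardK sum_distrib_left using h2 by (intro sum_mono)
  have Hm: "real (\<Sum>c\<in>C. m c) * \<delta> \<le> (\<Sum>x\<in>Kc. \<mu> x * H x)"
    unfolding sumK[of "\<lambda>x t. \<mu> x * t"] of_nat_sum sum_distrib_right using h3 by (intro sum_mono)
  define N where "N = {c \<in> C. core c \<noteq> {}}"
  have cP: "(\<Sum>c\<in>C. card (P c)) + 4 * card N \<le> 8 * (\<Sum>c\<in>C. m c)"
  proof -
    have "(\<Sum>c\<in>C. card (P c) + (if core c = {} then 0 else 4)) \<le> (\<Sum>c\<in>C. 8 * m c)"
      by (intro sum_mono P3)
    moreover have "(\<Sum>c\<in>C. (if core c = {} then 0 else 4)) = 4 * card N"
      unfolding N_def using C by (subst sum.If_cases) (auto intro!: arg_cong[where f = card])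
    ultimately show ?thesis by (simp add: sum.distrib sum_distrib_left)
  qed
  define P' where "P' = (\<Union>c\<in>C. P c) \<union> (\<lambda>c. ch c - core c) ` C"
  have ringgood: "good \<mu> (400000 * \<delta>) (ch c - core c)" for c
  proof (cases "core c = ch c")
    case True
    then show ?thesis by (simp add: good_def Dirichlet_def)
  next
    case False
    then show ?thesis
      using core1[of c] core3[of c] unfolding ch_def
      by (intro good_light_ring[OF refl mu \<delta>]) auto
  qed
  \<comment> \<open>Here Q becomes its own core and the sets \<open>ch c - core c\<close> become
    rings. The 8 consists of 4 for these rings and 4 for the credit of Q.\<close>
  have final: "\<exists>core P m h. cored_square \<mu> \<delta> (Suc s) Q core P m h"
    if m': "(\<Sum>c\<in>C. card (P c)) + 8 \<le> 8 * m'"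
      and h': "\<And>x. h' x \<ge> 0" "(\<Sum>x\<in>Q. N_fun_A (h' x)) \<le> 4/3 * real (card Q)"
      "real m' * \<delta> \<le> (\<Sum>x\<in>Q. \<mu> x * h' x)" for m' h'
  proof -
    have fin: "finite P'" unfolding P'_def using C P1 by auto
    have un: "\<Union>P' = Q"
    proof -
      have "\<Union>P' = (\<Union>c\<in>C. \<Union>(P c)) \<union> (\<Union>c\<in>C. ch c - core c)" unfolding P'_def by blast
      also have "\<dots> = (\<Union>c\<in>C. core c \<union> (ch c - core c))" unfolding P1(3) by blast
      also have "\<dots> = (\<Union>c\<in>C. ch c)" using core2 by blast
      finally show ?thesis using Qch by simp
    qed
    have wh: "\<exists>c\<in>C. A \<subseteq> ch c \<and> (A \<in> P c \<or> A = ch c - core c)" if "A \<in> P'" for A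
      using that core2 P1(3) unfolding P'_def by fast
    have disj: "disjoint P'"
    proof (rule disjointI)
      fix A B assume AB: "A \<in> P'" "B \<in> P'" "A \<noteq> B"
      obtain c where c: "c \<in> C" "A \<subseteq> ch c" "A \<in> P c \<or> A = ch c - core c" using wh[OF AB(1)] by blast
      obtain d where d: "d \<in> C" "B \<subseteq> ch d" "B \<in> P d \<or> B = ch d - core d" using wh[OF AB(2)] by blast
      show "A \<inter> B = {}"
      proof (cases "c = d")
        case False
        then show ?thesis using chdisj[OF c(1) d(1)] c d by blast
      next
        case True
        have "A \<inter> B = {}" if "A \<in> P c" "B \<in> P c" using P1(2)[of c] AB(3) that by (auto simp: disjoint_def)
        then show ?thesis using c(3) d(3) P1(3)[of c] AB(3) unfolding True[symmetric] by blast
      qed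
    qed
    have "card P' \<le> card (\<Union>c\<in>C. P c) + card ((\<lambda>c. ch c - core c) ` C)"
      unfolding P'_def by (rule card_Un_le)
    also have "\<dots> \<le> (\<Sum>c\<in>C. card (P c)) + 4"
      using card_UN_le[of C P] card_image_le[of C "\<lambda>c. ch c - core c"] C by simp
    finally have cd: "card P' + 4 \<le> 8 * m'" using m' by simp
    have Qne: "Q \<noteq> {}" unfolding Q_def by (rule sq_nonempty)
    have gd: "\<forall>R\<in>P'. good \<mu> (400000 * \<delta>) R" unfolding P'_def using P2 ringgood by blast
    have "cored_square \<mu> \<delta> (Suc s) Q Q P' m' h'"
      unfolding cored_square_def using fin un disj cd Qne gd h' by simp
    then show ?thesis by blast
  qed
  have cardQ: "card Q = 4 * 4^s" unfolding Q_def card_sq by simp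
  have "\<exists>core P m h. cored_square \<mu> \<delta> (Suc s) Q core P m h"
  proof (cases "card N \<ge> 2")
    case True
    have ext: "(\<Sum>x\<in>Q. F x (H x)) = (\<Sum>x\<in>Kc. F x (H x))" if "\<And>x. F x 0 = 0" for F :: "_ \<Rightarrow> _ \<Rightarrow> real"
      using KcQ finQ Hout that by (intro sum.mono_neutral_right) auto
    show ?thesis
    proof (rule final[of "\<Sum>c\<in>C. m c" H])
      show "(\<Sum>c\<in>C. card (P c)) + 8 \<le> 8 * (\<Sum>c\<in>C. m c)" using cP True by simp
      show "(\<Sum>x\<in>Q. N_fun_A (H x)) \<le> 4/3 * real (card Q)"
        using ext[of "\<lambda>_. N_fun_A"] HA card_mono[OF finQ KcQ] by simp
      show "real (\<Sum>c\<in>C. m c) * \<delta> \<le> (\<Sum>x\<in>Q. \<mu> x * H x)"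
        using ext[of "\<lambda>x t. \<mu> x * t"] Hm by simp
    qed (rule H0)
  next
    case False
    have finN: "finite N" unfolding N_def using C by simp
    have KN: "Kc = (\<Union>c\<in>N. core c)" unfolding Kc_def N_def by blast
    have "card N = 0 \<or> card N = 1" using False by linarith
    then have N01: "N = {} \<or> (\<exists>c. N = {c})" using finN by (auto simp: card_1_singleton_iff)
    have cardK4: "card Kc \<le> 4^s"
    proof (cases "N = {}")
      case False
      then obtain c where "N = {c}" using N01 by blast
      then have "Kc \<subseteq> ch c" using core2 unfolding KN by simp
      then have "card Kc \<le> card (ch c)" using finch card_mono by blast
      then show ?thesis unfolding ch_def card_sq .
    qed (simp add: KN)
    show ?thesis
    proof (cases "heavy \<mu> \<delta> (Q - Kc) (Suc s)")
      case True
      then obtain g where g: "\<And>x. g x \<ge> 0" "(\<Sum>x\<in>Q-Kc. N_fun_A (g x)) \<le> 4^Suc s"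
        "\<delta> < (\<Sum>x\<in>Q-Kc. \<mu> x * g x)" unfolding heavy_def by blast
      define h' where "h' x = (if x \<in> Kc then H x else g x)" for x
      have split: "(\<Sum>x\<in>Q. F x (h' x)) = (\<Sum>x\<in>Q-Kc. F x (g x)) + (\<Sum>x\<in>Kc. F x (H x))" for F :: "_ \<Rightarrow> _ \<Rightarrow> real"
        using sum.subset_diff[OF KcQ finQ, of "\<lambda>x. F x (h' x)"] unfolding h'_def by simp
      show ?thesis
      proof (rule final[of "(\<Sum>c\<in>C. m c) + 1" h'])
        show "(\<Sum>c\<in>C. card (P c)) + 8 \<le> 8 * ((\<Sum>c\<in>C. m c) + 1)" using cP by simp
        show "h' x \<ge> 0" for x unfolding h'_def using H0 g by simp
        have "real (card Q) = 4 * 4^s" unfolding cardQ by simp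
        moreover have "real (card Kc) \<le> 4^s" using cardK4 by (metis of_nat_le_iff of_nat_numeral of_nat_power)
        ultimately show "(\<Sum>x\<in>Q. N_fun_A (h' x)) \<le> 4/3 * real (card Q)"
          unfolding split[of "\<lambda>_. N_fun_A"] using g(2)[unfolded power_Suc] HA by linarith
        show "real ((\<Sum>c\<in>C. m c) + 1) * \<delta> \<le> (\<Sum>x\<in>Q. \<mu> x * h' x)"
          unfolding split[of "\<lambda>x t. \<mu> x * t"] using g(3) Hm by (simp add: distrib_right)
      qed
    next
      case light: False
      have "cored_square \<mu> \<delta> (Suc s) Q Kc (\<Union>c\<in>C. P c) (\<Sum>c\<in>C. m c) H"
      proof (cases "N = {}")
        case True
        then have e: "core c = {}" if "c \<in> C" for c using that unfolding N_def by blast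
        have "Kc = {}" "(\<Union>c\<in>C. P c) = {}" "(\<Sum>c\<in>C. m c) = 0"
          using e P4 unfolding Kc_def by auto
        then show ?thesis unfolding cored_square_def using light H0 by simp
      next
        case False
        then obtain c where Nc: "N = {c}" using N01 by blast
        then have c: "c \<in> C" "core c \<noteq> {}" unfolding N_def by auto
        have e: "core c' = {}" if "c' \<in> C" "c' \<noteq> c" for c' using that Nc unfolding N_def by blast
        have K: "Kc = core c" unfolding KN Nc by simp
        have "P c' \<subseteq> P c" if "c' \<in> C" for c' using e[OF that] P4[of c'] by (cases "c' = c") auto
        then have U: "(\<Union>c\<in>C. P c) = P c" using c(1) by blast
        have M: "(\<Sum>c\<in>C. m c) = m c"
          using sum.mono_neutral_right[of C "{c}" m] e P4 c C by auto
        have sub: "Kc = {} \<or> Kc = Q \<or> (\<exists>s'<Suc s. \<exists>i' j'. Kc = sq s' i' j')"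
          using core1[of c] unfolding K ch_def by (metis less_Suc_eq)
        show ?thesis unfolding cored_square_def U M
        proof (intro conjI)
          show "(\<Sum>x\<in>Kc. N_fun_A (H x)) \<le> 4/3 * real (card Kc)" by (rule HA)
          show "real (m c) * \<delta> \<le> (\<Sum>x\<in>Kc. \<mu> x * H x)" using Hm unfolding M .
        qed (use light KcQ sub P1[of c] P2[of _ c] P3[of c] c H0 K in auto)
      qed
      then show ?thesis by blast
    qed
  qed
  then show ?case unfolding Q_def .
qed

text \<open>Solomyak's covering lemma in a discrete form, with dyadic rings in place of overlapping squares.\<close>

lemma good_partition:
  fixes \<mu> :: "nat \<times> nat \<Rightarrow> real"
  assumes mu: "\<And>x. \<mu> x \<ge> 0" and \<delta>: "\<delta> > 0"
    and J: "\<And>h. \<lbrakk>\<And>x. h x \<ge> 0; (\<Sum>x\<in>sq K 0 0. N_fun_A (h x)) \<le> 4^K\<rbrakk> \<Longrightarrow> (\<Sum>x\<in>sq K 0 0. \<mu> x * h x) \<le> J"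
  shows "\<exists>P. finite P \<and> disjoint P \<and> \<Union>P = sq K 0 0 \<and> (\<forall>R\<in>P. good \<mu> (400000 * \<delta>) R) \<and>
    (J \<le> \<delta> \<longrightarrow> P = {sq K 0 0}) \<and> real (card P) * \<delta> \<le> \<delta> + 16 * J"
proof (cases "heavy \<mu> \<delta> (sq K 0 0) K")
  case False
  have "(\<Sum>x\<in>sq K 0 0. \<mu> x * 0) \<le> J" using J[of "\<lambda>_. 0"] by simp
  moreover have "good \<mu> (400000 * \<delta>) (sq K 0 0)"
    using good_light_ring[of "sq K 0 0" K 0 0 "{}" \<mu> \<delta>] False mu \<delta> by simp
  ultimately show ?thesis using \<delta> by (intro exI[of _ "{sq K 0 0}"]) auto
next
  case True
  let ?Q = "sq K 0 0"
  obtain g where "\<And>x. g x \<ge> 0" "(\<Sum>x\<in>?Q. N_fun_A (g x)) \<le> 4^K" "\<delta> < (\<Sum>x\<in>?Q. \<mu> x * g x)"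
    using True unfolding heavy_def by blast
  then have JJ: "J > \<delta>" using J[of g] by simp
  obtain core P m h where "cored_square \<mu> \<delta> K ?Q core P m h"
    using cored_square_exists[of \<mu> \<delta> K 0 0] mu \<delta> by auto
  note IH = this[unfolded cored_square_def]
  have c1: "core = {} \<or> core = ?Q \<or> (\<exists>s'<K. \<exists>i' j'. core = sq s' i' j')" "core \<subseteq> ?Q"
    "core \<noteq> ?Q \<Longrightarrow> \<not> heavy \<mu> \<delta> (?Q - core) K" using IH by blast+
  have P: "finite P" "disjoint P" "\<Union>P = core" "\<And>R. R \<in> P \<Longrightarrow> good \<mu> (400000 * \<delta>) R" using IH by blast+
  have ne: "core \<noteq> {}"
  proof
    assume e: "core = {}"
    then have "core \<noteq> ?Q" using sq_nonempty[of K 0 0] by metis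
    then show False using c1(3) True e by simp
  qed
  then have cP: "card P + 4 \<le> 8 * m" using IH by simp
  have h: "\<And>x. h x \<ge> 0" "(\<Sum>x\<in>core. N_fun_A (h x)) \<le> 4/3 * real (card core)"
    "real m * \<delta> \<le> (\<Sum>x\<in>core. \<mu> x * h x)" using IH by blast+
  have fin: "finite core" using c1(2) by (rule finite_subset) simp
  \<comment> \<open>The collected h may exceed the admissible size by the factor 4/3. Convexity of
    \<open>N_fun_A\<close> makes h/2 admissible, at the price of a factor 2 in front of J.\<close>
  have "(\<Sum>x\<in>?Q. \<mu> x * (if x \<in> core then h x / 2 else 0)) \<le> J"
  proof (rule J)
    have "(\<Sum>x\<in>?Q. N_fun_A (if x \<in> core then h x / 2 else 0)) = (\<Sum>x\<in>core. N_fun_A (h x / 2))"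
      using c1(2) by (intro sum.mono_neutral_cong_right) auto
    also have "\<dots> \<le> (\<Sum>x\<in>core. N_fun_A (h x) / 2)" by (intro sum_mono N_fun_A_divide) simp
    also have "\<dots> \<le> 4/3 * real (card core) / 2" using h(2) by (simp add: sum_divide_distrib[symmetric])
    also have "real (card core) \<le> real (4^K)"
      using card_mono[OF _ c1(2)] unfolding card_sq by (simp only: of_nat_le_iff finite_sq)
    also have "4/3 * real (4^K) / 2 \<le> 4^K" by simp
    finally show "(\<Sum>x\<in>?Q. N_fun_A (if x \<in> core then h x / 2 else 0)) \<le> 4^K" by simp
  qed (use h in auto)
  also have "(\<Sum>x\<in>?Q. \<mu> x * (if x \<in> core then h x / 2 else 0)) = (\<Sum>x\<in>core. \<mu> x * h x) / 2"
    unfolding sum_divide_distrib using c1(2) by (intro sum.mono_neutral_cong_right) auto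
  finally have mJ: "real m * \<delta> \<le> 2 * J" using h(3) by simp
  \<comment> \<open>The light outer ring completes the partition. The credit of 4 still held by the
    core pays for it.\<close>
  define P' where "P' = insert (?Q - core) P"
  have "card P' \<le> card P + 1" unfolding P'_def using P by (simp add: card_insert_if)
  then have "real (card P') \<le> 8 * real m" using cP by linarith
  then have "real (card P') * \<delta> \<le> 8 * real m * \<delta>" using \<delta> by (rule mult_right_mono[OF _ less_imp_le])
  then have cd: "real (card P') * \<delta> \<le> \<delta> + 16 * J" using mJ \<delta> by linarith
  have g: "good \<mu> (400000 * \<delta>) (?Q - core)"
  proof (cases "core = ?Q")
    case True
    then show ?thesis by (simp add: good_def Dirichlet_def)
  next
    case False
    then show ?thesis using c1(1) c1(3) mu \<delta> by (intro good_light_ring[OF refl]) auto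
  qed
  have dj: "disjoint P'" unfolding P'_def
  proof (rule disjointI)
    fix A B assume AB: "A \<in> insert (?Q - core) P" "B \<in> insert (?Q - core) P" "A \<noteq> B"
    have "A \<inter> B = {}" if "A \<in> P" "B \<in> P" using P(2) AB(3) that by (auto simp: disjoint_def)
    then show "A \<inter> B = {}" using AB P(3) by blast
  qed
  have "\<Union>P' = ?Q" unfolding P'_def using P(3) c1(2) by auto
  then show ?thesis using cd g dj P JJ by (intro exI[of _ P']) (auto simp: P'_def)
qed

section \<open>The form on a rectangular grid\<close>

definition grid_linear :: "((nat \<Rightarrow> nat \<Rightarrow> complex) \<Rightarrow> complex) \<Rightarrow> bool" where
  "grid_linear l \<longleftrightarrow> (\<forall>(n::nat) c w. l (\<lambda>k j. \<Sum>i<n. c i * w i k j) = (\<Sum>i<n. c i * l (w i)))"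

text \<open>Row k carries the samples on the k-th circle, so this is the discrete circular mean
  u.\<close>

definition row_mean :: "nat \<Rightarrow> (nat \<Rightarrow> nat \<Rightarrow> complex) \<Rightarrow> nat \<Rightarrow> complex" where
  "row_mean N w k = (\<Sum>j<N. w k j) / of_nat N"

lemma row_mean_linear:
  "row_mean N (\<lambda>k j. \<Sum>i<n. c i * w i k j) k = (\<Sum>i<n. c i * row_mean N (w i) k)"
  unfolding row_mean_def by (subst sum.swap) (simp add: sum_distrib_left sum_divide_distrib)

lemma grid_linear_deviation: "grid_linear (\<lambda>w. \<Sum>x\<in>S. w (f x) (g x) - row_mean N w (f x))"
  unfolding grid_linear_def
proof (intro allI)
  fix n c and w :: "nat \<Rightarrow> nat \<Rightarrow> nat \<Rightarrow> complex"
  show "(\<Sum>x\<in>S. (\<Sum>i<n. c i * w i (f x) (g x)) - row_mean N (\<lambda>k j. \<Sum>i<n. c i * w i k j) (f x))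
      = (\<Sum>i<n. c i * (\<Sum>x\<in>S. w i (f x) (g x) - row_mean N (w i) (f x)))"
    unfolding row_mean_linear sum_subtractf[symmetric] right_diff_distrib[symmetric]
    by (subst sum.swap) (simp add: sum_distrib_left)
qed

lemma grid_linear_row_mean: "grid_linear (\<lambda>w. row_mean N w k)"
  unfolding grid_linear_def by (simp add: row_mean_linear)

text \<open>Cauchy-Schwarz along a circle: passing to circular means does not increase the radial
  energy.\<close>

lemma row_mean_increment_le:
  assumes "N > 0"
  shows "real N * (cmod (row_mean N w (Suc k) - row_mean N w k))\<^sup>2 \<le> (\<Sum>j<N. (cmod (w (Suc k) j - w k j))\<^sup>2)"
proof -
  have "row_mean N w (Suc k) - row_mean N w k = (\<Sum>j<N. w (Suc k) j - w k j) / of_nat N"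
    unfolding row_mean_def by (simp add: sum_subtractf diff_divide_distrib)
  then have "cmod (row_mean N w (Suc k) - row_mean N w k) \<le> (\<Sum>j<N. cmod (w (Suc k) j - w k j)) / real N"
    by (simp add: norm_divide divide_right_mono norm_sum)
  then have "(cmod (row_mean N w (Suc k) - row_mean N w k))\<^sup>2 \<le> ((\<Sum>j<N. cmod (w (Suc k) j - w k j)) / real N)\<^sup>2"
    by (simp add: power_mono)
  also have "\<dots> \<le> ((\<Sum>j<N. (cmod (w (Suc k) j - w k j))\<^sup>2) * real (card {..<N})) / (real N)\<^sup>2"
    unfolding power_divide by (intro divide_right_mono sum_squared_le_sum_of_squares) auto
  finally show ?thesis using assms by (simp add: field_simps power2_eq_square)
qed

lemma sq_K: "sq K 0 0 = {..<2^K} \<times> {..<2^K}"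
  unfolding sq_def ivl_eq by auto

lemma Dirichlet_Union_le:
  assumes "finite P" "disjoint P" "\<Union>P = Q" "finite Q"
  shows "(\<Sum>R\<in>P. Dirichlet R v) \<le> Dirichlet Q v"
proof -
  have "(\<Sum>R\<in>P. Dirichlet R v) \<le> (\<Sum>R\<in>P. \<Sum>x\<in>R. (gx Q v x)\<^sup>2 + (gy Q v x)\<^sup>2)"
    unfolding Dirichlet_def using assms(3) by (intro sum_mono add_mono power_mono g_mono) auto
  also have "\<dots> = (\<Sum>x\<in>\<Union>P. (gx Q v x)\<^sup>2 + (gy Q v x)\<^sup>2)"
    using assms by (intro sum.Union_disjoint_sets[symmetric] | subst sum.Union_disjoint)+
      (auto simp: disjoint_def intro: finite_subset)
  finally show ?thesis unfolding Dirichlet_def assms(3) .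
qed

lemma good_partition_sum_le:
  assumes P: "finite P" "disjoint P" "\<Union>P = Q" "finite Q" and good: "\<And>R. R \<in> P \<Longrightarrow> good \<mu> \<beta> R"
    and v: "\<And>R. R \<in> P \<Longrightarrow> sum v R = 0" and \<beta>: "\<beta> \<ge> 0"
  shows "(\<Sum>x\<in>Q. \<mu> x * (cmod (v x))\<^sup>2) \<le> \<beta> * Dirichlet Q v"
proof -
  have "(\<Sum>x\<in>Q. \<mu> x * (cmod (v x))\<^sup>2) = (\<Sum>R\<in>P. \<Sum>x\<in>R. \<mu> x * (cmod (v x))\<^sup>2)"
    unfolding P(3)[symmetric] using P by (subst sum.Union_disjoint) (auto simp: disjoint_def intro: finite_subset)
  also have "\<dots> \<le> (\<Sum>R\<in>P. \<beta> * Dirichlet R v)" using good v unfolding good_def by (intro sum_mono) auto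
  also have "\<dots> \<le> \<beta> * Dirichlet Q v"
    unfolding sum_distrib_left[symmetric] using \<beta> by (intro mult_left_mono Dirichlet_Union_le P)
  finally show ?thesis .
qed

text \<open>Angular increments do not change when row means are subtracted. The radial increments of
  the means are bounded in square sum by those of w, so (p + q)^2 \<le> 2 p^2 + 2 q^2 gives the
  factor 4. The square is cut open at angle 0: the sum over j < N - 1 contains no edge that closes
  the circle.\<close>

lemma block_Dirichlet_le:
  fixes w :: "nat \<Rightarrow> nat \<Rightarrow> complex"
  assumes N: "N = 2^K"
  shows "Dirichlet (sq K 0 0) (\<lambda>(a, j). w (b*N+a) j - row_mean N w (b*N+a))
    \<le> (\<Sum>k\<in>{b*N..<b*N+N}. 4 * (\<Sum>j<N. (cmod (w (Suc k) j - w k j))\<^sup>2)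
         + (\<Sum>j<N-1. (cmod (w k (Suc j) - w k j))\<^sup>2))"
proof -
  define v where "v = (\<lambda>(a, j). w (b*N+a) j - row_mean N w (b*N+a))"
  have N0: "N > 0" unfolding N by simp
  have x: "(\<Sum>j<N. (gx (sq K 0 0) v (a, j))\<^sup>2) \<le> 4 * (\<Sum>j<N. (cmod (w (Suc (b*N+a)) j - w (b*N+a) j))\<^sup>2)" for a
  proof -
    let ?d = "\<lambda>j. w (Suc (b*N+a)) j - w (b*N+a) j"
    let ?r = "row_mean N w (Suc (b*N+a)) - row_mean N w (b*N+a)"
    have "(gx (sq K 0 0) v (a, j))\<^sup>2 \<le> 2 * (cmod (?d j))\<^sup>2 + 2 * (cmod ?r)\<^sup>2" for j
    proof -
      have "gx (sq K 0 0) v (a, j) \<le> cmod (?d j - ?r)"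
        unfolding gx_def v_def by (simp add: algebra_simps)
      also have "\<dots> \<le> cmod (?d j) + cmod ?r" by (rule norm_triangle_ineq4)
      finally have "(gx (sq K 0 0) v (a, j))\<^sup>2 \<le> (cmod (?d j) + cmod ?r)\<^sup>2" by (simp add: power_mono)
      also have "\<dots> \<le> 2 * (cmod (?d j))\<^sup>2 + 2 * (cmod ?r)\<^sup>2"
        using sum_squares_ge_zero[of "cmod (?d j) - cmod ?r" 0] by (simp add: power2_eq_square algebra_simps)
      finally show ?thesis .
    qed
    then have "(\<Sum>j<N. (gx (sq K 0 0) v (a, j))\<^sup>2) \<le> (\<Sum>j<N. 2 * (cmod (?d j))\<^sup>2 + 2 * (cmod ?r)\<^sup>2)"
      by (intro sum_mono)
    also have "\<dots> = 2 * (\<Sum>j<N. (cmod (?d j))\<^sup>2) + 2 * (real N * (cmod ?r)\<^sup>2)"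
      by (simp add: sum.distrib sum_distrib_left)
    also have "\<dots> \<le> 4 * (\<Sum>j<N. (cmod (?d j))\<^sup>2)"
      using row_mean_increment_le[OF N0, of w "b*N+a"] by simp
    finally show ?thesis .
  qed
  have y: "(\<Sum>j<N. (gy (sq K 0 0) v (a, j))\<^sup>2) \<le> (\<Sum>j<N-1. (cmod (w (b*N+a) (Suc j) - w (b*N+a) j))\<^sup>2)" for a
  proof -
    have "(\<Sum>j<N. (gy (sq K 0 0) v (a, j))\<^sup>2) = (\<Sum>j<N-1. (gy (sq K 0 0) v (a, j))\<^sup>2)"
      by (intro sum.mono_neutral_right) (auto simp: gy_def sq_K N)
    also have "\<dots> \<le> (\<Sum>j<N-1. (cmod (w (b*N+a) (Suc j) - w (b*N+a) j))\<^sup>2)"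
      by (intro sum_mono) (auto simp: gy_def v_def)
    finally show ?thesis .
  qed
  have "Dirichlet (sq K 0 0) v = (\<Sum>a<N. (\<Sum>j<N. (gx (sq K 0 0) v (a, j))\<^sup>2) + (\<Sum>j<N. (gy (sq K 0 0) v (a, j))\<^sup>2))"
    unfolding Dirichlet_def sum.distrib[symmetric] by (subst sum.cartesian_product) (simp add: sq_K N)
  also have "\<dots> \<le> (\<Sum>a<N. 4 * (\<Sum>j<N. (cmod (w (Suc (b*N+a)) j - w (b*N+a) j))\<^sup>2)
      + (\<Sum>j<N-1. (cmod (w (b*N+a) (Suc j) - w (b*N+a) j))\<^sup>2))"
    by (intro sum_mono add_mono x y)
  also have "\<dots> = (\<Sum>k\<in>{b*N..<b*N+N}. 4 * (\<Sum>j<N. (cmod (w (Suc k) j - w k j))\<^sup>2)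
         + (\<Sum>j<N-1. (cmod (w k (Suc j) - w k j))\<^sup>2))"
    using sum.shift_bounds_nat_ivl[of _ 0 "b*N" N, symmetric] by (simp add: lessThan_atLeast0 add.commute)
  finally show ?thesis unfolding v_def .
qed

lemma sum_blocks:
  fixes f :: "nat \<Rightarrow> real"
  shows "(\<Sum>b<M. \<Sum>k\<in>{b*N..<b*N+N}. f k) = (\<Sum>k<M*N. f k)"
  by (induction M) (simp_all add: sum.atLeastLessThan_concat lessThan_atLeast0 add.commute)

text \<open>\<open>J b\<close> bounds the discrete Orlicz norm of block b. A light block costs no
  condition; a heavy one has fewer than 17 J / \<delta> rings, because \<delta> + 16 J < 17 J. The
  constants 7/2, 3200000 and 800000 are twice 7/4, 4 * 400000 and 400000, the 2 coming from |w|^2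
  \<le> 2 |u|^2 + 2 |w - u|^2.\<close>

lemma grid_form_bound:
  fixes \<mu> :: "nat \<Rightarrow> nat \<Rightarrow> real" and J :: "nat \<Rightarrow> real"
  assumes N: "N = 2^K" and mu: "\<And>k j. \<mu> k j \<ge> 0" and \<delta>: "\<delta> > 0"
    and J: "\<And>b h. \<lbrakk>b < 2^m; \<And>x. h x \<ge> 0; (\<Sum>x\<in>sq K 0 0. N_fun_A (h x)) \<le> 4^K\<rbrakk>
      \<Longrightarrow> (\<Sum>x\<in>sq K 0 0. \<mu> (b*N + fst x) (snd x) * h x) \<le> J b"
  obtains \<Lambda> :: "((nat \<Rightarrow> nat \<Rightarrow> complex) \<Rightarrow> complex) set" and z :: "nat \<Rightarrow> nat" where
    "finite \<Lambda>" "\<And>l. l \<in> \<Lambda> \<Longrightarrow> grid_linear l"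
    "\<And>i. radial_mass N (\<lambda>k. \<Sum>j<N. \<mu> k j) i \<le> 1/4 \<Longrightarrow> z i = 0"
    "real (z 0) \<le> 2 * sqrt (radial_mass N (\<lambda>k. \<Sum>j<N. \<mu> k j) 0)"
    "\<And>i. real (z i) \<le> 4 * sqrt (radial_mass N (\<lambda>k. \<Sum>j<N. \<mu> k j) i)"
    "real (card \<Lambda>) \<le> (\<Sum>i\<le>m. real (z i)) + (\<Sum>b | b < 2^m \<and> J b > \<delta>. 17 / \<delta> * J b)"
    "\<And>w. \<lbrakk>row_mean N w 0 = 0; \<forall>l\<in>\<Lambda>. l w = 0\<rbrakk> \<Longrightarrow>
      (\<Sum>k<2^m*N. \<Sum>j<N. \<mu> k j * (cmod (w k j))\<^sup>2)
      \<le> (7/2 + 3200000 * \<delta>) * (\<Sum>k<2^m*N. \<Sum>j<N. (cmod (w (Suc k) j - w k j))\<^sup>2)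
        + 800000 * \<delta> * (\<Sum>k<2^m*N. \<Sum>j<N-1. (cmod (w k (Suc j) - w k j))\<^sup>2)"
proof -
  define G where "G k = (\<Sum>j<N. \<mu> k j)" for k
  have N0: "N > 0" unfolding N by simp
  have G0: "G k \<ge> 0" for k unfolding G_def using mu by (simp add: sum_nonneg)
  obtain Z where Z: "\<And>i. finite (Z i)" "\<And>i. radial_mass N G i \<le> 1/4 \<Longrightarrow> Z i = {}"
    "real (card (Z 0)) \<le> 2 * sqrt (radial_mass N G 0)"
    "\<And>i. real (card (Z i)) \<le> 4 * sqrt (radial_mass N G i)"
    "\<And>m u. u 0 = (0::complex) \<Longrightarrow> \<forall>i\<le>m. \<forall>z\<in>Z i. u z = 0 \<Longrightarrow>
      (\<Sum>k\<in>{0..<2^m*N}. G k * (cmod (u k))\<^sup>2)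
        \<le> 7/4 * real N * (\<Sum>k\<in>{0..<2^m*N}. (cmod (u (Suc k) - u k))\<^sup>2)"
    using half_line_zeros[of G N, OF G0 N0] by blast
  have Ge: "(\<lambda>k. \<Sum>j<N. \<mu> k j) = G" by (simp add: G_def fun_eq_iff)
  define Q where "Q = sq K 0 0"
  have finQ: "finite Q" unfolding Q_def by simp
  define part where "part b P \<longleftrightarrow> finite P \<and> disjoint P \<and> \<Union>P = Q \<and>
      (\<forall>R\<in>P. good (\<lambda>x. \<mu> (b*N + fst x) (snd x)) (400000 * \<delta>) R) \<and>
      (J b \<le> \<delta> \<longrightarrow> P = {Q}) \<and> real (card P) * \<delta> \<le> \<delta> + 16 * J b" for b P
  have "\<exists>P. part b P" if "b < 2^m" for b
    unfolding part_def Q_def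
    by (rule good_partition[of "\<lambda>x. \<mu> (b*N + fst x) (snd x)" \<delta> K "J b"]) (use mu \<delta> J[OF that] in auto)
  then obtain P where "\<And>b. b < 2^m \<Longrightarrow> part b (P b)" by metis
  note P = this[unfolded part_def]
  define B where "B = {b. b < 2^m \<and> J b > \<delta>}"
  have finB: "finite B" unfolding B_def by simp
  define \<Lambda>1 where "\<Lambda>1 = (\<lambda>z w. row_mean N w z) ` (\<Union>i\<le>m. Z i)"
  define \<Lambda>2 where "\<Lambda>2 = (\<lambda>(b, R) w. \<Sum>x\<in>R. w (b*N + fst x) (snd x) - row_mean N w (b*N + fst x)) ` (SIGMA b:B. P b)"
  define \<Lambda> where "\<Lambda> = \<Lambda>1 \<union> \<Lambda>2"
  have fP: "finite (SIGMA b:B. P b)" using finB P unfolding B_def by (intro finite_SigmaI) auto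
  show thesis
  proof (rule that[of \<Lambda> "\<lambda>i. card (Z i)"])
    show "finite \<Lambda>" unfolding \<Lambda>_def \<Lambda>1_def \<Lambda>2_def using fP Z(1) by auto
    show "grid_linear l" if "l \<in> \<Lambda>" for l
      using that unfolding \<Lambda>_def \<Lambda>1_def \<Lambda>2_def by (auto intro: grid_linear_row_mean grid_linear_deviation)
    have c1: "card \<Lambda>1 \<le> (\<Sum>i\<le>m. card (Z i))"
      unfolding \<Lambda>1_def using Z(1) card_image_le[of "\<Union>i\<le>m. Z i"] card_UN_le[of "{..m}" Z]
      by (meson finite_UN_I finite_atMost order_trans)
    have "card \<Lambda>2 \<le> (\<Sum>b\<in>B. card (P b))"
      unfolding \<Lambda>2_def using card_image_le[OF fP] finB P unfolding B_def by (subst card_SigmaI[symmetric]) auto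
    then have "real (card \<Lambda>2) \<le> (\<Sum>b\<in>B. real (card (P b)))" by (metis of_nat_le_iff of_nat_sum)
    also have "\<dots> \<le> (\<Sum>b\<in>B. 17 / \<delta> * J b)"
    proof (intro sum_mono)
      fix b assume b: "b \<in> B"
      then have "real (card (P b)) * \<delta> \<le> \<delta> + 16 * J b" "J b > \<delta>" using P[of b] unfolding B_def by auto
      then have "real (card (P b)) * \<delta> \<le> 17 * J b" by linarith
      then show "real (card (P b)) \<le> 17 / \<delta> * J b" using \<delta> by (simp add: field_simps)
    qed
    finally have c2: "real (card \<Lambda>2) \<le> (\<Sum>b\<in>B. 17 / \<delta> * J b)" .
    have "real (card \<Lambda>) \<le> real (card \<Lambda>1) + real (card \<Lambda>2)"
      unfolding \<Lambda>_def of_nat_add[symmetric] of_nat_le_iff by (rule card_Un_le)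
    moreover have "real (card \<Lambda>1) \<le> (\<Sum>i\<le>m. real (card (Z i)))" using c1 by (metis of_nat_le_iff of_nat_sum)
    ultimately show "real (card \<Lambda>) \<le> (\<Sum>i\<le>m. real (card (Z i))) + (\<Sum>b | b < 2^m \<and> J b > \<delta>. 17 / \<delta> * J b)"
      using c2 unfolding B_def by linarith
  next
    fix w assume w0: "row_mean N w 0 = 0" and w: "\<forall>l\<in>\<Lambda>. l w = 0"
    define u where "u = row_mean N w"
    define T where "T k = (\<Sum>j<N. (cmod (w (Suc k) j - w k j))\<^sup>2)" for k
    define \<Theta> where "\<Theta> k = (\<Sum>j<N-1. (cmod (w k (Suc j) - w k j))\<^sup>2)" for k
    have uz: "\<forall>i\<le>m. \<forall>z\<in>Z i. u z = 0"
    proof (intro allI impI ballI)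
      fix i z assume "i \<le> m" "z \<in> Z i"
      then have "(\<lambda>w. row_mean N w z) \<in> \<Lambda>" unfolding \<Lambda>_def \<Lambda>1_def by blast
      from bspec[OF w this] show "u z = 0" unfolding u_def .
    qed
    have "(\<Sum>k<2^m*N. G k * (cmod (u k))\<^sup>2) \<le> 7/4 * real N * (\<Sum>k<2^m*N. (cmod (u (Suc k) - u k))\<^sup>2)"
      using Z(5)[of u m] uz w0 unfolding u_def by (simp add: lessThan_atLeast0)
    also have "\<dots> = 7/4 * (\<Sum>k<2^m*N. real N * (cmod (u (Suc k) - u k))\<^sup>2)"
      by (simp add: sum_distrib_left mult.assoc)
    also have "\<dots> \<le> 7/4 * (\<Sum>k<2^m*N. T k)"
      unfolding u_def T_def by (intro mult_left_mono sum_mono row_mean_increment_le N0) auto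
    finally have rad: "(\<Sum>k<2^m*N. G k * (cmod (u k))\<^sup>2) \<le> 7/4 * (\<Sum>k<2^m*N. T k)" .
    have blk: "(\<Sum>k\<in>{b*N..<b*N+N}. \<Sum>j<N. \<mu> k j * (cmod (w k j - u k))\<^sup>2)
        \<le> 400000 * \<delta> * (\<Sum>k\<in>{b*N..<b*N+N}. 4 * T k + \<Theta> k)" if b: "b < 2^m" for b
    proof -
      define v where "v = (\<lambda>(a, j). w (b*N+a) j - row_mean N w (b*N+a))"
      have v0: "sum v R = 0" if R: "R \<in> P b" for R
      proof (cases "J b > \<delta>")
        case True
        then have "(\<lambda>w. \<Sum>x\<in>R. w (b*N + fst x) (snd x) - row_mean N w (b*N + fst x)) \<in> \<Lambda>"
          using R b unfolding \<Lambda>_def \<Lambda>2_def B_def by force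
        from bspec[OF w this]
        have "(\<Sum>x\<in>R. w (b*N + fst x) (snd x) - row_mean N w (b*N + fst x)) = 0" .
        then show ?thesis unfolding v_def by (simp add: case_prod_unfold)
      next
        case False
        \<comment> \<open>A light block is its own only ring, and deviations from row means have sum
          0 over it; so no condition has to be imposed.\<close>
        then have "R = Q" using P[OF b] R by auto
        then have "sum v R = (\<Sum>a<N. \<Sum>j<N. w (b*N+a) j - row_mean N w (b*N+a))"
          unfolding v_def by (subst sum.cartesian_product) (simp add: Q_def sq_K N)
        also have "\<dots> = 0" using N0 by (simp add: sum_subtractf row_mean_def)
        finally show ?thesis .
      qed
      have "(\<Sum>k\<in>{b*N..<b*N+N}. \<Sum>j<N. \<mu> k j * (cmod (w k j - u k))\<^sup>2)
        = (\<Sum>a<N. \<Sum>j<N. \<mu> (b*N+a) j * (cmod (w (b*N+a) j - u (b*N+a)))\<^sup>2)"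
        using sum.shift_bounds_nat_ivl[of "\<lambda>k. \<Sum>j<N. \<mu> k j * (cmod (w k j - u k))\<^sup>2" 0 "b*N" N]
        by (simp add: lessThan_atLeast0 add.commute)
      also have "\<dots> = (\<Sum>x\<in>Q. \<mu> (b*N + fst x) (snd x) * (cmod (v x))\<^sup>2)"
        unfolding v_def u_def by (subst sum.cartesian_product) (simp add: Q_def sq_K N case_prod_unfold)
      also have "\<dots> \<le> 400000 * \<delta> * Dirichlet Q v"
        using P[OF b] \<delta> v0 by (intro good_partition_sum_le[where P = "P b"] finQ) auto
      also have "\<dots> \<le> 400000 * \<delta> * (\<Sum>k\<in>{b*N..<b*N+N}. 4 * T k + \<Theta> k)"
        using block_Dirichlet_le[OF N, of w b] \<delta> unfolding Q_def v_def T_def \<Theta>_def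
        by (intro mult_left_mono) auto
      finally show ?thesis .
    qed
    have "(\<Sum>k<2^m*N. \<Sum>j<N. \<mu> k j * (cmod (w k j - u k))\<^sup>2)
        = (\<Sum>b<2^m. \<Sum>k\<in>{b*N..<b*N+N}. \<Sum>j<N. \<mu> k j * (cmod (w k j - u k))\<^sup>2)"
      by (rule sum_blocks[symmetric])
    also have "\<dots> \<le> (\<Sum>b<2^m. 400000 * \<delta> * (\<Sum>k\<in>{b*N..<b*N+N}. 4 * T k + \<Theta> k))"
      by (intro sum_mono blk) auto
    also have "\<dots> = 400000 * \<delta> * (\<Sum>k<2^m*N. 4 * T k + \<Theta> k)"
      unfolding sum_distrib_left[symmetric] sum_blocks ..
    also have "(\<Sum>k<2^m*N. 4 * T k + \<Theta> k) = 4 * (\<Sum>k<2^m*N. T k) + (\<Sum>k<2^m*N. \<Theta> k)"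
      by (simp add: sum.distrib sum_distrib_left)
    finally have dev: "(\<Sum>k<2^m*N. \<Sum>j<N. \<mu> k j * (cmod (w k j - u k))\<^sup>2)
      \<le> 400000 * \<delta> * (4 * (\<Sum>k<2^m*N. T k) + (\<Sum>k<2^m*N. \<Theta> k))" .
    have "(\<Sum>k<2^m*N. \<Sum>j<N. \<mu> k j * (cmod (w k j))\<^sup>2)
      \<le> (\<Sum>k<2^m*N. \<Sum>j<N. \<mu> k j * (2 * (cmod (u k))\<^sup>2 + 2 * (cmod (w k j - u k))\<^sup>2))"
    proof (intro sum_mono mult_left_mono mu)
      fix k j
      have "cmod (w k j) \<le> cmod (u k) + cmod (w k j - u k)"
        by (metis add_diff_cancel_left' diff_add_cancel norm_triangle_ineq)
      then have "(cmod (w k j))\<^sup>2 \<le> (cmod (u k) + cmod (w k j - u k))\<^sup>2" by (simp add: power_mono)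
      also have "\<dots> \<le> 2 * (cmod (u k))\<^sup>2 + 2 * (cmod (w k j - u k))\<^sup>2"
        using sum_squares_ge_zero[of "cmod (u k) - cmod (w k j - u k)" 0]
        by (simp add: power2_eq_square algebra_simps)
      finally show "(cmod (w k j))\<^sup>2 \<le> 2 * (cmod (u k))\<^sup>2 + 2 * (cmod (w k j - u k))\<^sup>2" .
    qed
    also have "\<dots> = 2 * (\<Sum>k<2^m*N. G k * (cmod (u k))\<^sup>2)
        + 2 * (\<Sum>k<2^m*N. \<Sum>j<N. \<mu> k j * (cmod (w k j - u k))\<^sup>2)"
      unfolding G_def by (simp add: sum.distrib sum_distrib_left sum_distrib_right distrib_left mult_ac)
    also have "\<dots> \<le> 2 * (7/4 * (\<Sum>k<2^m*N. T k))
        + 2 * (400000 * \<delta> * (4 * (\<Sum>k<2^m*N. T k) + (\<Sum>k<2^m*N. \<Theta> k)))"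
      using rad dev by linarith
    also have "\<dots> = (7/2 + 3200000 * \<delta>) * (\<Sum>k<2^m*N. T k) + 800000 * \<delta> * (\<Sum>k<2^m*N. \<Theta> k)"
      by (simp add: algebra_simps)
    finally show "(\<Sum>k<2^m*N. \<Sum>j<N. \<mu> k j * (cmod (w k j))\<^sup>2)
      \<le> (7/2 + 3200000 * \<delta>) * (\<Sum>k<2^m*N. \<Sum>j<N. (cmod (w (Suc k) j - w k j))\<^sup>2)
        + 800000 * \<delta> * (\<Sum>k<2^m*N. \<Sum>j<N-1. (cmod (w k (Suc j) - w k j))\<^sup>2)"
      unfolding T_def \<Theta>_def .
  qed (unfold Ge, use Z in auto)
qed

section \<open>Logarithmic polar cells\<close>

definition polar :: "real \<Rightarrow> real \<Rightarrow> real^2" where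
  "polar r \<theta> = vector [r * cos \<theta>, r * sin \<theta>]"

lemma polar_nth [simp]: "polar r \<theta> $ 1 = r * cos \<theta>" "polar r \<theta> $ 2 = r * sin \<theta>"
  by (simp_all add: polar_def)

lemma norm_real2: "norm (x :: real^2) = sqrt ((x$1)\<^sup>2 + (x$2)\<^sup>2)"
  by (simp add: norm_vec_def L2_set_def sum_2)

lemma norm_polar [simp]: "norm (polar r \<theta>) = \<bar>r\<bar>"
proof -
  have "(r * cos \<theta>)\<^sup>2 + (r * sin \<theta>)\<^sup>2 = r\<^sup>2 * ((cos \<theta>)\<^sup>2 + (sin \<theta>)\<^sup>2)"
    by (simp only: power_mult_distrib distrib_left)
  then show ?thesis by (simp add: norm_real2)
qed

definition angle :: "real^2 \<Rightarrow> real" where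
  "angle x = Arg2pi (Complex (x$1) (x$2))"

lemma angle_bounds: "0 \<le> angle x" "angle x < 2 * pi"
  unfolding angle_def by (auto simp: Arg2pi_ge_0 Arg2pi_lt_2pi)

lemma norm_Complex_real2: "cmod (Complex (x$1) (x$2)) = norm (x :: real^2)"
  by (simp add: norm_real2 cmod_def)

lemma polar_norm_angle: "polar (norm x) (angle x) = x"
proof -
  have "Complex (x$1) (x$2) = of_real (norm x) * exp (\<i> * of_real (angle x))"
    using Arg2pi_eq[of "Complex (x$1) (x$2)"] unfolding angle_def norm_Complex_real2 .
  also have "\<dots> = Complex (norm x * cos (angle x)) (norm x * sin (angle x))"
    by (simp add: complex_eq_iff Re_exp Im_exp)
  finally have "x$1 = norm x * cos (angle x)" "x$2 = norm x * sin (angle x)" by simp_all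
  then show ?thesis by (simp add: vec_eq_iff forall_2)
qed

lemma angle_polar:
  assumes "r > 0" "0 \<le> \<theta>" "\<theta> < 2 * pi"
  shows "angle (polar r \<theta>) = \<theta>"
  unfolding angle_def
  by (rule Arg2pi_unique[of r]) (use assms in \<open>auto simp: complex_eq_iff Re_exp Im_exp\<close>)

text \<open>\<open>Arg2pi\<close> jumps across the nonnegative reals but is 0 on them, so it equals
  its product with the indicator of the open complement, where it is continuous.\<close>

lemma borel_measurable_angle [measurable]: "angle \<in> borel_measurable borel"
proof -
  have o: "open (- \<real>\<^sub>\<ge>\<^sub>0 :: complex set)" by (simp add: open_Compl closed_nonneg_Reals_complex)
  have "continuous_on (- \<real>\<^sub>\<ge>\<^sub>0) Arg2pi"
    by (intro continuous_at_imp_continuous_on ballI continuous_at_Arg2pi) auto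
  then have "(\<lambda>z. indicator (- \<real>\<^sub>\<ge>\<^sub>0) z *\<^sub>R Arg2pi z) \<in> borel_measurable borel"
    using o by (intro borel_measurable_continuous_on_indicator) auto
  moreover have "(\<lambda>z. indicator (- \<real>\<^sub>\<ge>\<^sub>0) z *\<^sub>R Arg2pi z) = Arg2pi"
  proof
    fix z show "indicator (- \<real>\<^sub>\<ge>\<^sub>0) z *\<^sub>R Arg2pi z = Arg2pi z"
      by (auto simp: indicator_def nonneg_Reals_def Arg2pi_of_real)
  qed
  ultimately have "Arg2pi \<in> borel_measurable borel" by simp
  moreover have "(\<lambda>x::real^2. Complex (x$1) (x$2)) \<in> borel_measurable borel"
    unfolding Complex_eq by (intro borel_measurable_continuous_onI continuous_intros)
  ultimately show ?thesis unfolding angle_def by (rule measurable_compose[rotated])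
qed

lemma norm_polar_diff_le: "norm (polar r \<theta> - polar r' \<theta>') \<le> \<bar>r - r'\<bar> + \<bar>r'\<bar> * \<bar>\<theta> - \<theta>'\<bar>"
proof -
  have "(cos \<theta> - cos \<theta>')\<^sup>2 + (sin \<theta> - sin \<theta>')\<^sup>2 = 2 - 2 * cos (\<theta> - \<theta>')"
    using sin_cos_squared_add[of \<theta>] sin_cos_squared_add[of \<theta>']
    by (simp add: power2_diff cos_diff algebra_simps)
  also have "\<dots> \<le> (\<theta> - \<theta>')\<^sup>2"
  proof -
    have "1 - cos t \<le> t\<^sup>2 / 2" for t :: real
    proof -
      have "1 - cos t = 2 * (sin (t/2))\<^sup>2" using cos_double_sin[of "t/2"] by simp
      also have "(sin (t/2))\<^sup>2 \<le> (t/2)\<^sup>2" using abs_sin_x_le_abs_x[of "t/2"] by (simp only: abs_le_square_iff)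
      finally show ?thesis by (simp add: power_divide)
    qed
    from this[of "\<theta> - \<theta>'"] show ?thesis by simp
  qed
  finally have a: "sqrt ((cos \<theta> - cos \<theta>')\<^sup>2 + (sin \<theta> - sin \<theta>')\<^sup>2) \<le> \<bar>\<theta> - \<theta>'\<bar>"
    by (intro real_le_lsqrt) auto
  have "polar r \<theta> - polar r' \<theta>' = polar (r - r') \<theta> + (polar r' \<theta> - polar r' \<theta>')"
    by (simp add: vec_eq_iff forall_2 algebra_simps)
  then have "norm (polar r \<theta> - polar r' \<theta>') \<le> norm (polar (r - r') \<theta>) + norm (polar r' \<theta> - polar r' \<theta>')"
    by (metis norm_triangle_ineq)
  also have "norm (polar r' \<theta> - polar r' \<theta>') = \<bar>r'\<bar> * sqrt ((cos \<theta> - cos \<theta>')\<^sup>2 + (sin \<theta> - sin \<theta>')\<^sup>2)"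
    unfolding norm_real2 by (simp add: power_mult_distrib real_sqrt_mult flip: right_diff_distrib distrib_left)
  also have "\<dots> \<le> \<bar>r'\<bar> * \<bar>\<theta> - \<theta>'\<bar>" using a by (intro mult_left_mono) auto
  finally show ?thesis by simp
qed

text \<open>The image of a rectangle rather than a condition on \<open>angle\<close>, so that a
  rotation simply shifts \<alpha> and \<beta>, also across the cut at angle 0. Being half-open in
  the angle, the sectors tile the circle exactly.\<close>

definition pcell :: "real \<Rightarrow> real \<Rightarrow> real \<Rightarrow> real \<Rightarrow> (real^2) set" where
  "pcell a b \<alpha> \<beta> = {polar r \<theta> | r \<theta>. a < r \<and> r < b \<and> \<alpha> \<le> \<theta> \<and> \<theta> < \<beta>}"

lemma pcell_eq:
  assumes "0 \<le> a" "0 \<le> \<alpha>" "\<beta> \<le> 2 * pi"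
  shows "pcell a b \<alpha> \<beta> = {x. a < norm x \<and> norm x < b \<and> \<alpha> \<le> angle x \<and> angle x < \<beta>}"
proof (intro equalityI subsetI)
  fix x assume "x \<in> {x. a < norm x \<and> norm x < b \<and> \<alpha> \<le> angle x \<and> angle x < \<beta>}"
  then show "x \<in> pcell a b \<alpha> \<beta>" unfolding pcell_def
    by (intro CollectI exI[of _ "norm x"] exI[of _ "angle x"]) (auto simp: polar_norm_angle)
qed (use assms in \<open>auto simp: pcell_def angle_polar\<close>)

lemma pcell_borel [measurable]:
  assumes "0 \<le> a" "0 \<le> \<alpha>" "\<beta> \<le> 2 * pi"
  shows "pcell a b \<alpha> \<beta> \<in> sets borel"
  unfolding pcell_eq[OF assms] by measurable

lemma pcell_lmeasurable:
  assumes "0 \<le> a" "0 \<le> \<alpha>" "\<beta> \<le> 2 * pi"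
  shows "pcell a b \<alpha> \<beta> \<in> lmeasurable"
proof (rule bounded_set_imp_lmeasurable)
  show "bounded (pcell a b \<alpha> \<beta>)" unfolding pcell_eq[OF assms] by (intro boundedI[of _ b]) auto
qed (use pcell_borel[OF assms] in auto)

lemma measure_pcell_rotate:
  assumes "pcell a b \<alpha> \<beta> \<in> lmeasurable"
  shows "measure lebesgue (pcell a b (\<alpha> + \<gamma>) (\<beta> + \<gamma>)) = measure lebesgue (pcell a b \<alpha> \<beta>)"
proof -
  define rot :: "real^2 \<Rightarrow> real^2" where
    "rot x = vector [cos \<gamma> * x$1 - sin \<gamma> * x$2, sin \<gamma> * x$1 + cos \<gamma> * x$2]" for x
  have rn [simp]: "rot x $ 1 = cos \<gamma> * x$1 - sin \<gamma> * x$2" "rot x $ 2 = sin \<gamma> * x$1 + cos \<gamma> * x$2" for x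
    unfolding rot_def by simp_all
  have "linear rot" by (rule linearI) (simp_all add: vec_eq_iff forall_2 algebra_simps)
  moreover have "norm (rot x) = norm x" for x
  proof -
    have "(rot x $ 1)\<^sup>2 + (rot x $ 2)\<^sup>2 = ((cos \<gamma>)\<^sup>2 + (sin \<gamma>)\<^sup>2) * ((x$1)\<^sup>2 + (x$2)\<^sup>2)"
      unfolding rn by algebra
    then show ?thesis unfolding norm_real2 by simp
  qed
  ultimately have orth: "orthogonal_transformation rot" by (simp add: orthogonal_transformation)
  have rp: "rot (polar r \<theta>) = polar r (\<theta> + \<gamma>)" for r \<theta>
    by (simp add: vec_eq_iff forall_2 cos_add sin_add algebra_simps)
  have "rot ` pcell a b \<alpha> \<beta> = pcell a b (\<alpha> + \<gamma>) (\<beta> + \<gamma>)"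
  proof (intro equalityI subsetI)
    fix x assume "x \<in> pcell a b (\<alpha> + \<gamma>) (\<beta> + \<gamma>)"
    then obtain r \<theta> where x: "x = polar r \<theta>" "a < r" "r < b" "\<alpha> + \<gamma> \<le> \<theta>" "\<theta> < \<beta> + \<gamma>"
      unfolding pcell_def by blast
    have "x = rot (polar r (\<theta> - \<gamma>))" unfolding rp x by simp
    moreover have "polar r (\<theta> - \<gamma>) \<in> pcell a b \<alpha> \<beta>"
      unfolding pcell_def using x by (intro CollectI exI[of _ r] exI[of _ "\<theta> - \<gamma>"]) auto
    ultimately show "x \<in> rot ` pcell a b \<alpha> \<beta>" by blast
  next
    fix x assume "x \<in> rot ` pcell a b \<alpha> \<beta>"
    then show "x \<in> pcell a b (\<alpha> + \<gamma>) (\<beta> + \<gamma>)" unfolding pcell_def using rp by fastforce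
  qed
  then show ?thesis using measure_orthogonal_image[OF orth assms] by simp
qed

lemma measure_annulus:
  assumes "0 \<le> a" "a \<le> b"
  shows "measure lebesgue {x :: real^2. a < norm x \<and> norm x < b} = pi * (b\<^sup>2 - a\<^sup>2)"
proof (cases "a < b")
  case True
  have eq: "{x :: real^2. a < norm x \<and> norm x < b} = ball 0 b - cball 0 a" by auto
  have "measure lebesgue (ball (0::real^2) b - cball 0 a) = measure lebesgue (ball (0::real^2) b) - measure lebesgue (cball (0::real^2) a)"
    using True by (intro measurable_measure_Diff) auto
  then show ?thesis unfolding eq using assms
    by (simp add: content_ball content_cball unit_ball_vol_2 power2_eq_square algebra_simps)
next
  case False
  then have e: "{x :: real^2. a < norm x \<and> norm x < b} = {}" by auto
  show ?thesis unfolding e using False assms by simp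
qed

definition sector_pt :: "nat \<Rightarrow> nat \<Rightarrow> real" where
  "sector_pt N j = 2 * pi * real j / real N"

lemma sector_pt_Suc: "N > 0 \<Longrightarrow> sector_pt N (Suc j) = sector_pt N j + 2 * pi / real N"
  unfolding sector_pt_def by (simp add: field_simps)

lemma sector_pt_bounds:
  assumes "j < N"
  shows "0 \<le> sector_pt N j" "sector_pt N (Suc j) \<le> 2 * pi"
proof -
  have "2 * pi * real (Suc j) \<le> 2 * pi * real N" using assms by (intro mult_left_mono) auto
  then show "sector_pt N (Suc j) \<le> 2 * pi"
    unfolding sector_pt_def using assms by (subst pos_divide_le_eq) auto
qed (simp add: sector_pt_def)

lemma sector_partition:
  assumes N: "N > 0" and t: "0 \<le> t" "t < 2 * pi"
  shows "\<exists>!j. j < N \<and> sector_pt N j \<le> t \<and> t < sector_pt N (Suc j)"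
proof -
  define s where "s = t * real N / (2 * pi)"
  have s: "0 \<le> s" "s < real N" unfolding s_def using N t pi_gt_zero by (auto simp: field_simps)
  have eq: "sector_pt N j \<le> t \<and> t < sector_pt N (Suc j) \<longleftrightarrow> real j \<le> s \<and> s < real j + 1" for j
    unfolding sector_pt_def s_def using N pi_gt_zero by (auto simp: field_simps)
  have "real j \<le> s \<and> s < real j + 1 \<longleftrightarrow> j = nat \<lfloor>s\<rfloor>" for j
    using s by (auto simp: floor_eq_iff nat_eq_iff2 eq_nat_nat_iff)
  then show ?thesis unfolding eq using s by (intro ex1I[of _ "nat \<lfloor>s\<rfloor>"]) (auto simp: nat_less_iff floor_less_iff)
qed

text \<open>The N sectors are congruent by rotation and partition the annulus, whose area is a
  difference of two disc areas. So each sector has one N-th of it, and no change of variables is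
  involved.\<close>

lemma measure_pcell_sector:
  assumes "0 \<le> a" "a \<le> b" "j < N"
  shows "measure lebesgue (pcell a b (sector_pt N j) (sector_pt N (Suc j))) = pi / real N * (b\<^sup>2 - a\<^sup>2)"
proof -
  have N: "N > 0" using assms by simp
  define c where "c j = pcell a b (sector_pt N j) (sector_pt N (Suc j))" for j
  have lm: "c j \<in> lmeasurable" if "j < N" for j
    unfolding c_def using sector_pt_bounds[OF that] assms by (intro pcell_lmeasurable)
  have ceq: "c j = {x. a < norm x \<and> norm x < b \<and> sector_pt N j \<le> angle x \<and> angle x < sector_pt N (Suc j)}"
    if "j < N" for j unfolding c_def using sector_pt_bounds[OF that] assms by (intro pcell_eq)
  have "measure lebesgue (c (Suc j)) = measure lebesgue (c j)" if "Suc j < N" for j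
    unfolding c_def using measure_pcell_rotate[of a b "sector_pt N j" "sector_pt N (Suc j)" "2 * pi / real N"]
      lm[of j] that N unfolding c_def by (simp add: sector_pt_Suc[OF N])
  then have same: "j < N \<Longrightarrow> measure lebesgue (c j) = measure lebesgue (c 0)" for j
    by (induction j) auto
  have "(\<Union>j<N. c j) = {x. a < norm x \<and> norm x < b}"
  proof (intro equalityI subsetI)
    fix x assume x: "x \<in> {x::real^2. a < norm x \<and> norm x < b}"
    obtain j where "j < N" "sector_pt N j \<le> angle x" "angle x < sector_pt N (Suc j)"
      using sector_partition[OF N angle_bounds] by blast
    then show "x \<in> (\<Union>j<N. c j)" using x ceq by auto
  qed (use ceq in auto)
  then have "pi * (b\<^sup>2 - a\<^sup>2) = measure lebesgue (\<Union>j<N. c j)" using measure_annulus[of a b] assms by simp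
  also have "\<dots> = (\<Sum>j<N. measure lebesgue (c j))"
  proof (rule measure_UNION')
    show "pairwise (\<lambda>i j. disjnt (c i) (c j)) {..<N}"
    proof (rule pairwiseI)
      fix i j assume "i \<in> {..<N}" "j \<in> {..<N}" "i \<noteq> j"
      then show "disjnt (c i) (c j)"
        using sector_partition[OF N angle_bounds] ceq unfolding disjnt_def by fastforce
    qed
  qed (use lm in auto)
  also have "\<dots> = (\<Sum>j<N. measure lebesgue (c 0))" by (intro sum.cong refl same) simp
  finally have "measure lebesgue (c 0) = pi / real N * (b\<^sup>2 - a\<^sup>2)" using N by (simp add: field_simps)
  then show ?thesis using same[of j] assms unfolding c_def by simp
qed

text \<open>\<open>\<sigma>\<close> is \<open>1\<close> outside and \<open>-1\<close> inside the unit circle, and \<open>k\<close> counts steps away from the circle.\<close>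

definition rad :: "nat \<Rightarrow> real \<Rightarrow> nat \<Rightarrow> real" where
  "rad N \<sigma> k = exp (\<sigma> * (real k / real N))"

text \<open>min and max occur because for \<sigma> = -1 the radii decrease in k.\<close>

definition cell :: "nat \<Rightarrow> real \<Rightarrow> nat \<Rightarrow> nat \<Rightarrow> (real^2) set" where
  "cell N \<sigma> k j = pcell (min (rad N \<sigma> k) (rad N \<sigma> (Suc k))) (max (rad N \<sigma> k) (rad N \<sigma> (Suc k)))
     (sector_pt N j) (sector_pt N (Suc j))"

text \<open>The sampling point is a corner on the side of the unit circle. So k/N is a lower bound
  of |ln |x|| on the cell, and the nodes with k = 0 of the two half lines coincide.\<close>

definition node :: "nat \<Rightarrow> real \<Rightarrow> nat \<Rightarrow> nat \<Rightarrow> real^2" where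
  "node N \<sigma> k j = polar (rad N \<sigma> k) (sector_pt N j)"

definition annulus :: "real \<Rightarrow> (real^2) set" where
  "annulus M = {x. exp (- M) < norm x \<and> norm x < exp M}"

lemma rad_pos [simp]: "rad N \<sigma> k > 0" "\<bar>rad N \<sigma> k\<bar> = rad N \<sigma> k" by (simp_all add: rad_def)

lemma cell_iff:
  assumes N: "N > 0" "j < N" and \<sigma>: "\<sigma> = 1 \<or> \<sigma> = -1"
  shows "x \<in> cell N \<sigma> k j \<longleftrightarrow> x \<noteq> 0 \<and> real k / real N < \<sigma> * ln (norm x) \<and> \<sigma> * ln (norm x) < real (Suc k) / real N
    \<and> sector_pt N j \<le> angle x \<and> angle x < sector_pt N (Suc j)"
proof -
  have k: "real k / real N < real (Suc k) / real N" using N by (simp add: divide_strict_right_mono)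
  have "min (rad N \<sigma> k) (rad N \<sigma> (Suc k)) < norm x \<and> norm x < max (rad N \<sigma> k) (rad N \<sigma> (Suc k))
    \<longleftrightarrow> x \<noteq> 0 \<and> real k / real N < \<sigma> * ln (norm x) \<and> \<sigma> * ln (norm x) < real (Suc k) / real N"
  proof (cases "x = 0")
    case True
    then show ?thesis using rad_pos(1)[of N \<sigma> k] rad_pos(1)[of N \<sigma> "Suc k"] by (auto simp: min_def not_less intro: less_imp_le)
  next
    case False
    then have x: "norm x = exp (ln (norm x))" by simp
    show ?thesis
    proof (cases "\<sigma> = 1")
      case True
      then have "rad N \<sigma> k < rad N \<sigma> (Suc k)" using k by (simp add: rad_def)
      then have "min (rad N \<sigma> k) (rad N \<sigma> (Suc k)) = exp (real k / real N)"
        "max (rad N \<sigma> k) (rad N \<sigma> (Suc k)) = exp (real (Suc k) / real N)"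
        using True by (auto simp: rad_def)
      then show ?thesis using False True by (subst (1 2) x) (simp only: exp_less_cancel_iff mult_1 simp_thms)
    next
      case F: False
      then have s: "\<sigma> = -1" using \<sigma> by simp
      then have "rad N \<sigma> (Suc k) < rad N \<sigma> k" using k unfolding rad_def s exp_less_cancel_iff by linarith
      moreover have "rad N \<sigma> k = exp (- (real k / real N))" "rad N \<sigma> (Suc k) = exp (- (real (Suc k) / real N))"
        by (simp_all only: rad_def s mult_minus1)
      ultimately have "min (rad N \<sigma> k) (rad N \<sigma> (Suc k)) = exp (- (real (Suc k) / real N))"
        "max (rad N \<sigma> k) (rad N \<sigma> (Suc k)) = exp (- (real k / real N))"
        by (simp_all only: min_def max_def less_le_not_le simp_thms if_False if_True)
      then show ?thesis using False s by (subst (1 2) x) (simp only: exp_less_cancel_iff, auto)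
    qed
  qed
  moreover have "0 \<le> min (rad N \<sigma> k) (rad N \<sigma> (Suc k))" by (simp add: less_imp_le)
  ultimately show ?thesis
    unfolding cell_def using pcell_eq[OF _ sector_pt_bounds(1)[OF N(2)] sector_pt_bounds(2)[OF N(2)]] by auto
qed

lemma cell_lmeasurable:
  assumes "j < N" shows "cell N \<sigma> k j \<in> lmeasurable"
  unfolding cell_def using sector_pt_bounds[OF assms] by (intro pcell_lmeasurable) (auto simp: less_imp_le)

lemma measure_cell:
  assumes "j < N"
  shows "measure lebesgue (cell N \<sigma> k j) = pi / real N * \<bar>(rad N \<sigma> (Suc k))\<^sup>2 - (rad N \<sigma> k)\<^sup>2\<bar>"
proof -
  have "measure lebesgue (cell N \<sigma> k j) = pi / real N *
    ((max (rad N \<sigma> k) (rad N \<sigma> (Suc k)))\<^sup>2 - (min (rad N \<sigma> k) (rad N \<sigma> (Suc k)))\<^sup>2)"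
    unfolding cell_def using assms by (intro measure_pcell_sector) (auto simp: less_imp_le)
  also have "(max (rad N \<sigma> k) (rad N \<sigma> (Suc k)))\<^sup>2 - (min (rad N \<sigma> k) (rad N \<sigma> (Suc k)))\<^sup>2
    = \<bar>(rad N \<sigma> (Suc k))\<^sup>2 - (rad N \<sigma> k)\<^sup>2\<bar>"
  proof (cases "rad N \<sigma> k \<le> rad N \<sigma> (Suc k)")
    case True
    then have "(rad N \<sigma> k)\<^sup>2 \<le> (rad N \<sigma> (Suc k))\<^sup>2" by (intro power_mono) (auto simp: less_imp_le)
    then show ?thesis using True by simp
  next
    case False
    then have "(rad N \<sigma> (Suc k))\<^sup>2 \<le> (rad N \<sigma> k)\<^sup>2" by (intro power_mono) (auto simp: less_imp_le)
    then show ?thesis using False by simp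
  qed
  finally show ?thesis .
qed

lemma cell_disjoint:
  assumes "N > 0" "j < N" "j' < N" "\<sigma> = 1 \<or> \<sigma> = -1" "\<sigma>' = 1 \<or> \<sigma>' = -1"
    and x: "x \<in> cell N \<sigma> k j" "x \<in> cell N \<sigma>' k' j'"
  shows "\<sigma> = \<sigma>' \<and> k = k' \<and> j = j'"
proof -
  have a: "real k / real N < \<sigma> * ln (norm x)" "\<sigma> * ln (norm x) < real (Suc k) / real N"
    "sector_pt N j \<le> angle x" "angle x < sector_pt N (Suc j)"
    using x(1) assms by (auto simp: cell_iff)
  have b: "real k' / real N < \<sigma>' * ln (norm x)" "\<sigma>' * ln (norm x) < real (Suc k') / real N"
    "sector_pt N j' \<le> angle x" "angle x < sector_pt N (Suc j')"
    using x(2) assms by (auto simp: cell_iff)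
  have j: "j = j'" using a b sector_partition[OF assms(1) angle_bounds, of x] assms by blast
  have "0 \<le> real k / real N" "0 \<le> real k' / real N" by auto
  then have "0 < \<sigma> * ln (norm x)" "0 < \<sigma>' * ln (norm x)" using a b by linarith+
  then have s: "\<sigma> = \<sigma>'" using assms(4,5) by auto
  have "real k / real N < real (Suc k') / real N" "real k' / real N < real (Suc k) / real N"
    using a b unfolding s by linarith+
  then have "real k < real (Suc k')" "real k' < real (Suc k)" using assms(1) by (auto simp: divide_less_cancel)
  then show ?thesis using s j by auto
qed

lemma cell_cover:
  assumes N: "N > 0" and x: "x \<in> annulus (real M)"
    and ns: "\<And>k. norm x \<noteq> rad N 1 k" "\<And>k. norm x \<noteq> rad N (-1) k"
  obtains \<sigma> k j where "\<sigma> = 1 \<or> \<sigma> = -1" "k < M * N" "j < N" "x \<in> cell N \<sigma> k j"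
proof -
  have x0: "norm x > 0" using x unfolding annulus_def by (auto intro: less_trans[OF exp_gt_zero])
  have lb: "- real M < ln (norm x)" "ln (norm x) < real M"
  proof -
    have "exp (- real M) < norm x" "norm x < exp (real M)" using x unfolding annulus_def by auto
    then have "exp (- real M) < exp (ln (norm x))" "exp (ln (norm x)) < exp (real M)" using x0 by auto
    then show "- real M < ln (norm x)" "ln (norm x) < real M" by (simp_all only: exp_less_cancel_iff)
  qed
  have "ln (norm x) \<noteq> 0" using ns(1)[of 0] x0 by (auto simp: rad_def ln_eq_zero_iff)
  then obtain \<sigma> :: real where \<sigma>: "\<sigma> = 1 \<or> \<sigma> = -1" "\<sigma> * ln (norm x) > 0"
    by (cases "ln (norm x) > 0") (force, metis linorder_neqE_linordered_idom mult_minus1 neg_0_less_iff_less)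
  define s where "s = \<sigma> * ln (norm x) * real N"
  have s: "s > 0" "s < real (M * N)" unfolding s_def using \<sigma> lb N by auto
  have nn: "s \<noteq> real k" for k
  proof
    assume "s = real k"
    then have "\<sigma> * ln (norm x) = real k / real N" unfolding s_def using N by (simp add: field_simps)
    then have "ln (norm x) = \<sigma> * (real k / real N)" using \<sigma>(1) by auto
    then have "norm x = rad N \<sigma> k" unfolding rad_def using x0 by (metis exp_ln)
    then show False using ns \<sigma>(1) by auto
  qed
  define k where "k = nat \<lfloor>s\<rfloor>"
  have k: "real k \<le> s" "s < real k + 1" unfolding k_def using s by auto
  then have k': "real k < s" using nn[of k] by linarith
  have kM: "k < M * N" using k' s(2) by linarith
  obtain j where j: "j < N" "sector_pt N j \<le> angle x" "angle x < sector_pt N (Suc j)"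
    using sector_partition[OF N angle_bounds] by blast
  have "x \<in> cell N \<sigma> k j"
    unfolding cell_iff[OF N j(1) \<sigma>(1)] using k k' j x0 N unfolding s_def by (auto simp: field_simps)
  then show thesis using that \<sigma>(1) kM j(1) by blast
qed

definition cell_index :: "nat \<Rightarrow> nat \<Rightarrow> (real \<times> nat \<times> nat) set" where
  "cell_index N T = {1, -1} \<times> {..<T} \<times> {..<N}"

lemma cell_subset_annulus:
  assumes "N > 0" "j < N" "\<sigma> = 1 \<or> \<sigma> = -1" "k < M * N"
  shows "cell N \<sigma> k j \<subseteq> annulus (real M)"
proof
  fix x assume "x \<in> cell N \<sigma> k j"
  then have x: "x \<noteq> 0" "real k / real N < \<sigma> * ln (norm x)" "\<sigma> * ln (norm x) < real (Suc k) / real N"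
    using assms by (auto simp: cell_iff)
  have "real (Suc k) \<le> real (M * N)" using assms(4) by (simp only: of_nat_le_iff)
  then have "real (Suc k) / real N \<le> real M" using assms(1) by (simp add: field_simps)
  moreover have "0 \<le> real k / real N" by simp
  ultimately have "0 < \<sigma> * ln (norm x)" "\<sigma> * ln (norm x) < real M" using x by linarith+
  then have "- real M < ln (norm x)" "ln (norm x) < real M" using assms(3) by auto
  then have "exp (- real M) < exp (ln (norm x))" "exp (ln (norm x)) < exp (real M)" by simp_all
  then show "x \<in> annulus (real M)" unfolding annulus_def using x(1) by simp
qed

lemma sum_indicator_cells_le:
  assumes N: "N > 0" and I: "finite I" "I \<subseteq> {1, -1} \<times> UNIV \<times> {..<N}"
    and S: "\<And>\<sigma> k j. (\<sigma>, k, j) \<in> I \<Longrightarrow> cell N \<sigma> k j \<subseteq> S"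
  shows "(\<Sum>(\<sigma>, k, j)\<in>I. indicator (cell N \<sigma> k j) x) \<le> (indicator S x :: real)"
proof (cases "\<exists>q\<in>I. x \<in> (case q of (\<sigma>, k, j) \<Rightarrow> cell N \<sigma> k j)")
  case True
  then obtain \<sigma> k j where q: "(\<sigma>, k, j) \<in> I" "x \<in> cell N \<sigma> k j" by auto
  have "(\<Sum>(\<sigma>, k, j)\<in>I. indicator (cell N \<sigma> k j) x) = (\<Sum>p\<in>I. if p = (\<sigma>, k, j) then 1 else 0 :: real)"
  proof (intro sum.cong refl)
    fix p assume p: "p \<in> I"
    obtain \<sigma>' k' j' where pe: "p = (\<sigma>', k', j')" by (cases p)
    have *: "x \<in> cell N \<sigma>' k' j' \<Longrightarrow> \<sigma>' = \<sigma> \<and> k' = k \<and> j' = j"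
      using cell_disjoint[OF N, of j' j \<sigma>' \<sigma> x k' k] p q I pe by auto
    then show "(case p of (\<sigma>, k, j) \<Rightarrow> indicator (cell N \<sigma> k j) x) = (if p = (\<sigma>, k, j) then 1 else 0 :: real)"
    proof (cases "p = (\<sigma>, k, j)")
      case True
      then show ?thesis using q(2) by simp
    next
      case False
      then have "x \<notin> cell N \<sigma>' k' j'" using * unfolding pe by metis
      then show ?thesis using False unfolding pe by simp
    qed
  qed
  also have "\<dots> = 1" using q I by simp
  finally show ?thesis using S[OF q(1)] q(2) by auto
next
  case False
  then have "(\<Sum>(\<sigma>, k, j)\<in>I. indicator (cell N \<sigma> k j) x) = (0::real)"
    by (intro sum.neutral) (auto simp: indicator_def)
  then show ?thesis by simp
qed

text \<open>Within the annulus the cells, open in the radius, miss only points on the countably many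
  grid circles, which form a null set.\<close>

lemma AE_indicator_annulus_le:
  assumes N: "N > 0"
  shows "AE x in lebesgue. indicator (annulus (real M)) x
    \<le> (\<Sum>(\<sigma>, k, j)\<in>cell_index N (M * N). indicator (cell N \<sigma> k j) x :: real)"
proof -
  define E where "E = (\<Union>k. sphere (0::real^2) (rad N 1 k)) \<union> (\<Union>k. sphere 0 (rad N (-1) k))"
  have "negligible E" unfolding E_def
    by (intro negligible_Un negligible_countable_Union) (auto simp: negligible_sphere)
  then have "AE x in lebesgue. x \<notin> E"
    by (intro AE_not_in) (simp add: negligible_iff_null_sets)
  then show ?thesis
  proof eventually_elim
    case (elim x)
    show ?case
    proof (cases "x \<in> annulus (real M)")
      case True
      have "\<And>k. norm x \<noteq> rad N 1 k" "\<And>k. norm x \<noteq> rad N (-1) k" using elim unfolding E_def by auto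
      from cell_cover[OF N True this] obtain \<sigma> k j where
        q: "\<sigma> = 1 \<or> \<sigma> = -1" "k < M * N" "j < N" "x \<in> cell N \<sigma> k j" by metis
      have "(1::real) = (case (\<sigma>, k, j) of (\<sigma>, k, j) \<Rightarrow> indicator (cell N \<sigma> k j) x)" using q by simp
      also have "\<dots> \<le> (\<Sum>(\<sigma>, k, j)\<in>cell_index N (M * N). indicator (cell N \<sigma> k j) x)"
        using q by (intro member_le_sum) (auto simp: cell_index_def)
      finally show ?thesis using True by simp
    qed (auto intro: sum_nonneg)
  qed
qed

lemma dist_node_cell:
  assumes N: "N > 0" "j < N" and \<sigma>: "\<sigma> = 1 \<or> \<sigma> = -1" and x: "x \<in> cell N \<sigma> k j"
  shows "norm (x - node N \<sigma> k j) \<le> \<bar>rad N \<sigma> (Suc k) - rad N \<sigma> k\<bar> + rad N \<sigma> k * (2 * pi / real N)"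
proof -
  have "x \<in> pcell (min (rad N \<sigma> k) (rad N \<sigma> (Suc k))) (max (rad N \<sigma> k) (rad N \<sigma> (Suc k)))
     (sector_pt N j) (sector_pt N (Suc j))" using x unfolding cell_def .
  then obtain r \<theta> where r: "x = polar r \<theta>" "min (rad N \<sigma> k) (rad N \<sigma> (Suc k)) < r"
    "r < max (rad N \<sigma> k) (rad N \<sigma> (Suc k))" "sector_pt N j \<le> \<theta>" "\<theta> < sector_pt N (Suc j)"
    unfolding pcell_def by blast
  have "norm (x - node N \<sigma> k j) \<le> \<bar>r - rad N \<sigma> k\<bar> + \<bar>rad N \<sigma> k\<bar> * \<bar>\<theta> - sector_pt N j\<bar>"
    unfolding r node_def by (rule norm_polar_diff_le)
  also have "\<dots> \<le> \<bar>rad N \<sigma> (Suc k) - rad N \<sigma> k\<bar> + rad N \<sigma> k * (2 * pi / real N)"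
    unfolding rad_pos(2)
  proof (intro add_mono mult_left_mono)
    show "\<bar>\<theta> - sector_pt N j\<bar> \<le> 2 * pi / real N" using r sector_pt_Suc[OF N(1), of j] by linarith
  qed (use r in \<open>auto simp: less_imp_le\<close>)
  finally show ?thesis .
qed

lemma dist_nodes:
  assumes N: "N > 0"
  shows "norm (node N \<sigma> (Suc k) j - node N \<sigma> k j) \<le> \<bar>rad N \<sigma> (Suc k) - rad N \<sigma> k\<bar>"
    "norm (node N \<sigma> k (Suc j) - node N \<sigma> k j) \<le> rad N \<sigma> k * (2 * pi / real N)"
  unfolding node_def
  using norm_polar_diff_le[of "rad N \<sigma> (Suc k)" "sector_pt N j" "rad N \<sigma> k" "sector_pt N j"]
    norm_polar_diff_le[of "rad N \<sigma> k" "sector_pt N (Suc j)" "rad N \<sigma> k" "sector_pt N j"] N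
  by (auto simp: sector_pt_Suc)

text \<open>The trapezoidal rule overestimates the integral of the convex function exp over
  [0, h].\<close>

lemma exp_trapezoid:
  assumes "h \<ge> (0::real)"
  shows "2 * (exp h - 1) \<le> h * (exp h + 1)"
proof -
  define f where "f h = h * (exp h + 1) - 2 * (exp h - 1)" for h :: real
  have "f 0 \<le> f h"
  proof (rule DERIV_nonneg_imp_nondecreasing[OF assms])
    fix x :: real assume "0 \<le> x"
    have "(f has_real_derivative (exp x + 1 + x * exp x - 2 * exp x)) (at x)"
      unfolding f_def by (auto intro!: derivative_eq_intros)
    moreover have "exp x + 1 + x * exp x - 2 * exp x \<ge> 0"
    proof -
      have "1 - x \<le> exp (- x)" using exp_ge_add_one_self[of "- x"] by simp
      then have "(1 - x) * exp x \<le> exp (- x) * exp x" by (intro mult_right_mono) auto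
      also have "\<dots> = 1" by (simp flip: exp_add)
      finally show ?thesis by (simp add: algebra_simps)
    qed
    ultimately show "\<exists>y. (f has_real_derivative y) (at x) \<and> 0 \<le> y" by blast
  qed
  then show ?thesis unfolding f_def by simp
qed

lemma rad_Suc: "N > 0 \<Longrightarrow> rad N \<sigma> (Suc k) = rad N \<sigma> k * exp (\<sigma> / real N)"
  unfolding rad_def by (simp add: exp_add[symmetric] add_divide_distrib distrib_left)

text \<open>\<open>key\<close> says that the logarithmic mean of the two radii is at most their
  arithmetic mean, since their logarithms differ by 1/N. The resulting 1 / (2\<pi>) is the correct
  constant in the limit of a fine mesh; little could be lost here, as it is multiplied by
  7/2.\<close>

lemma radial_step_le_measure_cell:
  assumes N: "N > 0" "j < N" and \<sigma>: "\<sigma> = 1 \<or> \<sigma> = -1"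
  shows "(rad N \<sigma> (Suc k) - rad N \<sigma> k)\<^sup>2 \<le> measure lebesgue (cell N \<sigma> k j) / (2 * pi)"
proof -
  define a b where "a = rad N \<sigma> k" and "b = rad N \<sigma> (Suc k)"
  have ab: "a > 0" "b > 0" unfolding a_def b_def by simp_all
  have key: "2 * \<bar>b - a\<bar> * real N \<le> a + b"
  proof (cases "\<sigma> = 1")
    case True
    then have b: "b = a * exp (1 / real N)" unfolding a_def b_def using rad_Suc[OF N(1)] by simp
    have "2 * (exp (1 / real N) - 1) \<le> 1 / real N * (exp (1 / real N) + 1)" by (rule exp_trapezoid) simp
    then have "2 * (exp (1 / real N) - 1) * real N \<le> exp (1 / real N) + 1" using N by (simp add: field_simps)
    then have "a * (2 * (exp (1 / real N) - 1) * real N) \<le> a * (exp (1 / real N) + 1)"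
      using ab by (intro mult_left_mono) auto
    moreover have "b - a \<ge> 0" unfolding b using ab by simp
    ultimately show ?thesis unfolding b by (simp add: algebra_simps)
  next
    case False
    then have "b = a * exp (- (1 / real N))" unfolding a_def b_def using rad_Suc[OF N(1)] \<sigma> by auto
    then have a: "a = b * exp (1 / real N)" by (simp add: mult.assoc flip: exp_add)
    have "2 * (exp (1 / real N) - 1) \<le> 1 / real N * (exp (1 / real N) + 1)" by (rule exp_trapezoid) simp
    then have "2 * (exp (1 / real N) - 1) * real N \<le> exp (1 / real N) + 1" using N by (simp add: field_simps)
    then have "b * (2 * (exp (1 / real N) - 1) * real N) \<le> b * (exp (1 / real N) + 1)"
      using ab by (intro mult_left_mono) auto
    moreover have "a - b \<ge> 0" unfolding a using ab by simp
    ultimately show ?thesis unfolding a by (simp add: algebra_simps)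
  qed
  have "(b - a)\<^sup>2 * (2 * real N) = \<bar>b - a\<bar> * (2 * \<bar>b - a\<bar> * real N)"
    by (simp add: power2_eq_square flip: abs_mult)
  also have "\<dots> \<le> \<bar>b - a\<bar> * (a + b)" using key by (intro mult_left_mono) auto
  also have "\<dots> = \<bar>b\<^sup>2 - a\<^sup>2\<bar>"
  proof -
    have "b\<^sup>2 - a\<^sup>2 = (b - a) * (a + b)" by (simp add: power2_eq_square algebra_simps)
    then show ?thesis using ab by (simp add: abs_mult)
  qed
  finally have "(b - a)\<^sup>2 \<le> \<bar>b\<^sup>2 - a\<^sup>2\<bar> / (2 * real N)" using N by (simp add: field_simps)
  also have "\<dots> = measure lebesgue (cell N \<sigma> k j) / (2 * pi)"
    unfolding measure_cell[OF N(2)] a_def[symmetric] b_def[symmetric] by (simp add: field_simps)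
  finally show ?thesis unfolding a_def b_def .
qed

lemma exp_bounds_N:
  assumes "N > 0"
  shows "exp (2 / real N) \<le> 9"
proof -
  have "exp (2 / real N) \<le> exp (2::real)" using assms by (simp add: field_simps)
  also have "exp (2::real) = (exp 1)\<^sup>2" by (simp add: power2_eq_square flip: exp_add)
  also have "\<dots> \<le> 3\<^sup>2" by (intro power_mono exp_le) auto
  finally show ?thesis by simp
qed

text \<open>A crude constant suffices, because the angular sum enters the final estimate with the
  small factor 800000 * \<open>thr\<close>. The 9 bounds exp h for h = 2/N \<le> 2; it is needed
  where the radii decrease.\<close>

lemma angular_step_le_measure_cell:
  assumes N: "N > 0" "j < N" and \<sigma>: "\<sigma> = 1 \<or> \<sigma> = -1"
  shows "(rad N \<sigma> k * (2 * pi / real N))\<^sup>2 \<le> 18 * pi * measure lebesgue (cell N \<sigma> k j)"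
proof -
  define a where "a = rad N \<sigma> k"
  define h where "h = 2 / real N"
  have a: "a > 0" unfolding a_def by simp
  have h: "h > 0" unfolding h_def using N by simp
  have key: "h / 9 \<le> \<bar>exp (\<sigma> * h) - 1\<bar>"
  proof (cases "\<sigma> = 1")
    case True
    have "1 + h \<le> exp h" by simp
    then have "h / 9 \<le> exp h - 1" using h by linarith
    then show ?thesis unfolding True mult_1 by linarith
  next
    case False
    then have s: "\<sigma> = -1" using \<sigma> by simp
    have "h * exp (- h) \<le> (exp h - 1) * exp (- h)"
    proof (rule mult_right_mono)
      show "h \<le> exp h - 1" using exp_ge_add_one_self[of h] by linarith
    qed simp
    also have "\<dots> = 1 - exp (- h)" by (simp add: left_diff_distrib flip: exp_add)
    finally have 1: "h * exp (- h) \<le> 1 - exp (- h)" .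
    have "exp h \<le> 9" unfolding h_def by (rule exp_bounds_N[OF N(1)])
    then have "1 / 9 \<le> exp (- h)" by (simp add: exp_minus field_simps)
    then have "h * (1 / 9) \<le> h * exp (- h)" using h by (intro mult_left_mono) auto
    then have "h / 9 \<le> 1 - exp (- h)" using 1 by linarith
    then show ?thesis unfolding s mult_minus1 by linarith
  qed
  have "(rad N \<sigma> (Suc k))\<^sup>2 = a\<^sup>2 * exp (\<sigma> * h)"
  proof -
    have "exp (\<sigma> / real N) * exp (\<sigma> / real N) = exp (\<sigma> * h)" unfolding h_def by (simp flip: exp_add)
    then show ?thesis unfolding rad_Suc[OF N(1)] a_def by (simp add: power2_eq_square mult_ac)
  qed
  then have "(rad N \<sigma> (Suc k))\<^sup>2 - a\<^sup>2 = a\<^sup>2 * (exp (\<sigma> * h) - 1)" by (simp add: algebra_simps)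
  then have m: "measure lebesgue (cell N \<sigma> k j) = pi / real N * (a\<^sup>2 * \<bar>exp (\<sigma> * h) - 1\<bar>)"
    unfolding measure_cell[OF N(2)] a_def by (simp add: abs_mult)
  have "(a * (2 * pi / real N))\<^sup>2 = 18 * pi * (pi / real N * (a\<^sup>2 * (h / 9)))"
    unfolding h_def using N by (simp add: power2_eq_square field_simps)
  also have "\<dots> \<le> 18 * pi * measure lebesgue (cell N \<sigma> k j)"
    unfolding m using key by (intro mult_left_mono) auto
  finally show ?thesis unfolding a_def .
qed

section \<open>Continuously differentiable functions: from the grid form to integrals\<close>

definition has_gradient :: "(real^2 \<Rightarrow> complex) \<Rightarrow> (real^2 \<Rightarrow> complex \<times> complex) \<Rightarrow> bool" where
  "has_gradient u D \<longleftrightarrow> continuous_on UNIV D \<and>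
     (\<forall>x. (u has_derivative (\<lambda>h. (h$1) *\<^sub>R fst (D x) + (h$2) *\<^sub>R snd (D x))) (at x))"

lemma has_gradient_continuous: "has_gradient u D \<Longrightarrow> continuous_on S u"
  unfolding has_gradient_def
  by (meson continuous_at_imp_continuous_on has_derivative_continuous)

text \<open>The product type carries the Euclidean norm, so by Cauchy-Schwarz
  \<open>norm (D z)\<close> bounds the operator norm of the derivative, and the mean value
  inequality applies along the segment.\<close>

lemma has_gradient_norm_diff_le:
  assumes u: "has_gradient u D" and K: "\<And>z. z \<in> closed_segment a b \<Longrightarrow> norm (D z) \<le> K"
  shows "cmod (u b - u a) \<le> K * norm (b - a)"
proof (rule differentiable_bound[OF convex_closed_segment])
  fix x assume x: "x \<in> closed_segment a b"
  show "(u has_derivative (\<lambda>h. (h$1) *\<^sub>R fst (D x) + (h$2) *\<^sub>R snd (D x))) (at x within closed_segment a b)"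
    using u unfolding has_gradient_def by (blast intro: has_derivative_at_withinI)
  show "onorm (\<lambda>h :: real^2. (h$1) *\<^sub>R fst (D x) + (h$2) *\<^sub>R snd (D x)) \<le> K"
  proof (rule onorm_le)
    fix h :: "real^2"
    have "norm ((h$1) *\<^sub>R fst (D x) + (h$2) *\<^sub>R snd (D x)) \<le> \<bar>h$1\<bar> * cmod (fst (D x)) + \<bar>h$2\<bar> * cmod (snd (D x))"
      using norm_triangle_ineq[of "(h$1) *\<^sub>R fst (D x)" "(h$2) *\<^sub>R snd (D x)"] by simp
    also have "\<dots> \<le> sqrt ((h$1)\<^sup>2 + (h$2)\<^sup>2) * sqrt ((cmod (fst (D x)))\<^sup>2 + (cmod (snd (D x)))\<^sup>2)"
    proof -
      have "(\<bar>h$1\<bar> * cmod (fst (D x)) + \<bar>h$2\<bar> * cmod (snd (D x)))\<^sup>2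
        \<le> (\<bar>h$1\<bar>\<^sup>2 + \<bar>h$2\<bar>\<^sup>2) * ((cmod (fst (D x)))\<^sup>2 + (cmod (snd (D x)))\<^sup>2)"
      proof -
        have "0 \<le> (\<bar>h$1\<bar> * cmod (snd (D x)) - \<bar>h$2\<bar> * cmod (fst (D x)))\<^sup>2" by simp
        then show ?thesis by (simp only: power2_eq_square) (simp add: algebra_simps)
      qed
      then show ?thesis by (subst real_sqrt_mult[symmetric], intro real_le_rsqrt) simp
    qed
    also have "\<dots> = norm (D x) * norm h" by (cases "D x") (simp add: norm_real2 norm_Pair)
    also have "\<dots> \<le> K * norm h" using K[OF x] by (intro mult_right_mono) auto
    finally show "norm ((h$1) *\<^sub>R fst (D x) + (h$2) *\<^sub>R snd (D x)) \<le> K * norm h" .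
  qed
qed auto

lemma has_gradient_sum:
  assumes "\<And>i. i < n \<Longrightarrow> has_gradient (w i) (D i)"
  shows "has_gradient (\<lambda>x. \<Sum>i<(n::nat). c i * w i x)
    (\<lambda>x. (\<Sum>i<n. c i * fst (D i x), \<Sum>i<n. c i * snd (D i x)))"
  unfolding has_gradient_def
proof (intro conjI allI)
  have "continuous_on UNIV (D i)" if "i < n" for i using assms[OF that] unfolding has_gradient_def by simp
  then show "continuous_on UNIV (\<lambda>x. (\<Sum>i<n. c i * fst (D i x), \<Sum>i<n. c i * snd (D i x)))"
    by (intro continuous_on_Pair continuous_on_sum continuous_on_mult continuous_on_const
        continuous_on_fst continuous_on_snd) auto
  fix x
  have "((\<lambda>x. \<Sum>i<n. c i * w i x) has_derivative
     (\<lambda>h. \<Sum>i<n. c i * ((h$1) *\<^sub>R fst (D i x) + (h$2) *\<^sub>R snd (D i x)))) (at x)"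
    using assms unfolding has_gradient_def by (intro has_derivative_sum has_derivative_mult_right) auto
  moreover have "(\<lambda>h::real^2. \<Sum>i<n. c i * ((h$1) *\<^sub>R fst (D i x) + (h$2) *\<^sub>R snd (D i x)))
    = (\<lambda>h. (h$1) *\<^sub>R (\<Sum>i<n. c i * fst (D i x)) + (h$2) *\<^sub>R (\<Sum>i<n. c i * snd (D i x)))"
    by (simp add: fun_eq_iff scaleR_sum_right distrib_left sum.distrib)
  ultimately show "((\<lambda>x. \<Sum>i<n. c i * w i x) has_derivative
     (\<lambda>h. (h$1) *\<^sub>R fst (\<Sum>i<n. c i * fst (D i x), \<Sum>i<n. c i * snd (D i x))
        + (h$2) *\<^sub>R snd (\<Sum>i<n. c i * fst (D i x), \<Sum>i<n. c i * snd (D i x)))) (at x)" by simp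
qed

lemma integrable_indicator_lmeasurable: "S \<in> lmeasurable \<Longrightarrow> integrable lebesgue (indicat_real S)"
  by (intro integrable_real_indicator) (auto simp: fmeasurable_def)

lemma integrable_indicator_continuous:
  fixes f :: "real^2 \<Rightarrow> real"
  assumes S: "S \<in> sets lebesgue" "bounded S" and f: "continuous_on UNIV f"
  shows "integrable lebesgue (\<lambda>x. indicator S x * f x)"
proof -
  obtain R where R: "S \<subseteq> cball 0 R" using S(2) unfolding bounded_iff by (auto simp: subset_iff)
  have "continuous_on (cball 0 R) f" using f by (rule continuous_on_subset) simp
  then have "compact (f ` cball 0 R)" by (rule compact_continuous_image) simp
  then have "bounded (f ` cball 0 R)" by (rule compact_imp_bounded)
  then obtain K where "\<forall>y\<in>f ` cball 0 R. norm y \<le> K" unfolding bounded_iff by blast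
  then have K: "\<bar>f x\<bar> \<le> K" if "x \<in> cball 0 R" for x using that by (metis imageI real_norm_def)
  have lm: "S \<in> lmeasurable" using S by (simp add: bounded_set_imp_lmeasurable)
  have fm: "f \<in> borel_measurable lebesgue"
    using borel_measurable_continuous_onI[OF f] by (intro measurable_completion) simp
  show ?thesis
  proof (rule Bochner_Integration.integrable_bound)
    show "integrable lebesgue (\<lambda>x. K * indicator S x :: real)"
      using integrable_indicator_lmeasurable[OF lm] by simp
    show "(\<lambda>x. indicator S x * f x) \<in> borel_measurable lebesgue" using fm S by measurable
    show "AE x in lebesgue. norm (indicator S x * f x) \<le> norm (K * indicator S x)"
    proof (rule AE_I2)
      fix x show "norm (indicator S x * f x) \<le> norm (K * indicator S x)"
        using R K[of x] by (cases "x \<in> S") auto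
    qed
  qed
qed

lemma integrable_indicator_locally_integrable:
  fixes V :: "real^2 \<Rightarrow> real"
  assumes V: "locally_integrable V" and S: "S \<in> sets lebesgue" "bounded S"
  shows "integrable lebesgue (\<lambda>x. indicator S x * V x)"
proof -
  obtain R where R: "S \<subseteq> cball 0 R" using S(2) unfolding bounded_iff by (auto simp: subset_iff)
  have "integrable (lebesgue_on (cball 0 R)) V" using V unfolding locally_integrable_def by simp
  then have "integrable lebesgue (\<lambda>x. indicator (cball 0 R) x *\<^sub>R V x)"
    by (simp add: integrable_restrict_space)
  then have "integrable lebesgue (\<lambda>x. indicator S x *\<^sub>R (indicator (cball 0 R) x *\<^sub>R V x))"
    by (rule integrable_mult_indicator[OF S(1)])
  moreover have "(\<lambda>x. indicator S x *\<^sub>R (indicator (cball 0 R) x *\<^sub>R V x)) = (\<lambda>x. indicator S x * V x)"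
    using R by (auto simp: fun_eq_iff indicator_def)
  ultimately show ?thesis by simp
qed

lemma measure_cell_pos:
  assumes N: "N > 0" "j < N" and \<sigma>: "\<sigma> = 1 \<or> \<sigma> = -1"
  shows "measure lebesgue (cell N \<sigma> k j) > 0"
proof -
  have "0 < (rad N \<sigma> k * (2 * pi / real N))\<^sup>2"
    using N rad_pos(1)[of N \<sigma> k] by (intro zero_less_power mult_pos_pos divide_pos_pos) auto
  also have "\<dots> \<le> 18 * pi * measure lebesgue (cell N \<sigma> k j)" by (rule angular_step_le_measure_cell[OF assms])
  finally show ?thesis using pi_gt_zero by (simp add: zero_less_mult_iff)
qed

lemma bounded_cell: "bounded (cell N \<sigma> k j)"
proof (rule boundedI)
  fix x assume "x \<in> cell N \<sigma> k j"
  then obtain r \<theta> where r: "x = polar r \<theta>" "min (rad N \<sigma> k) (rad N \<sigma> (Suc k)) < r"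
    "r < max (rad N \<sigma> k) (rad N \<sigma> (Suc k))" unfolding cell_def pcell_def by blast
  have "0 < min (rad N \<sigma> k) (rad N \<sigma> (Suc k))" by simp
  then show "norm x \<le> max (rad N \<sigma> k) (rad N \<sigma> (Suc k))" using r by (simp del: min_less_iff_conj)
qed

text \<open>The bound t \<le> f y * d holds for every y in the cell, hence its square may be
  averaged over the cell, and d^2 is at most C times the area. This turns an increment between two
  nodes into a piece of the Dirichlet integral.\<close>

lemma squared_increment_le_cell_integral:
  fixes f :: "real^2 \<Rightarrow> real"
  assumes N: "N > 0" "j < N" and \<sigma>: "\<sigma> = 1 \<or> \<sigma> = -1" and f: "continuous_on UNIV f"
    and d: "d\<^sup>2 \<le> C * measure lebesgue (cell N \<sigma> k j)" "t \<ge> 0"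
    and t: "\<And>y. y \<in> cell N \<sigma> k j \<Longrightarrow> t \<le> f y * d"
  shows "t\<^sup>2 \<le> C * (LINT x|lebesgue. indicator (cell N \<sigma> k j) x * (f x)\<^sup>2)"
proof -
  let ?c = "cell N \<sigma> k j"
  let ?m = "measure lebesgue ?c"
  have lm: "?c \<in> lmeasurable" by (rule cell_lmeasurable[OF N(2)])
  have int: "integrable lebesgue (\<lambda>x. indicator ?c x * (f x)\<^sup>2)"
    using lm bounded_cell[of N \<sigma> k j] f by (intro integrable_indicator_continuous continuous_intros) auto
  have I0: "0 \<le> (LINT x|lebesgue. indicator ?c x * (f x)\<^sup>2)" by (intro integral_nonneg_AE) auto
  have "t\<^sup>2 * ?m = (LINT x|lebesgue. t\<^sup>2 * indicator ?c x)" using lm by (simp add: fmeasurable_def)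
  also have "\<dots> \<le> (LINT x|lebesgue. d\<^sup>2 * (indicator ?c x * (f x)\<^sup>2))"
  proof (rule integral_mono)
    show "integrable lebesgue (\<lambda>x. t\<^sup>2 * indicator ?c x)" using integrable_indicator_lmeasurable[OF lm] by simp
    show "integrable lebesgue (\<lambda>x. d\<^sup>2 * (indicator ?c x * (f x)\<^sup>2))" using int by simp
    fix x show "t\<^sup>2 * indicator ?c x \<le> d\<^sup>2 * (indicator ?c x * (f x)\<^sup>2)"
    proof (cases "x \<in> ?c")
      case True
      have "t\<^sup>2 \<le> (f x * d)\<^sup>2" using t[OF True] d(2) by (rule power_mono)
      then show ?thesis using True by (simp add: power_mult_distrib mult.commute)
    qed simp
  qed
  also have "\<dots> = d\<^sup>2 * (LINT x|lebesgue. indicator ?c x * (f x)\<^sup>2)" by simp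
  also have "\<dots> \<le> (C * ?m) * (LINT x|lebesgue. indicator ?c x * (f x)\<^sup>2)"
    using d I0 by (intro mult_right_mono)
  finally have "t\<^sup>2 * ?m \<le> (C * (LINT x|lebesgue. indicator ?c x * (f x)\<^sup>2)) * ?m" by (simp add: mult_ac)
  then show ?thesis using measure_cell_pos[OF N \<sigma>] by simp
qed

text \<open>The factor 51/50 is used twice, once for u and once for its gradient, and fits into the
  room left by the Hardy constant; the large factor 51 falls on the error terms.\<close>

lemma square_add_le: "(a + \<eta>)\<^sup>2 \<le> 51/50 * a\<^sup>2 + 51 * (\<eta>::real)\<^sup>2"
proof -
  have "0 \<le> (a - 50 * \<eta>)\<^sup>2" by simp
  then show ?thesis by (simp add: power2_eq_square algebra_simps)
qed

lemma sum_cell_index: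
  "(\<Sum>(\<sigma>, k, j)\<in>cell_index N T. F \<sigma> k j) = (\<Sum>\<sigma>\<in>{1,-1}. \<Sum>k<T. \<Sum>j<N. F \<sigma> k j :: real)"
  unfolding cell_index_def by (simp add: sum.cartesian_product')

lemma annulus_lmeasurable: "annulus M \<in> sets lebesgue" "bounded (annulus M)"
proof -
  have "annulus M \<in> sets borel" unfolding annulus_def by measurable
  then show "annulus M \<in> sets lebesgue" by simp
  show "bounded (annulus M)" unfolding annulus_def by (intro boundedI[of _ "exp M"]) auto
qed

text \<open>On the left, u is replaced by its value at the node of each cell. On the right, each
  increment is bounded by the gradient along a chord between nodes. Such a chord leaves its cell, so
  \<open>osc_D\<close> compares D in the cell with D at every point near the node.\<close>

lemma grid_to_integral_bound:
  fixes V :: "real^2 \<Rightarrow> real"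
  assumes N: "N > 0" and u: "has_gradient u D" and V: "locally_integrable V" "AE x in lebesgue. 0 \<le> V x"
    and osc_u: "\<And>\<sigma> k j y. \<lbrakk>(\<sigma>, k, j) \<in> cell_index N (M*N); y \<in> cell N \<sigma> k j\<rbrakk>
      \<Longrightarrow> cmod (u y) \<le> cmod (u (node N \<sigma> k j)) + \<eta>"
    and osc_D: "\<And>\<sigma> k j y z. \<lbrakk>(\<sigma>, k, j) \<in> cell_index N (M*N); y \<in> cell N \<sigma> k j;
      norm (z - node N \<sigma> k j) \<le> \<bar>rad N \<sigma> (Suc k) - rad N \<sigma> k\<bar> + rad N \<sigma> k * (2 * pi / real N)\<rbrakk>
      \<Longrightarrow> norm (D z) \<le> norm (D y) + \<eta>"
    and ab: "a \<ge> 0" "b \<ge> 0"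
    and grid: "(\<Sum>\<sigma>\<in>{1,-1}. \<Sum>k<M*N. \<Sum>j<N. (LINT x|lebesgue. indicator (cell N \<sigma> k j) x * V x) * (cmod (u (node N \<sigma> k j)))\<^sup>2)
      \<le> (\<Sum>\<sigma>\<in>{1,-1}. a * (\<Sum>k<M*N. \<Sum>j<N. (cmod (u (node N \<sigma> (Suc k) j) - u (node N \<sigma> k j)))\<^sup>2)
          + b * (\<Sum>k<M*N. \<Sum>j<N-1. (cmod (u (node N \<sigma> k (Suc j)) - u (node N \<sigma> k j)))\<^sup>2))"
  shows "(LINT x|lebesgue. indicator (annulus (real M)) x * V x * (cmod (u x))\<^sup>2)
    \<le> 51/50 * (a / (2 * pi) + 18 * pi * b) * (LINT x|lebesgue. indicator (annulus (real M)) x * (norm (D x) + \<eta>)\<^sup>2)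
      + 51 * \<eta>\<^sup>2 * (LINT x|lebesgue. indicator (annulus (real M)) x * V x)"
proof -
  let ?I = "cell_index N (M*N)"
  let ?A = "annulus (real M)"
  have cu: "continuous_on UNIV u" by (rule has_gradient_continuous[OF u])
  have cD: "continuous_on UNIV D" using u unfolding has_gradient_def by simp
  define f where "f x = norm (D x) + \<eta>" for x
  have cf: "continuous_on UNIV f" unfolding f_def by (intro continuous_intros cD)
  have Ix: "\<sigma> = 1 \<or> \<sigma> = -1" "k < M*N" "j < N" if "(\<sigma>, k, j) \<in> ?I" for \<sigma> k j
    using that unfolding cell_index_def by auto
  have finI: "finite ?I" unfolding cell_index_def by simp
  define \<mu> where "\<mu> = (\<lambda>(\<sigma>, k, j). LINT x|lebesgue. indicator (cell N \<sigma> k j) x * V x)"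
  define E where "E = (\<lambda>(\<sigma>, k, j). LINT x|lebesgue. indicator (cell N \<sigma> k j) x * (f x)\<^sup>2)"
  define W where "W = (\<lambda>(\<sigma>, k, j). (cmod (u (node N \<sigma> k j)))\<^sup>2)"
  have csets: "cell N \<sigma> k j \<in> sets lebesgue" "bounded (cell N \<sigma> k j)" if "j < N" for \<sigma> k j
    using cell_lmeasurable[OF that] bounded_cell[of N \<sigma> k j] by auto
  have intV: "integrable lebesgue (\<lambda>x. indicator (cell N \<sigma> k j) x * V x)" if "j < N" for \<sigma> k j
    by (rule integrable_indicator_locally_integrable[OF V(1) csets[OF that]])
  have intE: "integrable lebesgue (\<lambda>x. indicator (cell N \<sigma> k j) x * (f x)\<^sup>2)" if "j < N" for \<sigma> k j
    using csets[OF that] cf by (intro integrable_indicator_continuous continuous_intros)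
  have intEA: "integrable lebesgue (\<lambda>x. indicator ?A x * (f x)\<^sup>2)"
    using annulus_lmeasurable cf by (intro integrable_indicator_continuous continuous_intros)
  have intVA: "integrable lebesgue (\<lambda>x. indicator ?A x * V x)"
    by (rule integrable_indicator_locally_integrable[OF V(1) annulus_lmeasurable])
  have E0: "E q \<ge> 0" for q unfolding E_def by (auto split: prod.split intro!: integral_nonneg_AE)
  have \<mu>0: "\<mu> q \<ge> 0" for q
    unfolding \<mu>_def using V(2) by (auto split: prod.split intro!: integral_nonneg_AE elim!: eventually_mono)
  have ind: "(\<Sum>(\<sigma>, k, j)\<in>?I. indicator (cell N \<sigma> k j) x) \<le> (indicator ?A x :: real)" for x
  proof (rule sum_indicator_cells_le[OF N finI])
    show "?I \<subseteq> {1, -1} \<times> UNIV \<times> {..<N}" unfolding cell_index_def by blast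
    fix \<sigma> k j assume "(\<sigma>, k, j) \<in> ?I"
    then show "cell N \<sigma> k j \<subseteq> ?A" using cell_subset_annulus[OF N] Ix by metis
  qed
  have sumE: "(\<Sum>q\<in>?I. E q) \<le> (LINT x|lebesgue. indicator ?A x * (f x)\<^sup>2)"
  proof -
    have "(\<Sum>q\<in>?I. E q) = (LINT x|lebesgue. (\<Sum>q\<in>?I. (case q of (\<sigma>, k, j) \<Rightarrow> indicator (cell N \<sigma> k j) x * (f x)\<^sup>2)))"
      unfolding E_def by (subst Bochner_Integration.integral_sum) (auto intro!: sum.cong intE dest: Ix)
    also have "\<dots> \<le> (LINT x|lebesgue. indicator ?A x * (f x)\<^sup>2)"
    proof (rule integral_mono)
      show "integrable lebesgue (\<lambda>x. \<Sum>q\<in>?I. (case q of (\<sigma>, k, j) \<Rightarrow> indicator (cell N \<sigma> k j) x * (f x)\<^sup>2))"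
        by (intro Bochner_Integration.integrable_sum) (auto intro!: intE dest: Ix)
      fix x
      have "(\<Sum>q\<in>?I. (case q of (\<sigma>, k, j) \<Rightarrow> indicator (cell N \<sigma> k j) x * (f x)\<^sup>2))
        = (\<Sum>(\<sigma>, k, j)\<in>?I. indicator (cell N \<sigma> k j) x) * (f x)\<^sup>2"
        unfolding sum_distrib_right by (intro sum.cong) auto
      also have "\<dots> \<le> indicator ?A x * (f x)\<^sup>2"
        by (rule mult_right_mono[OF ind]) simp
      finally show "(\<Sum>q\<in>?I. (case q of (\<sigma>, k, j) \<Rightarrow> indicator (cell N \<sigma> k j) x * (f x)\<^sup>2)) \<le> indicator ?A x * (f x)\<^sup>2" .
    qed (rule intEA)
    finally show ?thesis .
  qed
  have sum\<mu>: "(\<Sum>q\<in>?I. \<mu> q) \<le> (LINT x|lebesgue. indicator ?A x * V x)"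
  proof -
    have "(\<Sum>q\<in>?I. \<mu> q) = (LINT x|lebesgue. (\<Sum>q\<in>?I. (case q of (\<sigma>, k, j) \<Rightarrow> indicator (cell N \<sigma> k j) x * V x)))"
      unfolding \<mu>_def by (subst Bochner_Integration.integral_sum) (auto intro!: sum.cong intV dest: Ix)
    also have "\<dots> \<le> (LINT x|lebesgue. indicator ?A x * V x)"
    proof (rule integral_mono_AE)
      show "integrable lebesgue (\<lambda>x. \<Sum>q\<in>?I. (case q of (\<sigma>, k, j) \<Rightarrow> indicator (cell N \<sigma> k j) x * V x))"
        by (intro Bochner_Integration.integrable_sum) (auto intro!: intV dest: Ix)
      show "AE x in lebesgue. (\<Sum>q\<in>?I. (case q of (\<sigma>, k, j) \<Rightarrow> indicator (cell N \<sigma> k j) x * V x)) \<le> indicator ?A x * V x"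
        using V(2)
      proof eventually_elim
        case (elim x)
        have "(\<Sum>q\<in>?I. (case q of (\<sigma>, k, j) \<Rightarrow> indicator (cell N \<sigma> k j) x * V x))
          = (\<Sum>(\<sigma>, k, j)\<in>?I. indicator (cell N \<sigma> k j) x) * V x"
          unfolding sum_distrib_right by (intro sum.cong) auto
        also have "\<dots> \<le> indicator ?A x * V x"
          by (rule mult_right_mono[OF ind elim])
        finally show ?case .
      qed
    qed (rule intVA)
    finally show ?thesis .
  qed
  have T: "(cmod (u (node N \<sigma> (Suc k) j) - u (node N \<sigma> k j)))\<^sup>2 \<le> 1 / (2 * pi) * E (\<sigma>, k, j)"
    if q: "(\<sigma>, k, j) \<in> ?I" for \<sigma> k j
    unfolding E_def prod.case
  proof (rule squared_increment_le_cell_integral[OF N Ix(3)[OF q] Ix(1)[OF q] cf])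
    show "\<bar>rad N \<sigma> (Suc k) - rad N \<sigma> k\<bar>\<^sup>2 \<le> 1 / (2 * pi) * measure lebesgue (cell N \<sigma> k j)"
      using radial_step_le_measure_cell[OF N Ix(3)[OF q] Ix(1)[OF q]] by simp
    fix y assume y: "y \<in> cell N \<sigma> k j"
    have "cmod (u (node N \<sigma> (Suc k) j) - u (node N \<sigma> k j)) \<le> f y * norm (node N \<sigma> (Suc k) j - node N \<sigma> k j)"
    proof (rule has_gradient_norm_diff_le[OF u])
      fix z assume "z \<in> closed_segment (node N \<sigma> k j) (node N \<sigma> (Suc k) j)"
      then have "norm (z - node N \<sigma> k j) \<le> norm (node N \<sigma> (Suc k) j - node N \<sigma> k j)"
        by (rule segment_bound1)
      also have "\<dots> \<le> \<bar>rad N \<sigma> (Suc k) - rad N \<sigma> k\<bar>" by (rule dist_nodes[OF N])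
      finally show "norm (D z) \<le> f y" unfolding f_def
        using osc_D[OF q y, of z] rad_pos(1)[of N \<sigma> k] by (simp add: add_increasing2 less_imp_le)
    qed
    also have "\<dots> \<le> f y * \<bar>rad N \<sigma> (Suc k) - rad N \<sigma> k\<bar>"
    proof (rule mult_left_mono[OF dist_nodes(1)[OF N]])
      have "norm (D (node N \<sigma> k j)) \<le> f y" unfolding f_def
        using osc_D[OF q y, of "node N \<sigma> k j"] rad_pos(1)[of N \<sigma> k] by (simp add: add_increasing2 less_imp_le)
      then show "0 \<le> f y" using norm_ge_zero order_trans by blast
    qed
    finally show "cmod (u (node N \<sigma> (Suc k) j) - u (node N \<sigma> k j)) \<le> f y * \<bar>rad N \<sigma> (Suc k) - rad N \<sigma> k\<bar>" .
  qed simp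
  have \<Theta>: "(cmod (u (node N \<sigma> k (Suc j)) - u (node N \<sigma> k j)))\<^sup>2 \<le> 18 * pi * E (\<sigma>, k, j)"
    if q: "(\<sigma>, k, j) \<in> ?I" for \<sigma> k j
    unfolding E_def prod.case
  proof (rule squared_increment_le_cell_integral[OF N Ix(3)[OF q] Ix(1)[OF q] cf])
    let ?d = "rad N \<sigma> k * (2 * pi / real N)"
    show "?d\<^sup>2 \<le> 18 * pi * measure lebesgue (cell N \<sigma> k j)"
      by (rule angular_step_le_measure_cell[OF N Ix(3)[OF q] Ix(1)[OF q]])
    fix y assume y: "y \<in> cell N \<sigma> k j"
    have "cmod (u (node N \<sigma> k (Suc j)) - u (node N \<sigma> k j)) \<le> f y * norm (node N \<sigma> k (Suc j) - node N \<sigma> k j)"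
    proof (rule has_gradient_norm_diff_le[OF u])
      fix z assume "z \<in> closed_segment (node N \<sigma> k j) (node N \<sigma> k (Suc j))"
      then have "norm (z - node N \<sigma> k j) \<le> norm (node N \<sigma> k (Suc j) - node N \<sigma> k j)"
        by (rule segment_bound1)
      also have "\<dots> \<le> ?d" by (rule dist_nodes[OF N])
      finally show "norm (D z) \<le> f y" unfolding f_def
        using osc_D[OF q y, of z] by simp
    qed
    also have "\<dots> \<le> f y * ?d"
    proof (rule mult_left_mono[OF dist_nodes(2)[OF N]])
      have "norm (D (node N \<sigma> k j)) \<le> f y" unfolding f_def
        using osc_D[OF q y, of "node N \<sigma> k j"] rad_pos(1)[of N \<sigma> k] by (simp add: add_increasing2 less_imp_le)
      then show "0 \<le> f y" using norm_ge_zero order_trans by blast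
    qed
    finally show "cmod (u (node N \<sigma> k (Suc j)) - u (node N \<sigma> k j)) \<le> f y * ?d" .
  qed simp
  have "(\<Sum>q\<in>?I. \<mu> q * W q)
    = (\<Sum>\<sigma>\<in>{1,-1}. \<Sum>k<M*N. \<Sum>j<N. (LINT x|lebesgue. indicator (cell N \<sigma> k j) x * V x) * (cmod (u (node N \<sigma> k j)))\<^sup>2)"
    unfolding sum_cell_index[symmetric] \<mu>_def W_def by (intro sum.cong) auto
  also note grid
  also have "(\<Sum>\<sigma>\<in>{1,-1}. a * (\<Sum>k<M*N. \<Sum>j<N. (cmod (u (node N \<sigma> (Suc k) j) - u (node N \<sigma> k j)))\<^sup>2)
          + b * (\<Sum>k<M*N. \<Sum>j<N-1. (cmod (u (node N \<sigma> k (Suc j)) - u (node N \<sigma> k j)))\<^sup>2))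
    \<le> (\<Sum>\<sigma>\<in>{1,-1}. a * (\<Sum>k<M*N. \<Sum>j<N. 1 / (2 * pi) * E (\<sigma>, k, j)) + b * (\<Sum>k<M*N. \<Sum>j<N. 18 * pi * E (\<sigma>, k, j)))"
  proof (intro sum_mono add_mono mult_left_mono ab)
    fix \<sigma> :: real and k assume \<sigma>: "\<sigma> \<in> {1,-1}" and k: "k \<in> {..<M*N}"
    show "(cmod (u (node N \<sigma> (Suc k) j) - u (node N \<sigma> k j)))\<^sup>2 \<le> 1 / (2 * pi) * E (\<sigma>, k, j)" if "j \<in> {..<N}" for j
      using \<sigma> k that by (intro T) (auto simp: cell_index_def)
    have "(\<Sum>j<N-1. (cmod (u (node N \<sigma> k (Suc j)) - u (node N \<sigma> k j)))\<^sup>2) \<le> (\<Sum>j<N-1. 18 * pi * E (\<sigma>, k, j))"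
      using \<sigma> k by (intro sum_mono \<Theta>) (auto simp: cell_index_def)
    also have "\<dots> \<le> (\<Sum>j<N. 18 * pi * E (\<sigma>, k, j))" using E0 by (intro sum_mono2) auto
    finally show "(\<Sum>j<N-1. (cmod (u (node N \<sigma> k (Suc j)) - u (node N \<sigma> k j)))\<^sup>2) \<le> (\<Sum>j<N. 18 * pi * E (\<sigma>, k, j))" .
  qed
  also have "\<dots> = (\<Sum>\<sigma>\<in>{1,-1}. (a / (2 * pi) + 18 * pi * b) * (\<Sum>k<M*N. \<Sum>j<N. E (\<sigma>, k, j)))"
    by (intro sum.cong refl) (simp only: sum_distrib_left[symmetric], simp add: algebra_simps)
  also have "\<dots> = (a / (2 * pi) + 18 * pi * b) * (\<Sum>\<sigma>\<in>{1,-1}. \<Sum>k<M*N. \<Sum>j<N. E (\<sigma>, k, j))"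
    by (rule sum_distrib_left[symmetric])
  also have "(\<Sum>\<sigma>\<in>{1,-1}. \<Sum>k<M*N. \<Sum>j<N. E (\<sigma>, k, j)) = (\<Sum>q\<in>?I. E q)"
    unfolding sum_cell_index[symmetric] by (intro sum.cong) auto
  also have "(a / (2 * pi) + 18 * pi * b) * (\<Sum>q\<in>?I. E q)
      \<le> (a / (2 * pi) + 18 * pi * b) * (LINT x|lebesgue. indicator ?A x * (f x)\<^sup>2)"
    using sumE ab by (intro mult_left_mono) auto
  finally have main: "(\<Sum>q\<in>?I. \<mu> q * W q)
      \<le> (a / (2 * pi) + 18 * pi * b) * (LINT x|lebesgue. indicator ?A x * (f x)\<^sup>2)" .
  have "(LINT x|lebesgue. indicator ?A x * V x * (cmod (u x))\<^sup>2)
    \<le> (LINT x|lebesgue. (\<Sum>q\<in>?I. (51/50 * W q + 51 * \<eta>\<^sup>2) * (case q of (\<sigma>, k, j) \<Rightarrow> indicator (cell N \<sigma> k j) x * V x)))"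
  proof (rule integral_mono_AE')
    show "integrable lebesgue (\<lambda>x. \<Sum>q\<in>?I. (51/50 * W q + 51 * \<eta>\<^sup>2) * (case q of (\<sigma>, k, j) \<Rightarrow> indicator (cell N \<sigma> k j) x * V x))"
      by (intro Bochner_Integration.integrable_sum integrable_mult_right) (auto intro!: intV dest: Ix)
    show "AE x in lebesgue. indicator ?A x * V x * (cmod (u x))\<^sup>2
      \<le> (\<Sum>q\<in>?I. (51/50 * W q + 51 * \<eta>\<^sup>2) * (case q of (\<sigma>, k, j) \<Rightarrow> indicator (cell N \<sigma> k j) x * V x))"
      using V(2) AE_indicator_annulus_le[OF N, of M]
    proof eventually_elim
      case (elim x)
      have "indicator ?A x * V x * (cmod (u x))\<^sup>2 = indicator ?A x * (V x * (cmod (u x))\<^sup>2)" by simp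
      also have "\<dots> \<le> (\<Sum>(\<sigma>, k, j)\<in>?I. indicator (cell N \<sigma> k j) x) * (V x * (cmod (u x))\<^sup>2)"
        using elim by (intro mult_right_mono) auto
      also have "\<dots> = (\<Sum>q\<in>?I. (case q of (\<sigma>, k, j) \<Rightarrow> indicator (cell N \<sigma> k j) x * V x) * (cmod (u x))\<^sup>2)"
        unfolding sum_distrib_right by (intro sum.cong) (auto split: prod.split)
      also have "\<dots> \<le> (\<Sum>q\<in>?I. (51/50 * W q + 51 * \<eta>\<^sup>2) * (case q of (\<sigma>, k, j) \<Rightarrow> indicator (cell N \<sigma> k j) x * V x))"
      proof (intro sum_mono)
        fix q assume q: "q \<in> ?I"
        obtain \<sigma> k j where qe: "q = (\<sigma>, k, j)" by (cases q)
        show "(case q of (\<sigma>, k, j) \<Rightarrow> indicator (cell N \<sigma> k j) x * V x) * (cmod (u x))\<^sup>2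
          \<le> (51/50 * W q + 51 * \<eta>\<^sup>2) * (case q of (\<sigma>, k, j) \<Rightarrow> indicator (cell N \<sigma> k j) x * V x)"
        proof (cases "x \<in> cell N \<sigma> k j")
          case True
          have "(cmod (u x))\<^sup>2 \<le> (cmod (u (node N \<sigma> k j)) + \<eta>)\<^sup>2"
            using osc_u[OF q[unfolded qe] True] by (intro power_mono) auto
          also have "\<dots> \<le> 51/50 * W q + 51 * \<eta>\<^sup>2" unfolding W_def qe prod.case by (rule square_add_le)
          finally have "(cmod (u x))\<^sup>2 * V x \<le> (51/50 * W q + 51 * \<eta>\<^sup>2) * V x"
            using elim by (intro mult_right_mono) auto
          then show ?thesis unfolding qe using True by (simp add: mult.commute)
        qed (simp add: qe)
      qed
      finally show ?case .
    qed
    show "AE x in lebesgue. 0 \<le> (\<Sum>q\<in>?I. (51/50 * W q + 51 * \<eta>\<^sup>2) * (case q of (\<sigma>, k, j) \<Rightarrow> indicator (cell N \<sigma> k j) x * V x))"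
      using V(2)
    proof eventually_elim
      case (elim x)
      have "W q \<ge> 0" for q unfolding W_def by (cases q) simp
      then show ?case using elim by (intro sum_nonneg mult_nonneg_nonneg add_nonneg_nonneg) (auto split: prod.split)
    qed
  qed
  also have "\<dots> = (\<Sum>q\<in>?I. (51/50 * W q + 51 * \<eta>\<^sup>2) * \<mu> q)"
    unfolding \<mu>_def by (subst Bochner_Integration.integral_sum) (auto intro!: sum.cong intV dest: Ix)
  also have "\<dots> = 51/50 * (\<Sum>q\<in>?I. \<mu> q * W q) + 51 * \<eta>\<^sup>2 * (\<Sum>q\<in>?I. \<mu> q)"
    unfolding sum_distrib_left sum.distrib[symmetric] by (intro sum.cong refl) (simp add: algebra_simps)
  also have "\<dots> \<le> 51/50 * ((a / (2 * pi) + 18 * pi * b) * (LINT x|lebesgue. indicator ?A x * (f x)\<^sup>2))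
      + 51 * \<eta>\<^sup>2 * (LINT x|lebesgue. indicator ?A x * V x)"
    using main sum\<mu> by (intro add_mono mult_left_mono) auto
  finally show ?thesis unfolding f_def by (simp only: mult.assoc)
qed

section \<open>Linear conditions from the potential\<close>

text \<open>Gaussian elimination: an equation with a nonzero coefficient at i0 is solved for the
  unknown i0, and the result is substituted into the other equations.\<close>

lemma homogeneous_system_nontrivial_solution:
  fixes a :: "'l \<Rightarrow> 'i \<Rightarrow> complex"
  assumes "finite \<Lambda>" "finite I" "card \<Lambda> < card I"
  shows "\<exists>c. (\<exists>i\<in>I. c i \<noteq> 0) \<and> (\<forall>l\<in>\<Lambda>. (\<Sum>i\<in>I. c i * a l i) = 0)"
  using assms
proof (induction \<Lambda> arbitrary: I a rule: finite_induct)
  case empty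
  then have "I \<noteq> {}" by auto
  then show ?case by (intro exI[of _ "\<lambda>_. 1"]) auto
next
  case (insert l \<Lambda>)
  show ?case
  proof (cases "\<forall>i\<in>I. a l i = 0")
    case True
    have "card \<Lambda> < card I" using insert by simp
    from insert.IH[OF insert.prems(1) this, of a] obtain c where
      "\<exists>i\<in>I. c i \<noteq> 0" "\<forall>l\<in>\<Lambda>. (\<Sum>i\<in>I. c i * a l i) = 0" by blast
    then show ?thesis using True by (intro exI[of _ c]) simp
  next
    case False
    then obtain i0 where i0: "i0 \<in> I" "a l i0 \<noteq> 0" by blast
    define I' where "I' = I - {i0}"
    have I': "finite I'" "card \<Lambda> < card I'" "I = insert i0 I'" "i0 \<notin> I'"
      unfolding I'_def using insert i0 by auto
    from insert.IH[OF I'(1,2), of "\<lambda>l' i. a l' i - a l' i0 * a l i / a l i0"] obtain c where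
      c: "\<exists>i\<in>I'. c i \<noteq> 0" "\<forall>l'\<in>\<Lambda>. (\<Sum>i\<in>I'. c i * (a l' i - a l' i0 * a l i / a l i0)) = 0" by blast
    define s where "s = - (\<Sum>i\<in>I'. c i * a l i) / a l i0"
    define c' where "c' = c(i0 := s)"
    have sum: "(\<Sum>i\<in>I. c' i * b i) = s * b i0 + (\<Sum>i\<in>I'. c i * b i)" for b :: "'i \<Rightarrow> complex"
    proof -
      have "(\<Sum>i\<in>I'. c' i * b i) = (\<Sum>i\<in>I'. c i * b i)"
        using I'(4) unfolding c'_def by (intro sum.cong) auto
      then show ?thesis unfolding I'(3) using I'(1,4) by (simp add: c'_def)
    qed
    have "(\<Sum>i\<in>I. c' i * a l' i) = 0" if "l' \<in> \<Lambda>" for l'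
    proof -
      have "0 = (\<Sum>i\<in>I'. c i * (a l' i - a l' i0 * a l i / a l i0))" using c(2) that by simp
      also have "\<dots> = (\<Sum>i\<in>I'. c i * a l' i) - (\<Sum>i\<in>I'. c i * a l i) * (a l' i0 / a l i0)"
        unfolding sum_distrib_right sum_subtractf[symmetric] by (intro sum.cong refl) (simp add: algebra_simps)
      finally show ?thesis unfolding sum s_def by (simp add: algebra_simps)
    qed
    moreover have "(\<Sum>i\<in>I. c' i * a l i) = 0" unfolding sum s_def using i0 by simp
    moreover have "\<exists>i\<in>I. c' i \<noteq> 0" using c(1) I' unfolding c'_def by auto
    ultimately show ?thesis by (intro exI[of _ c']) auto
  qed
qed

text \<open>Division by the largest coefficient keeps all coefficients in the unit disc and one of
  them equal to 1, so that limits exist along subsequences and cannot vanish.\<close>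

lemma normalized_solution:
  fixes a :: "'l \<Rightarrow> 'i \<Rightarrow> complex"
  assumes "finite \<Lambda>" "finite I" "card \<Lambda> < card I"
  obtains c where "\<And>i. i \<in> I \<Longrightarrow> cmod (c i) \<le> 1" "\<exists>i\<in>I. c i = 1" "\<And>l. l \<in> \<Lambda> \<Longrightarrow> (\<Sum>i\<in>I. c i * a l i) = 0"
proof -
  obtain c where c: "\<exists>i\<in>I. c i \<noteq> 0" "\<forall>l\<in>\<Lambda>. (\<Sum>i\<in>I. c i * a l i) = 0"
    using homogeneous_system_nontrivial_solution[OF assms] by blast
  define S where "S = (\<lambda>i. cmod (c i)) ` I"
  have S: "finite S" "S \<noteq> {}" unfolding S_def using assms c(1) by auto
  obtain i1 where i1: "i1 \<in> I" "cmod (c i1) = Max S" using Max_in[OF S] unfolding S_def by auto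
  have le: "cmod (c i) \<le> cmod (c i1)" if "i \<in> I" for i using Max_ge[OF S(1)] that i1(2) unfolding S_def by auto
  obtain i2 where i2: "i2 \<in> I" "c i2 \<noteq> 0" using c(1) by blast
  have "0 < cmod (c i2)" using i2 by simp
  also have "\<dots> \<le> cmod (c i1)" by (rule le[OF i2(1)])
  finally have nz: "c i1 \<noteq> 0" by simp
  show thesis
  proof (rule that[of "\<lambda>i. c i / c i1"])
    show "cmod (c i / c i1) \<le> 1" if "i \<in> I" for i using le[OF that] nz by (simp add: norm_divide)
    show "\<exists>i\<in>I. c i / c i1 = 1" using i1 nz by (intro bexI[of _ i1]) auto
    show "(\<Sum>i\<in>I. c i / c i1 * a l i) = 0" if "l \<in> \<Lambda>" for l
      using c(2) that by (simp add: sum_divide_distrib[symmetric])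
  qed
qed

section \<open>Grid masses against the numbers \<open>A\<^sub>n\<close> and
  \<open>\<B>\<^sub>n\<close>\<close>

definition cell_mass :: "(real^2 \<Rightarrow> real) \<Rightarrow> nat \<Rightarrow> real \<Rightarrow> nat \<Rightarrow> nat \<Rightarrow> real" where
  "cell_mass V N \<sigma> k j = (LINT x|lebesgue. indicator (cell N \<sigma> k j) x * V x)"

lemma cell_mass_nonneg:
  assumes "AE x in lebesgue. 0 \<le> V x"
  shows "cell_mass V N \<sigma> k j \<ge> 0"
  unfolding cell_mass_def using assms by (intro integral_nonneg_AE) (auto elim!: eventually_mono)

lemma integrable_cell:
  assumes "locally_integrable V" "j < N"
  shows "integrable lebesgue (\<lambda>x. indicator (cell N \<sigma> k j) x * V x :: real)"
  using cell_lmeasurable[OF assms(2)] bounded_cell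
  by (intro integrable_indicator_locally_integrable[OF assms(1)]) auto

text \<open>The common core of the comparisons with A: the cells are disjoint and lie in S, and on
  each of them the weight g is at least a constant.\<close>

lemma sum_cell_mass_le:
  assumes N: "N > 0" and I: "finite I" "I \<subseteq> {1, -1} \<times> UNIV \<times> {..<N}"
    and V: "locally_integrable V" "AE x in lebesgue. 0 \<le> V x"
    and S: "\<And>\<sigma> k j. (\<sigma>, k, j) \<in> I \<Longrightarrow> cell N \<sigma> k j \<subseteq> S"
    and c: "\<And>\<sigma> k j x. \<lbrakk>(\<sigma>, k, j) \<in> I; x \<in> cell N \<sigma> k j\<rbrakk> \<Longrightarrow> c \<sigma> k j \<le> g x"
    and g: "\<And>x. x \<in> S \<Longrightarrow> g x \<ge> 0" and int: "integrable lebesgue (\<lambda>x. indicator S x * (V x * g x))"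
  shows "(\<Sum>(\<sigma>, k, j)\<in>I. cell_mass V N \<sigma> k j * c \<sigma> k j) \<le> (LINT x|lebesgue. indicator S x * (V x * g x))"
proof -
  have intc: "integrable lebesgue (\<lambda>x. case q of (\<sigma>, k, j) \<Rightarrow> indicator (cell N \<sigma> k j) x * V x * c \<sigma> k j)"
    if "q \<in> I" for q
    using that I(2) integrable_cell[OF V(1)] by (cases q) auto
  have "(\<Sum>(\<sigma>, k, j)\<in>I. cell_mass V N \<sigma> k j * c \<sigma> k j)
    = (LINT x|lebesgue. (\<Sum>q\<in>I. case q of (\<sigma>, k, j) \<Rightarrow> indicator (cell N \<sigma> k j) x * V x * c \<sigma> k j))"
    unfolding cell_mass_def by (subst Bochner_Integration.integral_sum) (use intc in \<open>auto intro!: sum.cong\<close>)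
  also have "\<dots> \<le> (LINT x|lebesgue. indicator S x * (V x * g x))"
  proof (rule integral_mono_AE)
    show "integrable lebesgue (\<lambda>x. \<Sum>q\<in>I. case q of (\<sigma>, k, j) \<Rightarrow> indicator (cell N \<sigma> k j) x * V x * c \<sigma> k j)"
      using intc by (rule Bochner_Integration.integrable_sum)
    show "AE x in lebesgue. (\<Sum>q\<in>I. case q of (\<sigma>, k, j) \<Rightarrow> indicator (cell N \<sigma> k j) x * V x * c \<sigma> k j)
      \<le> indicator S x * (V x * g x)"
      using V(2)
    proof eventually_elim
      case (elim x)
      have ind: "(\<Sum>(\<sigma>, k, j)\<in>I. indicator (cell N \<sigma> k j) x) \<le> (indicator S x :: real)"
        using sum_indicator_cells_le[OF N I S] by blast
      show ?case
      proof (cases "x \<in> S")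
        case True
        have "(\<Sum>q\<in>I. case q of (\<sigma>, k, j) \<Rightarrow> indicator (cell N \<sigma> k j) x * V x * c \<sigma> k j)
          \<le> (\<Sum>q\<in>I. (case q of (\<sigma>, k, j) \<Rightarrow> indicator (cell N \<sigma> k j) x) * (V x * g x))"
        proof (intro sum_mono)
          fix q assume q: "q \<in> I"
          obtain \<sigma> k j where qe: "q = (\<sigma>, k, j)" by (cases q)
          show "(case q of (\<sigma>, k, j) \<Rightarrow> indicator (cell N \<sigma> k j) x * V x * c \<sigma> k j)
            \<le> (case q of (\<sigma>, k, j) \<Rightarrow> indicator (cell N \<sigma> k j) x) * (V x * g x)"
            unfolding qe prod.case using c[OF q[unfolded qe], of x] elim
            by (cases "x \<in> cell N \<sigma> k j") (simp_all add: mult_left_mono)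
        qed
        also have "\<dots> = (\<Sum>(\<sigma>, k, j)\<in>I. indicator (cell N \<sigma> k j) x) * (V x * g x)"
          by (rule sum_distrib_right[symmetric])
        also have "\<dots> \<le> indicator S x * (V x * g x)"
          using ind elim g[OF True] by (intro mult_right_mono) auto
        finally show ?thesis .
      next
        case False
        have "(case q of (\<sigma>, k, j) \<Rightarrow> indicator (cell N \<sigma> k j) x * V x * c \<sigma> k j) = 0" if "q \<in> I" for q
          using S False that by (cases q) (auto simp: indicator_def)
        then show ?thesis using False by simp
      qed
    qed
  qed (rule int)
  finally show ?thesis .
qed

text \<open>Both signs give 0 for n = 0: the two half lines meet in the annulus
  \<open>U 0\<close>.\<close>

definition side :: "real \<Rightarrow> nat \<Rightarrow> int" where
  "side \<sigma> n = (if \<sigma> = 1 then int n else - int n)"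

lemma U_sets: "U n \<in> sets lebesgue" "bounded (U n)"
proof -
  have "U n \<in> sets borel" unfolding U_def by (cases "n > 0"; cases "n = 0") (simp_all, measurable)
  then show "U n \<in> sets lebesgue" by simp
  show "bounded (U n)" unfolding U_def by (cases "n > 0"; cases "n = 0") (auto intro!: boundedI less_imp_le)
qed

lemma ln_exp_bounds:
  assumes "norm (x::real^2) > 0"
  shows "exp a < norm x \<longleftrightarrow> a < ln (norm x)" "norm x < exp b \<longleftrightarrow> ln (norm x) < b"
  using assms by (metis exp_less_cancel_iff exp_ln)+

lemma cell_bounds:
  assumes N: "N > 0" "j < N" and \<sigma>: "\<sigma> = 1 \<or> \<sigma> = -1" and x: "x \<in> cell N \<sigma> k j" and ab: "a * N \<le> k" "k < b * N"
  shows "norm x > 0" "real a < \<sigma> * ln (norm x)" "\<sigma> * ln (norm x) < real b" "real k / real N < \<sigma> * ln (norm x)"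
proof -
  have *: "x \<noteq> 0" "real k / real N < \<sigma> * ln (norm x)" "\<sigma> * ln (norm x) < real (Suc k) / real N"
    using x unfolding cell_iff[OF N \<sigma>] by auto
  have "real (a * N) \<le> real k" "real (Suc k) \<le> real (b * N)" using ab by (simp_all only: of_nat_le_iff Suc_leI)
  then have "real a \<le> real k / real N" "real (Suc k) / real N \<le> real b" using N by (auto simp: field_simps)
  then show "norm x > 0" "real a < \<sigma> * ln (norm x)" "\<sigma> * ln (norm x) < real b" "real k / real N < \<sigma> * ln (norm x)"
    using * by (simp, linarith+)
qed

lemma A_eq:
  assumes V: "locally_integrable V"
  shows "n \<noteq> 0 \<Longrightarrow> A V n = (LINT x|lebesgue. indicator (U n) x * (V x * \<bar>ln (norm x)\<bar>))"
    "A V 0 = (LINT x|lebesgue. indicator (U 0) x * (V x * 1))"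
  unfolding A_def using U_sets(1) by (simp_all add: integral_restrict_space)

text \<open>On \<open>U n\<close> the logarithm is bounded by 2^|n|, so integrability is inherited
  from V.\<close>

lemma integrable_U_ln:
  assumes V: "locally_integrable V"
  shows "integrable lebesgue (\<lambda>x. indicator (U n) x * (V x * \<bar>ln (norm x)\<bar>))"
proof (rule Bochner_Integration.integrable_bound)
  define K where "K = (2::real) ^ nat \<bar>n\<bar>"
  have K1: "K \<ge> 1" unfolding K_def by simp
  have int: "integrable lebesgue (\<lambda>x. indicator (U n) x * V x)"
    by (rule integrable_indicator_locally_integrable[OF V U_sets])
  then show "integrable lebesgue (\<lambda>x. K * (indicator (U n) x * V x))" by simp
  have "(\<lambda>x::real^2. \<bar>ln (norm x)\<bar>) \<in> borel_measurable lebesgue" by (rule measurable_completion) measurable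
  with borel_measurable_integrable[OF int]
  have "(\<lambda>x. indicator (U n) x * V x * \<bar>ln (norm x)\<bar>) \<in> borel_measurable lebesgue" by (rule borel_measurable_times)
  then show "(\<lambda>x. indicator (U n) x * (V x * \<bar>ln (norm x)\<bar>)) \<in> borel_measurable lebesgue" by (simp add: mult.assoc)
  have "\<bar>ln (norm x)\<bar> \<le> K" if "x \<in> U n" for x
  proof -
    have "norm x > 0" using that unfolding U_def by (auto split: if_splits intro: less_trans[OF exp_gt_zero])
    note le = ln_exp_bounds[OF this]
    consider "n > 0" | "n = 0" | "n < 0" by linarith
    then show ?thesis
    proof cases
      case 1
      have "(0::real) < 2 ^ nat (n - 1)" by simp
      moreover have "2 ^ nat (n - 1) < ln (norm x) \<and> ln (norm x) < 2 ^ nat n" using that 1 unfolding U_def by (simp add: le)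
      moreover have "K = 2 ^ nat n" unfolding K_def using 1 by simp
      ultimately show ?thesis by linarith
    next
      case 2
      then have "- 1 < ln (norm x) \<and> ln (norm x) < 1" using that unfolding U_def by (simp add: le)
      then show ?thesis using K1 by linarith
    next
      case 3
      have "(0::real) < 2 ^ (nat \<bar>n\<bar> - 1)" by simp
      moreover have "- (2 ^ nat \<bar>n\<bar>) < ln (norm x) \<and> ln (norm x) < - (2 ^ (nat \<bar>n\<bar> - 1))"
      proof -
        have "nat (- n - 1) = nat (- n) - Suc 0" by simp
        then show ?thesis using that 3 unfolding U_def by (simp add: le)
      qed
      ultimately show ?thesis unfolding K_def by linarith
    qed
  qed
  then show "AE x in lebesgue. norm (indicator (U n) x * (V x * \<bar>ln (norm x)\<bar>)) \<le> norm (K * (indicator (U n) x * V x))"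
  proof (intro AE_I2)
    fix x assume *: "\<And>x. x \<in> U n \<Longrightarrow> \<bar>ln (norm x)\<bar> \<le> K"
    show "norm (indicator (U n) x * (V x * \<bar>ln (norm x)\<bar>)) \<le> norm (K * (indicator (U n) x * V x))"
    proof (cases "x \<in> U n")
      case True
      have "\<bar>V x\<bar> * \<bar>ln (norm x)\<bar> \<le> \<bar>V x\<bar> * K" by (rule mult_left_mono[OF *[OF True]]) simp
      then show ?thesis using True K1 by (simp add: abs_mult mult.commute)
    qed simp
  qed
qed

text \<open>k/N is the value of |ln |x|| on the side of the cell nearest the unit circle, hence a
  lower bound on the cell; and the rows from 2^(n-1) N to 2^n N have their cells in the annulus on
  this side of the circle. So the grid never sees more mass than \<open>A\<^sub>n\<close>.\<close>

lemma radial_mass_le_A: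
  assumes N: "N > 0" and \<sigma>: "\<sigma> = 1 \<or> \<sigma> = -1" and V: "locally_integrable V" "AE x in lebesgue. 0 \<le> V x"
    and n: "n > 0"
  shows "radial_mass N (\<lambda>k. \<Sum>j<N. cell_mass V N \<sigma> k j) n \<le> A V (side \<sigma> n)"
proof -
  define I where "I = {\<sigma>} \<times> {2^(n-1)*N..<2^n*N} \<times> {..<N}"
  have pow: "nat (int n - 1) = n - 1" using n by simp
  have "radial_mass N (\<lambda>k. \<Sum>j<N. cell_mass V N \<sigma> k j) n
    = (\<Sum>(\<sigma>, k, j)\<in>I. cell_mass V N \<sigma> k j * (real k / real N))"
    unfolding radial_mass_def I_def using n by (simp add: sum.cartesian_product' sum_distrib_right sum_divide_distrib)
  also have "\<dots> \<le> (LINT x|lebesgue. indicator (U (side \<sigma> n)) x * (V x * \<bar>ln (norm x)\<bar>))"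
  proof (rule sum_cell_mass_le[OF N _ _ V])
    fix \<sigma>' k j assume q: "(\<sigma>', k, j) \<in> I"
    then have s: "\<sigma>' = \<sigma>" and k: "2^(n-1)*N \<le> k" "k < 2^n*N" and j: "j < N" unfolding I_def by auto
    show "cell N \<sigma>' k j \<subseteq> U (side \<sigma> n)"
    proof
      fix x assume "x \<in> cell N \<sigma>' k j"
      then have "x \<in> cell N \<sigma> k j" unfolding s .
      from cell_bounds[OF N j \<sigma> this k] have b: "norm x > 0" "real (2^(n-1)) < \<sigma> * ln (norm x)"
        "\<sigma> * ln (norm x) < real (2^n)" by auto
      show "x \<in> U (side \<sigma> n)"
        using b(2,3) \<sigma> n unfolding U_def side_def by (auto simp: ln_exp_bounds[OF b(1)] pow)
    qed
    fix x assume "x \<in> cell N \<sigma>' k j"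
    then have "x \<in> cell N \<sigma> k j" unfolding s .
    from cell_bounds(4)[OF N j \<sigma> this k] have "real k / real N < \<sigma> * ln (norm x)" .
    then show "real k / real N \<le> \<bar>ln (norm x)\<bar>" using \<sigma> by auto
  next
    show "integrable lebesgue (\<lambda>x. indicator (U (side \<sigma> n)) x * (V x * \<bar>ln (norm x)\<bar>))"
      by (rule integrable_U_ln[OF V(1)])
  qed (use \<sigma> in \<open>auto simp: I_def\<close>)
  also have "\<dots> = A V (side \<sigma> n)" using n by (subst A_eq(1)[OF V(1)]) (auto simp: side_def)
  finally show ?thesis .
qed

lemma radial_mass_0_le_A:
  assumes N: "N > 0" and V: "locally_integrable V" "AE x in lebesgue. 0 \<le> V x"
  shows "radial_mass N (\<lambda>k. \<Sum>j<N. cell_mass V N 1 k j) 0 + radial_mass N (\<lambda>k. \<Sum>j<N. cell_mass V N (-1) k j) 0 \<le> A V 0"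
proof -
  define I :: "(real \<times> nat \<times> nat) set" where "I = {1, -1} \<times> {0..<N} \<times> {..<N}"
  have "radial_mass N (\<lambda>k. \<Sum>j<N. cell_mass V N 1 k j) 0 + radial_mass N (\<lambda>k. \<Sum>j<N. cell_mass V N (-1) k j) 0
    = (\<Sum>(\<sigma>, k, j)\<in>I. cell_mass V N \<sigma> k j * 1)"
    unfolding radial_mass_def I_def by (simp add: sum.cartesian_product')
  also have "\<dots> \<le> (LINT x|lebesgue. indicator (U 0) x * (V x * 1))"
  proof (rule sum_cell_mass_le[OF N _ _ V])
    fix \<sigma> k j assume q: "(\<sigma>, k, j) \<in> I"
    then have \<sigma>: "\<sigma> = 1 \<or> \<sigma> = -1" and k: "0*N \<le> k" "k < 1*N" and j: "j < N" unfolding I_def by auto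
    show "cell N \<sigma> k j \<subseteq> U 0"
    proof
      fix x assume "x \<in> cell N \<sigma> k j"
      from cell_bounds[OF N j \<sigma> this k] have b: "norm x > 0" "0 < \<sigma> * ln (norm x)" "\<sigma> * ln (norm x) < 1" by auto
      show "x \<in> U 0" using b(2,3) \<sigma> unfolding U_def by (auto simp: ln_exp_bounds[OF b(1)])
    qed
  next
    show "integrable lebesgue (\<lambda>x. indicator (U 0) x * (V x * 1))"
      using integrable_indicator_locally_integrable[OF V(1) U_sets] by simp
  qed (auto simp: I_def)
  also have "\<dots> = A V 0" by (rule A_eq(2)[OF V(1), symmetric])
  finally show ?thesis .
qed

text \<open>Inside the unit circle \<open>ln |x|\<close> decreases along a block, hence the shift by one.\<close>

definition block :: "real \<Rightarrow> nat \<Rightarrow> int" where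
  "block \<sigma> b = (if \<sigma> = 1 then int b else - int b - 1)"

lemma measure_Omega: "measure lebesgue (Omega n) = pi * (exp (2 * of_int n) * (exp 2 - 1))"
proof -
  have "measure lebesgue (Omega n) = pi * ((exp (of_int n + 1))\<^sup>2 - (exp (of_int n))\<^sup>2)"
    unfolding Omega_def by (rule measure_annulus) auto
  also have "(exp (of_int n + 1 :: real))\<^sup>2 - (exp (of_int n))\<^sup>2 = exp (2 * of_int n) * (exp 2 - 1)"
    by (simp add: power2_eq_square exp_add[symmetric] algebra_simps)
  finally show ?thesis .
qed

lemma Omega_lmeasurable: "Omega n \<in> lmeasurable" "bounded (Omega n)" "Omega n \<in> sets lebesgue"
proof -
  have "Omega n \<in> sets borel" unfolding Omega_def by measurable
  then show s: "Omega n \<in> sets lebesgue" by simp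
  show b: "bounded (Omega n)" unfolding Omega_def by (auto intro!: boundedI less_imp_le)
  show "Omega n \<in> lmeasurable" using b s by (rule bounded_set_imp_lmeasurable)
qed

text \<open>The N^2 cells of a block are equal in logarithmic coordinates, and the conformal factor
  varies by exp 2 \<le> 9 within one annulus. So no cell exceeds 9 times the average area.\<close>

lemma measure_cell_le_Omega:
  assumes N: "N > 0" "j < N" and \<sigma>: "\<sigma> = 1 \<or> \<sigma> = -1" and k: "b * N \<le> k" "k < Suc b * N"
  shows "(real N)\<^sup>2 * measure lebesgue (cell N \<sigma> k j) \<le> 9 * measure lebesgue (Omega (block \<sigma> b))"
proof -
  let ?n = "real_of_int (block \<sigma> b)"
  define r where "r = rad N \<sigma> (if \<sigma> = 1 then k else Suc k)"
  have Ns: "real k / real N + 1 / real N = real (Suc k) / real N" by (simp add: add_divide_distrib)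
  have kb: "real b \<le> real k / real N" "real (Suc k) / real N \<le> real b + 1"
  proof -
    have "real (b * N) \<le> real k" "real (Suc k) \<le> real (Suc b * N)" using k by (simp_all only: of_nat_le_iff Suc_leI)
    then show "real b \<le> real k / real N" "real (Suc k) / real N \<le> real b + 1" using N by (auto simp: field_simps)
  qed
  have diff: "\<bar>(rad N \<sigma> (Suc k))\<^sup>2 - (rad N \<sigma> k)\<^sup>2\<bar> = r\<^sup>2 * (exp (2 / real N) - 1)"
  proof (cases "\<sigma> = 1")
    case True
    have "(rad N \<sigma> (Suc k))\<^sup>2 = r\<^sup>2 * exp (2 / real N)"
      unfolding r_def rad_def using True by (simp add: power2_eq_square exp_add[symmetric] add_divide_distrib)
    then have "(rad N \<sigma> (Suc k))\<^sup>2 - (rad N \<sigma> k)\<^sup>2 = r\<^sup>2 * (exp (2 / real N) - 1)"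
      unfolding r_def using True by (simp add: algebra_simps)
    then show ?thesis by simp
  next
    case False
    then have s: "\<sigma> = -1" using \<sigma> by simp
    have "(rad N \<sigma> k)\<^sup>2 = r\<^sup>2 * exp (2 / real N)"
      unfolding r_def rad_def s by (simp add: power2_eq_square exp_add[symmetric] add_divide_distrib diff_divide_distrib)
    then have "(rad N \<sigma> (Suc k))\<^sup>2 - (rad N \<sigma> k)\<^sup>2 = - (r\<^sup>2 * (exp (2 / real N) - 1))"
      unfolding r_def using False by (simp add: algebra_simps)
    then show ?thesis by simp
  qed
  have r2: "r\<^sup>2 \<le> exp 2 * exp (2 * ?n)"
  proof -
    have "r \<le> exp (1 + ?n)"
    proof (cases "\<sigma> = 1")
      case True
      have "real k / real N \<le> real (Suc k) / real N" by (simp add: divide_right_mono)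
      then show ?thesis unfolding r_def rad_def block_def using True kb by simp
    next
      case False
      then have s: "\<sigma> = -1" using \<sigma> by simp
      have "real k / real N \<le> real (Suc k) / real N" by (simp add: divide_right_mono)
      then have kb': "real b \<le> real (Suc k) / real N" using kb by linarith
      have "r = exp (-1 * (real (Suc k) / real N))" unfolding r_def rad_def using False s by (simp only: if_False)
      moreover have "?n = - real b - 1" unfolding block_def using False by simp
      ultimately show ?thesis using kb' by (simp only: exp_le_cancel_iff mult_minus1)
    qed
    then have "r\<^sup>2 \<le> (exp (1 + ?n))\<^sup>2" unfolding r_def by (intro power_mono) (auto simp: less_imp_le)
    also have "\<dots> = exp 2 * exp (2 * ?n)" by (simp add: power2_eq_square exp_add[symmetric])
    finally show ?thesis .
  qed
  have e: "real N * (exp (2 / real N) - 1) \<le> exp 2 - 1"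
  proof -
    have "convex_on UNIV (exp :: real \<Rightarrow> real)" by (rule exp_convex)
    from convex_onD[OF this, of "1 / real N" 0 2]
    have "exp (2 / real N) \<le> (1 - 1 / real N) + exp 2 / real N" using N by simp
    then have "real N * exp (2 / real N) \<le> real N * ((1 - 1 / real N) + exp 2 / real N)" by (rule mult_left_mono) simp
    also have "\<dots> = real N - 1 + exp 2" using N by (simp add: distrib_left right_diff_distrib)
    finally show ?thesis by (simp add: right_diff_distrib)
  qed
  have e2: "exp 2 \<le> (9::real)" using exp_bounds_N[of 1] by simp
  have "(real N)\<^sup>2 * measure lebesgue (cell N \<sigma> k j) = pi * (r\<^sup>2 * (real N * (exp (2 / real N) - 1)))"
    unfolding measure_cell[OF N(2)] diff using N by (simp add: power2_eq_square)
  also have "\<dots> \<le> pi * ((9 * exp (2 * ?n)) * (exp 2 - 1))"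
  proof (intro mult_left_mono mult_mono e)
    have "exp 2 * exp (2 * ?n) \<le> 9 * exp (2 * ?n)" by (rule mult_right_mono[OF e2]) simp
    then show "r\<^sup>2 \<le> 9 * exp (2 * ?n)" using r2 by linarith
  qed (auto simp: N)
  also have "\<dots> = 9 * measure lebesgue (Omega (block \<sigma> b))" unfolding measure_Omega by simp
  finally show ?thesis .
qed

text \<open>Spread h over the cells as the step function G with values h / 9. Convexity of
  \<open>N_fun_A\<close> gives back a factor 9, which pays for the bound on the areas of the cells;
  so G is admissible in the norm on the annulus. Testing V with G yields the sum divided by
  9.\<close>

lemma block_mass_le_B:
  assumes N: "N = 2^K" and \<sigma>: "\<sigma> = 1 \<or> \<sigma> = -1" and V: "locally_integrable V"
    and \<beta>: "B V (block \<sigma> b) = ennreal \<beta>" "\<beta> \<ge> 0"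
    and h: "\<And>x. h x \<ge> 0" "(\<Sum>x\<in>sq K 0 0. N_fun_A (h x)) \<le> 4^K"
  shows "(\<Sum>x\<in>sq K 0 0. cell_mass V N \<sigma> (b*N + fst x) (snd x) * h x) \<le> 9 * \<beta>"
proof -
  let ?\<Omega> = "Omega (block \<sigma> b)"
  let ?Q = "sq K 0 0"
  define C where "C x = cell N \<sigma> (b*N + fst x) (snd x)" for x :: "nat \<times> nat"
  define G where "G y = (\<Sum>x\<in>?Q. indicator (C x) y * (h x / 9))" for y
  have N0: "N > 0" unfolding N by simp
  have Q: "fst x < N" "snd x < N" if "x \<in> ?Q" for x using that unfolding sq_K N by auto
  have k: "b * N \<le> b*N + fst x" "b*N + fst x < Suc b * N" if "x \<in> ?Q" for x using Q[OF that] by auto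
  have Cl: "C x \<in> lmeasurable" if "x \<in> ?Q" for x unfolding C_def by (rule cell_lmeasurable[OF Q(2)[OF that]])
  have C\<Omega>: "C x \<subseteq> ?\<Omega>" if "x \<in> ?Q" for x
  proof
    fix y assume "y \<in> C x"
    from cell_bounds[OF N0 Q(2)[OF that] \<sigma> this[unfolded C_def] k[OF that]]
    have y: "norm y > 0" "real b < \<sigma> * ln (norm y)" "\<sigma> * ln (norm y) < real (Suc b)" by auto
    show "y \<in> ?\<Omega>" using y(2,3) \<sigma> unfolding Omega_def block_def by (auto simp: ln_exp_bounds[OF y(1)])
  qed
  have Cd: "x = x'" if "x \<in> ?Q" "x' \<in> ?Q" "y \<in> C x" "y \<in> C x'" for x x' y
    using cell_disjoint[OF N0 Q(2)[OF that(1)] Q(2)[OF that(2)] \<sigma> \<sigma> that(3)[unfolded C_def] that(4)[unfolded C_def]]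
    by (simp add: prod_eq_iff)
  have Gm: "G \<in> borel_measurable lebesgue" unfolding G_def using Cl by (intro borel_measurable_sum) auto
  have Gm': "G \<in> borel_measurable (lebesgue_on ?\<Omega>)" using Gm by (rule measurable_restrict_space1)
  have AG: "N_fun_A (G y) \<le> (\<Sum>x\<in>?Q. indicator (C x) y * (N_fun_A (h x) / 9))" for y
  proof (cases "\<exists>x\<in>?Q. y \<in> C x")
    case True
    then obtain x where x: "x \<in> ?Q" "y \<in> C x" by blast
    have s: "(\<Sum>x'\<in>?Q. indicator (C x') y * t x') = t x" for t :: "_ \<Rightarrow> real"
    proof -
      have "(\<Sum>x'\<in>?Q. indicator (C x') y * t x') = (\<Sum>x'\<in>?Q. if x' = x then t x else 0)"
      proof (intro sum.cong refl)
        fix x' assume x': "x' \<in> ?Q"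
        show "indicator (C x') y * t x' = (if x' = x then t x else 0)"
          using Cd[OF x' x(1) _ x(2)] x(2) by (cases "y \<in> C x'") auto
      qed
      then show ?thesis using x by simp
    qed
    show ?thesis unfolding G_def s by (rule N_fun_A_divide) simp
  next
    case False
    then have "G y = 0" unfolding G_def by (intro sum.neutral) auto
    then show ?thesis by (simp add: sum_nonneg N_fun_A_nonneg)
  qed
  have "(\<integral>\<^sup>+ y. ennreal (N_fun_A (G y)) \<partial>lebesgue_on ?\<Omega>) \<le> (\<integral>\<^sup>+ y. ennreal (N_fun_A (G y)) \<partial>lebesgue)"
    using Omega_lmeasurable(3) by (subst nn_integral_restrict_space) (auto intro!: nn_integral_mono simp: indicator_def)
  also have "\<dots> \<le> (\<integral>\<^sup>+ y. (\<Sum>x\<in>?Q. ennreal (N_fun_A (h x) / 9) * indicator (C x) y) \<partial>lebesgue)"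
  proof (intro nn_integral_mono)
    fix y
    have "ennreal (N_fun_A (G y)) \<le> ennreal (\<Sum>x\<in>?Q. indicator (C x) y * (N_fun_A (h x) / 9))"
      by (intro ennreal_leI AG)
    also have "\<dots> = (\<Sum>x\<in>?Q. ennreal (N_fun_A (h x) / 9) * indicator (C x) y)"
    proof -
      have "ennreal (\<Sum>x\<in>?Q. indicator (C x) y * (N_fun_A (h x) / 9)) = (\<Sum>x\<in>?Q. ennreal (indicator (C x) y * (N_fun_A (h x) / 9)))"
        by (rule sum_ennreal[symmetric]) (simp add: N_fun_A_nonneg)
      also have "\<dots> = (\<Sum>x\<in>?Q. ennreal (N_fun_A (h x) / 9) * indicator (C x) y)"
        by (intro sum.cong refl) (simp split: split_indicator)
      finally show ?thesis .
    qed
    finally show "ennreal (N_fun_A (G y)) \<le> (\<Sum>x\<in>?Q. ennreal (N_fun_A (h x) / 9) * indicator (C x) y)" .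
  qed
  also have "\<dots> = (\<Sum>x\<in>?Q. ennreal (N_fun_A (h x) / 9) * emeasure lebesgue (C x))"
  proof -
    have Cs: "C x \<in> sets lebesgue" if "x \<in> ?Q" for x using Cl[OF that] by simp
    have "(\<integral>\<^sup>+ y. (\<Sum>x\<in>?Q. ennreal (N_fun_A (h x) / 9) * indicator (C x) y) \<partial>lebesgue)
      = (\<Sum>x\<in>?Q. (\<integral>\<^sup>+ y. ennreal (N_fun_A (h x) / 9) * indicator (C x) y \<partial>lebesgue))"
      by (rule nn_integral_sum) (intro borel_measurable_times_ennreal borel_measurable_const borel_measurable_indicator Cs)
    also have "\<dots> = (\<Sum>x\<in>?Q. ennreal (N_fun_A (h x) / 9) * emeasure lebesgue (C x))"
      by (intro sum.cong refl nn_integral_cmult_indicator Cs)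
    finally show ?thesis .
  qed
  also have "\<dots> = ennreal (\<Sum>x\<in>?Q. N_fun_A (h x) / 9 * measure lebesgue (C x))"
  proof -
    have "ennreal (N_fun_A (h x) / 9) * emeasure lebesgue (C x) = ennreal (N_fun_A (h x) / 9 * measure lebesgue (C x))"
      if "x \<in> ?Q" for x
      unfolding emeasure_eq_ennreal_measure[OF fmeasurableD2[OF Cl[OF that]]]
      by (rule ennreal_mult[symmetric]) (auto simp: N_fun_A_nonneg)
    then have "(\<Sum>x\<in>?Q. ennreal (N_fun_A (h x) / 9) * emeasure lebesgue (C x))
      = (\<Sum>x\<in>?Q. ennreal (N_fun_A (h x) / 9 * measure lebesgue (C x)))" by (intro sum.cong refl)
    also have "\<dots> = ennreal (\<Sum>x\<in>?Q. N_fun_A (h x) / 9 * measure lebesgue (C x))"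
      by (rule sum_ennreal) (simp add: N_fun_A_nonneg)
    finally show ?thesis .
  qed
  also have "\<dots> \<le> ennreal (measure lebesgue ?\<Omega>)"
  proof (rule ennreal_leI)
    have "(\<Sum>x\<in>?Q. N_fun_A (h x) / 9 * measure lebesgue (C x)) \<le> (\<Sum>x\<in>?Q. N_fun_A (h x) / 9 * (9 * measure lebesgue ?\<Omega> / (real N)\<^sup>2))"
    proof (intro sum_mono mult_left_mono)
      fix x assume x: "x \<in> ?Q"
      have "(real N)\<^sup>2 * measure lebesgue (C x) \<le> 9 * measure lebesgue ?\<Omega>"
        unfolding C_def by (rule measure_cell_le_Omega[OF N0 Q(2)[OF x] \<sigma> k[OF x]])
      then show "measure lebesgue (C x) \<le> 9 * measure lebesgue ?\<Omega> / (real N)\<^sup>2"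
        using N0 by (simp add: field_simps)
    qed (auto simp: N_fun_A_nonneg)
    also have "\<dots> = (\<Sum>x\<in>?Q. N_fun_A (h x)) * (measure lebesgue ?\<Omega> / (real N)\<^sup>2)"
      unfolding sum_distrib_right by (intro sum.cong refl) simp
    also have "\<dots> \<le> 4^K * (measure lebesgue ?\<Omega> / (real N)\<^sup>2)" using h(2) by (intro mult_right_mono) auto
    also have "(real N)\<^sup>2 = 4^K" unfolding N by (simp add: power2_eq_square flip: power_mult_distrib)
    finally show "(\<Sum>x\<in>?Q. N_fun_A (h x) / 9 * measure lebesgue (C x)) \<le> measure lebesgue ?\<Omega>" by simp
  qed
  also have "\<dots> = emeasure lebesgue ?\<Omega>"
    by (rule emeasure_eq_ennreal_measure[OF fmeasurableD2[OF Omega_lmeasurable(1)], symmetric])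
  finally have adm: "(\<integral>\<^sup>+ y. ennreal (N_fun_A (G y)) \<partial>lebesgue_on ?\<Omega>) \<le> emeasure lebesgue ?\<Omega>" .
  \<comment> \<open>A finite value of \<open>B\<close> excludes the default \<infinity>.\<close>
  have "V \<in> Orlicz_space N_fun_B ?\<Omega>"
    using \<beta> unfolding B_def norm_B_av_def by (auto split: if_splits)
  then have "B V (block \<sigma> b) = (SUP g \<in> {g \<in> borel_measurable (lebesgue_on ?\<Omega>).
            (\<integral>\<^sup>+x. ennreal (N_fun_A (g x)) \<partial>lebesgue_on ?\<Omega>) \<le> emeasure lebesgue ?\<Omega>}.
          ennreal \<bar>LINT x|lebesgue_on ?\<Omega>. V x * g x\<bar>)"
    unfolding B_def norm_B_av_def by simp
  then have "ennreal \<bar>LINT x|lebesgue_on ?\<Omega>. V x * G x\<bar> \<le> ennreal \<beta>"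
    unfolding \<beta>(1)[symmetric] using adm Gm' by (auto intro: SUP_upper)
  then have le: "(LINT x|lebesgue_on ?\<Omega>. V x * G x) \<le> \<beta>" using \<beta>(2) by simp
  have intC: "integrable lebesgue (\<lambda>y. indicator (C x) y * V y)" if "x \<in> ?Q" for x
    unfolding C_def by (rule integrable_cell[OF V Q(2)[OF that]])
  have "(LINT y|lebesgue_on ?\<Omega>. V y * G y) = (LINT y|lebesgue. indicator ?\<Omega> y *\<^sub>R (V y * G y))"
    using Omega_lmeasurable(3) by (simp add: integral_restrict_space)
  also have "\<dots> = (LINT y|lebesgue. (\<Sum>x\<in>?Q. (indicator (C x) y * V y) * (h x / 9)))"
  proof (intro Bochner_Integration.integral_cong refl)
    fix y
    have "indicator ?\<Omega> y *\<^sub>R (V y * G y) = (\<Sum>x\<in>?Q. indicator ?\<Omega> y * (V y * (indicator (C x) y * (h x / 9))))"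
      unfolding G_def by (simp add: sum_distrib_left)
    also have "\<dots> = (\<Sum>x\<in>?Q. (indicator (C x) y * V y) * (h x / 9))"
      using C\<Omega> by (intro sum.cong refl) (auto simp: indicator_def)
    finally show "indicator ?\<Omega> y *\<^sub>R (V y * G y) = (\<Sum>x\<in>?Q. (indicator (C x) y * V y) * (h x / 9))" .
  qed
  also have "\<dots> = (\<Sum>x\<in>?Q. cell_mass V N \<sigma> (b*N + fst x) (snd x) * (h x / 9))"
    using intC by (subst Bochner_Integration.integral_sum) (auto simp: cell_mass_def C_def)
  also have "\<dots> = (\<Sum>x\<in>?Q. cell_mass V N \<sigma> (b*N + fst x) (snd x) * h x) / 9" by (simp add: sum_divide_distrib)
  finally show ?thesis using le by simp
qed

lemma node_0: "node N (-1) 0 j = node N 1 0 j" by (simp add: node_def rad_def)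

lemma exists_fine_mesh:
  assumes "\<rho> > 0"
  obtains K where "\<And>\<sigma> k. \<lbrakk>\<sigma> = 1 \<or> \<sigma> = -1; k < M * 2^K\<rbrakk> \<Longrightarrow>
    \<bar>rad (2^K) \<sigma> (Suc k) - rad (2^K) \<sigma> k\<bar> + rad (2^K) \<sigma> k * (2 * pi / real (2^K)) \<le> \<rho>"
    "\<And>\<sigma> k. \<lbrakk>\<sigma> = 1 \<or> \<sigma> = -1; k < M * 2^K\<rbrakk> \<Longrightarrow> rad (2^K) \<sigma> k \<le> exp (real M)"
proof -
  \<comment> \<open>9 = 1 + 8: a radial step is at most 1/N and an angular step at most 8/N, each
    times the largest radius exp M.\<close>
  obtain K where K: "9 * exp (real M) / \<rho> < 2^K" using real_arch_pow[of 2 "9 * exp (real M) / \<rho>"] by auto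
  define N where "N = (2::nat)^K"
  have N: "N > 0" "9 * exp (real M) / \<rho> < real N" unfolding N_def using K by auto
  have r: "rad N \<sigma> k \<le> exp (real M)" if \<sigma>: "\<sigma> = 1 \<or> \<sigma> = -1" and k: "k \<le> M * N" for \<sigma> k
  proof -
    have "real k \<le> real (M * N)" using k by (simp only: of_nat_le_iff)
    then have "real k / real N \<le> real M" using N by (simp add: field_simps)
    moreover have "0 \<le> real k / real N" by simp
    ultimately have "real k / real N \<le> real M" "- (real k / real N) \<le> real M" by linarith+
    then have "\<sigma> * (real k / real N) \<le> real M" using \<sigma> by auto
    then show ?thesis unfolding rad_def by simp
  qed
  have e: "1 - exp (- (1 / real N)) \<le> 1 / real N" using exp_ge_add_one_self[of "- (1 / real N)"] by linarith
  have d: "\<bar>rad N \<sigma> (Suc k) - rad N \<sigma> k\<bar> \<le> exp (real M) * (1 / real N)"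
    if \<sigma>: "\<sigma> = 1 \<or> \<sigma> = -1" and k: "k < M * N" for \<sigma> k
  proof (cases "\<sigma> = 1")
    case True
    have "rad N \<sigma> (Suc k) * exp (- (1 / real N)) = rad N \<sigma> k"
      unfolding rad_Suc[OF N(1)] True by (simp add: mult.assoc flip: exp_add)
    then have "rad N \<sigma> (Suc k) - rad N \<sigma> k = rad N \<sigma> (Suc k) * (1 - exp (- (1 / real N)))"
      by (simp add: right_diff_distrib)
    moreover have "0 \<le> 1 - exp (- (1 / real N))" by simp
    ultimately have "\<bar>rad N \<sigma> (Suc k) - rad N \<sigma> k\<bar> = rad N \<sigma> (Suc k) * (1 - exp (- (1 / real N)))"
      using rad_pos(1)[of N \<sigma> "Suc k"] by (simp add: abs_mult)
    also have "\<dots> \<le> exp (real M) * (1 / real N)"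
      using r[OF \<sigma>, of "Suc k"] k e by (intro mult_mono) auto
    finally show ?thesis .
  next
    case False
    then have s: "\<sigma> = -1" using \<sigma> by simp
    have "rad N \<sigma> k - rad N \<sigma> (Suc k) = rad N \<sigma> k * (1 - exp (- (1 / real N)))"
      unfolding rad_Suc[OF N(1)] s by (simp add: right_diff_distrib)
    moreover have "0 \<le> 1 - exp (- (1 / real N))" by simp
    ultimately have "\<bar>rad N \<sigma> (Suc k) - rad N \<sigma> k\<bar> = rad N \<sigma> k * (1 - exp (- (1 / real N)))"
      using rad_pos(1)[of N \<sigma> k] by (subst abs_minus_commute) (simp add: abs_mult)
    also have "\<dots> \<le> exp (real M) * (1 / real N)"
      using r[OF \<sigma>, of k] k e by (intro mult_mono) auto
    finally show ?thesis .
  qed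
  show thesis
  proof (rule that[of K, folded N_def])
    fix \<sigma> :: real and k assume \<sigma>: "\<sigma> = 1 \<or> \<sigma> = -1" and k: "k < M * N"
    show "rad N \<sigma> k \<le> exp (real M)" using r[OF \<sigma>] k by simp
    have "rad N \<sigma> k * (2 * pi / real N) \<le> exp (real M) * (8 / real N)"
      using r[OF \<sigma>, of k] k pi_less_4 by (intro mult_mono divide_right_mono) auto
    then have "\<bar>rad N \<sigma> (Suc k) - rad N \<sigma> k\<bar> + rad N \<sigma> k * (2 * pi / real N) \<le> exp (real M) * (9 / real N)"
    proof -
      have "9 / real N = 1 / real N + 8 / real N" by (simp add: add_divide_distrib[symmetric])
      then have "exp (real M) * (9 / real N) = exp (real M) * (1 / real N) + exp (real M) * (8 / real N)"
        by (simp only: distrib_left)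
      then show ?thesis using add_mono[OF d[OF \<sigma> k] \<open>rad N \<sigma> k * (2 * pi / real N) \<le> exp (real M) * (8 / real N)\<close>] by (simp only:)
    qed
    also have "\<dots> \<le> \<rho>" using N assms by (simp add: field_simps)
    finally show "\<bar>rad N \<sigma> (Suc k) - rad N \<sigma> k\<bar> + rad N \<sigma> k * (2 * pi / real N) \<le> \<rho>" .
  qed
qed

section \<open>From conditions on the grid to finite families of continuously differentiable
  functions\<close>

lemma finite_family_uniformly_continuous:
  fixes f :: "nat \<Rightarrow> real^2 \<Rightarrow> 'b::real_normed_vector"
  assumes "\<And>i. i < n \<Longrightarrow> continuous_on UNIV (f i)" "\<epsilon> > 0"
  obtains \<rho> where "\<rho> > 0" "\<And>i x y. \<lbrakk>i < n; norm x \<le> R; norm y \<le> R; norm (x - y) \<le> \<rho>\<rbrakk> \<Longrightarrow> norm (f i x - f i y) \<le> \<epsilon>"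
proof -
  have "\<exists>\<rho>>0. \<forall>x y. norm x \<le> R \<longrightarrow> norm y \<le> R \<longrightarrow> norm (x - y) \<le> \<rho> \<longrightarrow> norm (f i x - f i y) \<le> \<epsilon>" if "i < n" for i
  proof -
    have "continuous_on (cball 0 R) (f i)" using assms(1)[OF that] by (rule continuous_on_subset) simp
    then have "uniformly_continuous_on (cball 0 R) (f i)" by (rule compact_uniformly_continuous) simp
    then obtain d where "d > 0" and d: "\<And>x y. x \<in> cball 0 R \<Longrightarrow> y \<in> cball 0 R \<Longrightarrow> dist y x < d \<Longrightarrow> dist (f i y) (f i x) < \<epsilon>"
      unfolding uniformly_continuous_on_def using assms(2) by blast
    have "norm (f i x - f i y) \<le> \<epsilon>" if "norm x \<le> R" "norm y \<le> R" "norm (x - y) \<le> d / 2" for x y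
      using d[of y x] that \<open>d > 0\<close> by (simp add: dist_norm less_imp_le)
    then show ?thesis using \<open>d > 0\<close> by (intro exI[of _ "d/2"]) auto
  qed
  then obtain \<rho> where \<rho>: "\<And>i. i < n \<Longrightarrow> \<rho> i > 0"
    "\<And>i x y. i < n \<Longrightarrow> norm x \<le> R \<Longrightarrow> norm y \<le> R \<Longrightarrow> norm (x - y) \<le> \<rho> i \<Longrightarrow> norm (f i x - f i y) \<le> \<epsilon>"
    by metis
  define r where "r = Min (insert 1 (\<rho> ` {..<n}))"
  have "r > 0" unfolding r_def using \<rho>(1) by (subst Min_gr_iff) auto
  moreover have "r \<le> \<rho> i" if "i < n" for i unfolding r_def using that by (intro Min_le) auto
  ultimately show thesis
  proof (intro that[of r])
    fix i and x y :: "real^2" assume *: "i < n" "norm x \<le> R" "norm y \<le> R" "norm (x - y) \<le> r" "\<And>i. i < n \<Longrightarrow> r \<le> \<rho> i"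
    show "norm (f i x - f i y) \<le> \<epsilon>" by (rule \<rho>(2)[OF *(1-3)]) (rule order_trans[OF *(4) *(5)[OF *(1)]])
  qed
qed

text \<open>Small enough for the constant \<open>\<kappa>\<close> in the proof of \<open>smooth_form_bound\<close> to be below \<open>1\<close>.\<close>

definition thr :: real where "thr = 1 / 10^9"

text \<open>The mean over the unit circle belongs to both half lines, so a single condition makes
  both radial profiles start at 0; this is the summand 1. The indices \<open>block 1 b\<close> and
  \<open>block (-1) b\<close> never coincide, because each annulus \<open>\<Omega>\<^sub>n\<close>
  lies on one side of the circle. The 9 of \<open>block_mass_le_B\<close> turns 17 into 153 and the
  threshold \<open>thr\<close> into \<open>thr / 9\<close>.\<close>

lemma grid_conditions:
  assumes N: "N = 2^K" and V: "locally_integrable V" "AE x in lebesgue. 0 \<le> V x"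
    and \<beta>: "\<And>i. B V i = ennreal (\<beta> i)" "\<And>i. \<beta> i \<ge> 0"
  obtains \<Lambda> :: "((real \<Rightarrow> nat \<Rightarrow> nat \<Rightarrow> complex) \<Rightarrow> complex) set" and F F' :: "int set" where
    "finite \<Lambda>" "finite F" "F \<subseteq> {i. A V i > 1/4}" "finite F'" "F' \<subseteq> {i. \<beta> i > thr / 9}"
    "\<And>l n c W. l \<in> \<Lambda> \<Longrightarrow> l (\<lambda>\<sigma> k j. \<Sum>i<(n::nat). c i * W i \<sigma> k j) = (\<Sum>i<n. c i * l (W i))"
    "real (card \<Lambda>) \<le> 1 + 4 * (\<Sum>i\<in>F. sqrt (A V i)) + 153 / thr * (\<Sum>i\<in>F'. \<beta> i)"
    "\<And>W. \<lbrakk>\<And>j. W (-1) 0 j = W 1 0 j; \<forall>l\<in>\<Lambda>. l W = 0\<rbrakk> \<Longrightarrow>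
      (\<Sum>\<sigma>\<in>{1,-1}. \<Sum>k<2^m*N. \<Sum>j<N. cell_mass V N \<sigma> k j * (cmod (W \<sigma> k j))\<^sup>2)
      \<le> (\<Sum>\<sigma>\<in>{1,-1}. (7/2 + 3200000 * thr) * (\<Sum>k<2^m*N. \<Sum>j<N. (cmod (W \<sigma> (Suc k) j - W \<sigma> k j))\<^sup>2)
        + 800000 * thr * (\<Sum>k<2^m*N. \<Sum>j<N-1. (cmod (W \<sigma> k (Suc j) - W \<sigma> k j))\<^sup>2))"
proof -
  have N0: "N > 0" unfolding N by simp
  have t0: "thr > 0" unfolding thr_def by simp
  let ?\<mu> = "\<lambda>\<sigma>. cell_mass V N \<sigma>"
  let ?R = "\<lambda>\<sigma> i. radial_mass N (\<lambda>k. \<Sum>j<N. ?\<mu> \<sigma> k j) i"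
  define form where "form \<sigma> w \<longleftrightarrow> (\<Sum>k<2^m*N. \<Sum>j<N. ?\<mu> \<sigma> k j * (cmod (w k j))\<^sup>2)
      \<le> (7/2 + 3200000 * thr) * (\<Sum>k<2^m*N. \<Sum>j<N. (cmod (w (Suc k) j - w k j))\<^sup>2)
        + 800000 * thr * (\<Sum>k<2^m*N. \<Sum>j<N-1. (cmod (w k (Suc j) - w k j))\<^sup>2)" for \<sigma> w
  define cond where "cond \<sigma> \<Lambda> z \<longleftrightarrow> finite \<Lambda> \<and> (\<forall>l\<in>\<Lambda>. grid_linear l) \<and> (\<forall>i. ?R \<sigma> i \<le> 1/4 \<longrightarrow> z i = 0)
      \<and> real (z 0) \<le> 2 * sqrt (?R \<sigma> 0) \<and> (\<forall>i. real (z i) \<le> 4 * sqrt (?R \<sigma> i))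
      \<and> real (card \<Lambda>) \<le> (\<Sum>i\<le>m. real (z i)) + (\<Sum>b | b < 2^m \<and> 9 * \<beta> (block \<sigma> b) > thr. 17 / thr * (9 * \<beta> (block \<sigma> b)))
      \<and> (\<forall>w. row_mean N w 0 = 0 \<longrightarrow> (\<forall>l\<in>\<Lambda>. l w = 0) \<longrightarrow> form \<sigma> w)" for \<sigma> \<Lambda> z
  have P: "\<exists>\<Lambda> z. cond \<sigma> \<Lambda> z"
    if \<sigma>: "\<sigma> = 1 \<or> \<sigma> = -1" for \<sigma>
  proof -
    show ?thesis
    proof (rule grid_form_bound[OF N, of "?\<mu> \<sigma>" thr m "\<lambda>b. 9 * \<beta> (block \<sigma> b)"])
      show "?\<mu> \<sigma> k j \<ge> 0" for k j by (rule cell_mass_nonneg[OF V(2)])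
      show "thr > 0" by (rule t0)
      show "(\<Sum>x\<in>sq K 0 0. ?\<mu> \<sigma> (b*N + fst x) (snd x) * h x) \<le> 9 * \<beta> (block \<sigma> b)"
        if "\<And>x. h x \<ge> 0" "(\<Sum>x\<in>sq K 0 0. N_fun_A (h x)) \<le> 4^K" for b h
        by (rule block_mass_le_B[OF N \<sigma> V(1) \<beta>]) (fact that)+
      fix \<Lambda> :: "((nat \<Rightarrow> nat \<Rightarrow> complex) \<Rightarrow> complex) set" and z
      assume a: "finite \<Lambda>" "\<And>l. l \<in> \<Lambda> \<Longrightarrow> grid_linear l" "\<And>i. ?R \<sigma> i \<le> 1/4 \<Longrightarrow> z i = 0"
        "real (z 0) \<le> 2 * sqrt (?R \<sigma> 0)" "\<And>i. real (z i) \<le> 4 * sqrt (?R \<sigma> i)"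
        "real (card \<Lambda>) \<le> (\<Sum>i\<le>m. real (z i)) + (\<Sum>b | b < 2^m \<and> 9 * \<beta> (block \<sigma> b) > thr. 17 / thr * (9 * \<beta> (block \<sigma> b)))"
        "\<And>w. \<lbrakk>row_mean N w 0 = 0; \<forall>l\<in>\<Lambda>. l w = 0\<rbrakk> \<Longrightarrow>
          (\<Sum>k<2^m*N. \<Sum>j<N. ?\<mu> \<sigma> k j * (cmod (w k j))\<^sup>2)
          \<le> (7/2 + 3200000 * thr) * (\<Sum>k<2^m*N. \<Sum>j<N. (cmod (w (Suc k) j - w k j))\<^sup>2)
            + 800000 * thr * (\<Sum>k<2^m*N. \<Sum>j<N-1. (cmod (w k (Suc j) - w k j))\<^sup>2)"
      show ?thesis unfolding cond_def form_def
        by (intro exI[of _ \<Lambda>] exI[of _ z] conjI allI impI ballI) (assumption | rule a)+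
    qed
  qed
  obtain \<Lambda>1 z1 where "cond 1 \<Lambda>1 z1" using P[of 1] by auto
  note c1 = this[unfolded cond_def]
  note p1 = c1[THEN conjunct1] c1[THEN conjunct2, THEN conjunct1] c1[THEN conjunct2, THEN conjunct2, THEN conjunct1] c1[THEN conjunct2, THEN conjunct2, THEN conjunct2, THEN conjunct1] c1[THEN conjunct2, THEN conjunct2, THEN conjunct2, THEN conjunct2, THEN conjunct1] c1[THEN conjunct2, THEN conjunct2, THEN conjunct2, THEN conjunct2, THEN conjunct2, THEN conjunct1] c1[THEN conjunct2, THEN conjunct2, THEN conjunct2, THEN conjunct2, THEN conjunct2, THEN conjunct2]
  obtain \<Lambda>2 z2 where "cond (-1) \<Lambda>2 z2" using P[of "-1"] by auto
  note c2 = this[unfolded cond_def]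
  note p2 = c2[THEN conjunct1] c2[THEN conjunct2, THEN conjunct1] c2[THEN conjunct2, THEN conjunct2, THEN conjunct1] c2[THEN conjunct2, THEN conjunct2, THEN conjunct2, THEN conjunct1] c2[THEN conjunct2, THEN conjunct2, THEN conjunct2, THEN conjunct2, THEN conjunct1] c2[THEN conjunct2, THEN conjunct2, THEN conjunct2, THEN conjunct2, THEN conjunct2, THEN conjunct1] c2[THEN conjunct2, THEN conjunct2, THEN conjunct2, THEN conjunct2, THEN conjunct2, THEN conjunct2]
  have R0: "?R \<sigma> i \<ge> 0" for \<sigma> i
    unfolding radial_mass_def using cell_mass_nonneg[OF V(2)] by (auto intro!: sum_nonneg mult_nonneg_nonneg divide_nonneg_nonneg)
  define t where "t i = (if A V i > 1/4 then 4 * sqrt (A V i) else 0)" for i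
  have tA: "z \<le> t i" if "R \<le> 1/4 \<longrightarrow> z = 0" "z \<le> 4 * sqrt R" "R \<le> A V i" for R z :: real and i
    using that unfolding t_def by (auto simp: not_less intro: order_trans[of _ "4 * sqrt R"])
  have z1: "real (z1 i) \<le> t (int i)" if "i > 0" for i
    using p1(3,5) radial_mass_le_A[OF N0 _ V that, of 1] unfolding side_def by (intro tA[of "?R 1 i"]) auto
  have z2: "real (z2 i) \<le> t (- int i)" if "i > 0" for i
    using p2(3,5) radial_mass_le_A[OF N0 _ V that, of "-1"] unfolding side_def by (intro tA[of "?R (-1) i"]) auto
  have R00: "?R 1 0 + ?R (-1) 0 \<le> A V 0" by (rule radial_mass_0_le_A[OF N0 V])
  \<comment> \<open>Each half line spends at most 2 sqrt of its own share of the mass over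
    \<open>U 0\<close>, so both together spend at most 4 sqrt of the whole.\<close>
  have z0: "real (z1 0) + real (z2 0) \<le> t 0"
  proof (rule tA[OF _ _ R00])
    show "?R 1 0 + ?R (-1) 0 \<le> 1/4 \<longrightarrow> real (z1 0) + real (z2 0) = 0"
      using p1(3) p2(3) R0[of 1 0] R0[of "-1" 0] by auto
    have "sqrt (?R 1 0) \<le> sqrt (?R 1 0 + ?R (-1) 0)" "sqrt (?R (-1) 0) \<le> sqrt (?R 1 0 + ?R (-1) 0)"
      using R0[of 1 0] R0[of "-1" 0] by simp_all
    then show "real (z1 0) + real (z2 0) \<le> 4 * sqrt (?R 1 0 + ?R (-1) 0)" using p1(4) p2(4) by linarith
  qed
  define S where "S = {- int m..int m}"
  define F where "F = {i \<in> S. A V i > 1/4}"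
  have sumz: "(\<Sum>i\<le>m. real (z1 i)) + (\<Sum>i\<le>m. real (z2 i)) \<le> 4 * (\<Sum>i\<in>F. sqrt (A V i))"
  proof -
    have sp: "{..m} = insert 0 {1..m}" by auto
    have "(\<Sum>i\<le>m. real (z1 i)) + (\<Sum>i\<le>m. real (z2 i))
      = (real (z1 0) + real (z2 0)) + (\<Sum>i\<in>{1..m}. real (z1 i)) + (\<Sum>i\<in>{1..m}. real (z2 i))"
      unfolding sp by simp
    also have "\<dots> \<le> t 0 + (\<Sum>i\<in>{1..m}. t (int i)) + (\<Sum>i\<in>{1..m}. t (- int i))"
      using z0 z1 z2 by (intro add_mono sum_mono) auto
    also have "\<dots> = (\<Sum>i\<in>S. t i)"
    proof -
      have S: "S = insert 0 (int ` {1..m} \<union> (\<lambda>i. - int i) ` {1..m})"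
      proof (intro equalityI subsetI)
        fix i assume "i \<in> S"
        then have i: "- int m \<le> i" "i \<le> int m" unfolding S_def by auto
        consider "i = 0" | "i > 0" | "i < 0" by linarith
        then show "i \<in> insert 0 (int ` {1..m} \<union> (\<lambda>i. - int i) ` {1..m})"
        proof cases
          case 2
          then have "i = int (nat i)" "nat i \<in> {1..m}" using i by auto
          then show ?thesis by blast
        next
          case 3
          then have "i = - int (nat (- i))" "nat (- i) \<in> {1..m}" using i by auto
          then show ?thesis by blast
        qed simp
      qed (auto simp: S_def)
      have a: "(\<Sum>i\<in>int ` {1..m}. t i) = (\<Sum>i\<in>{1..m}. t (int i))" by (subst sum.reindex) auto
      have b: "(\<Sum>i\<in>(\<lambda>i. - int i) ` {1..m}. t i) = (\<Sum>i\<in>{1..m}. t (- int i))"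
        by (subst sum.reindex) (auto simp: inj_on_def)
      have "(\<Sum>i\<in>S. t i) = t 0 + (\<Sum>i\<in>int ` {1..m} \<union> (\<lambda>i. - int i) ` {1..m}. t i)"
        unfolding S by (rule sum.insert) auto
      also have "(\<Sum>i\<in>int ` {1..m} \<union> (\<lambda>i. - int i) ` {1..m}. t i)
        = (\<Sum>i\<in>int ` {1..m}. t i) + (\<Sum>i\<in>(\<lambda>i. - int i) ` {1..m}. t i)"
        by (rule sum.union_disjoint) auto
      finally show ?thesis unfolding a b by simp
    qed
    also have "\<dots> = (\<Sum>i\<in>F. 4 * sqrt (A V i))"
      unfolding F_def t_def by (subst sum.inter_filter[symmetric]) (auto simp: S_def)
    finally show ?thesis by (simp add: sum_distrib_left)
  qed
  define T where "T = block 1 ` {..<2^m} \<union> block (-1) ` {..<2^m}"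
  define F' where "F' = {i \<in> T. \<beta> i > thr / 9}"
  have sumb: "(\<Sum>b | b < 2^m \<and> 9 * \<beta> (block 1 b) > thr. 17 / thr * (9 * \<beta> (block 1 b)))
      + (\<Sum>b | b < 2^m \<and> 9 * \<beta> (block (-1) b) > thr. 17 / thr * (9 * \<beta> (block (-1) b))) = 153 / thr * (\<Sum>i\<in>F'. \<beta> i)"
  proof -
    define s where "s i = (if \<beta> i > thr / 9 then 153 / thr * \<beta> i else 0)" for i
    have conv: "(\<Sum>b | b < 2^m \<and> 9 * \<beta> (block \<sigma> b) > thr. 17 / thr * (9 * \<beta> (block \<sigma> b)))
      = (\<Sum>i\<in>block \<sigma> ` {..<2^m}. s i)" for \<sigma>
    proof -
      have "inj_on (block \<sigma>) {..<2^m}" unfolding block_def by (auto simp: inj_on_def split: if_splits)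
      then have "(\<Sum>i\<in>block \<sigma> ` {..<2^m}. s i) = (\<Sum>b<2^m. s (block \<sigma> b))" by (simp add: sum.reindex)
      also have "\<dots> = (\<Sum>b | b \<in> {..<2^m} \<and> \<beta> (block \<sigma> b) > thr / 9. 153 / thr * \<beta> (block \<sigma> b))"
        unfolding s_def by (rule sum.inter_filter[symmetric]) simp
      also have "\<dots> = (\<Sum>b | b < 2^m \<and> 9 * \<beta> (block \<sigma> b) > thr. 17 / thr * (9 * \<beta> (block \<sigma> b)))"
        by (intro sum.cong) auto
      finally show ?thesis by simp
    qed
    have "(\<Sum>i\<in>T. s i) = (\<Sum>i\<in>block 1 ` {..<2^m}. s i) + (\<Sum>i\<in>block (-1) ` {..<2^m}. s i)"
      unfolding T_def by (rule sum.union_disjoint) (auto simp: block_def)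
    moreover have "(\<Sum>i\<in>T. s i) = (\<Sum>i\<in>F'. 153 / thr * \<beta> i)"
      unfolding F'_def s_def by (rule sum.inter_filter[symmetric]) (simp add: T_def)
    ultimately show ?thesis unfolding conv by (simp add: sum_distrib_left)
  qed
  define \<Lambda> where "\<Lambda> = insert (\<lambda>W. row_mean N (W (1::real)) 0) ((\<lambda>l W. l (W 1)) ` \<Lambda>1 \<union> (\<lambda>l W. l (W (-1))) ` \<Lambda>2)"
  show thesis
  proof (rule that[of \<Lambda> F F'])
    show "finite \<Lambda>" unfolding \<Lambda>_def using p1(1) p2(1) by simp
    show "finite F" by (rule finite_subset[of _ S]) (auto simp: F_def S_def)
    show "F \<subseteq> {i. A V i > 1/4}" unfolding F_def by auto
    show "finite F'" by (rule finite_subset[of _ T]) (auto simp: F'_def T_def)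
    show "F' \<subseteq> {i. \<beta> i > thr / 9}" unfolding F'_def by auto
    show "l (\<lambda>\<sigma> k j. \<Sum>i<(n::nat). c i * W i \<sigma> k j) = (\<Sum>i<n. c i * l (W i))" if l: "l \<in> \<Lambda>" for l n c W
    proof -
      consider "l = (\<lambda>W. row_mean N (W 1) 0)" | l' where "l' \<in> \<Lambda>1" "l = (\<lambda>W. l' (W 1))"
        | l' where "l' \<in> \<Lambda>2" "l = (\<lambda>W. l' (W (-1)))" using l unfolding \<Lambda>_def by blast
      then show ?thesis
      proof cases
        case 1
        then show ?thesis by (simp add: row_mean_linear)
      next
        case 2
        then show ?thesis using bspec[OF p1(2) 2(1)] unfolding grid_linear_def by simp
      next
        case 3
        then show ?thesis using bspec[OF p2(2) 3(1)] unfolding grid_linear_def by simp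
      qed
    qed
    have "card \<Lambda> \<le> Suc (card ((\<lambda>l W. l (W (1::real))) ` \<Lambda>1 \<union> (\<lambda>l W. l (W (-1::real))) ` \<Lambda>2))"
      unfolding \<Lambda>_def using p1(1) p2(1) by (simp add: card_insert_if)
    also have "\<dots> \<le> Suc (card \<Lambda>1 + card \<Lambda>2)"
      using card_Un_le[of "(\<lambda>l W. l (W (1::real))) ` \<Lambda>1" "(\<lambda>l W. l (W (-1::real))) ` \<Lambda>2"]
        card_image_le[OF p1(1), of "\<lambda>l W. l (W (1::real))"] card_image_le[OF p2(1), of "\<lambda>l W. l (W (-1::real))"] by linarith
    finally have "real (card \<Lambda>) \<le> 1 + real (card \<Lambda>1) + real (card \<Lambda>2)" by linarith
    then show "real (card \<Lambda>) \<le> 1 + 4 * (\<Sum>i\<in>F. sqrt (A V i)) + 153 / thr * (\<Sum>i\<in>F'. \<beta> i)"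
      using p1(6) p2(6) sumz sumb by linarith
    fix W assume W0: "\<And>j. W (-1) 0 j = W 1 0 j" and W: "\<forall>l\<in>\<Lambda>. l W = 0"
    have m1: "row_mean N (W 1) 0 = 0" using bspec[OF W, of "\<lambda>W. row_mean N (W 1) 0"] unfolding \<Lambda>_def by simp
    then have m2: "row_mean N (W (-1)) 0 = 0" unfolding row_mean_def W0 .
    have "\<forall>l\<in>\<Lambda>1. l (W 1) = 0"
    proof
      fix l assume "l \<in> \<Lambda>1"
      then have "(\<lambda>W. l (W 1)) \<in> \<Lambda>" unfolding \<Lambda>_def by blast
      from bspec[OF W this] show "l (W 1) = 0" .
    qed
    then have f1: "form 1 (W 1)" using p1(7) m1 by simp
    have "\<forall>l\<in>\<Lambda>2. l (W (-1)) = 0"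
    proof
      fix l assume "l \<in> \<Lambda>2"
      then have "(\<lambda>W. l (W (-1))) \<in> \<Lambda>" unfolding \<Lambda>_def by blast
      from bspec[OF W this] show "l (W (-1)) = 0" .
    qed
    then have f2: "form (-1) (W (-1))" using p2(7) m2 by simp
    show "(\<Sum>\<sigma>\<in>{1,-1}. \<Sum>k<2^m*N. \<Sum>j<N. cell_mass V N \<sigma> k j * (cmod (W \<sigma> k j))\<^sup>2)
      \<le> (\<Sum>\<sigma>\<in>{1,-1}. (7/2 + 3200000 * thr) * (\<Sum>k<2^m*N. \<Sum>j<N. (cmod (W \<sigma> (Suc k) j - W \<sigma> k j))\<^sup>2)
        + 800000 * thr * (\<Sum>k<2^m*N. \<Sum>j<N-1. (cmod (W \<sigma> k (Suc j) - W \<sigma> k j))\<^sup>2))"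
      using f1 f2 unfolding form_def by (intro sum_mono) auto
  qed
qed

text \<open>\<open>count\<close> ranges over finite index sets because those met by the grid grow
  with m. It leaves fewer conditions than functions, so some normalized combination satisfies all of
  them. The coefficients depend on the mesh; their common bound 1 makes the oscillation of the
  combination small uniformly in that choice.\<close>

lemma smooth_form_bound:
  fixes V :: "real^2 \<Rightarrow> real" and w :: "nat \<Rightarrow> real^2 \<Rightarrow> complex" and D :: "nat \<Rightarrow> real^2 \<Rightarrow> complex \<times> complex"
  assumes w: "\<And>i. i < n \<Longrightarrow> has_gradient (w i) (D i)" and V: "locally_integrable V" "AE x in lebesgue. 0 \<le> V x"
    and \<beta>: "\<And>i. B V i = ennreal (\<beta> i)" "\<And>i. \<beta> i \<ge> 0"
    and count: "\<And>F F'. \<lbrakk>finite F; F \<subseteq> {i. A V i > 1/4}; finite F'; F' \<subseteq> {i. \<beta> i > thr / 9}\<rbrakk>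
      \<Longrightarrow> 1 + 4 * (\<Sum>i\<in>F. sqrt (A V i)) + 153 / thr * (\<Sum>i\<in>F'. \<beta> i) < real n"
    and e: "e > 0"
  obtains c where "\<And>i. i < n \<Longrightarrow> cmod (c i) \<le> 1" "\<exists>i<n. c i = 1"
    "(LINT x|lebesgue. indicator (annulus (2^m)) x * V x * (cmod (\<Sum>i<n. c i * w i x))\<^sup>2)
      \<le> (LINT x|lebesgue. indicator (annulus (2^m)) x * (norm (\<Sum>i<n. c i * fst (D i x), \<Sum>i<n. c i * snd (D i x)))\<^sup>2) + e"
proof -
  define M where "M = (2::nat)^m"
  have M: "real M = 2^m" unfolding M_def by simp
  let ?A = "annulus (real M)"
  define I1 where "I1 = measure lebesgue ?A"
  define I2 where "I2 = (LINT x|lebesgue. indicator ?A x * V x)"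
  have I0: "I1 \<ge> 0" "I2 \<ge> 0" unfolding I1_def I2_def using V(2)
    by (auto intro!: integral_nonneg_AE elim!: eventually_mono)
  \<comment> \<open>Chosen so that the two error terms together, 51 \<eta>^2 (I1 + I2), stay below
    e.\<close>
  define \<eta> where "\<eta> = sqrt (e / (51 * (I1 + I2 + 1)))"
  have \<eta>: "\<eta> > 0" "51 * \<eta>\<^sup>2 * (I1 + I2) \<le> e"
  proof -
    have p: "I1 + I2 + 1 > 0" using I0 by linarith
    show "\<eta> > 0" unfolding \<eta>_def using e p by simp
    define S where "S = I1 + I2 + 1"
    have "\<eta>\<^sup>2 = e / (51 * S)" unfolding \<eta>_def S_def using e p by simp
    then have "51 * \<eta>\<^sup>2 * S = e" using p unfolding S_def[symmetric] by simp
    then have "51 * \<eta>\<^sup>2 * (I1 + I2 + 1) = e" unfolding S_def .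
    moreover have "51 * \<eta>\<^sup>2 * (I1 + I2) \<le> 51 * \<eta>\<^sup>2 * (I1 + I2 + 1)" by (intro mult_left_mono) auto
    ultimately show "51 * \<eta>\<^sup>2 * (I1 + I2) \<le> e" by linarith
  qed
  have n0: "n > 0" using count[of "{}" "{}"] by simp
  define \<epsilon> where "\<epsilon> = \<eta> / real n"
  have \<epsilon>: "\<epsilon> > 0" unfolding \<epsilon>_def using \<eta> n0 by simp
  define R where "R = exp (real M) + 1"
  obtain \<rho>1 where \<rho>1: "\<rho>1 > 0" "\<And>i x y. \<lbrakk>i < n; norm x \<le> R; norm y \<le> R; norm (x - y) \<le> \<rho>1\<rbrakk> \<Longrightarrow> norm (w i x - w i y) \<le> \<epsilon>"
    using finite_family_uniformly_continuous[of n w \<epsilon> R] has_gradient_continuous[OF w] \<epsilon> by metis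
  have "continuous_on UNIV (D i)" if "i < n" for i using w[OF that] unfolding has_gradient_def by simp
  then obtain \<rho>2 where \<rho>2: "\<rho>2 > 0" "\<And>i x y. \<lbrakk>i < n; norm x \<le> R; norm y \<le> R; norm (x - y) \<le> \<rho>2\<rbrakk> \<Longrightarrow> norm (D i x - D i y) \<le> \<epsilon>"
    using finite_family_uniformly_continuous[of n D \<epsilon> R] \<epsilon> by metis
  \<comment> \<open>Two points within \<rho> of the same node are at most 2 \<rho> apart, and \<rho>
    \<le> 1 keeps them in the ball of radius R.\<close>
  define \<rho> where "\<rho> = min 1 (min \<rho>1 \<rho>2) / 2"
  have \<rho>: "\<rho> > 0" "2 * \<rho> \<le> \<rho>1" "2 * \<rho> \<le> \<rho>2" "\<rho> \<le> 1" unfolding \<rho>_def using \<rho>1(1) \<rho>2(1) by auto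
  obtain K where K: "\<And>\<sigma> k. \<lbrakk>\<sigma> = 1 \<or> \<sigma> = -1; k < M * 2^K\<rbrakk> \<Longrightarrow>
    \<bar>rad (2^K) \<sigma> (Suc k) - rad (2^K) \<sigma> k\<bar> + rad (2^K) \<sigma> k * (2 * pi / real (2^K)) \<le> \<rho>"
    "\<And>\<sigma> k. \<lbrakk>\<sigma> = 1 \<or> \<sigma> = -1; k < M * 2^K\<rbrakk> \<Longrightarrow> rad (2^K) \<sigma> k \<le> exp (real M)"
    using exists_fine_mesh[OF \<rho>(1), of M] by blast
  define N where "N = (2::nat)^K"
  note K = K[folded N_def]
  have N0: "N > 0" unfolding N_def by simp
  show thesis
  proof (rule grid_conditions[OF N_def V \<beta>])
  fix \<Lambda> :: "((real \<Rightarrow> nat \<Rightarrow> nat \<Rightarrow> complex) \<Rightarrow> complex) set" and F F'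
  assume
    \<Lambda>: "finite \<Lambda>" "finite F" "F \<subseteq> {i. A V i > 1/4}" "finite F'" "F' \<subseteq> {i. \<beta> i > thr / 9}"
    "\<And>l n c W. l \<in> \<Lambda> \<Longrightarrow> l (\<lambda>\<sigma> k j. \<Sum>i<(n::nat). c i * W i \<sigma> k j) = (\<Sum>i<n. c i * l (W i))"
    "real (card \<Lambda>) \<le> 1 + 4 * (\<Sum>i\<in>F. sqrt (A V i)) + 153 / thr * (\<Sum>i\<in>F'. \<beta> i)"
    "\<And>W. \<lbrakk>\<And>j. W (-1) 0 j = W 1 0 j; \<forall>l\<in>\<Lambda>. l W = 0\<rbrakk> \<Longrightarrow>
      (\<Sum>\<sigma>\<in>{1,-1}. \<Sum>k<2^m*N. \<Sum>j<N. cell_mass V N \<sigma> k j * (cmod (W \<sigma> k j))\<^sup>2)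
      \<le> (\<Sum>\<sigma>\<in>{1,-1}. (7/2 + 3200000 * thr) * (\<Sum>k<2^m*N. \<Sum>j<N. (cmod (W \<sigma> (Suc k) j - W \<sigma> k j))\<^sup>2)
        + 800000 * thr * (\<Sum>k<2^m*N. \<Sum>j<N-1. (cmod (W \<sigma> k (Suc j) - W \<sigma> k j))\<^sup>2))"
  have "card \<Lambda> < n" using count[OF \<Lambda>(2-5)] \<Lambda>(7) by linarith
  then have cl: "card \<Lambda> < card {..<n}" by simp
  define a where "a l i = l (\<lambda>\<sigma> k j. w i (node N \<sigma> k j))" for l :: "(real \<Rightarrow> nat \<Rightarrow> nat \<Rightarrow> complex) \<Rightarrow> complex" and i
  obtain c where c: "\<And>i. i \<in> {..<n} \<Longrightarrow> cmod (c i) \<le> 1" "\<exists>i\<in>{..<n}. c i = 1"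
    "\<And>l. l \<in> \<Lambda> \<Longrightarrow> (\<Sum>i<n. c i * a l i) = 0"
    using normalized_solution[OF \<Lambda>(1) finite_lessThan cl, of a] by blast
  define u where "u x = (\<Sum>i<n. c i * w i x)" for x
  define Du where "Du x = (\<Sum>i<n. c i * fst (D i x), \<Sum>i<n. c i * snd (D i x))" for x
  have ug: "has_gradient u Du" unfolding u_def Du_def by (rule has_gradient_sum[OF w])
  have grid: "(\<Sum>\<sigma>\<in>{1,-1}. \<Sum>k<M*N. \<Sum>j<N. cell_mass V N \<sigma> k j * (cmod (u (node N \<sigma> k j)))\<^sup>2)
      \<le> (\<Sum>\<sigma>\<in>{1,-1}. (7/2 + 3200000 * thr) * (\<Sum>k<M*N. \<Sum>j<N. (cmod (u (node N \<sigma> (Suc k) j) - u (node N \<sigma> k j)))\<^sup>2)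
        + 800000 * thr * (\<Sum>k<M*N. \<Sum>j<N-1. (cmod (u (node N \<sigma> k (Suc j)) - u (node N \<sigma> k j)))\<^sup>2))"
    unfolding M_def
  proof (rule \<Lambda>(8)[of "\<lambda>\<sigma> k j. u (node N \<sigma> k j)"])
    show "\<forall>l\<in>\<Lambda>. l (\<lambda>\<sigma> k j. u (node N \<sigma> k j)) = 0"
      using \<Lambda>(6)[where n = n and c = c and W = "\<lambda>i \<sigma> k j. w i (node N \<sigma> k j)"] c(3) unfolding u_def a_def by simp
  qed (simp add: node_0)
  have osc: "\<And>i. i < n \<Longrightarrow> norm (w i y - w i z) \<le> \<epsilon>" "\<And>i. i < n \<Longrightarrow> norm (D i y - D i z) \<le> \<epsilon>"
    if q: "(\<sigma>, k, j) \<in> cell_index N (M*N)" and "norm (y - node N \<sigma> k j) \<le> \<rho>" "norm (z - node N \<sigma> k j) \<le> \<rho>"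
    for \<sigma> k j y z
  proof -
    have q': "\<sigma> = 1 \<or> \<sigma> = -1" "k < M*N" using q unfolding cell_index_def by auto
    have nn: "norm (node N \<sigma> k j) \<le> exp (real M)" unfolding node_def using K(2)[OF q'] by simp
    have "norm y \<le> norm (y - node N \<sigma> k j) + norm (node N \<sigma> k j)" by (metis diff_add_cancel norm_triangle_ineq)
    then have yR: "norm y \<le> R" using that nn \<rho>(4) unfolding R_def by linarith
    have "norm z \<le> norm (z - node N \<sigma> k j) + norm (node N \<sigma> k j)" by (metis diff_add_cancel norm_triangle_ineq)
    then have zR: "norm z \<le> R" using that nn \<rho>(4) unfolding R_def by linarith
    have "norm (y - z) \<le> norm (y - node N \<sigma> k j) + norm (z - node N \<sigma> k j)"
      using norm_triangle_ineq4[of "y - node N \<sigma> k j" "z - node N \<sigma> k j"] by simp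
    then have yz: "norm (y - z) \<le> 2 * \<rho>" using that by linarith
    show "norm (w i y - w i z) \<le> \<epsilon>" if "i < n" for i using \<rho>1(2)[OF that yR zR] yz \<rho>(2) by linarith
    show "norm (D i y - D i z) \<le> \<epsilon>" if "i < n" for i using \<rho>2(2)[OF that yR zR] yz \<rho>(3) by linarith
  qed
  have n\<epsilon>: "(\<Sum>i<n. \<epsilon>) = \<eta>" unfolding \<epsilon>_def using n0 by simp
  have uosc: "cmod (u y - u z) \<le> \<eta>" if "\<And>i. i < n \<Longrightarrow> norm (w i y - w i z) \<le> \<epsilon>" for y z
  proof -
    have "u y - u z = (\<Sum>i<n. c i * (w i y - w i z))" unfolding u_def by (simp add: sum_subtractf right_diff_distrib)
    also have "cmod \<dots> \<le> (\<Sum>i<n. cmod (c i) * cmod (w i y - w i z))"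
      by (rule order_trans[OF norm_sum]) (simp add: norm_mult)
    also have "\<dots> \<le> (\<Sum>i<n. 1 * \<epsilon>)" using c(1) that \<epsilon> by (intro sum_mono mult_mono) auto
    finally show ?thesis using n\<epsilon> by simp
  qed
  have Dosc: "norm (Du y - Du z) \<le> \<eta>" if "\<And>i. i < n \<Longrightarrow> norm (D i y - D i z) \<le> \<epsilon>" for y z
  proof -
    have "Du y - Du z = (\<Sum>i<n. (c i * fst (D i y - D i z), c i * snd (D i y - D i z)))"
      unfolding Du_def by (simp add: prod_eq_iff fst_sum snd_sum sum_subtractf right_diff_distrib)
    also have "norm \<dots> \<le> (\<Sum>i<n. norm (c i * fst (D i y - D i z), c i * snd (D i y - D i z)))" by (rule norm_sum)
    also have "\<dots> = (\<Sum>i<n. cmod (c i) * norm (D i y - D i z))"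
    proof (intro sum.cong refl)
      fix i
      have "norm (c i * p, c i * q) = cmod (c i) * norm (p, q)" for p q :: complex
        by (simp add: norm_Pair norm_mult power_mult_distrib real_sqrt_mult flip: distrib_left)
      from this[of "fst (D i y - D i z)" "snd (D i y - D i z)"]
      show "norm (c i * fst (D i y - D i z), c i * snd (D i y - D i z)) = cmod (c i) * norm (D i y - D i z)"
        by (simp only: prod.collapse)
    qed
    also have "\<dots> \<le> (\<Sum>i<n. 1 * \<epsilon>)" using c(1) that \<epsilon> by (intro sum_mono mult_mono) auto
    finally show ?thesis using n\<epsilon> by simp
  qed
  have near: "norm (y - node N \<sigma> k j) \<le> \<rho>" if q: "(\<sigma>, k, j) \<in> cell_index N (M*N)" and y: "y \<in> cell N \<sigma> k j" for \<sigma> k j y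
  proof -
    have q': "\<sigma> = 1 \<or> \<sigma> = -1" "k < M*N" "j < N" using q unfolding cell_index_def by auto
    show ?thesis using dist_node_cell[OF N0 q'(3) q'(1) y] K(1)[OF q'(1,2)] by linarith
  qed
  have main: "(LINT x|lebesgue. indicator ?A x * V x * (cmod (u x))\<^sup>2)
    \<le> 51/50 * ((7/2 + 3200000 * thr) / (2 * pi) + 18 * pi * (800000 * thr)) * (LINT x|lebesgue. indicator ?A x * (norm (Du x) + \<eta>)\<^sup>2)
      + 51 * \<eta>\<^sup>2 * (LINT x|lebesgue. indicator ?A x * V x)"
  proof (rule grid_to_integral_bound[OF N0 ug V _ _ _ _ grid[unfolded cell_mass_def]])
    fix \<sigma> k j y assume q: "(\<sigma>, k, j) \<in> cell_index N (M*N)" and y: "y \<in> cell N \<sigma> k j"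
    have "cmod (u y - u (node N \<sigma> k j)) \<le> \<eta>"
      using uosc osc(1)[OF q near[OF q y], of "node N \<sigma> k j"] \<rho>(1) by simp
    then show "cmod (u y) \<le> cmod (u (node N \<sigma> k j)) + \<eta>"
      using norm_triangle_ineq2[of "u y" "u (node N \<sigma> k j)"] by linarith
    fix z assume z: "norm (z - node N \<sigma> k j) \<le> \<bar>rad N \<sigma> (Suc k) - rad N \<sigma> k\<bar> + rad N \<sigma> k * (2 * pi / real N)"
    have q': "\<sigma> = 1 \<or> \<sigma> = -1" "k < M*N" using q unfolding cell_index_def by auto
    have "norm (z - node N \<sigma> k j) \<le> \<rho>" using z K(1)[OF q'] by linarith
    then have "norm (Du z - Du y) \<le> \<eta>" using Dosc osc(2)[OF q _ near[OF q y], of z] by simp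
    then show "norm (Du z) \<le> norm (Du y) + \<eta>" using norm_triangle_ineq2[of "Du z" "Du y"] by linarith
  qed (auto simp: thr_def)
  have cDu: "continuous_on UNIV Du" using ug unfolding has_gradient_def by simp
  have As: "?A \<in> lmeasurable" using annulus_lmeasurable bounded_set_imp_lmeasurable by blast
  have intD: "integrable lebesgue (\<lambda>x. indicator ?A x * (norm (Du x))\<^sup>2)"
    using annulus_lmeasurable by (intro integrable_indicator_continuous continuous_intros cDu)
  define X where "X = (LINT x|lebesgue. indicator ?A x * (norm (Du x))\<^sup>2)"
  have X0: "X \<ge> 0" unfolding X_def by (intro integral_nonneg_AE) auto
  have Y: "(LINT x|lebesgue. indicator ?A x * (norm (Du x) + \<eta>)\<^sup>2) \<le> 51/50 * X + 51 * \<eta>\<^sup>2 * I1"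
  proof -
    have "(LINT x|lebesgue. indicator ?A x * (norm (Du x) + \<eta>)\<^sup>2)
      \<le> (LINT x|lebesgue. 51/50 * (indicator ?A x * (norm (Du x))\<^sup>2) + 51 * \<eta>\<^sup>2 * indicator ?A x)"
    proof (rule integral_mono)
      show "integrable lebesgue (\<lambda>x. indicator ?A x * (norm (Du x) + \<eta>)\<^sup>2)"
        using annulus_lmeasurable by (intro integrable_indicator_continuous continuous_intros cDu)
      show "integrable lebesgue (\<lambda>x. 51/50 * (indicator ?A x * (norm (Du x))\<^sup>2) + 51 * \<eta>\<^sup>2 * indicator ?A x)"
        using intD integrable_indicator_lmeasurable[OF As] by simp
      fix x show "indicator ?A x * (norm (Du x) + \<eta>)\<^sup>2 \<le> 51/50 * (indicator ?A x * (norm (Du x))\<^sup>2) + 51 * \<eta>\<^sup>2 * indicator ?A x"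
        using square_add_le[of "norm (Du x)" \<eta>] by (cases "x \<in> ?A") auto
    qed
    also have "\<dots> = 51/50 * X + 51 * \<eta>\<^sup>2 * I1"
      unfolding X_def I1_def using intD integrable_indicator_lmeasurable[OF As] As by simp
    finally show ?thesis .
  qed
  \<comment> \<open>With no more than 2 \<le> \<pi> < 4, the bracket is at most 0.95, and 0.95 *
    (51/50)^2 < 1. The second factor 51/50 comes from \<open>Y\<close>.\<close>
  define \<kappa> where "\<kappa> = 51/50 * ((7/2 + 3200000 * thr) / (2 * pi) + 18 * pi * (800000 * thr))"
  have \<kappa>: "0 \<le> \<kappa>" "\<kappa> * (51/50) \<le> 1" "\<kappa> \<le> 1"
  proof -
    have "(7/2 + 3200000 * thr) / (2 * pi) \<le> (7/2 + 3200000 * thr) / 4"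
      using pi_ge_two by (intro divide_left_mono) (auto simp: thr_def)
    moreover have "18 * pi * (800000 * thr) \<le> 18 * 4 * (800000 * thr)"
      using pi_less_4 by (intro mult_right_mono) (auto simp: thr_def)
    ultimately have le: "(7/2 + 3200000 * thr) / (2 * pi) + 18 * pi * (800000 * thr) \<le> 95/100"
      by (simp add: thr_def)
    have "\<kappa> \<le> 51/50 * (95/100)" unfolding \<kappa>_def by (rule mult_left_mono[OF le]) simp
    then show "\<kappa> * (51/50) \<le> 1" "\<kappa> \<le> 1" by simp_all
    show "0 \<le> \<kappa>" unfolding \<kappa>_def by (simp add: thr_def)
  qed
  have "(LINT x|lebesgue. indicator ?A x * V x * (cmod (u x))\<^sup>2)
    \<le> \<kappa> * (51/50 * X + 51 * \<eta>\<^sup>2 * I1) + 51 * \<eta>\<^sup>2 * I2"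
    using main mult_left_mono[OF Y \<kappa>(1)] unfolding \<kappa>_def I2_def by linarith
  also have "\<dots> \<le> X + e"
  proof -
    have "\<kappa> * (51/50) * X \<le> 1 * X" using \<kappa>(2) X0 by (rule mult_right_mono)
    moreover have "\<kappa> * (51 * \<eta>\<^sup>2 * I1) \<le> 1 * (51 * \<eta>\<^sup>2 * I1)" using \<kappa>(3) I0 by (intro mult_right_mono) auto
    ultimately show ?thesis using \<eta>(2) by (simp add: distrib_left)
  qed
  finally show thesis
    using c(1,2) that[of c] unfolding X_def Du_def u_def M by auto
  qed
qed

section \<open>Smooth bump functions\<close>

text \<open>Smoothness of order k on the line, with an existentially quantified derivative: sums,
  products and affine substitutions then go through by induction, and \<open>C_k_product\<close>
  carries the result over to \<open>C_k\<close> on the plane.\<close>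

fun ck :: "nat \<Rightarrow> (real \<Rightarrow> real) \<Rightarrow> bool" where
  "ck 0 f \<longleftrightarrow> continuous_on UNIV f"
| "ck (Suc k) f \<longleftrightarrow> (\<exists>f'. (\<forall>t. (f has_real_derivative f' t) (at t)) \<and> ck k f')"

lemma ck_continuous: "ck k f \<Longrightarrow> continuous_on UNIV f"
proof (cases k)
  case (Suc l)
  assume "ck k f"
  then obtain f' where "\<forall>t. (f has_real_derivative f' t) (at t)" unfolding Suc by auto
  then show ?thesis by (intro continuous_at_imp_continuous_on) (blast intro: DERIV_isCont)
qed simp

lemma ck_Suc_imp: "ck (Suc k) f \<Longrightarrow> ck k f"
proof (induction k arbitrary: f)
  case 0
  then show ?case using ck_continuous[of "Suc 0" f] by (simp only: ck.simps(1))
next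
  case (Suc k)
  then obtain f' where "\<forall>t. (f has_real_derivative f' t) (at t)" "ck (Suc k) f'" by auto
  then show ?case using Suc.IH by auto
qed

lemma ck_add: "ck k f \<Longrightarrow> ck k g \<Longrightarrow> ck k (\<lambda>t. f t + g t)"
proof (induction k arbitrary: f g)
  case (Suc k)
  then obtain f' g' where "\<forall>t. (f has_real_derivative f' t) (at t)" "ck k f'"
    "\<forall>t. (g has_real_derivative g' t) (at t)" "ck k g'" by auto
  then show ?case using Suc.IH[of f' g'] by (auto intro!: exI[of _ "\<lambda>t. f' t + g' t"] DERIV_add)
qed (simp add: continuous_on_add)

lemma ck_mult: "ck k f \<Longrightarrow> ck k g \<Longrightarrow> ck k (\<lambda>t. f t * g t)"
proof (induction k arbitrary: f g)
  case (Suc k)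
  then obtain f' g' where *: "\<forall>t. (f has_real_derivative f' t) (at t)" "ck k f'"
    "\<forall>t. (g has_real_derivative g' t) (at t)" "ck k g'" by auto
  have "ck k f" "ck k g" using Suc.prems by (auto intro: ck_Suc_imp simp del: ck.simps)
  then have "ck k (\<lambda>t. f' t * g t + f t * g' t)" using Suc.IH * by (intro ck_add) auto
  then show ?case using * by (auto intro!: exI[of _ "\<lambda>t. f' t * g t + f t * g' t"] derivative_eq_intros)
qed (simp add: continuous_on_mult)

lemma ck_const: "ck k (\<lambda>t. c)"
  by (induction k arbitrary: c) (auto intro!: exI[of _ "\<lambda>_. 0"])

lemma ck_affine: "ck k f \<Longrightarrow> ck k (\<lambda>t. f (a * t + b))"
proof (induction k arbitrary: f)
  case 0
  then have "continuous_on UNIV f" by simp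
  then show ?case by (simp, rule continuous_on_compose2) (intro continuous_intros, simp)
next
  case (Suc k)
  then obtain f' where *: "\<forall>t. (f has_real_derivative f' t) (at t)" "ck k f'" by auto
  have "ck k (\<lambda>t. a * f' (a * t + b))" by (intro ck_mult ck_const Suc.IH *(2))
  moreover have "((\<lambda>t. f (a * t + b)) has_real_derivative a * f' (a * t + b)) (at t)" for t
  proof -
    have "((\<lambda>t. a * t + b) has_real_derivative a) (at t)" by (auto intro!: derivative_eq_intros)
    from DERIV_chain2[OF spec[OF *(1), of "a * t + b"] this] show ?thesis by (simp add: mult.commute)
  qed
  ultimately show ?case unfolding ck.simps by (intro exI[of _ "\<lambda>t. a * f' (a * t + b)"] conjI allI)
qed

text \<open>This family is closed under differentiation, with X^2 (p - p') in place of p. So the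
  smoothness of exp (-1/t) at 0 follows by induction over all p at once.\<close>

definition flat :: "real poly \<Rightarrow> real \<Rightarrow> real" where
  "flat p t = (if t \<le> 0 then 0 else poly p (1 / t) * exp (- (1 / t)))"

lemma poly_exp_tendsto_0: "((\<lambda>x::real. poly p x * exp (- x)) \<longlongrightarrow> 0) at_top"
proof -
  have "((\<lambda>x::real. \<Sum>i\<le>degree p. coeff p i * (x ^ i / exp x)) \<longlongrightarrow> (\<Sum>i\<le>degree p. coeff p i * 0)) at_top"
    by (intro tendsto_sum tendsto_mult tendsto_const tendsto_power_div_exp_0)
  moreover have "(\<Sum>i\<le>degree p. coeff p i * (x ^ i / exp x)) = poly p x * exp (- x)" for x
    unfolding poly_altdef sum_distrib_right by (intro sum.cong refl) (simp add: exp_minus field_simps)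
  ultimately show ?thesis by simp
qed

lemma flat_DERIV:
  "(flat p has_real_derivative flat ([:0, 0, 1:] * (p - pderiv p)) t) (at t)"
proof -
  consider "t < 0" | "t > 0" | "t = 0" by linarith
  then show ?thesis
  proof cases
    case 1
    have "((\<lambda>_. 0) has_real_derivative 0) (at t)" by simp
    then have "(flat p has_real_derivative 0) (at t)"
      by (rule has_field_derivative_transform_within_open[of _ _ _ "{..<0}"]) (use 1 in \<open>auto simp: flat_def\<close>)
    then show ?thesis using 1 by (simp add: flat_def)
  next
    case 2
    have "((\<lambda>t. poly p (1 / t) * exp (- (1 / t))) has_real_derivative
        flat ([:0, 0, 1:] * (p - pderiv p)) t) (at t)"
      using 2 by (auto intro!: derivative_eq_intros poly_DERIV[THEN DERIV_chain2] simp: flat_def power2_eq_square field_simps)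
    then show ?thesis
      by (rule has_field_derivative_transform_within_open[of _ _ _ "{0<..}"]) (use 2 in \<open>auto simp: flat_def\<close>)
  next
    case 3
    have "((\<lambda>h. flat p h / h) \<longlongrightarrow> 0) (at_right 0)"
    proof -
      \<comment> \<open>For h > 0 the difference quotient at 0 is of the same kind, with X p in
        place of p.\<close>
      have "((\<lambda>h::real. poly ([:0, 1:] * p) (inverse h) * exp (- inverse h)) \<longlongrightarrow> 0) (at_right 0)"
        by (rule filterlim_compose[OF poly_exp_tendsto_0 filterlim_inverse_at_top_right])
      moreover have "\<forall>\<^sub>F h in at_right (0::real). poly ([:0, 1:] * p) (inverse h) * exp (- inverse h) = flat p h / h"
        by (intro eventually_at_right_less[THEN eventually_mono]) (auto simp: flat_def field_simps)
      ultimately show ?thesis by (rule Lim_transform_eventually)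
    qed
    moreover have "((\<lambda>h. flat p h / h) \<longlongrightarrow> 0) (at_left 0)"
    proof (rule Lim_transform_eventually[OF tendsto_const])
      show "\<forall>\<^sub>F h in at_left (0::real). 0 = flat p h / h"
        unfolding eventually_at_left_field by (intro exI[of _ "-1"]) (auto simp: flat_def)
    qed
    ultimately have "((\<lambda>h. flat p h / h) \<longlongrightarrow> 0) (at 0)" by (simp add: filterlim_split_at)
    then show ?thesis unfolding 3 DERIV_def by (simp add: flat_def)
  qed
qed

lemma ck_flat: "ck k (flat p)"
proof (induction k arbitrary: p)
  case 0
  have "continuous_on UNIV (flat p)" using flat_DERIV by (blast intro: DERIV_continuous_on has_field_derivative_at_within)
  then show ?case by simp
next
  case (Suc k)
  then show ?case using flat_DERIV by auto
qed

text \<open>A smooth even function that is positive exactly on (-1, 1). The arguments 1 * t + 1 and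
  (-1) * t + 1 have the form that \<open>ck_affine\<close> expects.\<close>

definition bump :: "real \<Rightarrow> real" where
  "bump t = flat 1 (1 * t + 1) * flat 1 ((-1) * t + 1)"

lemma ck_bump: "ck k bump" unfolding bump_def[abs_def] by (intro ck_mult ck_affine ck_flat)

lemma bump_nonneg: "bump t \<ge> 0" by (simp add: bump_def flat_def)
lemma bump_pos: "\<bar>t\<bar> < 1 \<Longrightarrow> bump t > 0" by (simp add: bump_def flat_def)
lemma bump_eq_0: "\<bar>t\<bar> \<ge> 1 \<Longrightarrow> bump t = 0" by (auto simp: bump_def flat_def)

lemma partial_product:
  assumes "\<And>t. (f has_real_derivative f' t) (at t)" "\<And>t. (g has_real_derivative g' t) (at t)"
  shows "((\<lambda>x::real^2. f (x$1) * g (x$2)) has_derivative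
      (\<lambda>h. h$1 * (f' (x$1) * g (x$2)) + h$2 * (f (x$1) * g' (x$2)))) (at x)"
    "partial 1 (\<lambda>x::real^2. f (x$1) * g (x$2)) = (\<lambda>x. f' (x$1) * g (x$2))"
    "partial 2 (\<lambda>x::real^2. f (x$1) * g (x$2)) = (\<lambda>x. f (x$1) * g' (x$2))"
proof -
  have c: "((\<lambda>x::real^2. k (x$i)) has_derivative (\<lambda>h. h$i * k' (x$i))) (at x)"
    if "\<And>t. (k has_real_derivative k' t) (at t)" for k k' i x
  proof -
    have "(k has_derivative (\<lambda>h. h * k' (x$i))) (at (x$i))"
      using that[of "x$i"] unfolding has_field_derivative_def by (rule has_derivative_eq_rhs) (simp add: fun_eq_iff)
    from diff_chain_at[OF bounded_linear_imp_has_derivative[OF bounded_linear_vec_nth] this]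
    show ?thesis by (simp add: o_def)
  qed
  show d: "((\<lambda>x::real^2. f (x$1) * g (x$2)) has_derivative
      (\<lambda>h. h$1 * (f' (x$1) * g (x$2)) + h$2 * (f (x$1) * g' (x$2)))) (at x)" for x
    by (rule has_derivative_eq_rhs[OF has_derivative_mult[OF c[of f f' 1 x, OF assms(1)] c[of g g' 2 x, OF assms(2)]]])
      (simp add: fun_eq_iff algebra_simps)
  have fd: "frechet_derivative (\<lambda>x::real^2. f (x$1) * g (x$2)) (at x)
    = (\<lambda>h. h$1 * (f' (x$1) * g (x$2)) + h$2 * (f (x$1) * g' (x$2)))" for x
    by (rule frechet_derivative_at[OF d, symmetric])
  show "partial 1 (\<lambda>x::real^2. f (x$1) * g (x$2)) = (\<lambda>x. f' (x$1) * g (x$2))"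
    "partial 2 (\<lambda>x::real^2. f (x$1) * g (x$2)) = (\<lambda>x. f (x$1) * g' (x$2))"
    unfolding partial_def fd by (simp_all add: axis_def)
qed

lemma C_k_product: "ck k f \<Longrightarrow> ck k g \<Longrightarrow> C_k k (\<lambda>x. f (x$1) * g (x$2))"
proof (induction k arbitrary: f g)
  case 0
  then have "continuous_on UNIV (\<lambda>x::real^2. f (x$1))" "continuous_on UNIV (\<lambda>x::real^2. g (x$2))"
    by (auto intro!: continuous_on_compose2[of UNIV f] continuous_on_compose2[of UNIV g] continuous_on_component)
  then show ?case by (simp add: continuous_on_mult)
next
  case (Suc k)
  then obtain f' g' where *: "\<And>t. (f has_real_derivative f' t) (at t)" "ck k f'"
    "\<And>t. (g has_real_derivative g' t) (at t)" "ck k g'" by auto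
  have fg: "ck k f" "ck k g" using Suc.prems by (auto intro: ck_Suc_imp simp del: ck.simps)
  note pp = partial_product[of f f' g g', OF *(1,3)]
  have "(\<lambda>x::real^2. f (x$1) * g (x$2)) differentiable_on UNIV"
    unfolding differentiable_on_def differentiable_def using pp(1) by auto
  moreover have "C_k k (partial i (\<lambda>x. f (x$1) * g (x$2)))" for i
    using exhaust_2[of i] Suc.IH[OF *(2) fg(2)] Suc.IH[OF fg(1) *(4)] by (auto simp: pp(2,3))
  ultimately show ?case by simp
qed

lemma test_function_product:
  assumes "\<And>k. ck k f" "\<And>k. ck k g" and "\<And>t. \<bar>t\<bar> > r \<Longrightarrow> f t = 0" "\<And>t. \<bar>t\<bar> > r \<Longrightarrow> g t = 0"
  shows "test_function (\<lambda>x. f (x$1) * g (x$2))"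
  unfolding test_function_def
proof (intro conjI allI)
  show "C_k k (\<lambda>x. f (x$1) * g (x$2))" for k by (rule C_k_product[OF assms(1,2)])
  have "{x::real^2. f (x$1) * g (x$2) \<noteq> 0} \<subseteq> cball 0 (2 * \<bar>r\<bar>)"
  proof
    fix x :: "real^2" assume "x \<in> {x. f (x$1) * g (x$2) \<noteq> 0}"
    then have "\<bar>x$1\<bar> \<le> r" "\<bar>x$2\<bar> \<le> r" using assms(3)[of "x$1"] assms(4)[of "x$2"] by (auto simp: not_less[symmetric])
    then have "norm x \<le> \<bar>x$1\<bar> + \<bar>x$2\<bar>" "\<bar>x$1\<bar> + \<bar>x$2\<bar> \<le> 2 * \<bar>r\<bar>"
      using norm_le_l1_cart[of x] by (auto simp: sum_2)
    then show "x \<in> cball 0 (2 * \<bar>r\<bar>)" by simp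
  qed
  then have "bounded {x::real^2. f (x$1) * g (x$2) \<noteq> 0}" using bounded_cball bounded_subset by blast
  then show "compact (closure {x::real^2. f (x$1) * g (x$2) \<noteq> 0})" by (simp add: compact_closure)
qed

section \<open>Mollification\<close>

definition kernel :: "real \<Rightarrow> (real^2 \<Rightarrow> real) \<Rightarrow> bool" where
  "kernel r \<kappa> \<longleftrightarrow> continuous_on UNIV \<kappa> \<and> (\<forall>z. norm z > r \<longrightarrow> \<kappa> z = 0)"

definition conv :: "(real^2 \<Rightarrow> real) \<Rightarrow> (real^2 \<Rightarrow> complex) \<Rightarrow> real^2 \<Rightarrow> complex" where
  "conv \<kappa> f x = (LINT y|lebesgue. \<kappa> (x - y) *\<^sub>R f y)"

lemma kernel_bounded:
  assumes "kernel r \<kappa>"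
  obtains C where "C > 0" "\<And>z. \<bar>\<kappa> z\<bar> \<le> C"
proof -
  have "continuous_on (cball 0 r) \<kappa>" using assms unfolding kernel_def by (blast intro: continuous_on_subset)
  then have "bounded (\<kappa> ` cball 0 r)" by (intro compact_imp_bounded compact_continuous_image) auto
  then obtain C where C: "\<forall>y\<in>\<kappa> ` cball 0 r. norm y \<le> C" unfolding bounded_iff by blast
  have "\<bar>\<kappa> z\<bar> \<le> \<bar>C\<bar> + 1" for z
  proof (cases "norm z \<le> r")
    case True
    then have "\<kappa> z \<in> \<kappa> ` cball 0 r" by simp
    then have "\<bar>\<kappa> z\<bar> \<le> C" using C by (metis real_norm_def)
    then show ?thesis by linarith
  qed (use assms in \<open>simp add: kernel_def\<close>)
  then show thesis by (intro that[of "\<bar>C\<bar> + 1"]) auto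
qed

lemma kernel_uniformly_continuous:
  assumes k: "kernel r \<kappa>" and e: "e > 0"
  obtains d where "d > 0" "d \<le> 1" "\<And>z z'. norm (z - z') < d \<Longrightarrow> \<bar>\<kappa> z - \<kappa> z'\<bar> < e"
proof -
  have "continuous_on (cball 0 (r + 1)) \<kappa>" using k unfolding kernel_def by (blast intro: continuous_on_subset)
  then have "uniformly_continuous_on (cball 0 (r + 1)) \<kappa>" by (rule compact_uniformly_continuous) simp
  then obtain d where d: "d > 0" "\<And>z z'. z \<in> cball 0 (r+1) \<Longrightarrow> z' \<in> cball 0 (r+1) \<Longrightarrow> dist z' z < d \<Longrightarrow> dist (\<kappa> z') (\<kappa> z) < e"
    unfolding uniformly_continuous_on_def using e by blast
  show thesis
  proof (rule that[of "min d 1"])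
    fix z z' :: "real^2" assume zz: "norm (z - z') < min d 1"
    show "\<bar>\<kappa> z - \<kappa> z'\<bar> < e"
    proof (cases "norm z \<le> r + 1 \<and> norm z' \<le> r + 1")
      case True
      then show ?thesis using d(2)[of z' z] zz by (simp add: dist_norm)
    next
      case False
      have "norm z \<le> norm z' + norm (z - z')" "norm z' \<le> norm z + norm (z - z')"
        using norm_triangle_ineq[of z' "z - z'"] norm_triangle_ineq4[of z "z - z'"] by simp_all
      then have "norm z > r" "norm z' > r" using False zz by auto
      then show ?thesis using k e unfolding kernel_def by simp
    qed
  qed (use d in auto)
qed

lemma integrable_cball_locally_integrable:
  fixes f :: "real^2 \<Rightarrow> complex"
  assumes "locally_integrable f"
  shows "integrable lebesgue (\<lambda>y. indicator (cball a R) y *\<^sub>R f y)"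
proof -
  have "integrable (lebesgue_on (cball a R)) f" using assms unfolding locally_integrable_def by simp
  then show ?thesis by (simp add: integrable_restrict_space)
qed

text \<open>The bound by sup |K| times an L1 norm over a ball yields both the continuity and the
  differentiability of \<open>conv\<close>: K is then a difference of two shifted kernels or a
  Taylor remainder.\<close>

lemma integrable_kernel_mult:
  fixes f :: "real^2 \<Rightarrow> complex"
  assumes f: "locally_integrable f" and K: "continuous_on UNIV K" "\<And>y. \<bar>K y\<bar> \<le> e" "\<And>y. y \<notin> cball a R \<Longrightarrow> K y = 0"
  shows "integrable lebesgue (\<lambda>y. K y *\<^sub>R f y)"
    "norm (LINT y|lebesgue. K y *\<^sub>R f y) \<le> e * (LINT y|lebesgue. norm (indicator (cball a R) y *\<^sub>R f y))"
proof -
  let ?g = "\<lambda>y. indicator (cball a R) y *\<^sub>R f y"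
  have g: "integrable lebesgue ?g" by (rule integrable_cball_locally_integrable[OF f])
  have Km: "K \<in> borel_measurable lebesgue"
    using borel_measurable_continuous_onI[OF K(1)] by (intro measurable_completion) simp
  have eq: "K y *\<^sub>R f y = K y *\<^sub>R ?g y" for y using K(3)[of y] by (auto simp: indicator_def)
  have bd: "norm (K y *\<^sub>R f y) \<le> e * norm (?g y)" for y
    by (subst eq, subst norm_scaleR) (rule mult_right_mono[OF K(2)], simp)
  have int: "integrable lebesgue (\<lambda>y. e * norm (?g y))"
    by (intro integrable_mult_right Bochner_Integration.integrable_norm g)
  show i: "integrable lebesgue (\<lambda>y. K y *\<^sub>R f y)"
  proof (rule Bochner_Integration.integrable_bound[OF int])
    show "(\<lambda>y. K y *\<^sub>R f y) \<in> borel_measurable lebesgue"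
      unfolding eq using Km borel_measurable_integrable[OF g] by (rule borel_measurable_scaleR)
    show "AE y in lebesgue. norm (K y *\<^sub>R f y) \<le> norm (e * norm (?g y))"
      using bd by (intro AE_I2) (metis abs_ge_self order_trans real_norm_def)
  qed
  have "norm (LINT y|lebesgue. K y *\<^sub>R f y) \<le> (LINT y|lebesgue. norm (K y *\<^sub>R f y))" by (rule integral_norm_bound)
  also have "\<dots> \<le> (LINT y|lebesgue. e * norm (?g y))" by (rule integral_mono[OF Bochner_Integration.integrable_norm[OF i] int bd])
  finally show "norm (LINT y|lebesgue. K y *\<^sub>R f y) \<le> e * (LINT y|lebesgue. norm (?g y))" by simp
qed

lemma kernel_shift_continuous:
  assumes "kernel r \<kappa>"
  shows "continuous_on UNIV (\<lambda>y. \<kappa> (x - y))"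
proof -
  have "continuous_on UNIV \<kappa>" using assms unfolding kernel_def by simp
  moreover have "continuous_on UNIV (\<lambda>y. x - y)" by (intro continuous_intros)
  ultimately show ?thesis by (rule continuous_on_compose2) simp
qed

lemma conv_integrable:
  fixes f :: "real^2 \<Rightarrow> complex"
  assumes "kernel r \<kappa>" "locally_integrable f"
  shows "integrable lebesgue (\<lambda>y. \<kappa> (x - y) *\<^sub>R f y)"
proof -
  obtain C where C: "\<And>z. \<bar>\<kappa> z\<bar> \<le> C" using kernel_bounded[OF assms(1)] by metis
  show ?thesis
    by (rule integrable_kernel_mult(1)[OF assms(2) kernel_shift_continuous[OF assms(1)], where e = C and a = x and R = r])
      (use C assms(1) in \<open>auto simp: kernel_def dist_norm\<close>)
qed

lemma conv_continuous:
  assumes k: "kernel r \<kappa>" and f: "locally_integrable f"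
  shows "continuous_on UNIV (conv \<kappa> f)"
  unfolding continuous_on_iff
proof (intro ballI allI impI)
  fix x :: "real^2" and e :: real assume e: "e > 0"
  define I where "I = (LINT y|lebesgue. norm (indicator (cball x (r + 1)) y *\<^sub>R f y))"
  have I0: "I \<ge> 0" unfolding I_def by (intro integral_nonneg_AE) auto
  define e' where "e' = e / (I + 1)"
  have e': "e' > 0" "e' * I < e" unfolding e'_def using e I0 by (auto simp: field_simps)
  obtain d where d: "d > 0" "d \<le> 1" "\<And>z z'. norm (z - z') < d \<Longrightarrow> \<bar>\<kappa> z - \<kappa> z'\<bar> < e'"
    using kernel_uniformly_continuous[OF k e'(1)] by blast
  have c: "continuous_on UNIV (\<lambda>y. \<kappa> (x - y))" for x
    by (rule kernel_shift_continuous[OF k])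
  have "dist (conv \<kappa> f x') (conv \<kappa> f x) < e" if x': "dist x' x < d" for x'
  proof -
    have xx: "norm (x' - x) < d" using x' by (simp add: dist_norm)
    have "conv \<kappa> f x' - conv \<kappa> f x = (LINT y|lebesgue. (\<kappa> (x' - y) - \<kappa> (x - y)) *\<^sub>R f y)"
      unfolding conv_def using conv_integrable[OF k f] by (simp add: scaleR_diff_left)
    also have "norm \<dots> \<le> e' * I" unfolding I_def
    proof (rule integrable_kernel_mult(2)[OF f])
      show "continuous_on UNIV (\<lambda>y. \<kappa> (x' - y) - \<kappa> (x - y))" by (intro continuous_on_diff c)
      show "\<bar>\<kappa> (x' - y) - \<kappa> (x - y)\<bar> \<le> e'" for y using d(3)[of "x' - y" "x - y"] xx by simp
      show "\<kappa> (x' - y) - \<kappa> (x - y) = 0" if "y \<notin> cball x (r + 1)" for y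
      proof -
        have 1: "norm (x - y) > r + 1" using that by (simp add: dist_norm)
        have "norm (x - y) \<le> norm (x' - y) + norm (x' - x)"
          using norm_triangle_ineq4[of "x' - y" "x' - x"] by simp
        then have "norm (x' - y) > r" using 1 xx d(2) by linarith
        then show ?thesis using 1 k unfolding kernel_def by simp
      qed
    qed
    finally show ?thesis using e'(2) by (simp add: dist_norm)
  qed
  then show "\<exists>d>0. \<forall>x'\<in>UNIV. dist x' x < d \<longrightarrow> dist (conv \<kappa> f x') (conv \<kappa> f x) < e" using d(1) by blast
qed

text \<open>Differentiation under the integral. K is the first order Taylor remainder of \<kappa>.
  Uniform continuity of k1 and k2 makes it at most 2 e' |h| for all y at once, and for |h| < 1 it
  vanishes off the ball of radius r + 1.\<close>

lemma conv_has_gradient: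
  assumes k: "kernel r \<kappa>" and k1: "kernel r k1" and k2: "kernel r k2" and f: "locally_integrable f"
    and der: "\<And>z. (\<kappa> has_derivative (\<lambda>h. h$1 * k1 z + h$2 * k2 z)) (at z)"
  shows "has_gradient (conv \<kappa> f) (\<lambda>x. (conv k1 f x, conv k2 f x))"
  unfolding has_gradient_def
proof (intro conjI allI)
  show "continuous_on UNIV (\<lambda>x. (conv k1 f x, conv k2 f x))"
    by (intro continuous_on_Pair conv_continuous[OF k1 f] conv_continuous[OF k2 f])
  fix x :: "real^2"
  have c: "continuous_on UNIV (\<lambda>y. \<kappa>' (x - y))" if "kernel r \<kappa>'" for x \<kappa>'
    by (rule kernel_shift_continuous[OF that])
  have bl: "bounded_linear (\<lambda>h::real^2. (h$1) *\<^sub>R conv k1 f x + (h$2) *\<^sub>R conv k2 f x)"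
    by (intro bounded_linear_add bounded_linear_compose[OF bounded_linear_scaleR_left] bounded_linear_vec_nth)
  have "\<exists>d>0. \<forall>x'. norm (x' - x) < d \<longrightarrow>
    norm (conv \<kappa> f x' - conv \<kappa> f x - (((x' - x)$1) *\<^sub>R conv k1 f x + ((x' - x)$2) *\<^sub>R conv k2 f x)) \<le> e * norm (x' - x)"
    if e: "e > 0" for e
  proof -
    define I where "I = (LINT y|lebesgue. norm (indicator (cball x (r + 1)) y *\<^sub>R f y))"
    have I0: "I \<ge> 0" unfolding I_def by (intro integral_nonneg_AE) auto
    define e' where "e' = e / (2 * (I + 1))"
    have e': "e' > 0" "2 * e' * I \<le> e" unfolding e'_def using e I0 by (auto simp: field_simps)
    obtain d1 where d1: "d1 > 0" "d1 \<le> 1" "\<And>z z'. norm (z - z') < d1 \<Longrightarrow> \<bar>k1 z - k1 z'\<bar> < e'"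
      using kernel_uniformly_continuous[OF k1 e'(1)] by blast
    obtain d2 where d2: "d2 > 0" "d2 \<le> 1" "\<And>z z'. norm (z - z') < d2 \<Longrightarrow> \<bar>k2 z - k2 z'\<bar> < e'"
      using kernel_uniformly_continuous[OF k2 e'(1)] by blast
    define d where "d = min d1 d2"
    have d: "d > 0" "d \<le> 1" unfolding d_def using d1 d2 by auto
    have "norm (conv \<kappa> f x' - conv \<kappa> f x - (((x' - x)$1) *\<^sub>R conv k1 f x + ((x' - x)$2) *\<^sub>R conv k2 f x)) \<le> e * norm (x' - x)"
      if x': "norm (x' - x) < d" for x'
    proof -
      define h where "h = x' - x"
      define K where "K y = \<kappa> (x' - y) - \<kappa> (x - y) - (h$1 * k1 (x - y) + h$2 * k2 (x - y))" for y
      have "conv \<kappa> f x' - conv \<kappa> f x - ((h$1) *\<^sub>R conv k1 f x + (h$2) *\<^sub>R conv k2 f x) = (LINT y|lebesgue. K y *\<^sub>R f y)"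
      proof -
        note ii = conv_integrable[OF k f, of x'] conv_integrable[OF k f, of x] conv_integrable[OF k1 f, of x] conv_integrable[OF k2 f, of x]
        have *: "(LINT y|lebesgue. K y *\<^sub>R f y) = (LINT y|lebesgue. \<kappa> (x' - y) *\<^sub>R f y - \<kappa> (x - y) *\<^sub>R f y
            - ((h$1) *\<^sub>R (k1 (x - y) *\<^sub>R f y) + (h$2) *\<^sub>R (k2 (x - y) *\<^sub>R f y)))"
          unfolding K_def by (simp add: algebra_simps)
        show ?thesis unfolding conv_def * using ii
          by (simp only: Bochner_Integration.integral_diff Bochner_Integration.integral_add integral_scaleR_right
              integrable_scaleR_right Bochner_Integration.integrable_diff Bochner_Integration.integrable_add)
      qed
      also have "norm \<dots> \<le> (norm h * (2 * e')) * I" unfolding I_def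
      proof (rule integrable_kernel_mult(2)[OF f])
        show "continuous_on UNIV K" unfolding K_def[abs_def]
          by (intro continuous_on_diff continuous_on_add continuous_on_mult continuous_on_const c k k1 k2)
        fix y
        define z where "z = x - y"
        have xy: "x' - y = z + h" unfolding z_def h_def by simp
        have "norm (\<kappa> (z + h) - \<kappa> z - (\<lambda>h'::real^2. h'$1 * k1 z + h'$2 * k2 z) (z + h - z)) \<le> norm (z + h - z) * (2 * e')"
        proof (rule differentiable_bound_linearization[where S = "closed_segment z (z + h)"
              and f' = "\<lambda>\<zeta> h'::real^2. h'$1 * k1 \<zeta> + h'$2 * k2 \<zeta>" and ?x0.0 = z])
          show "z + t *\<^sub>R (z + h - z) \<in> closed_segment z (z + h)" if "t \<in> {0..1}" for t
            using that unfolding closed_segment_def by (auto intro!: exI[of _ t] simp: algebra_simps)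
          show "(\<kappa> has_derivative (\<lambda>h'::real^2. h'$1 * k1 \<zeta> + h'$2 * k2 \<zeta>)) (at \<zeta> within closed_segment z (z + h))" for \<zeta>
            by (rule has_derivative_at_withinI[OF der])
          fix \<zeta> assume "\<zeta> \<in> closed_segment z (z + h)"
          then have "norm (\<zeta> - z) \<le> norm (z + h - z)" by (rule segment_bound1)
          then have \<zeta>: "norm (\<zeta> - z) < d" using x' unfolding h_def by simp
          show "onorm ((\<lambda>h'::real^2. h'$1 * k1 \<zeta> + h'$2 * k2 \<zeta>) - (\<lambda>h'::real^2. h'$1 * k1 z + h'$2 * k2 z)) \<le> 2 * e'"
          proof (rule onorm_le)
            fix h' :: "real^2"
            have "norm (((\<lambda>h'::real^2. h'$1 * k1 \<zeta> + h'$2 * k2 \<zeta>) - (\<lambda>h'::real^2. h'$1 * k1 z + h'$2 * k2 z)) h')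
              = \<bar>h'$1 * (k1 \<zeta> - k1 z) + h'$2 * (k2 \<zeta> - k2 z)\<bar>" by (simp add: algebra_simps)
            also have "\<dots> \<le> \<bar>h'$1\<bar> * \<bar>k1 \<zeta> - k1 z\<bar> + \<bar>h'$2\<bar> * \<bar>k2 \<zeta> - k2 z\<bar>"
              unfolding abs_mult[symmetric] by (rule abs_triangle_ineq)
            also have "\<dots> \<le> norm h' * e' + norm h' * e'"
              using d1(3)[of \<zeta> z] d2(3)[of \<zeta> z] \<zeta> unfolding d_def
              by (intro add_mono mult_mono component_le_norm_cart) auto
            finally show "norm (((\<lambda>h'::real^2. h'$1 * k1 \<zeta> + h'$2 * k2 \<zeta>) - (\<lambda>h'::real^2. h'$1 * k1 z + h'$2 * k2 z)) h') \<le> 2 * e' * norm h'" by simp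
          qed
        qed simp
        then show "\<bar>K y\<bar> \<le> norm h * (2 * e')" unfolding K_def xy z_def[symmetric] by simp
        show "K y = 0" if "y \<notin> cball x (r + 1)"
        proof -
          have 1: "norm (x - y) > r + 1" using that by (simp add: dist_norm)
          have "norm (x - y) \<le> norm (x' - y) + norm (x' - x)"
            using norm_triangle_ineq4[of "x' - y" "x' - x"] by simp
          then have "norm (x' - y) > r" using 1 x' d(2) by linarith
          then show ?thesis using 1 k k1 k2 unfolding kernel_def K_def by simp
        qed
      qed
      also have "\<dots> = (2 * e' * I) * norm h" by simp
      also have "\<dots> \<le> e * norm h" using e'(2) by (intro mult_right_mono) auto
      finally show ?thesis unfolding h_def .
    qed
    then show ?thesis using d(1) by blast
  qed
  then show "(conv \<kappa> f has_derivative (\<lambda>h. (h$1) *\<^sub>R fst (conv k1 f x, conv k2 f x) + (h$2) *\<^sub>R snd (conv k1 f x, conv k2 f x))) (at x)"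
    unfolding has_derivative_at_alt using bl by simp
qed

section \<open>Mollifiers: contraction in L1 and L2, local approximation\<close>

definition mollifier :: "real \<Rightarrow> (real^2 \<Rightarrow> real) \<Rightarrow> bool" where
  "mollifier r \<kappa> \<longleftrightarrow> kernel r \<kappa> \<and> (\<forall>z. \<kappa> z \<ge> 0) \<and> (\<forall>z. \<kappa> (- z) = \<kappa> z) \<and> (\<integral>\<^sup>+z. ennreal (\<kappa> z) \<partial>lborel) = 1"

lemma nn_integral_lborel_translate:
  fixes f :: "'a::euclidean_space \<Rightarrow> ennreal"
  assumes "f \<in> borel_measurable borel"
  shows "(\<integral>\<^sup>+x. f (x - a) \<partial>lborel) = (\<integral>\<^sup>+x. f x \<partial>lborel)"
proof -
  have "(\<integral>\<^sup>+x. f x \<partial>lborel) = (\<integral>\<^sup>+x. f x \<partial>distr lborel borel ((+) (- a)))" by (simp add: lborel_distr_plus)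
  also have "\<dots> = (\<integral>\<^sup>+x. f (- a + x) \<partial>lborel)" using assms by (subst nn_integral_distr) auto
  finally show ?thesis by (simp add: add.commute)
qed

lemma kernel_measurable: "kernel r \<kappa> \<Longrightarrow> \<kappa> \<in> borel_measurable borel"
  unfolding kernel_def by (blast intro: borel_measurable_continuous_onI)

text \<open>F is only Lebesgue measurable. It is replaced by a Borel function equal to it almost
  everywhere before the two integrals are swapped over \<open>lborel\<close>.\<close>

lemma mollifier_Tonelli:
  assumes m: "mollifier r \<kappa>" and F: "F \<in> borel_measurable lebesgue"
  shows "(\<integral>\<^sup>+x. (\<integral>\<^sup>+y. ennreal (\<kappa> (x - y)) * F y \<partial>lebesgue) \<partial>lebesgue) = (\<integral>\<^sup>+y. F y \<partial>lebesgue)"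
proof -
  have km[measurable]: "\<kappa> \<in> borel_measurable borel" using m kernel_measurable unfolding mollifier_def by blast
  obtain G where G[measurable]: "G \<in> borel_measurable lborel" and FG: "AE x in lborel. F x = G x"
    using completion_ex_borel_measurable[OF F] by blast
  have FG': "AE x in lebesgue. F x = G x" using FG by (rule AE_completion)
  have "(\<integral>\<^sup>+x. (\<integral>\<^sup>+y. ennreal (\<kappa> (x - y)) * F y \<partial>lebesgue) \<partial>lebesgue)
    = (\<integral>\<^sup>+x. (\<integral>\<^sup>+y. ennreal (\<kappa> (x - y)) * G y \<partial>lborel) \<partial>lborel)"
    unfolding nn_integral_completion
    using FG by (intro nn_integral_cong nn_integral_cong_AE) (auto elim!: eventually_mono)
  also have "\<dots> = (\<integral>\<^sup>+y. (\<integral>\<^sup>+x. ennreal (\<kappa> (x - y)) * G y \<partial>lborel) \<partial>lborel)"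
    by (rule lborel_pair.Fubini'[symmetric]) measurable
  also have "\<dots> = (\<integral>\<^sup>+y. G y \<partial>lborel)"
  proof (intro nn_integral_cong)
    fix y
    have "(\<integral>\<^sup>+x. ennreal (\<kappa> (x - y)) * G y \<partial>lborel) = (\<integral>\<^sup>+x. ennreal (\<kappa> (x - y)) \<partial>lborel) * G y"
      by (rule nn_integral_multc) measurable
    also have "(\<integral>\<^sup>+x. ennreal (\<kappa> (x - y)) \<partial>lborel) = 1"
      using nn_integral_lborel_translate[of "\<lambda>x. ennreal (\<kappa> x)" y] m unfolding mollifier_def by simp
    finally show "(\<integral>\<^sup>+x. ennreal (\<kappa> (x - y)) * G y \<partial>lborel) = G y" by simp
  qed
  also have "\<dots> = (\<integral>\<^sup>+y. F y \<partial>lebesgue)"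
    unfolding nn_integral_completion using FG by (intro nn_integral_cong_AE) (auto elim!: eventually_mono)
  finally show ?thesis .
qed

text \<open>Evenness of \<kappa> turns \<kappa> (x - y) into the translate \<kappa> (y - x), whose
  total mass is 1.\<close>

lemma mollifier_integral:
  assumes m: "mollifier r \<kappa>"
  shows "integrable lebesgue (\<lambda>y. \<kappa> (x - y))" "(LINT y|lebesgue. \<kappa> (x - y)) = 1"
proof -
  have km[measurable]: "\<kappa> \<in> borel_measurable borel" using m kernel_measurable unfolding mollifier_def by blast
  have "(\<integral>\<^sup>+y. ennreal (\<kappa> (x - y)) \<partial>lborel) = (\<integral>\<^sup>+y. ennreal (\<kappa> (y - x)) \<partial>lborel)"
    using m unfolding mollifier_def by (intro nn_integral_cong) (metis minus_diff_eq)
  also have "\<dots> = 1"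
    using nn_integral_lborel_translate[of "\<lambda>x. ennreal (\<kappa> x)" x] m unfolding mollifier_def by simp
  finally have 1: "(\<integral>\<^sup>+y. ennreal (\<kappa> (x - y)) \<partial>lebesgue) = ennreal 1" by (simp add: nn_integral_completion)
  have k0: "\<kappa> z \<ge> 0" for z using m unfolding mollifier_def by blast
  have meas: "(\<lambda>y. \<kappa> (x - y)) \<in> borel_measurable lebesgue" by (rule measurable_completion) measurable
  show "integrable lebesgue (\<lambda>y. \<kappa> (x - y))"
    using 1 k0 meas by (intro integrableI_nonneg) auto
  show "(LINT y|lebesgue. \<kappa> (x - y)) = 1"
    using 1 k0 meas by (subst integral_eq_nn_integral) auto
qed

lemma conv_L1_le:
  assumes m: "mollifier r \<kappa>" and f: "locally_integrable f" and fm: "f \<in> borel_measurable lebesgue"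
  shows "(\<integral>\<^sup>+x. ennreal (norm (conv \<kappa> f x)) \<partial>lebesgue) \<le> (\<integral>\<^sup>+y. ennreal (norm (f y)) \<partial>lebesgue)"
proof -
  have k: "kernel r \<kappa>" and k0: "\<kappa> z \<ge> 0" for z using m unfolding mollifier_def by auto
  have "ennreal (norm (conv \<kappa> f x)) \<le> (\<integral>\<^sup>+y. ennreal (\<kappa> (x - y)) * ennreal (norm (f y)) \<partial>lebesgue)" for x
  proof -
    have "ennreal (norm (conv \<kappa> f x)) \<le> (\<integral>\<^sup>+y. ennreal (norm (\<kappa> (x - y) *\<^sub>R f y)) \<partial>lebesgue)"
      unfolding conv_def by (rule integral_norm_bound_ennreal[OF conv_integrable[OF k f]])
    also have "\<dots> = (\<integral>\<^sup>+y. ennreal (\<kappa> (x - y)) * ennreal (norm (f y)) \<partial>lebesgue)"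
      using k0 by (intro nn_integral_cong) (simp add: ennreal_mult)
    finally show ?thesis .
  qed
  then have "(\<integral>\<^sup>+x. ennreal (norm (conv \<kappa> f x)) \<partial>lebesgue)
    \<le> (\<integral>\<^sup>+x. (\<integral>\<^sup>+y. ennreal (\<kappa> (x - y)) * ennreal (norm (f y)) \<partial>lebesgue) \<partial>lebesgue)"
    by (intro nn_integral_mono)
  also have "\<dots> = (\<integral>\<^sup>+y. ennreal (norm (f y)) \<partial>lebesgue)"
    using fm by (intro mollifier_Tonelli[OF m]) auto
  finally show ?thesis .
qed

text \<open>Jensen's inequality as the nonnegativity of a variance: expand the integral of \<kappa>
  (x - y) |g y - z|^2 over y at the mean z = \<open>conv \<kappa> g x\<close>.\<close>

lemma conv_square_le:
  assumes m: "mollifier r \<kappa>" and g: "locally_integrable g" "g \<in> L2 lebesgue"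
  shows "(cmod (conv \<kappa> g x))\<^sup>2 \<le> (LINT y|lebesgue. \<kappa> (x - y) * (cmod (g y))\<^sup>2)"
    "integrable lebesgue (\<lambda>y. \<kappa> (x - y) * (cmod (g y))\<^sup>2)"
proof -
  have k: "kernel r \<kappa>" and k0: "\<kappa> z \<ge> 0" for z using m unfolding mollifier_def by auto
  have gm: "g \<in> borel_measurable lebesgue" and gi: "integrable lebesgue (\<lambda>x. (norm (g x))\<^sup>2)"
    using g(2) unfolding L2_def by auto
  obtain C where C: "C > 0" "\<And>z. \<bar>\<kappa> z\<bar> \<le> C" using kernel_bounded[OF k] by metis
  have kx: "(\<lambda>y. \<kappa> (x - y)) \<in> borel_measurable lebesgue"
    by (rule borel_measurable_integrable[OF mollifier_integral(1)[OF m]])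
  show i2: "integrable lebesgue (\<lambda>y. \<kappa> (x - y) * (cmod (g y))\<^sup>2)"
  proof (rule Bochner_Integration.integrable_bound)
    show "integrable lebesgue (\<lambda>y. C * (cmod (g y))\<^sup>2)" using gi by simp
    show "(\<lambda>y. \<kappa> (x - y) * (cmod (g y))\<^sup>2) \<in> borel_measurable lebesgue" using kx gm by measurable
    show "AE y in lebesgue. norm (\<kappa> (x - y) * (cmod (g y))\<^sup>2) \<le> norm (C * (cmod (g y))\<^sup>2)"
      using C by (intro AE_I2) (simp add: abs_mult mult_right_mono)
  qed
  define z where "z = conv \<kappa> g x"
  have ig: "integrable lebesgue (\<lambda>y. \<kappa> (x - y) *\<^sub>R g y)" by (rule conv_integrable[OF k g(1)])
  have ik: "integrable lebesgue (\<lambda>y. \<kappa> (x - y))" by (rule mollifier_integral(1)[OF m])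
  have "0 \<le> (LINT y|lebesgue. \<kappa> (x - y) * (cmod (g y - z))\<^sup>2)"
    using k0 by (intro integral_nonneg_AE) auto
  also have "(\<lambda>y. \<kappa> (x - y) * (cmod (g y - z))\<^sup>2) = (\<lambda>y. \<kappa> (x - y) * (cmod (g y))\<^sup>2
      - 2 * (Re z * Re (\<kappa> (x - y) *\<^sub>R g y) + Im z * Im (\<kappa> (x - y) *\<^sub>R g y)) + (cmod z)\<^sup>2 * \<kappa> (x - y))"
    by (rule ext) (simp add: cmod_power2 power2_diff algebra_simps)
  also have "(LINT y|lebesgue. \<kappa> (x - y) * (cmod (g y))\<^sup>2
      - 2 * (Re z * Re (\<kappa> (x - y) *\<^sub>R g y) + Im z * Im (\<kappa> (x - y) *\<^sub>R g y)) + (cmod z)\<^sup>2 * \<kappa> (x - y))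
    = (LINT y|lebesgue. \<kappa> (x - y) * (cmod (g y))\<^sup>2) - 2 * (Re z * Re z + Im z * Im z) + (cmod z)\<^sup>2"
  proof -
    have r: "integrable lebesgue (\<lambda>y. Re (\<kappa> (x - y) *\<^sub>R g y))" "integrable lebesgue (\<lambda>y. Im (\<kappa> (x - y) *\<^sub>R g y))"
      by (rule integrable_Re[OF ig], rule integrable_Im[OF ig])
    have rz: "(LINT y|lebesgue. Re (\<kappa> (x - y) *\<^sub>R g y)) = Re z" "(LINT y|lebesgue. Im (\<kappa> (x - y) *\<^sub>R g y)) = Im z"
      unfolding z_def conv_def by (rule integral_Re[OF ig], rule integral_Im[OF ig])
    have j: "integrable lebesgue (\<lambda>y. 2 * (Re z * Re (\<kappa> (x - y) *\<^sub>R g y) + Im z * Im (\<kappa> (x - y) *\<^sub>R g y)))"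
      using r by (intro integrable_mult_right Bochner_Integration.integrable_add)
    have "(LINT y|lebesgue. 2 * (Re z * Re (\<kappa> (x - y) *\<^sub>R g y) + Im z * Im (\<kappa> (x - y) *\<^sub>R g y))) = 2 * (Re z * Re z + Im z * Im z)"
      using r rz by (simp only: Bochner_Integration.integral_mult_right_zero Bochner_Integration.integral_add integrable_mult_right)
    then show ?thesis
      using i2 j ik mollifier_integral(2)[OF m, of x]
      by (simp only: Bochner_Integration.integral_add Bochner_Integration.integral_diff
          Bochner_Integration.integral_mult_right_zero Bochner_Integration.integrable_diff integrable_mult_right mult_1_right)
  qed
  finally have "0 \<le> (LINT y|lebesgue. \<kappa> (x - y) * (cmod (g y))\<^sup>2) - 2 * (Re z * Re z + Im z * Im z) + (cmod z)\<^sup>2" .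
  then show "(cmod (conv \<kappa> g x))\<^sup>2 \<le> (LINT y|lebesgue. \<kappa> (x - y) * (cmod (g y))\<^sup>2)"
  proof -
    have "q \<le> P" if "0 \<le> P - 2 * q + q" for P q :: real using that by simp
    then show ?thesis
      using \<open>0 \<le> (LINT y|lebesgue. \<kappa> (x - y) * (cmod (g y))\<^sup>2) - 2 * (Re z * Re z + Im z * Im z) + (cmod z)\<^sup>2\<close>
      unfolding z_def[symmetric] cmod_power2[of z] power2_eq_square[of "Re z"] power2_eq_square[of "Im z"] by blast
  qed
qed

lemma conv_L2_le:
  assumes m: "mollifier r \<kappa>" and g: "locally_integrable g" "g \<in> L2 lebesgue"
  shows "(\<integral>\<^sup>+x. ennreal ((cmod (conv \<kappa> g x))\<^sup>2) \<partial>lebesgue) \<le> (\<integral>\<^sup>+y. ennreal ((cmod (g y))\<^sup>2) \<partial>lebesgue)"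
proof -
  have k0: "\<kappa> z \<ge> 0" for z using m unfolding mollifier_def by auto
  have gm: "g \<in> borel_measurable lebesgue" using g(2) unfolding L2_def by auto
  have "ennreal ((cmod (conv \<kappa> g x))\<^sup>2) \<le> (\<integral>\<^sup>+y. ennreal (\<kappa> (x - y)) * ennreal ((cmod (g y))\<^sup>2) \<partial>lebesgue)" for x
  proof -
    have "ennreal ((cmod (conv \<kappa> g x))\<^sup>2) \<le> ennreal (LINT y|lebesgue. \<kappa> (x - y) * (cmod (g y))\<^sup>2)"
      by (rule ennreal_leI[OF conv_square_le(1)[OF m g]])
    also have "\<dots> = (\<integral>\<^sup>+y. ennreal (\<kappa> (x - y) * (cmod (g y))\<^sup>2) \<partial>lebesgue)"
      using k0 by (intro nn_integral_eq_integral[symmetric] conv_square_le(2)[OF m g]) auto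
    also have "\<dots> = (\<integral>\<^sup>+y. ennreal (\<kappa> (x - y)) * ennreal ((cmod (g y))\<^sup>2) \<partial>lebesgue)"
      using k0 by (intro nn_integral_cong) (simp add: ennreal_mult)
    finally show ?thesis .
  qed
  then have "(\<integral>\<^sup>+x. ennreal ((cmod (conv \<kappa> g x))\<^sup>2) \<partial>lebesgue)
    \<le> (\<integral>\<^sup>+x. (\<integral>\<^sup>+y. ennreal (\<kappa> (x - y)) * ennreal ((cmod (g y))\<^sup>2) \<partial>lebesgue) \<partial>lebesgue)"
    by (intro nn_integral_mono)
  also have "\<dots> = (\<integral>\<^sup>+y. ennreal ((cmod (g y))\<^sup>2) \<partial>lebesgue)"
    using gm by (intro mollifier_Tonelli[OF m]) auto
  finally show ?thesis .
qed

lemma integrable_imp_locally_integrable: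
  fixes f :: "real^2 \<Rightarrow> complex"
  assumes "integrable lebesgue f"
  shows "locally_integrable f"
  unfolding locally_integrable_def
proof (intro allI impI)
  fix K :: "(real^2) set" assume "compact K"
  then have K: "K \<in> sets lebesgue" by (simp add: compact_imp_closed)
  then show "integrable (lebesgue_on K) f"
    using integrable_mult_indicator[OF K assms] by (simp add: integrable_restrict_space)
qed

lemma locally_integrable_diff:
  fixes f g :: "real^2 \<Rightarrow> complex"
  assumes "locally_integrable f" "locally_integrable g"
  shows "locally_integrable (\<lambda>x. f x - g x)"
  using assms unfolding locally_integrable_def by auto

text \<open>f is first truncated in height, and the truncation is an almost everywhere limit of
  continuous functions. These are clamped to the same height by \<open>cl\<close> and cut off by
  \<open>ct\<close>; both operations leave the limit unchanged and supply the majorant for dominated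
  convergence.\<close>

lemma continuous_L1_approximation:
  fixes f :: "real^2 \<Rightarrow> complex"
  assumes f: "integrable lebesgue f" and supp: "\<And>x. x \<notin> cball 0 R \<Longrightarrow> f x = 0" and \<eta>: "\<eta> > 0"
  obtains g where "continuous_on UNIV g" "integrable lebesgue g" "(LINT x|lebesgue. norm (f x - g x)) \<le> \<eta>"
proof -
  have fm[measurable]: "f \<in> borel_measurable lebesgue" by (rule borel_measurable_integrable[OF f])
  define F where "F n x = (if norm (f x) \<le> real n then f x else 0)" for n x
  have Fm[measurable]: "F n \<in> borel_measurable lebesgue" for n unfolding F_def by measurable
  have "(\<lambda>n. LINT x|lebesgue. norm (f x - F n x)) \<longlonglongrightarrow> (LINT x::real^2|lebesgue. 0)"
  proof (rule integral_dominated_convergence)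
    show "integrable lebesgue (\<lambda>x. norm (f x))" using f by (rule Bochner_Integration.integrable_norm)
    show "AE x in lebesgue. norm (norm (f x - F n x)) \<le> norm (f x)" for n by (intro AE_I2) (simp add: F_def)
    show "AE x in lebesgue. (\<lambda>n. norm (f x - F n x)) \<longlonglongrightarrow> 0"
    proof (intro AE_I2)
      fix x
      obtain N :: nat where "norm (f x) \<le> real N" using real_arch_simple by blast
      then have "\<forall>\<^sub>F n in sequentially. 0 = norm (f x - F n x)"
        unfolding eventually_sequentially by (intro exI[of _ N]) (auto simp: F_def)
      then show "(\<lambda>n. norm (f x - F n x)) \<longlonglongrightarrow> 0" by (rule Lim_transform_eventually[OF tendsto_const])
    qed
  qed measurable
  then have "\<forall>\<^sub>F n in sequentially. (LINT x|lebesgue. norm (f x - F n x)) < \<eta> / 2"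
    using \<eta> by (intro order_tendstoD(2)) auto
  then obtain n0 where n0: "\<And>n. n \<ge> n0 \<Longrightarrow> (LINT x|lebesgue. norm (f x - F n x)) < \<eta> / 2"
    unfolding eventually_sequentially by blast
  define n where "n = Suc n0"
  have n: "(LINT x|lebesgue. norm (f x - F n x)) < \<eta> / 2" "n > 0" using n0[of n] unfolding n_def by auto
  have "F n measurable_on UNIV" using Fm[of n] by (intro lebesgue_measurable_imp_measurable_on) (auto simp: lebesgue_on_UNIV_eq)
  then obtain Z g where Z: "negligible Z" and gc: "\<And>k. continuous_on UNIV (g k)"
    and gl: "\<And>x. x \<notin> Z \<Longrightarrow> (\<lambda>k. g k x) \<longlonglongrightarrow> F n x" unfolding measurable_on_def by auto
  define ct where "ct x = max 0 (min 1 (\<bar>R\<bar> + 1 - norm x))" for x :: "real^2"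
  define cl where "cl z = (real n / max (real n) (cmod z)) *\<^sub>R z" for z
  define h where "h k x = ct x *\<^sub>R cl (g k x)" for k x
  have clc: "continuous_on UNIV cl" unfolding cl_def using n(2) by (intro continuous_intros) auto
  have cln: "cmod (cl z) \<le> real n" for z
    unfolding cl_def using n(2) by (auto simp: max_def field_simps)
  have cli: "cl z = z" if "cmod z \<le> real n" for z unfolding cl_def using that n(2) by (simp add: max_def)
  have hc: "continuous_on UNIV (h k)" for k
    unfolding h_def[abs_def] ct_def
    by (intro continuous_on_scaleR continuous_on_compose2[OF clc gc] continuous_on_max continuous_on_min continuous_on_diff
        continuous_on_const continuous_on_norm continuous_on_id) auto
  have hm[measurable]: "h k \<in> borel_measurable lebesgue" for k
    using borel_measurable_continuous_onI[OF hc[of k]] by (intro measurable_completion) simp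
  have ct: "0 \<le> ct x" "ct x \<le> 1" "x \<notin> cball 0 (\<bar>R\<bar> + 1) \<Longrightarrow> ct x = 0" "x \<in> cball 0 R \<Longrightarrow> ct x = 1" for x
    unfolding ct_def by auto
  have hb: "norm (h k x) \<le> real n * indicator (cball 0 (\<bar>R\<bar> + 1)) x" for k x
  proof (cases "x \<in> cball 0 (\<bar>R\<bar> + 1)")
    case True
    have "ct x * cmod (cl (g k x)) \<le> 1 * real n" using ct[of x] cln by (intro mult_mono) auto
    then show ?thesis unfolding h_def using ct(1)[of x] True by simp
  qed (use ct(3) in \<open>simp add: h_def\<close>)
  have ib: "integrable lebesgue (\<lambda>x. real n * indicator (cball (0::real^2) (\<bar>R\<bar> + 1)) x :: real)" for n and R :: real
    by (intro integrable_mult_right integrable_indicator_lmeasurable) simp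
  have hi: "integrable lebesgue (h k)" for k
    using hb by (intro Bochner_Integration.integrable_bound[OF ib[of n R]]) (auto intro!: AE_I2 order_trans[OF hb])
  have Fb: "norm (F n x) \<le> real n * indicator (cball 0 (\<bar>R\<bar> + 1)) x" for x
    using supp[of x] unfolding F_def by (auto simp: indicator_def)
  have Fi: "integrable lebesgue (F n)"
    by (intro Bochner_Integration.integrable_bound[OF ib[of n R]]) (auto intro!: AE_I2 order_trans[OF Fb])
  have "(\<lambda>k. LINT x|lebesgue. norm (F n x - h k x)) \<longlonglongrightarrow> (LINT x::real^2|lebesgue. 0)"
  proof (rule integral_dominated_convergence)
    show "integrable lebesgue (\<lambda>x. 2 * (real n * indicator (cball (0::real^2) (\<bar>R\<bar> + 1)) x) :: real)"
      by (rule integrable_mult_right[OF ib[of n R]])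
    show "AE x in lebesgue. norm (norm (F n x - h k x)) \<le> 2 * (real n * indicator (cball 0 (\<bar>R\<bar> + 1)) x)" for k
    proof (intro AE_I2)
      fix x show "norm (norm (F n x - h k x)) \<le> 2 * (real n * indicator (cball 0 (\<bar>R\<bar> + 1)) x)"
        using Fb[of x] hb[of k x] norm_triangle_ineq4[of "F n x" "h k x"] by simp
    qed
    have "AE x in lebesgue. x \<notin> Z" using Z by (intro AE_not_in) (simp add: negligible_iff_null_sets)
    then show "AE x in lebesgue. (\<lambda>k. norm (F n x - h k x)) \<longlonglongrightarrow> 0"
    proof eventually_elim
      case (elim x)
      have "isCont cl (F n x)" using clc by (simp add: continuous_on_eq_continuous_at)
      then have "(\<lambda>k. cl (g k x)) \<longlonglongrightarrow> cl (F n x)" using gl[OF elim] by (rule isCont_tendsto_compose)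
      moreover have "cl (F n x) = F n x" by (rule cli) (simp add: F_def)
      ultimately have "(\<lambda>k. F n x - ct x *\<^sub>R cl (g k x)) \<longlonglongrightarrow> F n x - ct x *\<^sub>R F n x"
        by (intro tendsto_diff tendsto_scaleR tendsto_const) simp
      moreover have "ct x *\<^sub>R F n x = F n x" using ct(4)[of x] supp[of x] by (cases "x \<in> cball 0 R") (auto simp: F_def)
      ultimately have "(\<lambda>k. F n x - h k x) \<longlonglongrightarrow> 0" unfolding h_def by simp
      then show ?case by (rule tendsto_norm_zero)
    qed
  qed measurable
  then have "\<forall>\<^sub>F k in sequentially. (LINT x|lebesgue. norm (F n x - h k x)) < \<eta> / 2"
    using \<eta> by (intro order_tendstoD(2)) auto
  then obtain k where k: "(LINT x|lebesgue. norm (F n x - h k x)) < \<eta> / 2"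
    using eventually_happens by fastforce
  have "(LINT x|lebesgue. norm (f x - h k x)) \<le> (LINT x|lebesgue. norm (f x - F n x) + norm (F n x - h k x))"
  proof (rule integral_mono)
    fix x show "norm (f x - h k x) \<le> norm (f x - F n x) + norm (F n x - h k x)"
      using norm_triangle_ineq[of "f x - F n x" "F n x - h k x"] by simp
  qed (intro Bochner_Integration.integrable_norm Bochner_Integration.integrable_diff Bochner_Integration.integrable_add f Fi hi)+
  also have "\<dots> = (LINT x|lebesgue. norm (f x - F n x)) + (LINT x|lebesgue. norm (F n x - h k x))"
    by (intro Bochner_Integration.integral_add Bochner_Integration.integrable_norm Bochner_Integration.integrable_diff f Fi hi)
  finally have "(LINT x|lebesgue. norm (f x - h k x)) \<le> \<eta>" using n(1) k by linarith
  then show thesis using that[of "h k"] hc hi by blast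
qed

text \<open>A mollifier of radius at most 1 does not see f outside the ball of radius R + 1, so f
  may be cut off there and approximated by a continuous g. The three thirds of \<eta> are the
  mollified error f' - g, which contraction in L1 keeps small, the uniform error of mollifying g on
  the ball, and the error f' - g itself.\<close>

lemma mollify_L1_local:
  fixes f :: "real^2 \<Rightarrow> complex"
  assumes f: "locally_integrable f" and \<eta>: "\<eta> > 0"
  obtains \<epsilon> where "\<epsilon> > 0" "\<And>\<kappa> r. \<lbrakk>mollifier r \<kappa>; r \<le> \<epsilon>\<rbrakk> \<Longrightarrow>
    (\<integral>\<^sup>+x. ennreal (norm (indicator (cball 0 R) x *\<^sub>R (conv \<kappa> f x - f x))) \<partial>lebesgue) \<le> ennreal \<eta>"
proof -
  define f' where "f' y = indicator (cball 0 (R + 1)) y *\<^sub>R f y" for y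
  have f'i: "integrable lebesgue f'" unfolding f'_def by (rule integrable_cball_locally_integrable[OF f])
  have "f' x = 0" if "x \<notin> cball 0 (R + 1)" for x using that unfolding f'_def by simp
  note f'0 = this
  have "\<eta> / 3 > 0" using \<eta> by simp
  then obtain g where g: "continuous_on UNIV g" "integrable lebesgue g" "(LINT x|lebesgue. norm (f' x - g x)) \<le> \<eta> / 3"
    using continuous_L1_approximation[OF f'i f'0] by blast
  define A0 where "A0 = measure lebesgue (cball (0::real^2) R)"
  have A0: "A0 \<ge> 0" unfolding A0_def by simp
  define e where "e = \<eta> / (3 * (A0 + 1))"
  have e: "e > 0" "e * A0 \<le> \<eta> / 3" unfolding e_def using \<eta> A0 by (auto simp: field_simps)
  have "continuous_on (cball 0 (R + 1)) g" using g(1) by (rule continuous_on_subset) simp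
  then have "uniformly_continuous_on (cball 0 (R + 1)) g" by (rule compact_uniformly_continuous) simp
  then obtain d where d: "d > 0" "\<And>z z'. z \<in> cball 0 (R+1) \<Longrightarrow> z' \<in> cball 0 (R+1) \<Longrightarrow> dist z' z < d \<Longrightarrow> dist (g z') (g z) < e"
    unfolding uniformly_continuous_on_def using e(1) by blast
  have lg: "locally_integrable g" by (rule integrable_imp_locally_integrable[OF g(2)])
  have lf': "locally_integrable f'" by (rule integrable_imp_locally_integrable[OF f'i])
  show thesis
  proof (rule that[of "min 1 (d / 2)"])
    fix \<kappa> r assume m: "mollifier r \<kappa>" and r: "r \<le> min 1 (d / 2)"
    have k: "kernel r \<kappa>" and k0: "\<kappa> z \<ge> 0" for z using m unfolding mollifier_def by auto
    have cf: "conv \<kappa> f x = conv \<kappa> f' x" if "x \<in> cball 0 R" for x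
      unfolding conv_def
    proof (intro Bochner_Integration.integral_cong refl)
      fix y
      show "\<kappa> (x - y) *\<^sub>R f y = \<kappa> (x - y) *\<^sub>R f' y"
      proof (cases "norm (x - y) \<le> r")
        case True
        have "norm y \<le> norm x + norm (x - y)" using norm_triangle_ineq4[of x "x - y"] by simp
        then have "y \<in> cball 0 (R + 1)" using True r that by simp
        then show ?thesis unfolding f'_def by simp
      qed (use k in \<open>simp add: kernel_def\<close>)
    qed
    have cg: "norm (conv \<kappa> g x - g x) \<le> e" if x: "x \<in> cball 0 R" for x
    proof -
      have ik: "integrable lebesgue (\<lambda>y. \<kappa> (x - y))" by (rule mollifier_integral(1)[OF m])
      have ig: "integrable lebesgue (\<lambda>y. \<kappa> (x - y) *\<^sub>R g y)" by (rule conv_integrable[OF k lg])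
      have ikx: "integrable lebesgue (\<lambda>y. \<kappa> (x - y) *\<^sub>R g x)" using ik by (intro integrable_scaleR_left)
      have "(LINT y|lebesgue. \<kappa> (x - y) *\<^sub>R g x) = g x"
        using ik mollifier_integral(2)[OF m, of x] by (subst integral_scaleR_left) auto
      then have "conv \<kappa> g x - g x = (LINT y|lebesgue. \<kappa> (x - y) *\<^sub>R g y) - (LINT y|lebesgue. \<kappa> (x - y) *\<^sub>R g x)"
        unfolding conv_def by simp
      also have "\<dots> = (LINT y|lebesgue. \<kappa> (x - y) *\<^sub>R g y - \<kappa> (x - y) *\<^sub>R g x)"
        by (rule Bochner_Integration.integral_diff[OF ig ikx, symmetric])
      also have "norm \<dots> \<le> (LINT y|lebesgue. norm (\<kappa> (x - y) *\<^sub>R g y - \<kappa> (x - y) *\<^sub>R g x))"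
        by (rule integral_norm_bound)
      also have "\<dots> \<le> (LINT y|lebesgue. \<kappa> (x - y) * e)"
      proof (rule integral_mono)
        show "integrable lebesgue (\<lambda>y. norm (\<kappa> (x - y) *\<^sub>R g y - \<kappa> (x - y) *\<^sub>R g x))"
          using ig ikx by (intro Bochner_Integration.integrable_norm Bochner_Integration.integrable_diff)
        show "integrable lebesgue (\<lambda>y. \<kappa> (x - y) * e)" using ik by simp
        fix y
        show "norm (\<kappa> (x - y) *\<^sub>R g y - \<kappa> (x - y) *\<^sub>R g x) \<le> \<kappa> (x - y) * e"
        proof (cases "norm (x - y) \<le> r")
          case True
          have "norm y \<le> norm x + norm (x - y)" using norm_triangle_ineq4[of x "x - y"] by simp
          then have "y \<in> cball 0 (R + 1)" "x \<in> cball 0 (R + 1)" using True r x by auto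
          moreover have "dist y x < d" using True r d(1) by (simp add: dist_norm norm_minus_commute)
          ultimately have "dist (g y) (g x) < e" using d(2) by blast
          then have "norm (g y - g x) \<le> e" by (simp add: dist_norm)
          then have "\<kappa> (x - y) * norm (g y - g x) \<le> \<kappa> (x - y) * e" using k0 by (intro mult_left_mono)
          then show ?thesis using k0[of "x - y"] by (simp flip: scaleR_diff_right)
        qed (use k in \<open>simp add: kernel_def\<close>)
      qed
      also have "\<dots> = e" using mollifier_integral(2)[OF m, of x] by simp
      finally show ?thesis .
    qed
    have fg: "integrable lebesgue (\<lambda>x. f' x - g x)" using f'i g(2) by simp
    have lfg: "locally_integrable (\<lambda>x. f' x - g x)" by (rule integrable_imp_locally_integrable[OF fg])
    have fgm: "(\<lambda>x. f' x - g x) \<in> borel_measurable lebesgue" by (rule borel_measurable_integrable[OF fg])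
    have cdiff: "conv \<kappa> (\<lambda>x. f' x - g x) x = conv \<kappa> f' x - conv \<kappa> g x" for x
      unfolding conv_def using conv_integrable[OF k lf', of x] conv_integrable[OF k lg, of x]
      by (simp add: scaleR_diff_right)
    have convm: "(\<lambda>x. ennreal (norm (conv \<kappa> (\<lambda>x. f' x - g x) x))) \<in> borel_measurable lebesgue"
    proof -
      have "conv \<kappa> (\<lambda>x. f' x - g x) \<in> borel_measurable lebesgue"
        using borel_measurable_continuous_onI[OF conv_continuous[OF k lfg]] by (intro measurable_completion) simp
      then show ?thesis by simp
    qed
    have nfg: "(\<integral>\<^sup>+x. ennreal (norm (f' x - g x)) \<partial>lebesgue) \<le> ennreal (\<eta> / 3)"
      using g(3) nn_integral_eq_integral[OF Bochner_Integration.integrable_norm[OF fg]] by (simp add: ennreal_leI)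
    have "(\<integral>\<^sup>+x. ennreal (norm (indicator (cball 0 R) x *\<^sub>R (conv \<kappa> f x - f x))) \<partial>lebesgue)
      \<le> (\<integral>\<^sup>+x. ennreal (norm (conv \<kappa> (\<lambda>x. f' x - g x) x)) + (ennreal e * indicator (cball 0 R) x + ennreal (norm (f' x - g x))) \<partial>lebesgue)"
    proof (intro nn_integral_mono)
      fix x
      show "ennreal (norm (indicator (cball 0 R) x *\<^sub>R (conv \<kappa> f x - f x)))
        \<le> ennreal (norm (conv \<kappa> (\<lambda>x. f' x - g x) x)) + (ennreal e * indicator (cball 0 R) x + ennreal (norm (f' x - g x)))"
      proof (cases "x \<in> cball 0 R")
        case True
        have "f x = f' x" using True unfolding f'_def by simp
        then have "conv \<kappa> f x - f x = conv \<kappa> (\<lambda>x. f' x - g x) x + ((conv \<kappa> g x - g x) + (g x - f' x))"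
          unfolding cf[OF True] cdiff by simp
        then have "norm (conv \<kappa> f x - f x) \<le> norm (conv \<kappa> (\<lambda>x. f' x - g x) x) + (norm (conv \<kappa> g x - g x) + norm (g x - f' x))"
          by (metis norm_triangle_ineq add_left_mono order_trans)
        also have "\<dots> \<le> norm (conv \<kappa> (\<lambda>x. f' x - g x) x) + (e + norm (f' x - g x))"
          using cg[OF True] by (simp add: norm_minus_commute)
        finally have "ennreal (norm (conv \<kappa> f x - f x)) \<le> ennreal (norm (conv \<kappa> (\<lambda>x. f' x - g x) x) + (e + norm (f' x - g x)))"
          by (rule ennreal_leI)
        then show ?thesis using True e(1) by simp
      qed simp
    qed
    also have "\<dots> = (\<integral>\<^sup>+x. ennreal (norm (conv \<kappa> (\<lambda>x. f' x - g x) x)) \<partial>lebesgue)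
      + ((\<integral>\<^sup>+x. ennreal e * indicator (cball (0::real^2) R) x \<partial>lebesgue) + (\<integral>\<^sup>+x. ennreal (norm (f' x - g x)) \<partial>lebesgue))"
    proof -
      have 1: "(\<lambda>x. ennreal e * indicator (cball (0::real^2) R) x) \<in> borel_measurable lebesgue"
        by (intro borel_measurable_times_ennreal borel_measurable_const borel_measurable_indicator) simp
      have 2: "(\<lambda>x. ennreal (norm (f' x - g x))) \<in> borel_measurable lebesgue" using fgm by simp
      show ?thesis using nn_integral_add[OF convm borel_measurable_add[OF 1 2]] nn_integral_add[OF 1 2] by simp
    qed
    also have "\<dots> \<le> ennreal (\<eta> / 3) + (ennreal (\<eta> / 3) + ennreal (\<eta> / 3))"
    proof (intro add_mono nfg)
      show "(\<integral>\<^sup>+x. ennreal (norm (conv \<kappa> (\<lambda>x. f' x - g x) x)) \<partial>lebesgue) \<le> ennreal (\<eta> / 3)"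
        using conv_L1_le[OF m lfg fgm] nfg by (rule order_trans)
      have "(\<integral>\<^sup>+x. ennreal e * indicator (cball (0::real^2) R) x \<partial>lebesgue) = ennreal e * emeasure lebesgue (cball (0::real^2) R)"
        by (rule nn_integral_cmult_indicator) simp
      also have "\<dots> = ennreal (e * A0)"
        unfolding A0_def emeasure_eq_ennreal_measure[OF fmeasurableD2[OF lmeasurable_cball]]
        by (rule ennreal_mult[symmetric]) (use e(1) in auto)
      also have "\<dots> \<le> ennreal (\<eta> / 3)" using e(2) by (rule ennreal_leI)
      finally show "(\<integral>\<^sup>+x. ennreal e * indicator (cball (0::real^2) R) x \<partial>lebesgue) \<le> ennreal (\<eta> / 3)" .
    qed
    also have "\<dots> = ennreal \<eta>" using \<eta> by (simp flip: ennreal_plus)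
    finally show "(\<integral>\<^sup>+x. ennreal (norm (indicator (cball 0 R) x *\<^sub>R (conv \<kappa> f x - f x))) \<partial>lebesgue) \<le> ennreal \<eta>" .
  qed (use d in auto)
qed

text \<open>k holds the partial derivatives of \<kappa>. The last clause concerns the reflected
  function of y, which is what a weak derivative is tested with; the reflection reverses the
  sign.\<close>

definition smooth_mollifier :: "real \<Rightarrow> (real^2 \<Rightarrow> real) \<Rightarrow> (2 \<Rightarrow> real^2 \<Rightarrow> real) \<Rightarrow> bool" where
  "smooth_mollifier r \<kappa> k \<longleftrightarrow> mollifier r \<kappa> \<and> (\<forall>i. kernel r (k i)) \<and>
     (\<forall>z. (\<kappa> has_derivative (\<lambda>h. h$1 * k 1 z + h$2 * k 2 z)) (at z)) \<and>
     (\<forall>x. test_function (\<lambda>y. \<kappa> (x - y)) \<and> (\<forall>i. partial i (\<lambda>y. \<kappa> (x - y)) = (\<lambda>y. - k i (x - y))))"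

lemma product_kernel:
  fixes f g :: "real \<Rightarrow> real"
  assumes "continuous_on UNIV f" "continuous_on UNIV g" "\<And>t. \<bar>t\<bar> > r / 2 \<Longrightarrow> f t = 0" "\<And>t. \<bar>t\<bar> > r / 2 \<Longrightarrow> g t = 0"
  shows "kernel r (\<lambda>z. f (z$1) * g (z$2))"
  unfolding kernel_def
proof (intro conjI allI impI)
  show "continuous_on UNIV (\<lambda>z::real^2. f (z$1) * g (z$2))"
    by (intro continuous_on_mult continuous_on_compose2[OF assms(1)] continuous_on_compose2[OF assms(2)]
        continuous_on_component continuous_on_id) auto
  fix z :: "real^2" assume "norm z > r"
  then have "\<bar>z$1\<bar> + \<bar>z$2\<bar> > r" using norm_le_l1_cart[of z] by (simp add: sum_2)
  then have "\<bar>z$1\<bar> > r / 2 \<or> \<bar>z$2\<bar> > r / 2" by linarith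
  then show "f (z$1) * g (z$2) = 0" using assms(3,4) by auto
qed

lemma derivative_outside_support:
  assumes "\<And>t. (f has_real_derivative f' t) (at t)" "\<And>t. \<bar>t\<bar> > r \<Longrightarrow> f t = (0::real)" "\<bar>t\<bar> > r"
  shows "f' t = 0"
proof -
  have "open {t::real. r < \<bar>t\<bar>}" by (intro open_Collect_less continuous_intros)
  then have "(f has_real_derivative 0) (at t)"
    using assms(2,3) by (intro has_field_derivative_transform_within_open[of "\<lambda>_. 0" 0 t "{t. r < \<bar>t\<bar>}" f]) auto
  then show ?thesis using assms(1) DERIV_unique by blast
qed

text \<open>A product of two one-dimensional bumps, because partial derivatives of products are
  again products. Half-width r/2 in each coordinate puts the support into the ball of radius r. The
  normalising constant 1/I sits in the first factor only.\<close>

lemma smooth_mollifier_exists: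
  assumes r: "r > 0"
  obtains \<kappa> k where "smooth_mollifier r \<kappa> k"
proof -
  define \<psi> where "\<psi> t = bump (2 / r * t + 0)" for t
  have ck\<psi>: "ck n \<psi>" for n unfolding \<psi>_def by (rule ck_affine[OF ck_bump])
  have \<psi>0: "\<psi> t \<ge> 0" for t unfolding \<psi>_def by (rule bump_nonneg)
  have \<psi>s: "\<psi> t = 0" if "\<bar>t\<bar> > r / 2" for t
    unfolding \<psi>_def using that r by (intro bump_eq_0) (auto simp: abs_mult field_simps)
  have \<psi>e: "\<psi> (- t) = \<psi> t" for t unfolding \<psi>_def bump_def by (simp add: mult.commute)
  have \<psi>c: "continuous_on UNIV \<psi>" by (rule ck_continuous[OF ck\<psi>])
  define \<phi> where "\<phi> z = \<psi> (z$1) * \<psi> (z$2)" for z :: "real^2"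
  define I where "I = (LINT z|lebesgue. \<phi> z)"
  have ker: "kernel r \<phi>" unfolding \<phi>_def[abs_def] by (rule product_kernel[OF \<psi>c \<psi>c \<psi>s \<psi>s])
  have \<phi>c: "continuous_on UNIV \<phi>" using ker unfolding kernel_def by simp
  have eq: "(\<lambda>z. indicator (cball 0 r) z * \<phi> z) = \<phi>"
    using ker unfolding kernel_def by (auto simp: indicator_def fun_eq_iff)
  have "integrable lebesgue (\<lambda>z. indicator (cball 0 r) z * \<phi> z)"
    using integrable_indicator_continuous[of "cball 0 r", OF _ _ \<phi>c] by simp
  then have int: "integrable lebesgue \<phi>" unfolding eq .
  have I: "I > 0"
  proof (rule ccontr)
    assume "\<not> I > 0"
    moreover have "I \<ge> 0" unfolding I_def \<phi>_def using \<psi>0 by (intro integral_nonneg_AE) auto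
    ultimately have "I = 0" by simp
    then have "AE z in lebesgue. \<phi> z = 0"
      unfolding I_def using integral_nonneg_eq_0_iff_AE[OF int] \<psi>0 unfolding \<phi>_def by simp
    moreover have "\<psi> t > 0" if "\<bar>t\<bar> < r / 2" for t
      unfolding \<psi>_def using that r by (intro bump_pos) (auto simp: abs_mult field_simps)
    then have "\<phi> z > 0" if "norm z < r / 2" for z :: "real^2"
      using that component_le_norm_cart[of z 1] component_le_norm_cart[of z 2] unfolding \<phi>_def by (intro mult_pos_pos) auto
    then have "\<phi> z \<noteq> 0" if "z \<in> ball 0 (r / 2)" for z :: "real^2" using that by (metis less_irrefl mem_ball_0)
    ultimately have "AE z in lebesgue. z \<notin> ball (0::real^2) (r / 2)" by (auto elim!: eventually_mono)
    then have "negligible (ball (0::real^2) (r / 2))"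
      unfolding negligible_iff_null_sets by (subst (asm) AE_iff_null_sets[symmetric]) auto
    moreover have "\<not> negligible (ball (0::real^2) (r / 2))" using r by (intro open_not_negligible) auto
    ultimately show False by simp
  qed
  define f where "f t = 1 / I * \<psi> t" for t
  have ckf: "ck n f" for n unfolding f_def[abs_def] by (intro ck_mult ck_const ck\<psi>)
  have fs: "f t = 0" if "\<bar>t\<bar> > r / 2" for t unfolding f_def using \<psi>s[OF that] by simp
  have fc: "continuous_on UNIV f" by (rule ck_continuous[OF ckf])
  obtain f' where f': "\<And>t. (f has_real_derivative f' t) (at t)" "ck 0 f'" using ckf[of "Suc 0"] by auto
  obtain \<psi>' where \<psi>': "\<And>t. (\<psi> has_real_derivative \<psi>' t) (at t)" "ck 0 \<psi>'" using ck\<psi>[of "Suc 0"] by auto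
  have f's: "f' t = 0" if "\<bar>t\<bar> > r / 2" for t by (rule derivative_outside_support[OF f'(1) fs that])
  have \<psi>'s: "\<psi>' t = 0" if "\<bar>t\<bar> > r / 2" for t by (rule derivative_outside_support[OF \<psi>'(1) \<psi>s that])
  define \<kappa> where "\<kappa> z = f (z$1) * \<psi> (z$2)" for z :: "real^2"
  define k :: "2 \<Rightarrow> real^2 \<Rightarrow> real" where "k i z = (if i = 1 then f' (z$1) * \<psi> (z$2) else f (z$1) * \<psi>' (z$2))" for i z
  show thesis
  proof (rule that[of \<kappa> k], unfold smooth_mollifier_def, intro conjI allI)
    show "mollifier r \<kappa>" unfolding mollifier_def
    proof (intro conjI allI)
      show "kernel r \<kappa>" unfolding \<kappa>_def[abs_def] by (rule product_kernel[OF fc \<psi>c fs \<psi>s])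
      show p: "0 \<le> \<kappa> z" for z unfolding \<kappa>_def f_def using \<psi>0 I by simp
      show "\<kappa> (- z) = \<kappa> z" for z unfolding \<kappa>_def f_def by (simp add: \<psi>e)
      have eq: "\<kappa> z = 1 / I * \<phi> z" for z unfolding \<kappa>_def f_def \<phi>_def by simp
      have "integrable lebesgue \<kappa>" unfolding eq[abs_def] using int by (rule integrable_mult_right)
      then have "(\<integral>\<^sup>+z. ennreal (\<kappa> z) \<partial>lebesgue) = ennreal (LINT z|lebesgue. \<kappa> z)"
        using p by (intro nn_integral_eq_integral) auto
      also have "(LINT z|lebesgue. \<kappa> z) = 1 / I * I" unfolding eq I_def by simp
      also have "\<dots> = 1" using I by simp
      finally show "(\<integral>\<^sup>+z. ennreal (\<kappa> z) \<partial>lborel) = 1" by (simp add: nn_integral_completion)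
    qed
    have f'c: "continuous_on UNIV f'" "continuous_on UNIV \<psi>'" using f'(2) \<psi>'(2) by simp_all
    show "kernel r (k i)" for i
      unfolding k_def[abs_def]
      by (cases "i = 1") (simp_all add: product_kernel[OF f'c(1) \<psi>c f's \<psi>s] product_kernel[OF fc f'c(2) fs \<psi>'s])
    show "(\<kappa> has_derivative (\<lambda>h. h$1 * k 1 z + h$2 * k 2 z)) (at z)" for z
      unfolding \<kappa>_def[abs_def] k_def using partial_product(1)[of f f' \<psi> \<psi>' z, OF f'(1) \<psi>'(1)] by simp
    fix x :: "real^2"
    define F where "F t = f (-1 * t + x$1)" for t
    define G where "G t = \<psi> (-1 * t + x$2)" for t
    have e: "(\<lambda>y. \<kappa> (x - y)) = (\<lambda>y. F (y$1) * G (y$2))" unfolding \<kappa>_def F_def G_def by (simp add: fun_eq_iff)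
    show "test_function (\<lambda>y. \<kappa> (x - y))" unfolding e
    proof (rule test_function_product[where r = "r / 2 + \<bar>x$1\<bar> + \<bar>x$2\<bar>"])
      show "ck n F" "ck n G" for n unfolding F_def[abs_def] G_def[abs_def] by (intro ck_affine ckf ck\<psi>)+
      show "F t = 0" if "\<bar>t\<bar> > r / 2 + \<bar>x$1\<bar> + \<bar>x$2\<bar>" for t unfolding F_def using that by (intro fs) linarith
      show "G t = 0" if "\<bar>t\<bar> > r / 2 + \<bar>x$1\<bar> + \<bar>x$2\<bar>" for t unfolding G_def using that by (intro \<psi>s) linarith
    qed
    have aff: "((\<lambda>t. -1 * t + c) has_real_derivative -1) (at t)" for c t :: real by (auto intro!: derivative_eq_intros)
    have dF: "(F has_real_derivative - f' (-1 * t + x$1)) (at t)" for t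
      unfolding F_def[abs_def] using DERIV_chain2[OF f'(1) aff] by simp
    have dG: "(G has_real_derivative - \<psi>' (-1 * t + x$2)) (at t)" for t
      unfolding G_def[abs_def] using DERIV_chain2[OF \<psi>'(1) aff] by simp
    show "partial i (\<lambda>y. \<kappa> (x - y)) = (\<lambda>y. - k i (x - y))" for i
      using exhaust_2[of i] partial_product(2,3)[of F "\<lambda>t. - f' (-1 * t + x$1)" G "\<lambda>t. - \<psi>' (-1 * t + x$2)", OF dF dG]
      unfolding e by (auto simp: k_def F_def G_def fun_eq_iff)
  qed
qed

section \<open>Weak derivatives under mollification\<close>

lemma conv_weak_partial:
  assumes m: "smooth_mollifier r \<kappa> k" and w: "has_weak_partial i w g"
  shows "conv (k i) w x = conv \<kappa> g x"
proof -
  have t: "test_function (\<lambda>y. \<kappa> (x - y))" and p: "partial i (\<lambda>y. \<kappa> (x - y)) = (\<lambda>y. - k i (x - y))"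
    using m unfolding smooth_mollifier_def by blast+
  \<comment> \<open>The weak derivative is tested with the reflected mollifier; the signs from the
    reflection and from the integration by parts cancel.\<close>
  have "(LINT y|lebesgue. partial i (\<lambda>y. \<kappa> (x - y)) y *\<^sub>R w y) = - (LINT y|lebesgue. \<kappa> (x - y) *\<^sub>R g y)"
    using w t unfolding has_weak_partial_def by blast
  then show ?thesis unfolding p conv_def by simp
qed

text \<open>By \<open>conv_weak_partial\<close> the mollifications of g and g' coincide, so those of
  g - g' vanish, while they approximate g - g' locally in L1. The energy is defined through a chosen
  representative, which this result allows to exchange.\<close>

lemma weak_partial_unique:
  assumes "has_weak_partial i w g" "has_weak_partial i w g'"
  shows "AE x in lebesgue. g x = g' x"
proof -
  have lg: "locally_integrable g" "locally_integrable g'" using assms unfolding has_weak_partial_def by auto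
  define d where "d x = g x - g' x" for x
  have ld: "locally_integrable d" unfolding d_def[abs_def] by (rule locally_integrable_diff[OF lg])
  have "AE x in lebesgue. indicator (cball 0 (real n)) x *\<^sub>R d x = 0" for n
  proof -
    have dm: "(\<lambda>x. indicator (cball 0 (real n)) x *\<^sub>R d x) \<in> borel_measurable lebesgue"
      by (rule borel_measurable_integrable[OF integrable_cball_locally_integrable[OF ld]])
    have le: "(\<integral>\<^sup>+x. ennreal (norm (indicator (cball 0 (real n)) x *\<^sub>R d x)) \<partial>lebesgue) \<le> 0 + ennreal \<eta>" if \<eta>: "\<eta> > 0" for \<eta>
    proof -
      obtain \<epsilon> where \<epsilon>: "\<epsilon> > 0" "\<And>\<kappa> r. \<lbrakk>mollifier r \<kappa>; r \<le> \<epsilon>\<rbrakk> \<Longrightarrow>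
        (\<integral>\<^sup>+x. ennreal (norm (indicator (cball 0 (real n)) x *\<^sub>R (conv \<kappa> d x - d x))) \<partial>lebesgue) \<le> ennreal \<eta>"
        using mollify_L1_local[OF ld \<eta>, of "real n"] by blast
      obtain \<kappa> k where m: "smooth_mollifier \<epsilon> \<kappa> k" using smooth_mollifier_exists[OF \<epsilon>(1)] by blast
      have mm: "mollifier \<epsilon> \<kappa>" and kk: "kernel \<epsilon> \<kappa>" using m unfolding smooth_mollifier_def mollifier_def by auto
      have "conv \<kappa> d x = 0" for x
      proof -
        have "conv \<kappa> d x = conv \<kappa> g x - conv \<kappa> g' x"
          unfolding conv_def d_def using conv_integrable[OF kk lg(1), of x] conv_integrable[OF kk lg(2), of x]
          by (simp add: scaleR_diff_right)
        then show ?thesis using conv_weak_partial[OF m assms(1), of x] conv_weak_partial[OF m assms(2), of x] by simp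
      qed
      then show ?thesis using \<epsilon>(2)[OF mm order_refl] by simp
    qed
    have "(\<integral>\<^sup>+x. ennreal (norm (indicator (cball 0 (real n)) x *\<^sub>R d x)) \<partial>lebesgue) \<le> 0"
      by (rule ennreal_le_epsilon) (use le in auto)
    then have "(\<integral>\<^sup>+x. ennreal (norm (indicator (cball 0 (real n)) x *\<^sub>R d x)) \<partial>lebesgue) = 0" by simp
    then have "AE x in lebesgue. ennreal (norm (indicator (cball 0 (real n)) x *\<^sub>R d x)) = 0"
      using nn_integral_0_iff_AE[OF measurable_compose[OF measurable_compose[OF dm borel_measurable_norm] measurable_ennreal]] by blast
    then show ?thesis by eventually_elim simp
  qed
  then have "AE x in lebesgue. \<forall>n. indicator (cball 0 (real n)) x *\<^sub>R d x = 0" by (subst AE_all_countable) blast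
  then show ?thesis
  proof eventually_elim
    case (elim x)
    obtain n where "norm x \<le> real n" using real_arch_simple by blast
    then have "d x = 0" using elim[rule_format, of n] by simp
    then show ?case unfolding d_def by simp
  qed
qed

text \<open>The j-th radius is so small that on the ball of radius j the L1 error of every
  \<open>f i\<close> is at most (1/2)^j. These errors are summable, so for almost every x their
  pointwise sum is finite and they tend to 0 along the sequence itself.\<close>

lemma mollifying_sequence:
  fixes f :: "nat \<Rightarrow> real^2 \<Rightarrow> complex"
  assumes f: "\<And>i. i < n \<Longrightarrow> locally_integrable (f i)"
  obtains r \<kappa> k where "\<And>j::nat. smooth_mollifier (r j) (\<kappa> j) (k j)"
    "AE x in lebesgue. \<forall>i<n. (\<lambda>j. conv (\<kappa> j) (f i) x) \<longlonglongrightarrow> f i x"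
proof -
  define ok where "ok i j \<epsilon> \<longleftrightarrow> \<epsilon> > 0 \<and> (\<forall>\<kappa> r. mollifier r \<kappa> \<longrightarrow> r \<le> \<epsilon> \<longrightarrow>
    (\<integral>\<^sup>+x. ennreal (norm (indicator (cball 0 (real j)) x *\<^sub>R (conv \<kappa> (f i) x - f i x))) \<partial>lebesgue) \<le> ennreal ((1/2)^j))"
    for i j \<epsilon>
  have ex: "\<exists>\<epsilon>. ok i j \<epsilon>" if "i < n" for i j
  proof (rule mollify_L1_local[OF f[OF that], of "(1/2)^j" "real j"])
    fix \<epsilon> :: real
    assume 1: "\<epsilon> > 0" and 2: "\<And>\<kappa> r. \<lbrakk>mollifier r \<kappa>; r \<le> \<epsilon>\<rbrakk> \<Longrightarrow>
      (\<integral>\<^sup>+x. ennreal (norm (indicator (cball 0 (real j)) x *\<^sub>R (conv \<kappa> (f i) x - f i x))) \<partial>lebesgue) \<le> ennreal ((1/2)^j)"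
    have "ok i j \<epsilon>" unfolding ok_def by (intro conjI allI impI 1 2)
    then show ?thesis by (rule exI)
  qed simp
  define \<epsilon> where "\<epsilon> i j = (SOME e. ok i j e)" for i j
  have ok: "ok i j (\<epsilon> i j)" if "i < n" for i j unfolding \<epsilon>_def by (rule someI_ex[OF ex[OF that]])
  have \<epsilon>: "\<epsilon> i j > 0" if "i < n" for i j using ok[OF that, of j] unfolding ok_def by (rule conjunct1)
  have \<epsilon>2: "(\<integral>\<^sup>+x. ennreal (norm (indicator (cball 0 (real j)) x *\<^sub>R (conv \<kappa> (f i) x - f i x))) \<partial>lebesgue) \<le> ennreal ((1/2)^j)"
    if "i < n" "mollifier r \<kappa>" "r \<le> \<epsilon> i j" for i j \<kappa> r
    using ok[OF that(1), of j] that(2,3) unfolding ok_def by (elim conjE allE impE)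
  \<comment> \<open>One radius serves all n functions; the inserted 1 covers n = 0.\<close>
  define r where "r j = Min (insert 1 ((\<lambda>i. \<epsilon> i j) ` {..<n}))" for j
  have r0: "r j > 0" for j unfolding r_def using \<epsilon> by (subst Min_gr_iff) auto
  have rle: "r j \<le> \<epsilon> i j" if "i < n" for i j unfolding r_def using that by (intro Min_le) auto
  have "\<exists>\<kappa> k. smooth_mollifier (r j) \<kappa> k" for j using smooth_mollifier_exists[OF r0[of j]] by blast
  then obtain \<kappa> k where m: "\<And>j. smooth_mollifier (r j) (\<kappa> j) (k j)" by metis
  have mm: "mollifier (r j) (\<kappa> j)" "kernel (r j) (\<kappa> j)" for j
    using m[of j] unfolding smooth_mollifier_def mollifier_def by auto
  have "AE x in lebesgue. (\<lambda>j. conv (\<kappa> j) (f i) x) \<longlonglongrightarrow> f i x" if i: "i < n" for i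
  proof -
    define a where "a j x = norm (indicator (cball 0 (real j)) x *\<^sub>R (conv (\<kappa> j) (f i) x - f i x))" for j x
    have am: "(\<lambda>x. ennreal (a j x)) \<in> borel_measurable lebesgue" for j
    proof -
      have 1: "(\<lambda>x. indicator (cball 0 (real j)) x *\<^sub>R f i x) \<in> borel_measurable lebesgue"
        by (rule borel_measurable_integrable[OF integrable_cball_locally_integrable[OF f[OF i]]])
      have 2: "conv (\<kappa> j) (f i) \<in> borel_measurable lebesgue"
        using borel_measurable_continuous_onI[OF conv_continuous[OF mm(2) f[OF i]]] by (intro measurable_completion) simp
      have 3: "(\<lambda>x. indicator (cball (0::real^2) (real j)) x :: real) \<in> borel_measurable lebesgue"
        by (rule borel_measurable_indicator) simp
      have "a j = (\<lambda>x. norm (indicator (cball 0 (real j)) x *\<^sub>R conv (\<kappa> j) (f i) x - indicator (cball 0 (real j)) x *\<^sub>R f i x))"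
        unfolding a_def by (simp add: fun_eq_iff scaleR_diff_right)
      also have "\<dots> \<in> borel_measurable lebesgue"
        by (rule measurable_compose[OF borel_measurable_diff[OF borel_measurable_scaleR[OF 3 2] 1] borel_measurable_norm])
      finally show ?thesis by simp
    qed
    have "(\<integral>\<^sup>+x. (\<Sum>j. ennreal (a j x)) \<partial>lebesgue) = (\<Sum>j. \<integral>\<^sup>+x. ennreal (a j x) \<partial>lebesgue)"
      by (rule nn_integral_suminf[OF am])
    also have "\<dots> \<le> (\<Sum>j. ennreal ((1/2)^j))"
      unfolding a_def by (intro suminf_le \<epsilon>2[OF i mm(1) rle[OF i]]) auto
    also have "\<dots> = ennreal (\<Sum>j. (1/2)^j)" by (intro suminf_ennreal2) auto
    also have "\<dots> < \<infinity>" by simp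
    finally have "(\<integral>\<^sup>+x. (\<Sum>j. ennreal (a j x)) \<partial>lebesgue) \<noteq> \<infinity>" by simp
    then have "AE x in lebesgue. (\<Sum>j. ennreal (a j x)) \<noteq> \<infinity>"
      using am by (intro nn_integral_noteq_infinite) auto
    then show ?thesis
    proof eventually_elim
      case (elim x)
      then have "summable (\<lambda>j. a j x)" by (intro summable_suminf_not_top) (auto simp: a_def)
      then have "(\<lambda>j. a j x) \<longlonglongrightarrow> 0" by (rule summable_LIMSEQ_zero)
      moreover obtain N :: nat where "norm x \<le> real N" using real_arch_simple by blast
      then have "\<forall>\<^sub>F j in sequentially. a j x = norm (conv (\<kappa> j) (f i) x - f i x)"
        unfolding eventually_sequentially by (intro exI[of _ N]) (auto simp: a_def)
      ultimately have "(\<lambda>j. norm (conv (\<kappa> j) (f i) x - f i x)) \<longlonglongrightarrow> 0" by (rule Lim_transform_eventually)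
      then show ?case by (simp add: tendsto_norm_zero_iff Lim_null[symmetric])
    qed
  qed
  then have "AE x in lebesgue. \<forall>i\<in>{..<n}. (\<lambda>j. conv (\<kappa> j) (f i) x) \<longlonglongrightarrow> f i x"
    by (intro AE_finite_allI) auto
  then show thesis using that[OF m] by (auto simp: Ball_def)
qed

section \<open>Passage to the limit\<close>

lemma locally_integrable_measurable:
  fixes f :: "'a::euclidean_space \<Rightarrow> 'b::{banach, second_countable_topology}"
  assumes "locally_integrable f"
  shows "f \<in> borel_measurable lebesgue"
proof (rule borel_measurable_LIMSEQ_metric)
  show "(\<lambda>x. indicator (cball 0 (real n)) x *\<^sub>R f x) \<in> borel_measurable lebesgue" for n
  proof -
    have "integrable (lebesgue_on (cball 0 (real n))) f" using assms unfolding locally_integrable_def by simp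
    then have "integrable lebesgue (\<lambda>x. indicator (cball 0 (real n)) x *\<^sub>R f x)" by (simp add: integrable_restrict_space)
    then show ?thesis by (rule borel_measurable_integrable)
  qed
  fix x :: 'a
  obtain N :: nat where "norm x \<le> real N" using real_arch_simple by blast
  then have "\<forall>\<^sub>F n in sequentially. indicator (cball 0 (real n)) x *\<^sub>R f x = f x"
    unfolding eventually_sequentially by (intro exI[of _ N]) auto
  then show "(\<lambda>n. indicator (cball 0 (real n)) x *\<^sub>R f x) \<longlonglongrightarrow> f x" by (rule tendsto_eventually)
qed

lemma bounded_convergent_subsequence:
  fixes c :: "nat \<Rightarrow> nat \<Rightarrow> complex"
  assumes "\<And>j i. i < n \<Longrightarrow> cmod (c j i) \<le> 1"
  obtains s l where "strict_mono s" "\<And>i. i < n \<Longrightarrow> (\<lambda>j. c (s j) i) \<longlonglongrightarrow> l i"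
  using assms
proof (induction n arbitrary: thesis)
  case 0
  then show ?case using strict_mono_id by blast
next
  case (Suc n)
  obtain s l where s: "strict_mono s" "\<And>i. i < n \<Longrightarrow> (\<lambda>j. c (s j) i) \<longlonglongrightarrow> l i"
    using Suc.IH Suc.prems(2) by (metis less_SucI)
  have "\<forall>j. c (s j) n \<in> cball 0 1" using Suc.prems(2) by simp
  moreover have "seq_compact (cball (0::complex) 1)" by (simp add: compact_imp_seq_compact)
  ultimately obtain a r where r: "strict_mono r" "((\<lambda>j. c (s j) n) \<circ> r) \<longlonglongrightarrow> a"
    unfolding seq_compact_def by meson
  show ?case
  proof (rule Suc.prems(1)[of "s \<circ> r" "l(n := a)"])
    show "strict_mono (s \<circ> r)" by (rule strict_mono_o[OF s(1) r(1)])
    fix i assume "i < Suc n"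
    then consider "i = n" | "i < n" by linarith
    then show "(\<lambda>j. c ((s \<circ> r) j) i) \<longlonglongrightarrow> (l(n := a)) i"
    proof cases
      case 2
      then show ?thesis using LIMSEQ_subseq_LIMSEQ[OF s(2)[OF 2] r(1)] by (simp add: o_def)
    qed (use r(2) in \<open>simp add: o_def\<close>)
  qed
qed

lemma cmod_sum_square_le:
  assumes "\<And>i. i < n \<Longrightarrow> cmod (c i) \<le> 1"
  shows "(cmod (\<Sum>i<n. c i * z i))\<^sup>2 \<le> real n * (\<Sum>i<n. (cmod (z i))\<^sup>2)"
proof -
  have "cmod (\<Sum>i<n. c i * z i) \<le> (\<Sum>i<n. cmod (c i * z i))" by (rule norm_sum)
  also have "\<dots> \<le> (\<Sum>i<n. cmod (z i))"
    using assms by (intro sum_mono) (simp add: norm_mult mult_left_le_one_le)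
  finally have "(cmod (\<Sum>i<n. c i * z i))\<^sup>2 \<le> (\<Sum>i<n. cmod (z i))\<^sup>2" by (intro power_mono) auto
  also have "\<dots> \<le> (\<Sum>i<n. (cmod (z i))\<^sup>2) * card {..<n}" by (rule sum_squared_le_sum_of_squares)
  finally show ?thesis by (simp add: mult.commute)
qed

lemma locally_integrable_combination:
  fixes f :: "nat \<Rightarrow> real^2 \<Rightarrow> complex"
  assumes "\<And>i. i < n \<Longrightarrow> locally_integrable (f i)"
  shows "locally_integrable (\<lambda>x. \<Sum>i<n. c i * f i x)"
  using assms unfolding locally_integrable_def
  by (intro allI impI Bochner_Integration.integrable_sum integrable_mult_right) auto

text \<open>The partial derivatives vanish off the closed support as well, because \<phi> is 0 on
  its open complement. So both multipliers are continuous with bounded support.\<close>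

lemma test_function_integrable:
  fixes w :: "real^2 \<Rightarrow> complex"
  assumes \<phi>: "test_function \<phi>" and w: "locally_integrable w"
  shows "integrable lebesgue (\<lambda>x. \<phi> x *\<^sub>R w x)" "integrable lebesgue (\<lambda>x. partial l \<phi> x *\<^sub>R w x)"
proof -
  let ?S = "closure {x. \<phi> x \<noteq> 0}"
  have S: "compact ?S" and C: "C_k k \<phi>" for k using \<phi> unfolding test_function_def by auto
  obtain R where R: "?S \<subseteq> cball 0 R" using compact_imp_bounded[OF S] unfolding bounded_iff by (auto simp: subset_iff)
  have main: "integrable lebesgue (\<lambda>x. K x *\<^sub>R w x)"
    if K: "continuous_on UNIV K" "\<And>x. x \<notin> ?S \<Longrightarrow> K x = 0" for K
  proof -
    have 0: "K x = 0" if "x \<notin> cball 0 R" for x using K(2) R that by blast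
    then have "kernel R K" unfolding kernel_def using K(1) by simp
    then obtain e where "\<And>x. \<bar>K x\<bar> \<le> e" using kernel_bounded by metis
    then show ?thesis using integrable_kernel_mult(1)[OF w K(1) _ 0] by blast
  qed
  have out: "\<phi> x = 0" if "x \<notin> ?S" for x
  proof (rule ccontr)
    assume "\<phi> x \<noteq> 0"
    then have "x \<in> ?S" by (intro subsetD[OF closure_subset]) simp
    then show False using that by contradiction
  qed
  have "continuous_on UNIV \<phi>" using C[of 0] by (simp only: C_k.simps)
  then show "integrable lebesgue (\<lambda>x. \<phi> x *\<^sub>R w x)" using out by (rule main)
  show "integrable lebesgue (\<lambda>x. partial l \<phi> x *\<^sub>R w x)"
  proof (rule main)
    show "continuous_on UNIV (partial l \<phi>)" using C[of "Suc 0"] by (simp only: C_k.simps)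
    fix x assume x: "x \<notin> ?S"
    have "(\<phi> has_derivative (\<lambda>h. 0)) (at x)"
    proof (rule has_derivative_transform_within_open)
      show "((\<lambda>x. 0) has_derivative (\<lambda>h. 0)) (at x)" by (rule has_derivative_const)
      show "open (- ?S)" by (rule open_Compl[OF closed_closure])
      show "x \<in> - ?S" by (rule ComplI) (use x in contradiction)
      show "0 = \<phi> y" if "y \<in> - ?S" for y using out[OF ComplD[OF that]] by (rule sym)
    qed
    from frechet_derivative_at[OF this, symmetric] show "partial l \<phi> x = 0" unfolding partial_def by (simp only:)
  qed
qed

lemma has_weak_partial_combination:
  fixes n :: nat
  assumes "\<And>i. i < n \<Longrightarrow> has_weak_partial l (w i) (g i)"
  shows "has_weak_partial l (\<lambda>x. \<Sum>i<n. c i * w i x) (\<lambda>x. \<Sum>i<n. c i * g i x)"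
  unfolding has_weak_partial_def
proof (intro conjI allI impI)
  have l: "locally_integrable (w i)" "locally_integrable (g i)" if "i < n" for i
    using assms[OF that] unfolding has_weak_partial_def by auto
  show "locally_integrable (\<lambda>x. \<Sum>i<n. c i * w i x)" by (rule locally_integrable_combination) (rule l(1))
  show "locally_integrable (\<lambda>x. \<Sum>i<n. c i * g i x)" by (rule locally_integrable_combination) (rule l(2))
  fix \<phi> assume \<phi>: "test_function \<phi>"
  note int = test_function_integrable[OF \<phi>]
  have "(LINT x|lebesgue. partial l \<phi> x *\<^sub>R (\<Sum>i<n. c i * w i x)) = (LINT x|lebesgue. (\<Sum>i<n. c i * (partial l \<phi> x *\<^sub>R w i x)))"
    by (simp add: scaleR_sum_right)
  also have "\<dots> = (\<Sum>i<n. LINT x|lebesgue. c i * (partial l \<phi> x *\<^sub>R w i x))"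
    using int(2) l by (intro Bochner_Integration.integral_sum integrable_mult_right) auto
  also have "\<dots> = (\<Sum>i<n. c i * (LINT x|lebesgue. partial l \<phi> x *\<^sub>R w i x))"
    by (simp only: Bochner_Integration.integral_mult_right_zero)
  also have "\<dots> = (\<Sum>i<n. c i * - (LINT x|lebesgue. \<phi> x *\<^sub>R g i x))"
    using assms \<phi> unfolding has_weak_partial_def by (intro sum.cong refl) simp
  also have "\<dots> = - (\<Sum>i<n. LINT x|lebesgue. c i * (\<phi> x *\<^sub>R g i x))"
    by (simp only: Bochner_Integration.integral_mult_right_zero mult_minus_right sum_negf)
  also have "(\<Sum>i<n. LINT x|lebesgue. c i * (\<phi> x *\<^sub>R g i x)) = (LINT x|lebesgue. (\<Sum>i<n. c i * (\<phi> x *\<^sub>R g i x)))"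
    using int(1) l by (intro Bochner_Integration.integral_sum[symmetric] integrable_mult_right) auto
  also have "\<dots> = (LINT x|lebesgue. \<phi> x *\<^sub>R (\<Sum>i<n. c i * g i x))" by (simp add: scaleR_sum_right)
  finally show "(LINT x|lebesgue. partial l \<phi> x *\<^sub>R (\<Sum>i<n. c i * w i x)) = - (LINT x|lebesgue. \<phi> x *\<^sub>R (\<Sum>i<n. c i * g i x))" .
qed

lemma conv_combination:
  assumes k: "kernel r \<kappa>" and f: "\<And>i. i < n \<Longrightarrow> locally_integrable (f i)"
  shows "conv \<kappa> (\<lambda>x. \<Sum>i<n. c i * f i x) x = (\<Sum>i<n. c i * conv \<kappa> (f i) x)"
proof -
  have "conv \<kappa> (\<lambda>x. \<Sum>i<n. c i * f i x) x = (LINT y|lebesgue. (\<Sum>i<n. c i * (\<kappa> (x - y) *\<^sub>R f i y)))"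
    unfolding conv_def by (simp add: scaleR_sum_right)
  also have "\<dots> = (\<Sum>i<n. LINT y|lebesgue. c i * (\<kappa> (x - y) *\<^sub>R f i y))"
    using conv_integrable[OF k f] by (intro Bochner_Integration.integral_sum integrable_mult_right) auto
  also have "\<dots> = (\<Sum>i<n. c i * conv \<kappa> (f i) x)"
    by (simp only: conv_def Bochner_Integration.integral_mult_right_zero)
  finally show ?thesis .
qed

lemma L2_combination:
  fixes n :: nat
  assumes f: "\<And>i. i < n \<Longrightarrow> f i \<in> L2 M" and c: "\<And>i. i < n \<Longrightarrow> cmod (c i) \<le> 1"
  shows "(\<lambda>x. \<Sum>i<n. c i * f i x) \<in> L2 M"
proof -
  have m: "f i \<in> borel_measurable M" and i: "integrable M (\<lambda>x. (cmod (f i x))\<^sup>2)" if "i < n" for i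
    using f[OF that] unfolding L2_def by auto
  have mm: "(\<lambda>x. \<Sum>i<n. c i * f i x) \<in> borel_measurable M" using m by (intro borel_measurable_sum borel_measurable_times) auto
  have "integrable M (\<lambda>x. (cmod (\<Sum>i<n. c i * f i x))\<^sup>2)"
  proof (rule Bochner_Integration.integrable_bound)
    show "integrable M (\<lambda>x. real n * (\<Sum>i<n. (cmod (f i x))\<^sup>2))"
      using i by (intro integrable_mult_right Bochner_Integration.integrable_sum) auto
    show "(\<lambda>x. (cmod (\<Sum>i<n. c i * f i x))\<^sup>2) \<in> borel_measurable M" using mm by measurable
    show "AE x in M. norm ((cmod (\<Sum>i<n. c i * f i x))\<^sup>2) \<le> norm (real n * (\<Sum>i<n. (cmod (f i x))\<^sup>2))"
      using cmod_sum_square_le[OF c] by (intro AE_I2) (simp add: sum_nonneg)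
  qed
  then show ?thesis using mm unfolding L2_def by simp
qed

text \<open>A basis of L is either infinite, or finite with more than N elements; in both cases it
  contains N + 1 independent vectors. This treats the two values of \<open>edim\<close>
  alike.\<close>

lemma cfun_independent_subset:
  assumes "edim scale_fun L > enat N"
  obtains S where "S \<subseteq> L" "cfun.independent S" "finite S" "card S = Suc N"
proof -
  obtain B where B: "B \<subseteq> L" "cfun.independent B" "L \<subseteq> cfun.span B" "card B = cfun.dim L" by (rule cfun.basis_exists)
  have "\<exists>S\<subseteq>B. finite S \<and> card S = Suc N"
  proof (cases "finite B")
    case True
    then have "edim scale_fun L = enat (cfun.dim L)" unfolding edim_def using B(3) by auto
    then have "Suc N \<le> card B" using assms B(4) by simp
    then show ?thesis by (meson obtain_subset_with_card_n)
  next
    case False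
    then show ?thesis using infinite_arbitrarily_large by blast
  qed
  then obtain S where S: "S \<subseteq> B" "finite S" "card S = Suc N" by blast
  show thesis by (rule that[OF _ cfun.independent_mono[OF B(2) S(1)] S(2,3)]) (use S(1) B(1) in blast)
qed

lemma independent_combination_nonzero:
  fixes n :: nat
  assumes S: "cfun.independent S" "finite S" and w: "bij_betw w {..<n} S" and c: "\<exists>i<n. c i \<noteq> 0"
  shows "(\<lambda>x. \<Sum>i<n. c i * w i x) \<noteq> 0" "S \<subseteq> L \<Longrightarrow> cfun.subspace L \<Longrightarrow> (\<lambda>x. \<Sum>i<n. c i * w i x) \<in> L"
proof -
  have ap: "sum f I x = (\<Sum>i\<in>I. f i x)" for f :: "nat \<Rightarrow> 'a \<Rightarrow> complex" and I x
    by (induction I rule: infinite_finite_induct) auto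
  have e: "(\<lambda>x. \<Sum>i<n. c i * w i x) = (\<Sum>i<n. scale_fun (c i) (w i))"
    by (simp add: fun_eq_iff ap scale_fun_def)
  define u where "u v = c (the_inv_into {..<n} w v)" for v
  have inj: "inj_on w {..<n}" and im: "w ` {..<n} = S" using w unfolding bij_betw_def by auto
  have u: "u (w i) = c i" if "i < n" for i unfolding u_def using that by (simp add: the_inv_into_f_f[OF inj])
  have s: "(\<Sum>i<n. scale_fun (c i) (w i)) = (\<Sum>v\<in>S. scale_fun (u v) v)"
    unfolding im[symmetric] by (subst sum.reindex[OF inj]) (simp add: u)
  show "(\<lambda>x. \<Sum>i<n. c i * w i x) \<noteq> 0"
  proof
    assume "(\<lambda>x. \<Sum>i<n. c i * w i x) = 0"
    then have "(\<Sum>v\<in>S. scale_fun (u v) v) = 0" using e s by simp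
    then have "\<forall>v\<in>S. u v = 0" using S unfolding cfun.independent_explicit_finite_subsets by blast
    then show False using c u im by (metis imageI lessThan_iff)
  qed
  assume "S \<subseteq> L" "cfun.subspace L"
  then show "(\<lambda>x. \<Sum>i<n. c i * w i x) \<in> L"
    unfolding e using im by (intro cfun.subspace_sum cfun.subspace_scale) auto
qed

text \<open>Mollification commutes with weak derivatives and contracts L2. So the right-hand side
  can be stated with the weak derivatives themselves, and \<kappa> enters it only through the choice
  of c. The left-hand side is an extended integral, as Fatou's lemma requires.\<close>

lemma mollified_form_bound:
  fixes V :: "real^2 \<Rightarrow> real" and w :: "nat \<Rightarrow> real^2 \<Rightarrow> complex" and g :: "nat \<Rightarrow> 2 \<Rightarrow> real^2 \<Rightarrow> complex"
  assumes V: "locally_integrable V" "AE x in lebesgue. 0 \<le> V x"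
    and \<beta>: "\<And>i. B V i = ennreal (\<beta> i)" "\<And>i. \<beta> i \<ge> 0"
    and count: "\<And>F F'. \<lbrakk>finite F; F \<subseteq> {i. A V i > 1/4}; finite F'; F' \<subseteq> {i. \<beta> i > thr / 9}\<rbrakk>
      \<Longrightarrow> 1 + 4 * (\<Sum>i\<in>F. sqrt (A V i)) + 153 / thr * (\<Sum>i\<in>F'. \<beta> i) < real n"
    and w: "\<And>i l. i < n \<Longrightarrow> has_weak_partial l (w i) (g i l)" and g: "\<And>i l. i < n \<Longrightarrow> g i l \<in> L2 lebesgue"
    and m: "smooth_mollifier r \<kappa> k" and e: "e > 0"
  obtains c where "\<And>i. i < n \<Longrightarrow> cmod (c i) \<le> 1" "\<exists>i<n. c i = 1"
    "(\<integral>\<^sup>+x. ennreal (indicator (annulus (2^j)) x * V x * (cmod (\<Sum>i<n. c i * conv \<kappa> (w i) x))\<^sup>2) \<partial>lebesgue)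
      \<le> ennreal ((LINT x|lebesgue. (cmod (\<Sum>i<n. c i * g i 1 x))\<^sup>2) + (LINT x|lebesgue. (cmod (\<Sum>i<n. c i * g i 2 x))\<^sup>2) + e)"
proof -
  have mm: "mollifier r \<kappa>" and kk: "kernel r \<kappa>" and k: "kernel r (k i)"
    and der: "(\<kappa> has_derivative (\<lambda>h. h$1 * k 1 z + h$2 * k 2 z)) (at z)" for i z
    using m unfolding smooth_mollifier_def mollifier_def by auto
  have lw: "locally_integrable (w i)" and lg: "locally_integrable (g i l)" if "i < n" for i l
    using w[OF that] unfolding has_weak_partial_def by auto
  define D where "D i x = (conv (k 1) (w i) x, conv (k 2) (w i) x)" for i x
  have grad: "has_gradient (conv \<kappa> (w i)) (D i)" if "i < n" for i
    unfolding D_def[abs_def] by (rule conv_has_gradient[OF kk k k lw[OF that] der])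
  show thesis
  proof (rule smooth_form_bound[of n "\<lambda>i. conv \<kappa> (w i)" D V \<beta> e j, OF grad V \<beta> count e])
    fix c
    assume c: "\<And>i. i < n \<Longrightarrow> cmod (c i) \<le> 1" "\<exists>i<n. c i = 1"
      and le: "(LINT x|lebesgue. indicator (annulus (2^j)) x * V x * (cmod (\<Sum>i<n. c i * conv \<kappa> (w i) x))\<^sup>2)
      \<le> (LINT x|lebesgue. indicator (annulus (2^j)) x * (norm (\<Sum>i<n. c i * fst (D i x), \<Sum>i<n. c i * snd (D i x)))\<^sup>2) + e"
    let ?I = "indicator (annulus (2^j)) :: real^2 \<Rightarrow> real"
    let ?u = "\<lambda>x. \<Sum>i<n. c i * conv \<kappa> (w i) x"
    define G where "G l x = (\<Sum>i<n. c i * g i l x)" for l x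
    have lG: "locally_integrable (G l)" for l unfolding G_def[abs_def] by (rule locally_integrable_combination) (rule lg)
    have L2G: "G l \<in> L2 lebesgue" for l unfolding G_def[abs_def] by (rule L2_combination) (rule g c(1), assumption)+
    have Gi: "integrable lebesgue (\<lambda>x. (cmod (G l x))\<^sup>2)" for l using L2G[of l] unfolding L2_def by simp
    have cG: "conv \<kappa> (G l) x = (\<Sum>i<n. c i * conv (k l) (w i) x)" for l x
    proof -
      have "conv \<kappa> (G l) x = (\<Sum>i<n. c i * conv \<kappa> (g i l) x)"
        unfolding G_def[abs_def] by (rule conv_combination[OF kk]) (rule lg)
      also have "\<dots> = (\<Sum>i<n. c i * conv (k l) (w i) x)"
        by (intro sum.cong refl) (simp add: conv_weak_partial[OF m w])
      finally show ?thesis .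
    qed
    have cu: "continuous_on UNIV (\<lambda>x. (cmod (?u x))\<^sup>2)"
      by (intro continuous_intros conv_continuous[OF kk] lw) simp
    have cGc: "continuous_on UNIV (\<lambda>x. (cmod (conv \<kappa> (G l) x))\<^sup>2)" for l
      by (intro continuous_intros conv_continuous[OF kk lG])
    have IV: "integrable lebesgue (\<lambda>x. ?I x * V x)"
      by (rule integrable_indicator_locally_integrable[OF V(1) annulus_lmeasurable])
    obtain R where R: "annulus (2^j) \<subseteq> cball (0::real^2) R"
      using annulus_lmeasurable(2)[of "2^j"] unfolding bounded_iff by (auto simp: subset_iff)
    have "bounded ((\<lambda>x. (cmod (?u x))\<^sup>2) ` cball 0 R)"
      by (intro compact_imp_bounded compact_continuous_image continuous_on_subset[OF cu]) auto
    then obtain C where C: "\<And>x. x \<in> cball 0 R \<Longrightarrow> norm ((cmod (?u x))\<^sup>2) \<le> C" unfolding bounded_iff by blast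
    have i1: "integrable lebesgue (\<lambda>x. ?I x * V x * (cmod (?u x))\<^sup>2)"
    proof (rule Bochner_Integration.integrable_bound)
      show "integrable lebesgue (\<lambda>x. C * (?I x * V x))" by (rule integrable_mult_right[OF IV])
      have "(\<lambda>x. (cmod (?u x))\<^sup>2) \<in> borel_measurable lebesgue"
        using borel_measurable_continuous_onI[OF cu] by (intro measurable_completion) simp
      then show "(\<lambda>x. ?I x * V x * (cmod (?u x))\<^sup>2) \<in> borel_measurable lebesgue"
        by (rule borel_measurable_times[OF borel_measurable_integrable[OF IV]])
      have "norm (?I x * V x * (cmod (?u x))\<^sup>2) \<le> norm (C * (?I x * V x))" for x
      proof (cases "x \<in> annulus (2^j)")
        case True
        then have "(cmod (?u x))\<^sup>2 \<le> \<bar>C\<bar>" using C[of x] R by fastforce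
        then have "\<bar>V x\<bar> * (cmod (?u x))\<^sup>2 \<le> \<bar>V x\<bar> * \<bar>C\<bar>" by (rule mult_left_mono) simp
        then show ?thesis using True by (simp add: abs_mult mult.commute)
      qed simp
      then show "AE x in lebesgue. norm (?I x * V x * (cmod (?u x))\<^sup>2) \<le> norm (C * (?I x * V x))" by (rule AE_I2)
    qed
    have i2: "integrable lebesgue (\<lambda>x. ?I x * ((cmod (conv \<kappa> (G 1) x))\<^sup>2 + (cmod (conv \<kappa> (G 2) x))\<^sup>2))"
      by (intro integrable_indicator_continuous annulus_lmeasurable continuous_on_add cGc)
    have eq: "(LINT x|lebesgue. ?I x * (norm (\<Sum>i<n. c i * fst (D i x), \<Sum>i<n. c i * snd (D i x)))\<^sup>2)
      = (LINT x|lebesgue. ?I x * ((cmod (conv \<kappa> (G 1) x))\<^sup>2 + (cmod (conv \<kappa> (G 2) x))\<^sup>2))"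
      unfolding cG D_def norm_Pair by simp
    have "ennreal (LINT x|lebesgue. ?I x * ((cmod (conv \<kappa> (G 1) x))\<^sup>2 + (cmod (conv \<kappa> (G 2) x))\<^sup>2))
      = (\<integral>\<^sup>+x. ennreal (?I x * ((cmod (conv \<kappa> (G 1) x))\<^sup>2 + (cmod (conv \<kappa> (G 2) x))\<^sup>2)) \<partial>lebesgue)"
      by (intro nn_integral_eq_integral[symmetric] i2 AE_I2) simp
    also have "\<dots> \<le> (\<integral>\<^sup>+x. ennreal ((cmod (conv \<kappa> (G 1) x))\<^sup>2) + ennreal ((cmod (conv \<kappa> (G 2) x))\<^sup>2) \<partial>lebesgue)"
      by (intro nn_integral_mono) (auto simp: indicator_def simp flip: ennreal_plus)
    also have "\<dots> = (\<integral>\<^sup>+x. ennreal ((cmod (conv \<kappa> (G 1) x))\<^sup>2) \<partial>lebesgue) + (\<integral>\<^sup>+x. ennreal ((cmod (conv \<kappa> (G 2) x))\<^sup>2) \<partial>lebesgue)"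
    proof -
      have m: "(\<lambda>x. ennreal ((cmod (conv \<kappa> (G l) x))\<^sup>2)) \<in> borel_measurable lebesgue" for l
        using borel_measurable_continuous_onI[OF cGc[of l]] by (intro measurable_completion) simp
      show ?thesis by (rule nn_integral_add[OF m m])
    qed
    also have "\<dots> \<le> (\<integral>\<^sup>+x. ennreal ((cmod (G 1 x))\<^sup>2) \<partial>lebesgue) + (\<integral>\<^sup>+x. ennreal ((cmod (G 2 x))\<^sup>2) \<partial>lebesgue)"
      by (intro add_mono conv_L2_le[OF mm lG L2G])
    also have "\<dots> = ennreal (LINT x|lebesgue. (cmod (G 1 x))\<^sup>2) + ennreal (LINT x|lebesgue. (cmod (G 2 x))\<^sup>2)"
      using nn_integral_eq_integral[OF Gi] by simp
    also have "\<dots> = ennreal ((LINT x|lebesgue. (cmod (G 1 x))\<^sup>2) + (LINT x|lebesgue. (cmod (G 2 x))\<^sup>2))"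
      by (intro ennreal_plus[symmetric] integral_nonneg_AE AE_I2) auto
    finally have "(LINT x|lebesgue. ?I x * ((cmod (conv \<kappa> (G 1) x))\<^sup>2 + (cmod (conv \<kappa> (G 2) x))\<^sup>2))
      \<le> (LINT x|lebesgue. (cmod (G 1 x))\<^sup>2) + (LINT x|lebesgue. (cmod (G 2 x))\<^sup>2)"
      by (subst (asm) ennreal_le_iff) (auto intro!: add_nonneg_nonneg integral_nonneg_AE)
    then have le': "(LINT x|lebesgue. ?I x * V x * (cmod (?u x))\<^sup>2)
      \<le> (LINT x|lebesgue. (cmod (G 1 x))\<^sup>2) + (LINT x|lebesgue. (cmod (G 2 x))\<^sup>2) + e"
      using le unfolding eq by linarith
    have "(\<integral>\<^sup>+x. ennreal (?I x * V x * (cmod (?u x))\<^sup>2) \<partial>lebesgue) = ennreal (LINT x|lebesgue. ?I x * V x * (cmod (?u x))\<^sup>2)"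
      by (intro nn_integral_eq_integral i1) (use V(2) in eventually_elim, simp)
    also have "\<dots> \<le> ennreal ((LINT x|lebesgue. (cmod (G 1 x))\<^sup>2) + (LINT x|lebesgue. (cmod (G 2 x))\<^sup>2) + e)"
      by (rule ennreal_leI[OF le'])
    finally have fin: "(\<integral>\<^sup>+x. ennreal (?I x * V x * (cmod (?u x))\<^sup>2) \<partial>lebesgue)
      \<le> ennreal ((LINT x|lebesgue. (cmod (G 1 x))\<^sup>2) + (LINT x|lebesgue. (cmod (G 2 x))\<^sup>2) + e)" .
    show thesis by (rule that[OF c fin[unfolded G_def]])
  qed
qed

text \<open>On the left, annulus, mollifier and coefficients all change with j; the integrand
  converges almost everywhere and Fatou's lemma applies. On the right, apart from the error 1/(j+1),
  only the coefficients change, within the unit disc, and dominated convergence gives the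
  limit.\<close>

lemma limit_form_bound:
  fixes V :: "real^2 \<Rightarrow> real" and w :: "nat \<Rightarrow> real^2 \<Rightarrow> complex" and g :: "nat \<Rightarrow> 2 \<Rightarrow> real^2 \<Rightarrow> complex"
  assumes V: "locally_integrable V" "AE x in lebesgue. 0 \<le> V x"
    and \<beta>: "\<And>i. B V i = ennreal (\<beta> i)" "\<And>i. \<beta> i \<ge> 0"
    and count: "\<And>F F'. \<lbrakk>finite F; F \<subseteq> {i. A V i > 1/4}; finite F'; F' \<subseteq> {i. \<beta> i > thr / 9}\<rbrakk>
      \<Longrightarrow> 1 + 4 * (\<Sum>i\<in>F. sqrt (A V i)) + 153 / thr * (\<Sum>i\<in>F'. \<beta> i) < real n"
    and w: "\<And>i l. i < n \<Longrightarrow> has_weak_partial l (w i) (g i l)" and g: "\<And>i l. i < n \<Longrightarrow> g i l \<in> L2 lebesgue"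
  obtains c where "\<And>i. i < n \<Longrightarrow> cmod (c i) \<le> 1" "\<exists>i<n. c i \<noteq> 0"
    "(\<integral>\<^sup>+x. ennreal (V x * (cmod (\<Sum>i<n. c i * w i x))\<^sup>2) \<partial>lebesgue)
      \<le> ennreal ((LINT x|lebesgue. (cmod (\<Sum>i<n. c i * g i 1 x))\<^sup>2) + (LINT x|lebesgue. (cmod (\<Sum>i<n. c i * g i 2 x))\<^sup>2))"
proof -
  have lw: "locally_integrable (w i)" if "i < n" for i
    using w[OF that] unfolding has_weak_partial_def by auto
  obtain r \<kappa> k where m: "\<And>j::nat. smooth_mollifier (r j) (\<kappa> j) (k j)"
    and lim: "AE x in lebesgue. \<forall>i<n. (\<lambda>j. conv (\<kappa> j) (w i) x) \<longlonglongrightarrow> w i x"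
    using mollifying_sequence[of n w, OF lw] by blast
  have kk: "kernel (r j) (\<kappa> j)" for j using m[of j] unfolding smooth_mollifier_def mollifier_def by blast
  define Q where "Q l c = (LINT x|lebesgue. (cmod (\<Sum>i<n. c i * g i l x))\<^sup>2)" for l :: 2 and c :: "nat \<Rightarrow> complex"
  define ind where "ind j = (indicator (annulus (2^j)) :: real^2 \<Rightarrow> real)" for j :: nat
  define ok where "ok j c \<longleftrightarrow> (\<forall>i<n. cmod (c i) \<le> 1) \<and> (\<exists>i<n. c i = 1) \<and>
    (\<integral>\<^sup>+x. ennreal (ind j x * V x * (cmod (\<Sum>i<n. c i * conv (\<kappa> j) (w i) x))\<^sup>2) \<partial>lebesgue)
      \<le> ennreal (Q 1 c + Q 2 c + 1 / real (Suc j))" for j c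
  have pos: "1 / real (Suc j) > 0" for j by simp
  have "\<exists>c. ok j c" for j
  proof (rule mollified_form_bound[of V \<beta> n w g "r j" "\<kappa> j" "k j" "1 / real (Suc j)" j, OF V \<beta> count w g m pos])
    fix c
    assume 1: "\<And>i. i < n \<Longrightarrow> cmod (c i) \<le> 1" "\<exists>i<n. c i = 1"
      "(\<integral>\<^sup>+x. ennreal (indicator (annulus (2^j)) x * V x * (cmod (\<Sum>i<n. c i * conv (\<kappa> j) (w i) x))\<^sup>2) \<partial>lebesgue)
      \<le> ennreal ((LINT x|lebesgue. (cmod (\<Sum>i<n. c i * g i 1 x))\<^sup>2) + (LINT x|lebesgue. (cmod (\<Sum>i<n. c i * g i 2 x))\<^sup>2) + 1 / real (Suc j))"
    have "ok j c" unfolding ok_def Q_def ind_def by (intro conjI allI impI 1)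
    then show ?thesis by (rule exI[of "ok j" c])
  qed
  then obtain c where ok: "\<And>j. ok j (c j)" by metis
  have c1: "cmod (c j i) \<le> 1" if "i < n" for i j using ok[of j] that unfolding ok_def by blast
  have c2: "\<exists>i<n. c j i = 1" for j using ok[of j] unfolding ok_def by blast
  have c3: "(\<integral>\<^sup>+x. ennreal (ind j x * V x * (cmod (\<Sum>i<n. c j i * conv (\<kappa> j) (w i) x))\<^sup>2) \<partial>lebesgue)
      \<le> ennreal (Q 1 (c j) + Q 2 (c j) + 1 / real (Suc j))" for j
    using ok[of j] unfolding ok_def by (elim conjE)
  obtain s l where s: "strict_mono s" and sl: "\<And>i. i < n \<Longrightarrow> (\<lambda>j. c (s j) i) \<longlonglongrightarrow> l i"
    using bounded_convergent_subsequence[of n c, OF c1] by blast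
  have l1: "cmod (l i) \<le> 1" if "i < n" for i
    by (rule LIMSEQ_le_const2[OF tendsto_norm[OF sl[OF that]]]) (use c1[OF that] in blast)
  have lnz: "\<exists>i<n. l i \<noteq> 0"
  proof (rule ccontr)
    assume "\<not> ?thesis"
    then have "(\<lambda>j. \<Sum>i<n. cmod (c (s j) i)) \<longlonglongrightarrow> (\<Sum>i<n. 0)"
      using sl by (intro tendsto_sum tendsto_norm_zero) auto
    \<comment> \<open>The index of the coefficient 1 may change with j, so the sum of all moduli is
      followed instead.\<close>
    moreover have "1 \<le> (\<Sum>i<n. cmod (c (s j) i))" for j
    proof -
      obtain i where i: "i < n" "c (s j) i = 1" using c2 by blast
      have "cmod (c (s j) i) \<le> (\<Sum>i<n. cmod (c (s j) i))" by (rule member_le_sum) (use i in auto)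
      then show ?thesis using i by simp
    qed
    ultimately have "1 \<le> (\<Sum>i<n. (0::real))" by (intro LIMSEQ_le_const) auto
    then show False by simp
  qed
  have gm: "g i q \<in> borel_measurable lebesgue" and gi: "integrable lebesgue (\<lambda>x. (cmod (g i q x))\<^sup>2)" if "i < n" for i q
    using g[OF that, of q] unfolding L2_def by auto
  have Gm: "(\<lambda>x. (cmod (\<Sum>i<n. a i * g i q x))\<^sup>2) \<in> borel_measurable lebesgue" for a q
  proof -
    have "(\<lambda>x. \<Sum>i<n. a i * g i q x) \<in> borel_measurable lebesgue"
      using gm by (intro borel_measurable_sum borel_measurable_times) auto
    then show ?thesis by measurable
  qed
  have Ql: "(\<lambda>j. Q q (c (s j))) \<longlonglongrightarrow> Q q l" for q
    unfolding Q_def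
  proof (rule integral_dominated_convergence[OF Gm Gm])
    show "integrable lebesgue (\<lambda>x. real n * (\<Sum>i<n. (cmod (g i q x))\<^sup>2))"
      using gi by (intro integrable_mult_right Bochner_Integration.integrable_sum) auto
    show "AE x in lebesgue. norm ((cmod (\<Sum>i<n. c (s j) i * g i q x))\<^sup>2) \<le> real n * (\<Sum>i<n. (cmod (g i q x))\<^sup>2)" for j
      using cmod_sum_square_le[of n "c (s j)", OF c1] by (intro AE_I2) simp
    show "AE x in lebesgue. (\<lambda>j. (cmod (\<Sum>i<n. c (s j) i * g i q x))\<^sup>2) \<longlonglongrightarrow> (cmod (\<Sum>i<n. l i * g i q x))\<^sup>2"
      using sl by (intro AE_I2 tendsto_power tendsto_norm tendsto_sum tendsto_mult tendsto_const) auto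
  qed
  define f where "f j x = ennreal (ind (s j) x * V x * (cmod (\<Sum>i<n. c (s j) i * conv (\<kappa> (s j)) (w i) x))\<^sup>2)" for j x
  have Vm: "V \<in> borel_measurable lebesgue" by (rule locally_integrable_measurable[OF V(1)])
  have fm: "f j \<in> borel_measurable lebesgue" for j
  proof -
    have "continuous_on UNIV (\<lambda>x. (cmod (\<Sum>i<n. c (s j) i * conv (\<kappa> (s j)) (w i) x))\<^sup>2)"
      by (intro continuous_intros conv_continuous[OF kk] lw) simp
    from borel_measurable_continuous_onI[OF this]
    have 1: "(\<lambda>x. (cmod (\<Sum>i<n. c (s j) i * conv (\<kappa> (s j)) (w i) x))\<^sup>2) \<in> borel_measurable lebesgue"
      by (intro measurable_completion) simp
    have 2: "ind (s j) \<in> borel_measurable lebesgue"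
      unfolding ind_def by (rule borel_measurable_indicator[OF annulus_lmeasurable(1)])
    show ?thesis unfolding f_def[abs_def]
      by (rule measurable_compose[OF borel_measurable_times[OF borel_measurable_times[OF 2 Vm] 1] measurable_ennreal])
  qed
  \<comment> \<open>The origin lies in no annulus; every other point lies in all sufficiently large
    ones.\<close>
  have "AE x in lebesgue. x \<notin> {0::real^2}" by (rule AE_not_in) (simp add: negligible_iff_null_sets[symmetric])
  then have "AE x in lebesgue. ennreal (V x * (cmod (\<Sum>i<n. l i * w i x))\<^sup>2) = liminf (\<lambda>j. f j x)"
    using lim
  proof eventually_elim
    case (elim x)
    obtain N :: nat where N: "\<bar>ln (norm x)\<bar> < real N" using reals_Archimedean2 by blast
    have "ind (s j) x = 1" if "j \<ge> N" for j
    proof -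
      have "real N \<le> real (s j)" using that strict_mono_imp_increasing[OF s, of j] by simp
      moreover have "real (s j) < 2 ^ s j" by (rule of_nat_less_two_power)
      ultimately have "\<bar>ln (norm x)\<bar> < 2 ^ s j" using N by linarith
      then have "exp (- (2 ^ s j)) < exp (ln (norm x))" "exp (ln (norm x)) < exp (2 ^ s j)" by auto
      moreover have "exp (ln (norm x)) = norm x" using elim(1) by simp
      ultimately have "x \<in> annulus (2 ^ s j)" unfolding annulus_def by (simp only: mem_Collect_eq simp_thms)
      then show ?thesis unfolding ind_def by simp
    qed
    then have "\<forall>\<^sub>F j in sequentially. ind (s j) x = 1" unfolding eventually_sequentially by blast
    then have "(\<lambda>j. ind (s j) x) \<longlonglongrightarrow> 1" by (rule tendsto_eventually)
    moreover have "(\<lambda>j. conv (\<kappa> (s j)) (w i) x) \<longlonglongrightarrow> w i x" if "i < n" for i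
      using LIMSEQ_subseq_LIMSEQ[OF elim(2)[rule_format, OF that] s] by (simp add: o_def)
    ultimately have "(\<lambda>j. f j x) \<longlonglongrightarrow> ennreal (1 * V x * (cmod (\<Sum>i<n. l i * w i x))\<^sup>2)"
      unfolding f_def using sl
      by (intro tendsto_ennrealI tendsto_power tendsto_norm tendsto_sum tendsto_mult tendsto_const) auto
    then have "liminf (\<lambda>j. f j x) = ennreal (1 * V x * (cmod (\<Sum>i<n. l i * w i x))\<^sup>2)"
      by (intro lim_imp_Liminf) auto
    then show ?case by simp
  qed
  then have "(\<integral>\<^sup>+x. ennreal (V x * (cmod (\<Sum>i<n. l i * w i x))\<^sup>2) \<partial>lebesgue) = (\<integral>\<^sup>+x. liminf (\<lambda>j. f j x) \<partial>lebesgue)"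
    by (rule nn_integral_cong_AE)
  also have "\<dots> \<le> liminf (\<lambda>j. \<integral>\<^sup>+x. f j x \<partial>lebesgue)" by (rule nn_integral_liminf[OF fm])
  also have "\<dots> \<le> liminf (\<lambda>j. ennreal (Q 1 (c (s j)) + Q 2 (c (s j)) + 1 / real (Suc (s j))))"
    unfolding f_def by (intro Liminf_mono always_eventually allI c3)
  also have "\<dots> = ennreal (Q 1 l + Q 2 l + 0)"
  proof (rule lim_imp_Liminf)
    have "(\<lambda>j. 1 / real (Suc (s j))) \<longlonglongrightarrow> 0"
      using LIMSEQ_subseq_LIMSEQ[OF LIMSEQ_Suc[OF lim_1_over_n] s] by (simp add: o_def)
    then show "(\<lambda>j. ennreal (Q 1 (c (s j)) + Q 2 (c (s j)) + 1 / real (Suc (s j)))) \<longlonglongrightarrow> ennreal (Q 1 l + Q 2 l + 0)"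
      by (intro tendsto_ennrealI tendsto_add Ql)
  qed simp
  finally have fin: "(\<integral>\<^sup>+x. ennreal (V x * (cmod (\<Sum>i<n. l i * w i x))\<^sup>2) \<partial>lebesgue) \<le> ennreal (Q 1 l + Q 2 l)" by simp
  show thesis by (rule that[OF l1 lnz fin[unfolded Q_def]])
qed

lemma energy_nonneg_combination:
  fixes V :: "real^2 \<Rightarrow> real" and w :: "nat \<Rightarrow> real^2 \<Rightarrow> complex"
  assumes V: "locally_integrable V" "AE x in lebesgue. 0 \<le> V x"
    and \<beta>: "\<And>i. B V i = ennreal (\<beta> i)" "\<And>i. \<beta> i \<ge> 0"
    and count: "\<And>F F'. \<lbrakk>finite F; F \<subseteq> {i. A V i > 1/4}; finite F'; F' \<subseteq> {i. \<beta> i > thr / 9}\<rbrakk>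
      \<Longrightarrow> 1 + 4 * (\<Sum>i\<in>F. sqrt (A V i)) + 153 / thr * (\<Sum>i\<in>F'. \<beta> i) < real n"
    and w: "\<And>i. i < n \<Longrightarrow> w i \<in> W12"
  obtains c where "\<exists>i<n. c i \<noteq> 0" "energy V (\<lambda>x. \<Sum>i<n. c i * w i x) \<ge> 0"
proof -
  have ex: "\<exists>g. g \<in> L2 lebesgue \<and> has_weak_partial l (w i) g" if "i < n" for i l
    using w[OF that] unfolding W12_def by blast
  define g where "g i l = (SOME g. g \<in> L2 lebesgue \<and> has_weak_partial l (w i) g)" for i l
  have g: "g i l \<in> L2 lebesgue" "has_weak_partial l (w i) (g i l)" if "i < n" for i l
    using someI_ex[OF ex[OF that]] unfolding g_def by auto
  show thesis
  proof (rule limit_form_bound[of V \<beta> n w g, OF V \<beta> count g(2,1)])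
    fix c
    assume c1: "\<And>i. i < n \<Longrightarrow> cmod (c i) \<le> 1" and c2: "\<exists>i<n. c i \<noteq> 0"
      and le: "(\<integral>\<^sup>+x. ennreal (V x * (cmod (\<Sum>i<n. c i * w i x))\<^sup>2) \<partial>lebesgue)
      \<le> ennreal ((LINT x|lebesgue. (cmod (\<Sum>i<n. c i * g i 1 x))\<^sup>2) + (LINT x|lebesgue. (cmod (\<Sum>i<n. c i * g i 2 x))\<^sup>2))"
    define u where "u x = (\<Sum>i<n. c i * w i x)" for x
    define G where "G l x = (\<Sum>i<n. c i * g i l x)" for l x
    have uG: "has_weak_partial l u (G l)" for l
      unfolding u_def[abs_def] G_def[abs_def] by (rule has_weak_partial_combination) (rule g(2))
    have G2: "integrable lebesgue (\<lambda>x. (cmod (G l x))\<^sup>2)" for l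
    proof -
      have "G l \<in> L2 lebesgue" unfolding G_def[abs_def] by (rule L2_combination) (rule g(1) c1, assumption)+
      then show ?thesis unfolding L2_def by simp
    qed
    define P where "P l = (LINT x|lebesgue. (cmod (G l x))\<^sup>2)" for l
    have P0: "P l \<ge> 0" for l unfolding P_def by (intro integral_nonneg_AE) auto
    have wp: "has_weak_partial l u (weak_partial l u)" for l unfolding weak_partial_def by (rule someI[of "has_weak_partial l u", OF uG])
    have AE: "AE x in lebesgue. weak_partial l u x = G l x" for l by (rule weak_partial_unique[OF wp uG])
    have m: "weak_partial l u \<in> borel_measurable lebesgue" "G l \<in> borel_measurable lebesgue" "u \<in> borel_measurable lebesgue" for l
      using wp[of l] uG[of l] unfolding has_weak_partial_def by (auto intro: locally_integrable_measurable)
    have "(LINT x|lebesgue. (\<Sum>l\<in>UNIV. (norm (weak_partial l u x))\<^sup>2)) = (LINT x|lebesgue. (cmod (G 1 x))\<^sup>2 + (cmod (G 2 x))\<^sup>2)"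
    proof (rule integral_cong_AE)
      note m[measurable]
      show "(\<lambda>x. \<Sum>l\<in>UNIV. (norm (weak_partial l u x))\<^sup>2) \<in> borel_measurable lebesgue"
        "(\<lambda>x. (cmod (G 1 x))\<^sup>2 + (cmod (G 2 x))\<^sup>2) \<in> borel_measurable lebesgue" by measurable
      show "AE x in lebesgue. (\<Sum>l\<in>UNIV. (norm (weak_partial l u x))\<^sup>2) = (cmod (G 1 x))\<^sup>2 + (cmod (G 2 x))\<^sup>2"
        using AE[of 1] AE[of 2] by eventually_elim (simp add: sum_2)
    qed
    also have "\<dots> = P 1 + P 2" unfolding P_def by (rule Bochner_Integration.integral_add[OF G2 G2])
    finally have grad: "(LINT x|lebesgue. (\<Sum>l\<in>UNIV. (norm (weak_partial l u x))\<^sup>2)) = P 1 + P 2" .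
    \<comment> \<open>The bound obtained so far is for the extended integral, while
      \<open>energy\<close> is written with the Bochner integral.\<close>
    have "(LINT x|lebesgue. V x * (cmod (u x))\<^sup>2) = enn2real (\<integral>\<^sup>+x. ennreal (V x * (cmod (u x))\<^sup>2) \<partial>lebesgue)"
    proof (rule integral_eq_nn_integral)
      note m(3)[measurable] locally_integrable_measurable[OF V(1), measurable]
      show "(\<lambda>x. V x * (cmod (u x))\<^sup>2) \<in> borel_measurable lebesgue" by measurable
      show "AE x in lebesgue. 0 \<le> V x * (cmod (u x))\<^sup>2" using V(2) by eventually_elim simp
    qed
    also have "\<dots> \<le> P 1 + P 2"
      using le P0 unfolding u_def G_def P_def by (intro enn2real_leI add_nonneg_nonneg) auto
    finally have "energy V u \<ge> 0" unfolding energy_def grad by simp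
    then show thesis unfolding u_def[abs_def] by (rule that[OF c2])
  qed
qed

section \<open>Counting dimensions\<close>

lemma edim_le_of_negative:
  fixes V :: "real^2 \<Rightarrow> real"
  assumes V: "locally_integrable V" "AE x in lebesgue. 0 \<le> V x"
    and \<beta>: "\<And>i. B V i = ennreal (\<beta> i)" "\<And>i. \<beta> i \<ge> 0"
    and count: "\<And>F F'. \<lbrakk>finite F; F \<subseteq> {i. A V i > 1/4}; finite F'; F' \<subseteq> {i. \<beta> i > thr / 9}\<rbrakk>
      \<Longrightarrow> 1 + 4 * (\<Sum>i\<in>F. sqrt (A V i)) + 153 / thr * (\<Sum>i\<in>F'. \<beta> i) < real (Suc N)"
    and L: "cfun.subspace L" "L \<subseteq> Dom_energy V" "\<And>u. u \<in> L - {0} \<Longrightarrow> energy V u < 0"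
  shows "edim scale_fun L \<le> enat N"
proof (rule ccontr)
  assume "\<not> ?thesis"
  then have "edim scale_fun L > enat N" by (rule not_le_imp_less)
  then obtain S where S: "S \<subseteq> L" "cfun.independent S" "finite S" "card S = Suc N" by (rule cfun_independent_subset)
  obtain w where w: "bij_betw w {..<Suc N} S"
    using ex_bij_betw_nat_finite[OF S(3)] S(4) by (auto simp: atLeast0LessThan)
  have "w i \<in> W12" if "i < Suc N" for i
  proof -
    have "w i \<in> S" using w that unfolding bij_betw_def by blast
    then show ?thesis using S(1) L(2) unfolding Dom_energy_def by blast
  qed
  then obtain c where c: "\<exists>i<Suc N. c i \<noteq> 0" "energy V (\<lambda>x. \<Sum>i<Suc N. c i * w i x) \<ge> 0"
    using energy_nonneg_combination[of V \<beta> "Suc N" w, OF V \<beta> count] by blast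
  note u = independent_combination_nonzero[OF S(2,3) w c(1)]
  have "energy V (\<lambda>x. \<Sum>i<Suc N. c i * w i x) < 0" by (rule L(3)) (use u(1) u(2)[OF S(1) L(1)] in blast)
  then show False using c(2) by linarith
qed

lemma N_minus_le:
  fixes V :: "real^2 \<Rightarrow> real"
  assumes V: "locally_integrable V" "AE x in lebesgue. 0 \<le> V x"
  shows "ennreal_of_enat (N_minus V) \<le> 1 + 4 * (\<Sum>\<^sub>\<infinity>n\<in>{n. A V n > 1 / 4}. ennreal (sqrt (A V n)))
    + ennreal (153 / thr) * (\<Sum>\<^sub>\<infinity>n\<in>{n. B V n > ennreal (thr / 9)}. B V n)" (is "_ \<le> ?R")
proof (cases "?R = \<infinity>")
  case True
  show ?thesis unfolding True by simp
next
  case False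
  have t: "thr > 0" unfolding thr_def by simp
  let ?SA = "{n. A V n > 1 / 4}" and ?SB = "{n. B V n > ennreal (thr / 9)}"
  have part: "sum f F \<le> (\<Sum>\<^sub>\<infinity>n\<in>S. f n)" if "finite F" "F \<subseteq> S" for f :: "int \<Rightarrow> ennreal" and F S
    using that by (subst nonneg_infsum_complete) (auto intro: SUP_upper)
  \<comment> \<open>An infinite \<open>B V i\<close> lies above the threshold, hence occurs in the
    second sum and would make the right-hand side infinite.\<close>
  have Bfin: "B V i < \<infinity>" for i
  proof (rule ccontr)
    assume "\<not> ?thesis"
    then have i: "B V i = \<infinity>" by (simp add: not_less top.extremum_unique)
    then have "B V i \<le> (\<Sum>\<^sub>\<infinity>n\<in>?SB. B V n)" using part[of "{i}" ?SB "B V"] by simp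
    then have "(\<Sum>\<^sub>\<infinity>n\<in>?SB. B V n) = \<infinity>" using i by (simp add: top.extremum_unique)
    then have "?R = \<infinity>" using t by (simp add: ennreal_mult_top)
    then show False using False by simp
  qed
  define \<beta> where "\<beta> i = enn2real (B V i)" for i
  have \<beta>: "B V i = ennreal (\<beta> i)" "\<beta> i \<ge> 0" for i unfolding \<beta>_def using Bfin[of i] by simp_all
  define R where "R = enn2real ?R"
  have R: "?R = ennreal R" "R \<ge> 0" unfolding R_def using False by (simp_all add: less_top)
  \<comment> \<open>The dimension is an integer, so it suffices to exclude N + 1 independent
    directions; N + 1 exceeds R, as \<open>count\<close> demands.\<close>
  define N where "N = nat \<lfloor>R\<rfloor>"
  have N: "real N \<le> R" "R < real (Suc N)" unfolding N_def using R(2) by linarith+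
  have count: "1 + 4 * (\<Sum>i\<in>F. sqrt (A V i)) + 153 / thr * (\<Sum>i\<in>F'. \<beta> i) < real (Suc N)"
    if F: "finite F" "F \<subseteq> ?SA" and F': "finite F'" "F' \<subseteq> {i. \<beta> i > thr / 9}" for F F'
  proof -
    have s0: "sqrt (A V i) \<ge> 0" if "i \<in> F" for i using F(2) that by auto
    have F'': "F' \<subseteq> ?SB" using F'(2) t unfolding \<beta>(1) by (auto simp: ennreal_less_iff)
    have S0: "(\<Sum>i\<in>F. sqrt (A V i)) \<ge> 0" "(\<Sum>i\<in>F'. \<beta> i) \<ge> 0" using s0 \<beta>(2) by (auto intro: sum_nonneg)
    have "ennreal (1 + 4 * (\<Sum>i\<in>F. sqrt (A V i)) + 153 / thr * (\<Sum>i\<in>F'. \<beta> i))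
      = 1 + 4 * (\<Sum>i\<in>F. ennreal (sqrt (A V i))) + ennreal (153 / thr) * (\<Sum>i\<in>F'. B V i)"
    proof -
      have "(\<Sum>i\<in>F. ennreal (sqrt (A V i))) = ennreal (\<Sum>i\<in>F. sqrt (A V i))" using s0 by (rule sum_ennreal)
      moreover have "(\<Sum>i\<in>F'. B V i) = ennreal (\<Sum>i\<in>F'. \<beta> i)" unfolding \<beta>(1) using \<beta>(2) by (intro sum_ennreal)
      moreover have "153 / thr * (\<Sum>i\<in>F'. \<beta> i) \<ge> 0" using t S0 by simp
      moreover have "(4::ennreal) = ennreal 4" by simp
      ultimately show ?thesis using S0 t by (simp only: ennreal_plus ennreal_mult[symmetric] ennreal_1[symmetric] zero_le_numeral zero_le_one add_nonneg_nonneg mult_nonneg_nonneg divide_nonneg_pos)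
    qed
    also have "\<dots> \<le> ?R" by (intro add_mono mult_left_mono part F F'(1) F'' order_refl) auto
    finally have "1 + 4 * (\<Sum>i\<in>F. sqrt (A V i)) + 153 / thr * (\<Sum>i\<in>F'. \<beta> i) \<le> R" unfolding R(1) using R(2) by simp
    then show ?thesis using N(2) by linarith
  qed
  have "N_minus V \<le> enat N"
    unfolding N_minus_def neg_index_def
    by (intro SUP_least edim_le_of_negative[OF V \<beta> count]) auto
  then have "ennreal_of_enat (N_minus V) \<le> ennreal_of_enat (enat N)" by (subst ennreal_of_enat_le_iff)
  also have "\<dots> = ennreal (real N)" by (simp add: ennreal_of_nat_eq_real_of_nat)
  also have "\<dots> \<le> ?R" unfolding R(1) using N(1) by (rule ennreal_leI)
  finally show ?thesis .
qed

theorem theorem6p1: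
  shows "\<exists>C\<^sub>7 c :: real. C\<^sub>7 > 0 \<and> c > 0 \<and>
    (\<forall>V :: real^2 \<Rightarrow> real.
       locally_integrable V \<and> (AE x in lebesgue. 0 \<le> V x) \<longrightarrow>
       ennreal_of_enat (N_minus V)
         \<le> 1 + 4 * (\<Sum>\<^sub>\<infinity>n\<in>{n. A V n > 1 / 4}. ennreal (sqrt (A V n)))
             + ennreal C\<^sub>7 * (\<Sum>\<^sub>\<infinity>n\<in>{n. B V n > ennreal c}. B V n))"
proof (intro exI conjI allI impI)
  show "153 / thr > 0" "thr / 9 > 0" unfolding thr_def by simp_all
  fix V :: "real^2 \<Rightarrow> real"
  assume "locally_integrable V \<and> (AE x in lebesgue. 0 \<le> V x)"
  then show "ennreal_of_enat (N_minus V)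
    \<le> 1 + 4 * (\<Sum>\<^sub>\<infinity>n\<in>{n. A V n > 1 / 4}. ennreal (sqrt (A V n)))
      + ennreal (153 / thr) * (\<Sum>\<^sub>\<infinity>n\<in>{n. B V n > ennreal (thr / 9)}. B V n)"
    by (intro N_minus_le) auto
qed

end
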